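(* Let $M$ be the maximum of the standard reflected Brownian bridge and $\rho$ the time at which it is attained. Then $M$ and $\rho$ have densities given, for $z>0$ and $0<u<1$, by $$\frac{\mathbb{P}(M\in dz)}{dz}=\frac{\sqrt{2\pi}\,\pi^2}{z^4}\sum_{n\geq0}\left(n+\tfrac{1}{2}\right)^2 e^{-\frac{(n+1/2)^2\pi^2}{2z^2}}+\frac{2\sqrt{2\pi}}{z^2}\sum_{\substack{m,n\geq0 \\ m\neq n}}(-1)^{m+n}\frac{(m+\frac12)(n+\frac12)}{(m+\frac12)^2 -(n+\frac12)^2}\left(e^{-\frac{(n+1/2)^2\pi^2}{2z^2}}-e^{-\frac{(m+1/2)^2\pi^2}{2z^2}}\right)\quad(\mathcal{A}),$$ $$\frac{\mathbb{P}(\rho\in du)}{du}=2\sum_{m,n\geq0}(-1)^{m+n}\frac{(2m+1)(2n+1)}{[(2n+1)^2 u+(2m+1)^2 (1-u)]^{3/2}}\quad(\mathcal{A}),$$ where $(\mathcal{A})$ means that the double series are understood in the sense of Abel summation.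
   Context: The standard reflected Brownian bridge is $X=|b|$ where $b$ is a standard Brownian bridge on $[0,1]$ from $0$ to $0$ (equivalently, the standard Bessel bridge of dimension $1$). $M=\sup_{0\le u\le1}X_u$ and $\rho=\inf\{u\in[0,1]:X_u=M\}$. Abel summation of double series: for a complex double sequence $(u_{m,n})$ one writes $\sum_{m,n}u_{m,n}=S\ (\mathcal{A})$ if $\sum_{m,n}\alpha^{m+n}|u_{m,n}|<\infty$ for all $\alpha\in(0,1)$ and $\sum_{m,n}\alpha_1^m\alpha_2^nu_{m,n}\to S$ as $(\alpha_1,\alpha_2)\to(1^-,1^-)$. *)

theory Defs
  imports "HOL-Probability.Probability"
begin

text \<open>Gaussian laws are allowed to be degenerate (Dirac masses).\<close>

definition gaussian_rv :: "'a measure \<Rightarrow> ('a \<Rightarrow> real) \<Rightarrow> bool" where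
  "gaussian_rv P Y \<longleftrightarrow> Y \<in> borel_measurable P \<and>
     (\<exists>\<mu> \<sigma>. (\<sigma> = 0 \<and> (AE \<omega> in P. Y \<omega> = \<mu>)) \<or>
            (\<sigma> > 0 \<and> distributed P lborel Y (\<lambda>x. ennreal (normal_density \<mu> \<sigma> x))))"

definition gaussian_process :: "'a measure \<Rightarrow> 't set \<Rightarrow> ('t \<Rightarrow> 'a \<Rightarrow> real) \<Rightarrow> bool" where
  "gaussian_process P T X \<longleftrightarrow>
     (\<forall>F c. finite F \<longrightarrow> F \<subseteq> T \<longrightarrow> gaussian_rv P (\<lambda>\<omega>. \<Sum>t\<in>F. c t * X t \<omega>))"

text \<open>The bridge from \<open>0\<close> to \<open>0\<close> on \<open>[0,1]\<close>: the covariance formula gives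
  \<open>b 0 = b 1 = 0\<close> almost surely.\<close>

definition standard_brownian_bridge :: "'a measure \<Rightarrow> (real \<Rightarrow> 'a \<Rightarrow> real) \<Rightarrow> bool" where
  "standard_brownian_bridge P b \<longleftrightarrow>
     prob_space P \<and>
     gaussian_process P {0..1} b \<and>
     (\<forall>t\<in>{0..1}. integral\<^sup>L P (b t) = 0) \<and>
     (\<forall>s\<in>{0..1}. \<forall>t\<in>{0..1}. integral\<^sup>L P (\<lambda>\<omega>. b s \<omega> * b t \<omega>) = min s t - s * t) \<and>
     (\<forall>\<omega>\<in>space P. continuous_on {0..1} (\<lambda>t. b t \<omega>))"

definition path_sup :: "(real \<Rightarrow> real) \<Rightarrow> real" where
  "path_sup x = (SUP u\<in>{0..1}. x u)"

definition path_sup_time :: "(real \<Rightarrow> real) \<Rightarrow> real" where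
  "path_sup_time x = Inf {u\<in>{0..1}. x u = path_sup x}"

text \<open>A density of \<open>Y\<close> with respect to Lebesgue measure. Nonnegativity is required explicitly
  because \<open>ennreal\<close> truncates negative values to \<open>0\<close>.\<close>

definition has_density :: "'a measure \<Rightarrow> ('a \<Rightarrow> real) \<Rightarrow> (real \<Rightarrow> real) \<Rightarrow> bool" where
  "has_density P Y f \<longleftrightarrow> (\<forall>x. 0 \<le> f x) \<and> distributed P lborel Y (\<lambda>x. ennreal (f x))"

text \<open>Abel summation of double series. The two parameters tend to \<open>1\<close> from below
  jointly, hence the product filter rather than an iterated limit.\<close>

definition abel_sums2 :: "(nat \<Rightarrow> nat \<Rightarrow> 'a::real_normed_vector) \<Rightarrow> 'a \<Rightarrow> bool" where
  "abel_sums2 u S \<longleftrightarrow>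
     (\<forall>\<alpha>::real. 0 < \<alpha> \<and> \<alpha> < 1 \<longrightarrow> (\<lambda>(m, n). \<alpha> ^ (m + n) * norm (u m n)) summable_on UNIV) \<and>
     ((\<lambda>(\<alpha>\<^sub>1::real, \<alpha>\<^sub>2::real). \<Sum>\<^sub>\<infinity>(m, n). (\<alpha>\<^sub>1 ^ m * \<alpha>\<^sub>2 ^ n) *\<^sub>R u m n) \<longlongrightarrow> S)
       (at_left 1 \<times>\<^sub>F at_left 1)"

end

theory Submission
  imports Defs
begin

text \<open>The joint law of the maximum and its location comes from confinement probabilities: the event that
  \<open>\<bar>b\<bar>\<close> stays below \<open>z1\<close> on \<open>[0, u]\<close> and below \<open>z2\<close> on \<open>[u, 1]\<close> has, by the Markov property on finer
  and finer grids, a probability that is an integral of a product of two heat kernels with absorbing endpoints.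
  Differentiating in the levels at \<open>z1 = z2 = z\<close> and expanding both kernels in cosine modes, the increment in
  \<open>u\<close> reduces to a boundary term at the level \<open>z\<close>. Hence the pair has the joint density
  \<open>sqrt (2 \<pi>) \<pi>^2 / z^4 h (\<kappa> s) h (\<kappa> (1 - s))\<close> with \<open>\<kappa> = \<pi>^2 / (2 z^2)\<close> and
  \<open>h s = (\<Sum>n. (-1)^n (n + 1/2) exp (- (n + 1/2)^2 s))\<close>. Integrating out one variable term by term is not
  absolutely convergent; inserting \<open>(\<alpha>1)^m (\<alpha>2)^n\<close> makes it so, and summation by parts bounds the damped
  series \<open>h\<close> uniformly in the damping, so that dominated convergence gives the Abel sums.\<close>

section \<open>Series of functions\<close>

text \<open>The event that the maximum is attained by time u is not a confinement event. Together
  with a < \<open>Mx\<close> \<le> c it lies between differences of confinement events in which only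
  the first level moves from a to c, the second being a or c. Hence only the derivative in the first
  level enters, and the formula has to be continued across z1 = z2 by the odd extension of the
  kernel. A walk killed at grid times alone keeps more mass than the absorbed motion. Its density is
  caught between the kernel for z and, up to an error, the kernel for z + e. This needs the sign of
  the kernel and its size at small times, which the cosine series hides; the image series shows
  them. Bounding \<open>hser\<close> term by term gives order 1/s at 0, and 1/(s (1 - s)) is not
  integrable on the unit interval. The alternating signs improve the order to s^(-1/2), which makes
  the product integrable.\<close>

lemma continuous_on_suminf_bounded:
  fixes f :: "nat \<Rightarrow> 'a::topological_space \<Rightarrow> real"
  assumes "\<And>n. continuous_on S (f n)" "\<And>n x. x \<in> S \<Longrightarrow> \<bar>f n x\<bar> \<le> K n" "summable K"
  shows "continuous_on S (\<lambda>x. \<Sum>n. f n x)"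
proof -
  have "uniform_limit S (\<lambda>n x. \<Sum>i<n. f i x) (\<lambda>x. \<Sum>i. f i x) sequentially"
    by (rule Weierstrass_m_test) (use assms in auto)
  then show ?thesis
    by (rule uniform_limit_theorem[rotated]) (auto intro!: always_eventually continuous_on_sum assms)
qed

text \<open>The bounded factor \<open>g\<close> turns the majorant \<open>K n\<close> into
  \<open>K n * \<bar>B\<bar>\<close>, so the M-test still applies. This serves both to read off
  Fourier coefficients and to expand products of kernels mode by mode.\<close>

lemma sums_integral_mult:
  fixes f :: "nat \<Rightarrow> real \<Rightarrow> real" and g :: "real \<Rightarrow> real"
  assumes cf: "\<And>n. continuous_on {a..b} (f n)" and bd: "\<And>n x. x \<in> {a..b} \<Longrightarrow> \<bar>f n x\<bar> \<le> K n"
    and K: "summable K" and cg: "continuous_on {a..b} g"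
  shows "(\<lambda>n. integral {a..b} (\<lambda>x. f n x * g x)) sums integral {a..b} (\<lambda>x. (\<Sum>n. f n x) * g x)"
proof -
  obtain B where B: "\<And>x. x \<in> {a..b} \<Longrightarrow> \<bar>g x\<bar> \<le> B"
    using compact_imp_bounded[OF compact_continuous_image[OF cg compact_Icc]]
    unfolding bounded_iff by (metis (no_types, lifting) imageI real_norm_def)
  have "uniform_limit {a..b} (\<lambda>n x. \<Sum>i<n. f i x * g x) (\<lambda>x. \<Sum>i. f i x * g x) sequentially"
  proof (rule Weierstrass_m_test)
    show "norm (f n x * g x) \<le> K n * \<bar>B\<bar>" if "x \<in> {a..b}" for n x
      using bd[OF that, of n] B[OF that] by (auto simp: abs_mult intro!: mult_mono)
    show "summable (\<lambda>n. K n * \<bar>B\<bar>)"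
      using K by (rule summable_mult2)
  qed
  moreover have eq: "(\<Sum>i. f i x * g x) = (\<Sum>i. f i x) * g x" if "x \<in> {a..b}" for x
    using summable_comparison_test'[OF K, of 0 "\<lambda>i. f i x"] bd[of x] that
    by (intro suminf_mult2[symmetric]) auto
  moreover have "uniform_limit {a..b} (\<lambda>n x. \<Sum>i<n. f i x * g x) (\<lambda>x. \<Sum>i. f i x * g x) sequentially
      \<longleftrightarrow> uniform_limit {a..b} (\<lambda>n x. \<Sum>i<n. f i x * g x) (\<lambda>x. (\<Sum>i. f i x) * g x) sequentially"
    by (rule uniform_limit_cong') (auto simp: eq)
  ultimately have ul: "uniform_limit (cbox a b) (\<lambda>n x. \<Sum>i<n. f i x * g x) (\<lambda>x. (\<Sum>i. f i x) * g x) sequentially"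
    by (simp add: cbox_interval)
  have int: "(\<lambda>x. f i x * g x) integrable_on {a..b}" for i
    by (intro integrable_continuous_real continuous_intros cf cg)
  have hi: "((\<lambda>x. \<Sum>i<n. f i x * g x) has_integral (\<Sum>i<n. integral {a..b} (\<lambda>x. f i x * g x))) (cbox a b)" for n
    using int by (auto intro!: has_integral_sum integrable_integral)
  have "(\<lambda>n. \<Sum>i<n. integral {a..b} (\<lambda>x. f i x * g x)) \<longlonglongrightarrow> integral {a..b} (\<lambda>x. (\<Sum>i. f i x) * g x)"
  proof -
    obtain I J where IJ: "\<And>n. ((\<lambda>x. \<Sum>i<n. f i x * g x) has_integral I n) (cbox a b)"
       "((\<lambda>x. (\<Sum>i. f i x) * g x) has_integral J) (cbox a b)" "(I \<longlongrightarrow> J) sequentially"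
    proof (rule uniform_limit_integral_cbox[OF ul])
      show "continuous_on (cbox a b) (\<lambda>x. \<Sum>i<n. f i x * g x)" for n
        by (intro continuous_intros) (use cf cg in auto)
    qed auto
    have "I = (\<lambda>n. \<Sum>i<n. integral {a..b} (\<lambda>x. f i x * g x))"
      using has_integral_unique[OF IJ(1) hi] by blast
    moreover have "J = integral {a..b} (\<lambda>x. (\<Sum>i. f i x) * g x)"
      using IJ(2) by (simp add: integral_unique)
    ultimately show ?thesis using IJ(3) by simp
  qed
  then show ?thesis by (simp add: sums_def)
qed

text \<open>The even eigenfunctions on [-z, z] with zero boundary values are cos
  (\<open>hf n\<close> * pi * x / z); the half-integers make them vanish at both endpoints.\<close>

definition hf :: "nat \<Rightarrow> real" where "hf n = real n + 1/2"

lemma hf_pos [simp]: "0 < hf n" and hf_ge_half: "1/2 \<le> hf n" and hf_nonneg [simp]: "0 \<le> hf n"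
  and hf_ne_0 [simp]: "hf n \<noteq> 0"
  by (auto simp: hf_def)

lemma hf_sq_ge: "real n \<le> (hf n)\<^sup>2" "1/4 \<le> (hf n)\<^sup>2"
  by (auto simp: hf_def power2_eq_square algebra_simps)

lemma summable_exp_hf:
  assumes "0 < c" shows "summable (\<lambda>n. exp (- (c * (hf n)\<^sup>2)))"
proof (rule summable_comparison_test'[of "\<lambda>n. exp (-c) ^ n" 0])
  show "summable (\<lambda>n. exp (- c) ^ n)" using assms by (intro summable_geometric) auto
  show "norm (exp (- (c * (hf n)\<^sup>2))) \<le> exp (- c) ^ n" for n
    using hf_sq_ge(1)[of n] assms by (simp add: exp_of_nat_mult[symmetric] mult.commute)
qed

lemma summable_power_exp_hf:
  assumes "0 < c" shows "summable (\<lambda>n. hf n ^ k * exp (- (c * (hf n)\<^sup>2)))"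
proof -
  \<comment> \<open>Half of the Gaussian exponent has to absorb the power. Writing
    \<open>hf n\<close> = (K / c) y, this value of K gives k y \<le> c \<open>hf n\<close> / 4, and
    \<open>hf n\<close> \<ge> 1/2 turns that into at most (c / 2) \<open>hf n\<close>^2. The summand
    1 keeps K positive for k = 0.\<close>
  define K :: real where "K = 4 * (real k + 1)"
  have K: "0 < K" by (simp add: K_def)
  show ?thesis
proof (rule summable_comparison_test'[of "\<lambda>n. (K / c) ^ k * exp (- ((c/2) * (hf n)\<^sup>2))" 0])
  show "summable (\<lambda>n. (K / c) ^ k * exp (- (c/2 * (hf n)\<^sup>2)))"
    using assms by (intro summable_mult summable_exp_hf) auto
  show "norm (hf n ^ k * exp (- (c * (hf n)\<^sup>2))) \<le> (K / c) ^ k * exp (- (c/2 * (hf n)\<^sup>2))" for n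
  proof -
    define y where "y = c * hf n / K"
    have y: "0 \<le> y" using assms K by (simp add: y_def)
    have hfy: "hf n = (K / c) * y" using assms K by (simp add: y_def)
    have "y \<le> exp y" using exp_ge_add_one_self[of y] by linarith
    then have "y ^ k \<le> exp y ^ k" using y by (rule power_mono)
    also have "\<dots> = exp (real k * y)" by (simp add: exp_of_nat_mult)
    also have "\<dots> \<le> exp (c/2 * (hf n)\<^sup>2)"
    proof -
      have "real k * y \<le> c * hf n / 4" using assms by (simp add: y_def K_def field_simps)
      also have "\<dots> \<le> c/2 * (hf n)\<^sup>2" using assms hf_ge_half[of n] by (simp add: power2_eq_square)
      finally show ?thesis by simp
    qed
    finally have *: "y ^ k \<le> exp (c/2 * (hf n)\<^sup>2)" .
    have "hf n ^ k * exp (- (c * (hf n)\<^sup>2)) = (K / c) ^ k * (y ^ k * exp (- (c * (hf n)\<^sup>2)))"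
      by (subst (1) hfy) (simp only: power_mult_distrib mult.assoc)
    also have "\<dots> \<le> (K / c) ^ k * (exp (c/2 * (hf n)\<^sup>2) * exp (- (c * (hf n)\<^sup>2)))"
      using * assms K by (intro mult_left_mono mult_right_mono) auto
    also have "\<dots> = (K / c) ^ k * exp (- (c/2 * (hf n)\<^sup>2))"
      by (simp add: exp_add[symmetric])
    finally show ?thesis by simp
  qed
qed
qed

text \<open>The square is linearised: (sqrt s * \<open>hf n\<close> - 1)^2 \<ge> 0 bounds each term
  by a geometric one with ratio exp (- 2 sqrt s). The order s^(-1/2) is that of the Gaussian
  integral, and it drives both the bound on the kernel and the bound on the damped series.\<close>

lemma exp_hf_sum_le:
  assumes s: "0 < s" shows "(\<Sum>n. exp (- (s * (hf n)\<^sup>2))) \<le> 3 / sqrt s"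
proof -
  define y where "y = sqrt s"
  have y: "0 < y" "s = y\<^sup>2" using s by (auto simp: y_def)
  define r where "r = exp (- (2 * y))"
  have r: "0 < r" "r < 1" using y by (auto simp: r_def)
  have le: "exp (- (s * (hf n)\<^sup>2)) \<le> exp 1 * exp (- y) * r ^ n" for n
  proof -
    have "0 \<le> (y * hf n - 1)\<^sup>2" by simp
    then have "- (s * (hf n)\<^sup>2) \<le> 1 - 2 * (y * hf n)" by (simp add: y(2) power2_eq_square algebra_simps)
    also have "\<dots> = 1 + (- y) + real n * (- (2 * y))" by (simp add: hf_def algebra_simps)
    finally have "exp (- (s * (hf n)\<^sup>2)) \<le> exp (1 + (- y) + real n * (- (2 * y)))" by simp
    then show ?thesis by (simp only: exp_add exp_of_nat_mult r_def)
  qed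
  have "(\<Sum>n. exp (- (s * (hf n)\<^sup>2))) \<le> (\<Sum>n. exp 1 * exp (- y) * r ^ n)"
    using summable_exp_hf[OF s] r by (intro suminf_le le summable_mult summable_geometric) auto
  also have "\<dots> = exp 1 * (exp (- y) / (1 - r))"
    using r by (subst suminf_mult) (auto simp: suminf_geometric summable_geometric)
  also have "\<dots> \<le> 3 * (1 / y)"
  proof (rule mult_mono)
    show "exp 1 \<le> (3::real)" by (rule exp_le)
    have "r \<le> 1 / (1 + 2 * y)"
      using exp_ge_add_one_self[of "2*y"] y by (simp add: r_def exp_minus field_simps)
    then have r1: "2 * y / (1 + 2 * y) \<le> 1 - r" using y by (simp add: field_simps)
    have "exp (- y) \<le> 1 / (1 + y)"
      using exp_ge_add_one_self[of y] y by (simp add: exp_minus field_simps)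
    also have "\<dots> \<le> 2 / (1 + 2 * y)" using y by (simp add: field_simps)
    also have "\<dots> = (1 / y) * (2 * y / (1 + 2 * y))" using y by (simp add: field_simps)
    also have "\<dots> \<le> (1 / y) * (1 - r)" using r1 y by (intro mult_left_mono) auto
    finally show "exp (- y) / (1 - r) \<le> 1 / y" using r by (simp add: field_simps)
  qed (use y r in auto)
  finally show ?thesis by (simp add: y_def)
qed

section \<open>The Gaussian kernel\<close>

definition gk :: "real \<Rightarrow> real \<Rightarrow> real" where "gk t x = exp (- (x\<^sup>2 / (2 * t))) / sqrt (2 * pi * t)"

lemma gk_eq_normal_density: "0 < t \<Longrightarrow> gk t (x - m) = normal_density m (sqrt t) x"
  by (simp add: gk_def normal_density_def)

lemma gk_nonneg [simp]: "0 \<le> gk t x" if "0 \<le> t"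
  using that by (simp add: gk_def)

lemma gk_minus [simp]: "gk t (- x) = gk t x"
  by (simp add: gk_def)

lemma gk_minus_commute: "gk t (x - y) = gk t (y - x)"
  by (simp add: gk_def power2_commute)

lemma gk_measurable [measurable]: "gk t \<in> borel_measurable borel"
  unfolding gk_def by measurable

lemma continuous_gk [continuous_intros]:
  "0 < t \<Longrightarrow> continuous_on S f \<Longrightarrow> continuous_on S (\<lambda>x. gk t (f x))"
  unfolding gk_def by (intro continuous_intros) auto

lemma gk_mono: "0 < t \<Longrightarrow> \<bar>x\<bar> \<le> \<bar>y\<bar> \<Longrightarrow> gk t y \<le> gk t x"
  unfolding gk_def by (intro divide_right_mono) (auto simp: abs_le_square_iff divide_right_mono)

lemma gk_scale: "0 < z \<Longrightarrow> 0 < t \<Longrightarrow> gk (t / z\<^sup>2) (x / z) = z * gk t x"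
  by (simp add: gk_def real_sqrt_divide power_divide field_simps)

text \<open>The characteristic function of the standard normal law, rescaled by sqrt d.\<close>

lemma gk_iexp:
  assumes d: "0 < d"
  shows "has_bochner_integral lborel (\<lambda>u. gk d u *\<^sub>R iexp (w * u)) (exp (- (w\<^sup>2 * d / 2)))"
proof -
  have "integrable std_normal_distribution (\<lambda>x. iexp (sqrt d * w * x))"
    by (intro finite_measure.integrable_const_bound[where B=1])
       (auto intro!: prob_space.finite_measure real_distribution.axioms(1) simp: real_distribution_def
        intro: real_dist_normal_dist)
  then have i: "integrable lborel (\<lambda>x. std_normal_density x *\<^sub>R iexp (sqrt d * w * x))"
    by (subst (asm) integrable_density) auto
  have e: "(LINT x|lborel. std_normal_density x *\<^sub>R iexp (sqrt d * w * x)) = exp (- ((sqrt d * w)\<^sup>2) / 2)"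
    using fun_cong[OF char_std_normal_distribution, of "sqrt d * w"]
    unfolding char_def by (subst (asm) integral_density) auto
  have "has_bochner_integral lborel (\<lambda>x. std_normal_density x *\<^sub>R iexp (sqrt d * w * x)) (exp (- ((sqrt d * w)\<^sup>2) / 2))"
    using i e by (simp add: has_bochner_integral_iff)
  then have "has_bochner_integral lborel (\<lambda>x. std_normal_density (0 + (1 / sqrt d) * x) *\<^sub>R iexp (sqrt d * w * (0 + (1 / sqrt d) * x)))
     (inverse \<bar>1 / sqrt d\<bar> *\<^sub>R complex_of_real (exp (- ((sqrt d * w)\<^sup>2) / 2)))"
    using d by (subst (asm) lborel_has_bochner_integral_real_affine_iff[where c="1/sqrt d" and t=0]) auto
  then have "has_bochner_integral lborel (\<lambda>x. (1 / sqrt d) *\<^sub>R (std_normal_density (0 + (1 / sqrt d) * x) *\<^sub>R iexp (sqrt d * w * (0 + (1 / sqrt d) * x))))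
     ((1 / sqrt d) *\<^sub>R (inverse \<bar>1 / sqrt d\<bar> *\<^sub>R complex_of_real (exp (- ((sqrt d * w)\<^sup>2) / 2))))"
    by (rule has_bochner_integral_scaleR_right)
  also have "(\<lambda>x. (1 / sqrt d) *\<^sub>R (std_normal_density (0 + (1 / sqrt d) * x) *\<^sub>R iexp (sqrt d * w * (0 + (1 / sqrt d) * x))))
     = (\<lambda>u. gk d u *\<^sub>R iexp (w * u))"
    using d by (auto simp: fun_eq_iff std_normal_density_def gk_def power_divide real_sqrt_mult scaleR_conv_of_real field_simps)
  also have "((1 / sqrt d) *\<^sub>R (inverse \<bar>1 / sqrt d\<bar> *\<^sub>R complex_of_real (exp (- ((sqrt d * w)\<^sup>2) / 2)))) = exp (- (w\<^sup>2 * d / 2))"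
    using d by (simp add: power_mult_distrib mult.commute)
  finally show ?thesis .
qed

lemma gk_eq_normal_density_0: "0 < d \<Longrightarrow> gk d = normal_density 0 (sqrt d)"
  by (simp add: fun_eq_iff gk_def normal_density_def)

lemma gk_integrable: "0 < d \<Longrightarrow> integrable lborel (gk d)"
  by (simp add: gk_eq_normal_density_0 integrable_normal_density)

lemma gk_integral: "0 < d \<Longrightarrow> integral\<^sup>L lborel (gk d) = 1"
  by (simp add: gk_eq_normal_density_0 integral_normal_density)

text \<open>A cosine is an eigenfunction of convolution with the Gaussian: after a shift of the
  variable the integral is the characteristic function times \<open>iexp (w * x)\<close>, and the
  real part is taken.\<close>

lemma gk_conv_cos:
  assumes d: "0 < d"
  shows "has_bochner_integral lborel (\<lambda>y. gk d (x - y) * cos (w * y)) (exp (- (w\<^sup>2 * d / 2)) * cos (w * x))"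
proof -
  have "has_bochner_integral lborel (\<lambda>u. Re (iexp (w * x) * (gk d u *\<^sub>R iexp (w * u)))) (Re (iexp (w * x) * exp (- (w\<^sup>2 * d / 2))))"
    by (intro has_bochner_integral_bounded_linear[OF bounded_linear_Re] has_bochner_integral_mult_right gk_iexp d)
  then have "has_bochner_integral lborel (\<lambda>y. Re (iexp (w * x) * (gk d (- x + 1 * y) *\<^sub>R iexp (w * (- x + 1 * y))))) (Re (iexp (w * x) * exp (- (w\<^sup>2 * d / 2))))"
    by (subst (asm) lborel_has_bochner_integral_real_affine_iff[where c=1 and t="-x"]) auto
  also have "(\<lambda>y. Re (iexp (w * x) * (gk d (- x + 1 * y) *\<^sub>R iexp (w * (- x + 1 * y))))) = (\<lambda>y. gk d (x - y) * cos (w * y))"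
  proof
    fix y
    have "iexp (w * x) * (gk d (- x + 1 * y) *\<^sub>R iexp (w * (- x + 1 * y))) = gk d (y - x) *\<^sub>R iexp (w * y)"
    proof -
      have "iexp (w * x) * iexp (w * (- x + 1 * y)) = iexp (w * y)"
        by (subst exp_add[symmetric]) (simp add: algebra_simps)
      then show ?thesis
        by (simp add: scaleR_conv_of_real mult.left_commute)
    qed
    then have "Re (iexp (w * x) * (gk d (- x + 1 * y) *\<^sub>R iexp (w * (- x + 1 * y)))) = Re (gk d (y - x) *\<^sub>R iexp (w * y))"
      by (simp only:)
    also have "\<dots> = gk d (x - y) * cos (w * y)"
      by (simp add: Re_exp gk_minus_commute[of d x])
    finally show "Re (iexp (w * x) * (gk d (- x + 1 * y) *\<^sub>R iexp (w * (- x + 1 * y)))) = gk d (x - y) * cos (w * y)" .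
  qed
  finally show ?thesis by (simp add: Re_exp mult.commute)
qed

section \<open>The heat kernel on an interval with absorbing endpoints\<close>

text \<open>The transition density from 0 of Brownian motion absorbed at z and -z. Sine modes vanish
  at the starting point, so only cosines occur; 1/z normalises them in L^2. The series is kept for
  all real x, where it extends the kernel oddly across the endpoints.\<close>

definition q :: "real \<Rightarrow> real \<Rightarrow> real \<Rightarrow> real" where
  "q t z x = (\<Sum>n. exp (- ((hf n * pi / z)\<^sup>2 * t / 2)) * cos (hf n * pi / z * x)) / z"

lemma q_exponent: "exp (- ((hf n * pi / z)\<^sup>2 * t / 2)) = exp (- (((pi / z)\<^sup>2 * t / 2) * (hf n)\<^sup>2))"
  by (simp add: power_mult_distrib power_divide mult_ac)

lemma abs_mult_cos_le: "0 \<le> a \<Longrightarrow> \<bar>a * cos b\<bar> \<le> (a::real)"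
  by (simp add: abs_mult mult_left_le)

lemma summable_q_exp:
  assumes "0 < t" "0 < z" shows "summable (\<lambda>n. exp (- ((hf n * pi / z)\<^sup>2 * t / 2)))"
  unfolding q_exponent using assms by (intro summable_exp_hf) auto

lemma summable_q_term:
  assumes "0 < t" "0 < z"
  shows "summable (\<lambda>n. exp (- ((hf n * pi / z)\<^sup>2 * t / 2)) * cos (hf n * pi / z * x))"
  by (rule summable_comparison_test'[OF summable_q_exp[OF assms], of 0]) (simp only: real_norm_def, intro abs_mult_cos_le, simp)

text \<open>The mode sum is of order z / sqrt t, so the prefactor 1/z cancels and the bound is
  uniform in the level and the position. The inequality pi^2 \<ge> 2 absorbs the remaining
  constants.\<close>

lemma q_bound:
  assumes t: "0 < t" and z: "0 < z" shows "\<bar>q t z x\<bar> \<le> 3 / sqrt t"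
proof -
  have "\<bar>\<Sum>n. exp (- ((hf n * pi / z)\<^sup>2 * t / 2)) * cos (hf n * pi / z * x)\<bar>
      \<le> (\<Sum>n. \<bar>exp (- ((hf n * pi / z)\<^sup>2 * t / 2)) * cos (hf n * pi / z * x)\<bar>)"
    by (rule summable_rabs) (rule summable_comparison_test'[OF summable_q_exp[OF t z], of 0], auto simp: abs_mult mult_left_le)
  also have "\<dots> \<le> (\<Sum>n. exp (- ((hf n * pi / z)\<^sup>2 * t / 2)))"
  proof (rule suminf_le)
    show "summable (\<lambda>n. \<bar>exp (- ((hf n * pi / z)\<^sup>2 * t / 2)) * cos (hf n * pi / z * x)\<bar>)"
      by (rule summable_comparison_test'[OF summable_q_exp[OF t z], of 0]) (auto simp: abs_mult mult_left_le)
  qed (auto intro: summable_q_exp t z abs_mult_cos_le)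
  also have "\<dots> \<le> 3 / sqrt ((pi / z)\<^sup>2 * t / 2)"
    unfolding q_exponent using t z by (intro exp_hf_sum_le) auto
  also have "\<dots> \<le> 3 * z / sqrt t"
  proof -
    have "2 * 2 \<le> pi * pi" using pi_ge_two by (intro mult_mono) auto
    then have "2 \<le> pi\<^sup>2" by (simp add: power2_eq_square)
    then have "t / z\<^sup>2 \<le> (pi / z)\<^sup>2 * t / 2" using t z by (simp add: field_simps)
    then have "sqrt (t / z\<^sup>2) \<le> sqrt ((pi / z)\<^sup>2 * t / 2)" by simp
    then have "3 / sqrt ((pi / z)\<^sup>2 * t / 2) \<le> 3 / sqrt (t / z\<^sup>2)" using t z by (intro divide_left_mono) auto
    then show ?thesis using z by (simp add: real_sqrt_divide)
  qed
  finally show ?thesis using z unfolding q_def by (simp add: abs_mult field_simps)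
qed

lemma q_even [simp]: "q t z (- x) = q t z x"
  by (simp add: q_def)

lemma cos_hf_shift: "cos (hf n * pi * (x + 2)) = - cos (hf n * pi * x)"
proof -
  have "hf n * pi * (x + 2) = (hf n * pi * x + pi) + 2 * real n * pi" by (simp add: hf_def algebra_simps)
  then have "cos (hf n * pi * (x + 2)) = cos ((hf n * pi * x + pi) + 2 * real n * pi)" by (simp only:)
  also have "\<dots> = - cos (hf n * pi * x)" by (subst cos_add) (simp only: cos_2npi sin_2npi, simp)
  finally show ?thesis .
qed

text \<open>A shift by 2z adds an odd multiple of pi to every phase. Together with evenness this
  says that the extended kernel is odd about z and about -z, the analytic form of the reflection
  principle.\<close>

lemma q_shift: assumes "0 < t" "0 < z" shows "q t z (x + 2 * z) = - q t z x"
proof -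
  have "cos (hf n * pi / z * (x + 2 * z)) = - cos (hf n * pi / z * x)" for n
    using cos_hf_shift[of n "x / z"] assms by (simp add: field_simps)
  then show ?thesis using suminf_minus[OF summable_q_term[OF assms, of x]] by (simp add: q_def)
qed

lemma q_scale: assumes "0 < z" shows "q t z x = q (t / z\<^sup>2) 1 (x / z) / z"
  by (simp add: q_def power_mult_distrib power_divide mult_ac)

lemma continuous_on_q_series:
  assumes "0 < t" "0 < z"
  shows "continuous_on S (\<lambda>x. \<Sum>n. exp (- ((hf n * pi / z)\<^sup>2 * t / 2)) * cos (hf n * pi / z * x))"
proof (rule continuous_on_suminf_bounded[OF _ _ summable_q_exp[OF assms]])
  show "\<bar>exp (- ((hf n * pi / z)\<^sup>2 * t / 2)) * cos (hf n * pi / z * x)\<bar> \<le> exp (- ((hf n * pi / z)\<^sup>2 * t / 2))" for n x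
    by (intro abs_mult_cos_le) simp
qed (intro continuous_intros)

lemma continuous_on_q [continuous_intros]:
  assumes "0 < t" "0 < z" "continuous_on S f" shows "continuous_on S (\<lambda>x. q t z (f x))"
proof -
  have "continuous_on UNIV (q t z)"
    unfolding q_def[abs_def] using assms(2) by (intro continuous_on_divide continuous_on_q_series assms) auto
  then show ?thesis by (rule continuous_on_compose2[OF _ assms(3)]) auto
qed

lemma q_measurable [measurable]:
  "q t z \<in> borel_measurable borel"
  unfolding q_def[abs_def] by measurable

text \<open>The Gaussian acts diagonally on the modes, so over the whole line the extended kernel
  evolves exactly. Killing restricts the integral to [-z, z]; the error of one step is the part
  outside.\<close>

lemma q_conv:
  assumes d: "0 < d" and t: "0 < t" and z: "0 < z"
  shows "has_bochner_integral lborel (\<lambda>y. q t z y * gk d (x - y)) (q (t + d) z x)"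
proof -
  define e where "e = (\<lambda>n. exp (- ((hf n * pi / z)\<^sup>2 * t / 2)))"
  define w where "w = (\<lambda>n. hf n * pi / z)"
  have e: "summable e" using summable_q_exp[OF t z] by (simp add: e_def)
  have ig: "integrable lborel (\<lambda>y. gk d (x - y))"
    using gk_integrable[OF d] lborel_integrable_real_affine[of "gk d" "-1" x] by simp
  have G: "(LINT y|lborel. gk d (x - y)) = 1"
    using gk_integral[OF d] lborel_integral_real_affine[of "-1" "gk d" x] by simp
  define f where "f = (\<lambda>n y. e n * (gk d (x - y) * cos (w n * y)))"
  have fi: "integrable lborel (f n)" for n
    unfolding f_def using gk_conv_cos[OF d, of x "w n"]
    by (intro integrable_mult_right) (auto simp: has_bochner_integral_iff)
  have fb: "\<bar>f n y\<bar> \<le> e n * gk d (x - y)" for n y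
    using d by (auto simp: f_def e_def abs_mult intro!: mult_left_le)
  have s1: "AE y in lborel. summable (\<lambda>n. norm (f n y))"
    using fb by (intro AE_I2 summable_comparison_test'[OF summable_mult2[OF e], of 0 _ ]) auto
  have fn: "(LINT y|lborel. norm (f n y)) \<le> e n" for n
  proof -
    have "(LINT y|lborel. norm (f n y)) \<le> (LINT y|lborel. e n * gk d (x - y))"
      using fi fb ig by (intro integral_mono) auto
    then show ?thesis using G by simp
  qed
  have s2: "summable (\<lambda>n. LINT y|lborel. norm (f n y))"
    by (rule summable_comparison_test'[OF e, of 0]) (use fn in \<open>auto simp: abs_of_nonneg integral_nonneg_AE\<close>)
  have "(\<Sum>n. f n y) = z * (q t z y * gk d (x - y))" for y
  proof -
    have "f n y = (e n * cos (w n * y)) * gk d (x - y)" for n by (simp add: f_def)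
    moreover have "summable (\<lambda>n. e n * cos (w n * y))"
      using summable_q_term[OF t z, of y] by (simp add: e_def w_def)
    ultimately have "(\<Sum>n. f n y) = (\<Sum>n. e n * cos (w n * y)) * gk d (x - y)"
      by (simp add: suminf_mult2)
    then show ?thesis using z by (simp add: q_def e_def w_def)
  qed
  then have 1: "integrable lborel (\<lambda>y. z * (q t z y * gk d (x - y)))"
    and 2: "(LINT y|lborel. z * (q t z y * gk d (x - y))) = (\<Sum>n. LINT y|lborel. f n y)"
    using integrable_suminf[OF fi s1 s2] integral_suminf[OF fi s1 s2] by auto
  have "(LINT y|lborel. f n y) = exp (- ((hf n * pi / z)\<^sup>2 * (t + d) / 2)) * cos (hf n * pi / z * x)" for n
  proof -
    have "(LINT y|lborel. f n y) = e n * (exp (- ((w n)\<^sup>2 * d / 2)) * cos (w n * x))"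
      using gk_conv_cos[OF d, of x "w n"] unfolding f_def by (simp add: has_bochner_integral_iff)
    then show ?thesis by (simp add: e_def w_def exp_add[symmetric] algebra_simps add_divide_distrib)
  qed
  with 2 have 3: "z * (LINT y|lborel. q t z y * gk d (x - y)) = z * q (t + d) z x"
    using z by (simp add: q_def)
  have 4: "integrable lborel (\<lambda>y. q t z y * gk d (x - y))"
    using 1 z by (simp add: integrable_mult_right_iff)
  show ?thesis using 3 4 z by (simp add: has_bochner_integral_iff)
qed

subsection \<open>Comparison with reflected Gaussians\<close>

text \<open>The method of images on [-1, 1] with source 0: copies of the Gaussian at the even
  integers with alternating signs. It converges fast for small t, where the cosine series is
  slow.\<close>

definition im :: "real \<Rightarrow> real \<Rightarrow> real" where
  "im t y = gk t y + (\<Sum>k. (-1) ^ Suc k * (gk t (2 * real (Suc k) + y) + gk t (2 * real (Suc k) - y)))"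

lemma gk_le_exp:
  assumes t: "0 < t" shows "gk t (2 * real k + 1) \<le> exp (- (2 / t)) ^ k / sqrt (2 * pi * t)"
proof -
  have "2 * real k * (2 * t) \<le> (2 * real k + 1)\<^sup>2 * t"
  proof -
    have "4 * real k \<le> (2 * real k + 1)\<^sup>2" by (simp add: power2_eq_square algebra_simps)
    then show ?thesis using t by simp
  qed
  then have "exp (- ((2 * real k + 1)\<^sup>2 / (2 * t))) \<le> exp (real k * (- (2 / t)))"
    using t by (simp add: field_simps)
  then have "exp (- ((2 * real k + 1)\<^sup>2 / (2 * t))) \<le> exp (- (2 / t)) ^ k"
    by (simp only: exp_of_nat_mult)
  then show ?thesis unfolding gk_def using t by (intro divide_right_mono) auto
qed

lemma summable_gk_odd: assumes "0 < t" shows "summable (\<lambda>k. gk t (2 * real k + 1))"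
proof (rule summable_comparison_test'[of "\<lambda>k. exp (- (2 / t)) ^ k / sqrt (2 * pi * t)" 0])
  show "summable (\<lambda>k. exp (- (2 / t)) ^ k / sqrt (2 * pi * t))"
    using assms by (intro summable_divide summable_geometric) auto
qed (use gk_le_exp[OF assms] assms in auto)

lemma im_term_bound:
  assumes "0 < t" "\<bar>y\<bar> \<le> 1"
  shows "gk t (2 * real (Suc k) + y) \<le> gk t (2 * real k + 1)" "gk t (2 * real (Suc k) - y) \<le> gk t (2 * real k + 1)"
  using assms by (auto intro!: gk_mono)

lemma im_cont: assumes "0 < t" shows "continuous_on {-1..1} (im t)"
  unfolding im_def[abs_def]
proof (intro continuous_on_add continuous_on_suminf_bounded[where K="\<lambda>k. 2 * gk t (2 * real k + 1)"] summable_mult summable_gk_odd assms continuous_intros)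
  fix k and y :: real assume "y \<in> {-1..1}"
  then have y: "\<bar>y\<bar> \<le> 1" by auto
  show "\<bar>(- 1) ^ Suc k * (gk t (2 * real (Suc k) + y) + gk t (2 * real (Suc k) - y))\<bar> \<le> 2 * gk t (2 * real k + 1)"
    using im_term_bound[OF assms y, of k] assms by (simp add: abs_mult power_abs del: of_nat_Suc)
qed

lemma has_integral_cos_zero:
  assumes "k \<noteq> 0" "k \<in> \<int>" shows "((\<lambda>y. cos (k * pi * y)) has_integral 0) {-1..1}"
proof -
  have "((\<lambda>y. cos (k * pi * y)) has_integral (sin (k * pi * 1) / (k * pi) - sin (k * pi * (-1)) / (k * pi))) {-1..1}"
    using assms by (intro fundamental_theorem_of_calculus)
      (auto intro!: derivative_eq_intros simp flip: has_real_derivative_iff_has_vector_derivative)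
  moreover have "sin (k * pi) = 0" using assms(2) by (auto elim!: Ints_cases simp: sin_zero_iff_int2)
  ultimately show ?thesis by simp
qed

lemma integral_cos_hf_cos_hf:
  "integral {-1..1} (\<lambda>y. cos (hf n * pi * y) * cos (hf j * pi * y)) = (if n = j then 1 else 0)"
proof -
  have eq: "(\<lambda>y. cos (hf n * pi * y) * cos (hf j * pi * y)) =
     (\<lambda>y. cos ((hf n - hf j) * pi * y) / 2 + cos ((hf n + hf j) * pi * y) / 2)"
    by (auto simp: fun_eq_iff cos_times_cos left_diff_distrib distrib_right add_divide_distrib)
  have "hf n + hf j = of_int (int n + int j + 1)" by (simp add: hf_def)
  then have p: "hf n + hf j \<in> \<int>" by (metis Ints_of_int)
  have "hf n - hf j = of_int (int n - int j)" by (simp add: hf_def)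
  then have m: "hf n - hf j \<in> \<int>" by (metis Ints_of_int)
  have p0: "hf n + hf j \<noteq> 0" using hf_pos[of n] hf_pos[of j] by linarith
  have P: "((\<lambda>y. cos ((hf n + hf j) * pi * y) / 2) has_integral 0 / 2) {-1..1}"
    by (intro has_integral_divide has_integral_cos_zero p p0)
  have M: "((\<lambda>y. cos ((hf n - hf j) * pi * y) / 2) has_integral (if n = j then 1 else 0)) {-1..1}"
  proof (cases "n = j")
    case True
    then show ?thesis using has_integral_const_real[of "1/2::real" "-1" 1] by simp
  next
    case False
    then have "hf n - hf j \<noteq> 0" by (simp add: hf_def)
    from has_integral_divide[OF has_integral_cos_zero[OF this m], of 2] False show ?thesis by simp
  qed
  show ?thesis unfolding eq using has_integral_add[OF M P] by (simp add: integral_unique)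
qed

lemma q_coeff:
  assumes t: "0 < t"
  shows "integral {-1..1} (\<lambda>y. q t 1 y * cos (hf j * pi * y)) = exp (- ((hf j * pi)\<^sup>2 * t / 2))"
proof -
  let ?e = "\<lambda>n. exp (- ((hf n * pi)\<^sup>2 * t / 2))"
  have "(\<lambda>n. integral {-1..1} (\<lambda>y. (?e n * cos (hf n * pi * y)) * cos (hf j * pi * y))) sums
     integral {-1..1} (\<lambda>y. (\<Sum>n. ?e n * cos (hf n * pi * y)) * cos (hf j * pi * y))"
    using summable_q_exp[OF t, of 1]
    by (intro sums_integral_mult[where K = ?e]) (auto intro!: continuous_intros simp: abs_mult)
  also have "(\<lambda>n. integral {-1..1} (\<lambda>y. (?e n * cos (hf n * pi * y)) * cos (hf j * pi * y))) = (\<lambda>n. if n = j then ?e n else 0)"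
    using integral_cos_hf_cos_hf[of _ j] by (auto simp: fun_eq_iff mult.assoc[of "exp _"])
  finally have "(\<lambda>n. if n = j then ?e n else 0) sums integral {-1..1} (\<lambda>y. q t 1 y * cos (hf j * pi * y))"
    by (simp add: q_def)
  then show ?thesis using sums_single[of j ?e] sums_unique2 by blast
qed

text \<open>Unfolding: the translates of [-1, 1] by even integers tile the line, and the cosine
  changes sign under a shift by 2 just as the images do. The coefficient is therefore the integral
  of \<open>gk t\<close> times the cosine over the whole line.\<close>

lemma im_coeff:
  assumes t: "0 < t"
  shows "integral {-1..1} (\<lambda>y. im t y * cos (hf j * pi * y)) = exp (- ((hf j * pi)\<^sup>2 * t / 2))"
proof -
  define c where "c = (\<lambda>y. cos (hf j * pi * y))"
  define g where "g = (\<lambda>x. gk t x * c x)"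
  have cc: "continuous_on S c" for S by (auto simp: c_def intro!: continuous_intros)
  have cg: "continuous_on S g" for S using t by (auto simp: g_def intro!: continuous_intros cc)
  have int: "g integrable_on {a..b}" for a b by (rule integrable_continuous_real[OF cg])
  define T where "T = (\<lambda>k y. (-1) ^ Suc k * (gk t (2 * real (Suc k) + y) + gk t (2 * real (Suc k) - y)))"
  have Tc: "continuous_on {-1..1} (T k)" for k unfolding T_def using t by (intro continuous_intros) auto
  have Tb: "\<bar>T k y\<bar> \<le> 2 * gk t (2 * real k + 1)" if "y \<in> {-1..1}" for k y
  proof -
    have "\<bar>y\<bar> \<le> 1" using that by auto
    from im_term_bound[OF t this, of k] show ?thesis using t
      by (simp add: T_def abs_mult power_abs del: of_nat_Suc)
  qed
  have Ts: "(\<lambda>k. integral {-1..1} (\<lambda>y. T k y * c y)) sums integral {-1..1} (\<lambda>y. (\<Sum>k. T k y) * c y)"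
    by (rule sums_integral_mult[OF Tc Tb summable_mult[OF summable_gk_odd[OF t]] cc])
  have cs: "c (y - 2 * real m) = (-1) ^ m * c y" for m y
  proof (induction m arbitrary: y)
    case (Suc m)
    have "c (y - 2 * real (Suc m)) = - c (y - 2 * real (Suc m) + 2)"
      using cos_hf_shift[of j "y - 2 * real (Suc m)"] by (simp add: c_def)
    also have "y - 2 * real (Suc m) + 2 = y - 2 * real m" by simp
    finally show ?case using Suc by simp
  qed simp
  have ce: "c (- y) = c y" for y by (simp add: c_def)
  \<comment> \<open>The two images of index k fill the two outer intervals of length 2 that extend
    [-(2k+1), 2k+1] to [-(2k+3), 2k+3]; partial sums thus become integrals over growing symmetric
    intervals.\<close>
  have T1: "integral {-1..1} (\<lambda>y. T k y * c y) = integral {2 * real k + 1..2 * real k + 3} g + integral {-(2 * real k + 3)..-(2 * real k + 1)} g" for k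
  proof -
    let ?m = "2 * real (Suc k)"
    have 1: "((\<lambda>y. g (y + ?m)) has_integral integral {2 * real k + 1..2 * real k + 3} g) {-1..1}"
    proof -
      have "(g has_integral integral {2 * real k + 1..2 * real k + 3} g) (cbox (-1 + ?m) (1 + ?m))"
        using integrable_integral[OF int, of "2 * real k + 1" "2 * real k + 3"] by (simp add: algebra_simps)
      from has_integral_affinity'[OF this, of 1 ?m] show ?thesis by simp
    qed
    have 2: "((\<lambda>y. g (y - ?m)) has_integral integral {-(2 * real k + 3)..-(2 * real k + 1)} g) {-1..1}"
    proof -
      have "(g has_integral integral {-(2 * real k + 3)..-(2 * real k + 1)} g) (cbox (-1 - ?m) (1 - ?m))"
        using integrable_integral[OF int, of "-(2 * real k + 3)" "-(2 * real k + 1)"] by (simp add: algebra_simps)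
      from has_integral_affinity'[OF this, of 1 "-?m"]
      have "((\<lambda>y. g (y + - ?m)) has_integral integral {-(2 * real k + 3)..-(2 * real k + 1)} g) {-1..1}"
        by (simp add: algebra_simps)
      then show ?thesis by (simp only: add_uminus_conv_diff)
    qed
    have "T k y * c y = g (y + ?m) + g (y - ?m)" for y
    proof -
      have "- y - ?m = - (y + ?m)" by (rule minus_add_distrib[symmetric, unfolded add_uminus_conv_diff])
      then have "c (y + ?m) = c (- y - ?m)" by (simp only: ce)
      also have "\<dots> = (-1) ^ Suc k * c y" by (simp only: cs ce)
      finally have a: "c (y + ?m) = (-1) ^ Suc k * c y" .
      have b: "c (y - ?m) = (-1) ^ Suc k * c y" by (rule cs)
      have "gk t (y - ?m) = gk t (?m - y)" by (rule gk_minus_commute)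
      moreover have "gk t (?m + y) = gk t (y + ?m)" by (simp only: add.commute)
      ultimately show ?thesis unfolding g_def a b T_def by (simp only: distrib_left distrib_right mult.commute mult.left_commute)
    qed
    then have "(\<lambda>y. T k y * c y) = (\<lambda>y. g (y + ?m) + g (y - ?m))" by (rule ext)
    with has_integral_add[OF 1 2] show ?thesis by (simp only: integral_unique)
  qed
  have part: "integral {-1..1} g + (\<Sum>k<N. integral {-1..1} (\<lambda>y. T k y * c y)) = integral {-(2 * real N + 1)..2 * real N + 1} g" for N
  proof (induction N)
    case (Suc N)
    have "integral {-(2 * real N + 3)..2 * real N + 3} g = integral {-(2 * real N + 3)..-(2 * real N + 1)} g + integral {-(2 * real N + 1)..2 * real N + 3} g"
      by (rule Henstock_Kurzweil_Integration.integral_combine[symmetric]) (auto intro: int)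
    also have "integral {-(2 * real N + 1)..2 * real N + 3} g = integral {-(2 * real N + 1)..2 * real N + 1} g + integral {2 * real N + 1..2 * real N + 3} g"
      by (rule Henstock_Kurzweil_Integration.integral_combine[symmetric]) (auto intro: int)
    finally have "integral {-(2 * real N + 3)..2 * real N + 3} g =
       integral {-1..1} g + (\<Sum>k<Suc N. integral {-1..1} (\<lambda>y. T k y * c y))"
      using Suc T1[of N] by (simp only: sum.lessThan_Suc add.assoc add.commute add.left_commute)
    moreover have "2 * real (Suc N) + 1 = 2 * real N + 3" by simp
    ultimately show ?case by (simp only:)
  qed simp
  have hb: "has_bochner_integral lborel g (exp (- ((hf j * pi)\<^sup>2 * t / 2)))"
    using gk_conv_cos[OF t, of 0 "hf j * pi"] unfolding g_def c_def by simp
  have lim: "(\<lambda>N. integral {-(2 * real N + 1)..2 * real N + 1} g) \<longlonglongrightarrow> exp (- ((hf j * pi)\<^sup>2 * t / 2))"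
  proof -
    have gi: "integrable lborel g" using hb by (simp add: has_bochner_integral_iff)
    have "(\<lambda>N. LINT x:{-(2 * real N + 1)..2 * real N + 1}|lborel. g x) \<longlonglongrightarrow> (LINT x|lborel. g x)"
      unfolding set_lebesgue_integral_def
    proof (rule integral_dominated_convergence[where w="\<lambda>x. norm (g x)"])
      show "AE x in lborel. (\<lambda>N. indicator {-(2 * real N + 1)..2 * real N + 1} x *\<^sub>R g x) \<longlonglongrightarrow> g x"
      proof (rule AE_I2)
        fix x :: real
        obtain N0 where "\<bar>x\<bar> \<le> real N0" using real_arch_simple by blast
        then have "\<forall>\<^sub>F N in sequentially. indicator {-(2 * real N + 1)..2 * real N + 1} x *\<^sub>R g x = g x"
          by (intro eventually_sequentiallyI[of N0]) (auto simp: indicator_def)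
        then show "(\<lambda>N. indicator {-(2 * real N + 1)..2 * real N + 1} x *\<^sub>R g x) \<longlonglongrightarrow> g x"
          by (rule tendsto_eventually)
      qed
    qed (use gi in \<open>auto simp: indicator_def\<close>)
    moreover have "(LINT x:{-(2 * real N + 1)..2 * real N + 1}|lborel. g x) = integral {-(2 * real N + 1)..2 * real N + 1} g" for N
      by (rule set_borel_integral_eq_integral) (rule borel_integrable_atLeastAtMost', rule cg)
    ultimately show ?thesis using hb by (simp add: has_bochner_integral_iff)
  qed
  have "(\<lambda>N. integral {-1..1} g + (\<Sum>k<N. integral {-1..1} (\<lambda>y. T k y * c y))) \<longlonglongrightarrow> integral {-1..1} g + integral {-1..1} (\<lambda>y. (\<Sum>k. T k y) * c y)"
    using Ts by (intro tendsto_intros) (simp only: sums_def)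
  from LIMSEQ_unique[OF this[unfolded part] lim]
  have "integral {-1..1} g + integral {-1..1} (\<lambda>y. (\<Sum>k. T k y) * c y) = exp (- ((hf j * pi)\<^sup>2 * t / 2))" .
  moreover have "integral {-1..1} (\<lambda>y. im t y * c y) = integral {-1..1} g + integral {-1..1} (\<lambda>y. (\<Sum>k. T k y) * c y)"
  proof -
    have "continuous_on {-1..1} (\<lambda>y. \<Sum>k. T k y)"
      by (rule continuous_on_suminf_bounded[OF Tc Tb summable_mult[OF summable_gk_odd[OF t]]])
    then have "(\<lambda>y. (\<Sum>k. T k y) * c y) integrable_on {-1..1}"
      by (intro integrable_continuous_real continuous_intros cc)
    moreover have "(\<lambda>y. im t y * c y) = (\<lambda>y. g y + (\<Sum>k. T k y) * c y)"
      by (simp only: im_def g_def T_def distrib_right)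
    ultimately show ?thesis by (simp only: integral_add[OF int])
  qed
  ultimately show ?thesis by (simp add: c_def)
qed

lemma im_minus: "im t (- y) = im t y"
  by (simp add: im_def add.commute)

text \<open>Both sides are even and antiperiodic with the same Fourier coefficients. Their difference is therefore
  orthogonal to \<open>cos (\<pi> y / 2) p (cos (\<pi> y))\<close> for every polynomial \<open>p\<close>, hence zero by Weierstrass.\<close>

lemma q_eq_im:
  assumes t: "0 < t" and y: "\<bar>y\<bar> < 1"
  shows "q t 1 y = im t y"
proof -
  define D where "D = (\<lambda>y. q t 1 y - im t y)"
  have cD: "continuous_on {-1..1} D" unfolding D_def using t by (intro continuous_intros im_cont) auto
  have De: "D (- y) = D y" for y by (simp add: D_def im_minus)
  define c where "c = (\<lambda>j y. cos (hf j * pi * y))"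
  have cc: "continuous_on S (c j)" for S j unfolding c_def by (intro continuous_intros)
  have ck: "continuous_on S (\<lambda>y. cos (pi * y) ^ k)" for S k by (intro continuous_intros)
  have orth: "integral {-1..1} (\<lambda>y. D y * c j y * cos (pi * y) ^ k) = 0" for k j
  proof (induction k arbitrary: j)
    case 0
    have "integral {-1..1} (\<lambda>y. q t 1 y * c j y - im t y * c j y) = integral {-1..1} (\<lambda>y. q t 1 y * c j y) - integral {-1..1} (\<lambda>y. im t y * c j y)"
      using t by (intro integral_diff integrable_continuous_real continuous_intros cc im_cont) auto
    then show ?case using q_coeff[OF t, of j] im_coeff[OF t, of j] by (simp add: D_def c_def left_diff_distrib)
  next
    case (Suc k)
    \<comment> \<open>For j = 0 the truncated j - 1 is 0, which is the right neighbour: its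
      frequency is -1/2 and cosine is even. Multiplication by cos (pi y) thus stays inside the
      family \<open>c\<close>, so the induction on k works for all j at once.\<close>
    have c1: "c j y * cos (pi * y) = c (Suc j) y / 2 + c (j - 1) y / 2" for y
    proof -
      have a: "hf j * pi * y + pi * y = hf (Suc j) * pi * y" by (simp add: hf_def algebra_simps)
      have b: "cos (hf j * pi * y - pi * y) = c (j - 1) y"
      proof (cases j)
        case 0
        have "hf j * pi * y - pi * y = - (hf 0 * pi * y)" using 0 by (simp add: hf_def algebra_simps)
        then have "cos (hf j * pi * y - pi * y) = cos (- (hf 0 * pi * y))" by (simp only:)
        then show ?thesis using 0 by (simp add: c_def)
      next
        case (Suc i)
        have "hf j * pi * y - pi * y = hf i * pi * y" using Suc by (simp add: hf_def algebra_simps)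
        then show ?thesis using Suc by (simp add: c_def)
      qed
      have "c j y * cos (pi * y) = (cos (hf j * pi * y - pi * y) + cos (hf j * pi * y + pi * y)) / 2"
        unfolding c_def by (rule cos_times_cos)
      then show ?thesis unfolding b a by (simp add: c_def)
    qed
    have c2: "D y * c j y * cos (pi * y) ^ Suc k = D y * c (Suc j) y * cos (pi * y) ^ k / 2 + D y * c (j - 1) y * cos (pi * y) ^ k / 2" for y
    proof -
      have "D y * c j y * cos (pi * y) ^ Suc k = D y * (c j y * cos (pi * y)) * cos (pi * y) ^ k" by simp
      then show ?thesis unfolding c1 by (simp add: algebra_simps)
    qed
    have i: "(\<lambda>y. D y * c j y * cos (pi * y) ^ k) integrable_on {-1..1}" for j
      by (intro integrable_continuous_real continuous_intros cD cc)
    have h: "((\<lambda>y. D y * c j y * cos (pi * y) ^ k / 2) has_integral 0 / 2) {-1..1}" for j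
      using integrable_integral[OF i, of j] by (intro has_integral_divide) (simp add: Suc)
    show ?case unfolding c2 using has_integral_add[OF h h, of "Suc j" "j - 1"] by (simp add: integral_unique)
  qed
  obtain B where B: "\<And>y. y \<in> {-1..1} \<Longrightarrow> \<bar>D y\<bar> \<le> B"
    using compact_imp_bounded[OF compact_continuous_image[OF cD compact_Icc]]
    unfolding bounded_iff by (metis (no_types, lifting) imageI real_norm_def)
  have B0: "0 \<le> B" using B[of 0] by auto
  \<comment> \<open>Evenness of \<open>D\<close> makes it a function of cos (pi y) on the whole
    interval, and a polynomial close to \<open>G\<close> can be tested against
    \<open>D\<close>.\<close>
  define G where "G = (\<lambda>u. D (arccos u / pi))"
  have cG: "continuous_on {-1..1} G"
    unfolding G_def
  proof (rule continuous_on_compose2[OF cD])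
    show "(\<lambda>u. arccos u / pi) ` {-1..1} \<subseteq> {-1..1}"
    proof (rule image_subsetI)
      fix u :: real assume "u \<in> {-1..1}"
      then have "0 \<le> arccos u" "arccos u \<le> pi" using arccos_lbound[of u] arccos_ubound[of u] by auto
      then have "0 \<le> arccos u / pi" "arccos u / pi \<le> 1" by auto
      then show "arccos u / pi \<in> {-1..1}" by auto
    qed
    show "continuous_on {-1..1} (\<lambda>u. arccos u / pi)"
      by (intro continuous_on_divide continuous_on_arccos' continuous_on_const) auto
  qed
  have DG: "D y = G (cos (pi * y))" if "y \<in> {-1..1}" for y
  proof -
    have "cos (pi * y) = cos (pi * \<bar>y\<bar>)" by (cases "0 \<le> y") auto
    moreover have "arccos (cos (pi * \<bar>y\<bar>)) = pi * \<bar>y\<bar>" using that by (intro arccos_cos) auto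
    ultimately have "G (cos (pi * y)) = D \<bar>y\<bar>" by (simp add: G_def)
    then show ?thesis using De[of y] by (auto simp: abs_if)
  qed
  \<comment> \<open>Replacing one factor \<open>D\<close> by its polynomial approximation costs at
    most a multiple of e, and the rest is 0 by orthogonality; so the weighted square integral
    vanishes. The weight \<open>c 0\<close> is positive inside the interval.\<close>
  define J where "J = integral {-1..1} (\<lambda>y. D y * c 0 y * D y)"
  have le: "\<bar>J\<bar> \<le> 2 * B * e" if e: "0 < e" for e
  proof -
    obtain p where p: "real_polynomial_function p" "\<And>x. x \<in> {-1..1} \<Longrightarrow> \<bar>G x - p x\<bar> < e"
      using Stone_Weierstrass_real_polynomial_function[OF compact_Icc cG e] by blast
    obtain a n where pn: "p = (\<lambda>x. \<Sum>i\<le>n. a i * x ^ i)" using p(1) unfolding real_polynomial_function_iff_sum by blast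
    have "((\<lambda>y. \<Sum>i\<le>n. a i * (D y * c 0 y * cos (pi * y) ^ i)) has_integral (\<Sum>i\<le>n. a i * 0)) {-1..1}"
    proof (intro has_integral_sum has_integral_mult_right)
      show "((\<lambda>y. D y * c 0 y * cos (pi * y) ^ i) has_integral 0) {-1..1}" for i
      proof -
        have "(\<lambda>y. D y * c 0 y * cos (pi * y) ^ i) integrable_on {-1..1}"
          by (intro integrable_continuous_real continuous_intros cD cc)
        from integrable_integral[OF this] show ?thesis by (simp only: orth)
      qed
    qed auto
    moreover have "(\<lambda>y. \<Sum>i\<le>n. a i * (D y * c 0 y * cos (pi * y) ^ i)) = (\<lambda>y. D y * c 0 y * p (cos (pi * y)))"
      by (simp add: pn sum_distrib_left mult.left_commute)
    ultimately have pi0: "((\<lambda>y. D y * c 0 y * p (cos (pi * y))) has_integral 0) {-1..1}"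
      by simp
    have "((\<lambda>y. D y * c 0 y * D y) has_integral J) {-1..1}"
      unfolding J_def by (intro integrable_integral integrable_continuous_real continuous_intros cD cc)
    from has_integral_diff[OF this pi0]
    have hi: "((\<lambda>y. D y * c 0 y * (D y - p (cos (pi * y)))) has_integral J) (cbox (-1) 1)"
      by (simp add: right_diff_distrib)
    have "norm J \<le> (B * e) * measure lborel (cbox (-1) (1::real))"
    proof (rule has_integral_bound[OF _ hi])
      fix y :: real assume "y \<in> cbox (-1) 1"
      then have y: "y \<in> {-1..1}" by simp
      have "\<bar>D y - p (cos (pi * y))\<bar> \<le> e" using p(2)[of "cos (pi * y)"] DG[OF y] by auto
      moreover have "\<bar>D y * c 0 y\<bar> \<le> B * 1"
        unfolding abs_mult using B[OF y] by (intro mult_mono) (auto simp: c_def)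
      ultimately show "norm (D y * c 0 y * (D y - p (cos (pi * y)))) \<le> B * e"
        unfolding real_norm_def abs_mult[of "D y * c 0 y"] using B0 by (intro mult_mono) auto
    qed (use B0 e in auto)
    then show ?thesis by simp
  qed
  have "J = 0"
  proof (rule ccontr)
    assume "J \<noteq> 0"
    then have J: "0 < \<bar>J\<bar>" by simp
    have "\<bar>J\<bar> \<le> 2 * B * (\<bar>J\<bar> / (2 * (2 * B + 1)))" using J B0 by (intro le) auto
    also have "\<dots> < \<bar>J\<bar>" using J B0 by (simp add: field_simps add_pos_nonneg)
    finally show False by simp
  qed
  have c0: "0 \<le> c 0 y" if "y \<in> {-1..1}" for y
  proof -
    have "\<bar>pi * y / 2\<bar> \<le> pi / 2" using that by (auto simp: abs_mult abs_le_iff)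
    then show ?thesis unfolding c_def hf_def by (auto intro!: cos_ge_zero simp: abs_le_iff)
  qed
  have nn: "0 \<le> D y * c 0 y * D y" if "y \<in> {-1..1}" for y
    using mult_nonneg_nonneg[OF c0[OF that] zero_le_square[of "D y"]] by (simp only: mult.assoc mult.commute mult.left_commute)
  have "continuous_on {-1..1} (\<lambda>y. D y * c 0 y * D y)"
    by (intro continuous_intros cD cc)
  from integral_eq_0_iff[OF this _ nn] \<open>J = 0\<close> have "\<forall>y\<in>{-1..1}. D y * c 0 y * D y = 0"
    unfolding J_def by simp
  moreover have "c 0 y > 0"
  proof -
    have "\<bar>pi * y / 2\<bar> < pi / 2" using y by (auto simp: abs_mult abs_less_iff)
    then show ?thesis unfolding c_def hf_def by (auto intro!: cos_gt_zero_pi simp: abs_less_iff)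
  qed
  ultimately have "D y = 0" using y by (auto simp: abs_less_iff)
  then show ?thesis by (simp add: D_def)
qed

section \<open>Positivity and small-time bounds of the absorbing kernel\<close>

lemma exp_minus_two_series:
  shows "summable (\<lambda>n. (2 * real (Suc n) + 1) * exp (- 2 * real (Suc n)))"
    and "(\<Sum>n. (2 * real (Suc n) + 1) * exp (- 2 * real (Suc n))) \<le> 1"
proof -
  have "5/2 \<le> exp (1::real)" using exp_lower_Taylor_quadratic[of 1] by (simp add: power2_eq_square)
  then have "(5/2)^2 \<le> exp (1::real) ^ 2" by (intro power_mono) auto
  then have e2: "3 * exp (-2::real) \<le> 1/2"
    by (simp add: power2_eq_square exp_minus field_simps flip: exp_add)
  \<comment> \<open>With 2m + 1 \<le> 3^m the terms are at most (3 exp (-2))^m \<le> 2^(-m), and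
    these sum to 1 from m = 1 on.\<close>
  have p3: "2 * real n + 1 \<le> 3 ^ n" for n by (induction n) auto
  have le: "(2 * real (Suc n) + 1) * exp (- 2 * real (Suc n)) \<le> (1/2) ^ Suc n" for n
  proof -
    have "exp (- 2 * real (Suc n)) = exp (-2) ^ Suc n"
      using exp_of_nat_mult[of "Suc n" "-2::real"] by (simp add: mult.commute)
    then have "(2 * real (Suc n) + 1) * exp (- 2 * real (Suc n)) \<le> 3 ^ Suc n * exp (-2) ^ Suc n"
      using p3[of "Suc n"] by (metis exp_ge_zero mult_right_mono zero_le_power)
    also have "\<dots> = (3 * exp (-2)) ^ Suc n" by (simp only: power_mult_distrib)
    also have "\<dots> \<le> (1/2) ^ Suc n" using e2 by (intro power_mono) auto
    finally show ?thesis .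
  qed
  have g: "(\<lambda>n. (1/2::real) ^ Suc n) sums 1" by (rule power_half_series)
  show s: "summable (\<lambda>n. (2 * real (Suc n) + 1) * exp (- 2 * real (Suc n)))"
    by (rule summable_comparison_test'[of "\<lambda>n. (1/2::real) ^ Suc n" 0]) (use le g in \<open>auto simp: sums_iff\<close>)
  show "(\<Sum>n. (2 * real (Suc n) + 1) * exp (- 2 * real (Suc n))) \<le> 1"
    using suminf_le[OF le s] g by (simp add: sums_iff)
qed

text \<open>The weights of the tail sum to at most 1, so the tail cannot outweigh the head. The
  bound is relative to \<open>a 0\<close> because in both uses the head itself tends to 0 at the
  endpoint.\<close>

lemma suminf_nonneg_if_head_dominates:
  fixes a :: "nat \<Rightarrow> real"
  assumes a0: "0 \<le> a 0" and le: "\<And>n. \<bar>a (Suc n)\<bar> \<le> a 0 * ((2 * real (Suc n) + 1) * exp (- 2 * real (Suc n)))"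
  shows "0 \<le> (\<Sum>n. a n)"
proof -
  note e = exp_minus_two_series
  have s: "summable (\<lambda>n. \<bar>a (Suc n)\<bar>)"
    by (rule summable_comparison_test'[OF summable_mult[OF e(1), of "a 0"], of 0]) (use le in auto)
  then have s': "summable a" using summable_Suc_iff summable_rabs_cancel by blast
  have "\<bar>\<Sum>n. a (Suc n)\<bar> \<le> (\<Sum>n. \<bar>a (Suc n)\<bar>)" by (rule summable_rabs[OF s])
  also have "\<dots> \<le> (\<Sum>n. a 0 * ((2 * real (Suc n) + 1) * exp (- 2 * real (Suc n))))"
    by (intro suminf_le le s summable_mult e)
  also have "\<dots> = a 0 * (\<Sum>n. ((2 * real (Suc n) + 1) * exp (- 2 * real (Suc n))))"
    by (rule suminf_mult[OF e(1)])
  also have "\<dots> \<le> a 0 * 1" by (intro mult_left_mono e a0)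
  finally show ?thesis using suminf_split_head[OF s'] by linarith
qed

text \<open>The cosine analogue of |sin (n x)| \<le> n |sin x|. It retains the factor cos p, so that
  higher modes can be compared with the first one up to the endpoint, where both vanish.\<close>

lemma abs_cos_odd_le:
  assumes "0 \<le> cos (p::real)" shows "\<bar>cos ((2 * real n + 1) * p)\<bar> \<le> (2 * real n + 1) * cos p"
proof (induction n)
  case (Suc n)
  have "(2 * real (Suc n) + 1) * p = (2 * real n + 1) * p + 2 * p" by (simp add: algebra_simps)
  then have "cos ((2 * real (Suc n) + 1) * p) = cos ((2 * real n + 1) * p) * cos (2 * p) - sin ((2 * real n + 1) * p) * sin (2 * p)"
    by (simp only: cos_add)
  also have "\<bar>\<dots>\<bar> \<le> \<bar>cos ((2 * real n + 1) * p) * cos (2 * p)\<bar> + \<bar>sin ((2 * real n + 1) * p) * sin (2 * p)\<bar>"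
    by (rule abs_triangle_ineq4)
  also have "\<dots> \<le> (2 * real n + 1) * cos p * 1 + 1 * (2 * cos p)"
  proof (intro add_mono)
    show "\<bar>cos ((2 * real n + 1) * p) * cos (2 * p)\<bar> \<le> (2 * real n + 1) * cos p * 1"
      unfolding abs_mult using Suc assms by (intro mult_mono) auto
    have "\<bar>sin (2 * p)\<bar> \<le> 2 * cos p"
      using assms abs_sin_le_one[of p] mult_right_mono[of "\<bar>sin p\<bar>" 1 "cos p"] by (simp add: sin_double abs_mult)
    then show "\<bar>sin ((2 * real n + 1) * p) * sin (2 * p)\<bar> \<le> 1 * (2 * cos p)"
      unfolding abs_mult using assms by (intro mult_mono) auto
  qed
  finally show ?case by (simp add: algebra_simps)
qed (use assms in simp)

lemma q_end: assumes "0 < t" "0 < z" shows "q t z z = 0" "q t z (- z) = 0"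
  using q_shift[OF assms, of "-z"] by auto

text \<open>No maximum principle is invoked. For t \<ge> 1 the first cosine mode dominates all
  others; for t < 1 the pair of images nearest to the point dominates. The endpoints form a case of
  their own since the image formula is available only in the open interval.\<close>

lemma q1_nonneg:
  assumes t: "0 < t" and y: "\<bar>y\<bar> \<le> 1" shows "0 \<le> q t 1 y"
proof -
  consider "1 \<le> t" | "t < 1" "\<bar>y\<bar> = 1" | "t < 1" "\<bar>y\<bar> < 1" using y by linarith
  then show ?thesis
  proof cases
    case 1
    let ?a = "\<lambda>n. exp (- ((hf n * pi)\<^sup>2 * t / 2)) * cos (hf n * pi * y)"
    have cy: "0 \<le> cos (pi * y / 2)"
    proof -
      have "\<bar>pi * y / 2\<bar> \<le> pi / 2" using y by (auto simp: abs_mult)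
      then show ?thesis by (auto intro!: cos_ge_zero simp: abs_le_iff)
    qed
    have "0 \<le> (\<Sum>n. ?a n)"
    proof (rule suminf_nonneg_if_head_dominates)
      have a0: "?a 0 = exp (- (pi\<^sup>2 * t / 8)) * cos (pi * y / 2)"
        by (simp add: hf_def power_mult_distrib power_divide power2_eq_square)
      show "0 \<le> ?a 0" unfolding a0 using cy by simp
      fix n
      let ?m = "Suc n"
      have c: "\<bar>cos (hf ?m * pi * y)\<bar> \<le> (2 * real ?m + 1) * cos (pi * y / 2)"
        using abs_cos_odd_le[OF cy, of ?m] by (simp add: hf_def algebra_simps add_divide_distrib)
      have p2: "4 \<le> pi\<^sup>2"
        using mult_mono[of 2 pi 2 pi] pi_ge_two by (simp add: power2_eq_square)
      have "2 * real ?m \<le> real ?m * (real ?m + 1) * (pi\<^sup>2 * t / 2)"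
      proof -
        have "1 * 2 \<le> (real ?m + 1) * (pi\<^sup>2 * t / 2)"
        proof (rule mult_mono)
          have "4 * 1 \<le> pi\<^sup>2 * t" using p2 1 by (intro mult_mono) auto
          then show "2 \<le> pi\<^sup>2 * t / 2" by simp
        qed auto
        then have "real ?m * 2 \<le> real ?m * ((real ?m + 1) * (pi\<^sup>2 * t / 2))" by (intro mult_left_mono) auto
        then show ?thesis by (simp only: mult.assoc mult.commute mult.left_commute)
      qed
      moreover have "(hf ?m * pi)\<^sup>2 * t / 2 = pi\<^sup>2 * t / 8 + real ?m * (real ?m + 1) * (pi\<^sup>2 * t / 2)"
        by (simp add: hf_def power2_eq_square field_simps)
      ultimately have "exp (- ((hf ?m * pi)\<^sup>2 * t / 2)) \<le> exp (- (pi\<^sup>2 * t / 8) + (- 2 * real ?m))"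
        by (simp only: exp_le_cancel_iff)
      then have e: "exp (- ((hf ?m * pi)\<^sup>2 * t / 2)) \<le> exp (- (pi\<^sup>2 * t / 8)) * exp (- 2 * real ?m)" by (simp only: exp_add)
      have "\<bar>?a ?m\<bar> \<le> (exp (- (pi\<^sup>2 * t / 8)) * exp (- 2 * real ?m)) * ((2 * real ?m + 1) * cos (pi * y / 2))"
        unfolding abs_mult using e c cy by (intro mult_mono) auto
      then show "\<bar>?a ?m\<bar> \<le> ?a 0 * ((2 * real ?m + 1) * exp (- 2 * real ?m))"
        unfolding a0 by (simp only: mult.assoc mult.commute mult.left_commute)
    qed
    then show ?thesis by (simp add: q_def)
  next
    case 2
    then have "y = 1 \<or> y = -1" by auto
    then show ?thesis using q_end[OF t, of 1] by auto
  next
    case 3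
    define x where "x = \<bar>y\<bar>"
    have x: "0 \<le> x" "x < 1" using 3 by (auto simp: x_def)
    have qx: "q t 1 y = q t 1 x" by (auto simp: x_def abs_if)
    \<comment> \<open>The images at 2j + x and 2(j + 1) - x have opposite signs and coincide in size
      at x = 1, so each difference carries the boundary zero.\<close>
    define a where "a = (\<lambda>j. (-1) ^ j * (gk t (2 * real j + x) - gk t (2 * real (Suc j) - x)))"
    have "im t x = (\<Sum>j. a j)"
    proof -
      let ?u = "\<lambda>j. (-1) ^ j * gk t (2 * real j + x)"
      let ?v = "\<lambda>j. (-1) ^ Suc j * gk t (2 * real (Suc j) - x)"
      have su: "summable (\<lambda>j. ?u (Suc j))"
        by (rule summable_comparison_test'[OF summable_gk_odd[OF t], of 0])
           (use im_term_bound[OF t, of x] x t in \<open>auto simp: abs_mult power_abs simp del: of_nat_Suc\<close>)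
      then have su': "summable ?u" using summable_Suc_iff[of ?u] by blast
      have sv: "summable ?v"
        by (rule summable_comparison_test'[OF summable_gk_odd[OF t], of 0])
           (use im_term_bound[OF t, of x] x t in \<open>auto simp: abs_mult power_abs simp del: of_nat_Suc\<close>)
      have "im t x = gk t x + ((\<Sum>j. ?u (Suc j)) + (\<Sum>j. ?v j))"
        unfolding im_def by (simp only: distrib_left suminf_add[OF su sv, symmetric])
      also have "\<dots> = (\<Sum>j. ?u j) + (\<Sum>j. ?v j)" using suminf_split_head[OF su'] by simp
      also have "\<dots> = (\<Sum>j. ?u j + ?v j)" by (rule suminf_add[OF su' sv])
      also have "(\<lambda>j. ?u j + ?v j) = a" by (simp add: fun_eq_iff a_def right_diff_distrib del: of_nat_Suc)
      finally show ?thesis .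
    qed
    moreover have "0 \<le> (\<Sum>j. a j)"
    proof (rule suminf_nonneg_if_head_dominates)
      \<comment> \<open>The ratio of the two paired Gaussians is s^(2j+1) because the difference of
        their squared arguments is (2 - 2x)(4j + 2).\<close>
      define s where "s = exp (- (2 * (1 - x) / t))"
      have s: "0 < s" "s \<le> 1" using x t by (auto simp: s_def)
      have D: "gk t (2 * real j + x) - gk t (2 * real (Suc j) - x) = gk t (2 * real j + x) * (1 - s ^ (2 * j + 1))" for j
      proof -
        have "s ^ (2 * j + 1) = exp (real (2 * j + 1) * (- (2 * (1 - x) / t)))"
          unfolding s_def by (simp only: exp_of_nat_mult)
        moreover have "- ((2 * real (Suc j) - x)\<^sup>2 / (2 * t)) = - ((2 * real j + x)\<^sup>2 / (2 * t)) + real (2 * j + 1) * (- (2 * (1 - x) / t))"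
          using t by (simp add: field_simps power2_eq_square)
        ultimately have "gk t (2 * real (Suc j) - x) = gk t (2 * real j + x) * s ^ (2 * j + 1)"
          unfolding gk_def by (simp only: exp_add times_divide_eq_left)
        then show ?thesis by (simp only: right_diff_distrib mult_1_right)
      qed
      have a0: "a 0 = gk t x * (1 - s)" using D[of 0] by (simp add: a_def)
      show "0 \<le> a 0" unfolding a0 using s t by simp
      fix n
      let ?m = "Suc n"
      \<comment> \<open>Bernoulli extracts the factor 1 - s, which is exactly the boundary zero of
        the head.\<close>
      have "1 + real (2 * ?m + 1) * (s - 1) \<le> (1 + (s - 1)) ^ (2 * ?m + 1)"
        using s by (intro Bernoulli_inequality) auto
      then have b: "1 - s ^ (2 * ?m + 1) \<le> (2 * real ?m + 1) * (1 - s)" by (simp add: algebra_simps)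
      have b0: "0 \<le> 1 - s ^ (2 * ?m + 1)" using s power_le_one[of s "2 * ?m + 1"] by simp
      \<comment> \<open>Here t < 1 is used: (2m + x)^2 exceeds x^2 by at least 4m^2, hence by at
        least 4mt.\<close>
      have g: "gk t (2 * real ?m + x) \<le> gk t x * exp (- 2 * real ?m)"
      proof -
        have "2 * real ?m * (2 * t) + x\<^sup>2 \<le> (2 * real ?m + x)\<^sup>2"
        proof -
          have "2 * real ?m * (2 * t) \<le> 2 * real ?m * (2 * real ?m)"
            using 3 by (intro mult_left_mono) auto
          moreover have "0 \<le> real ?m * x" using x by simp
          ultimately show ?thesis by (simp add: power2_eq_square algebra_simps)
        qed
        then have "- ((2 * real ?m + x)\<^sup>2 / (2 * t)) \<le> - (x\<^sup>2 / (2 * t)) + (- 2 * real ?m)"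
          using t by (simp add: field_simps)
        then have "exp (- ((2 * real ?m + x)\<^sup>2 / (2 * t))) \<le> exp (- (x\<^sup>2 / (2 * t))) * exp (- 2 * real ?m)"
          by (simp only: exp_add[symmetric] exp_le_cancel_iff)
        then show ?thesis unfolding gk_def using t by (simp add: divide_right_mono)
      qed
      have "\<bar>a ?m\<bar> = gk t (2 * real ?m + x) * (1 - s ^ (2 * ?m + 1))"
        unfolding a_def D using b0 t by (simp only: abs_mult power_abs abs_minus_cancel abs_one power_one mult_1_left abs_of_nonneg gk_nonneg less_imp_le)
      also have "\<dots> \<le> (gk t x * exp (- 2 * real ?m)) * ((2 * real ?m + 1) * (1 - s))"
        using g b b0 t by (intro mult_mono) auto
      finally show "\<bar>a ?m\<bar> \<le> a 0 * ((2 * real ?m + 1) * exp (- 2 * real ?m))"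
        unfolding a0 by (simp only: mult.assoc mult.commute mult.left_commute)
    qed
    ultimately show ?thesis using q_eq_im[OF t, of x] x qx by simp
  qed
qed

lemma q_nonneg:
  assumes "0 < t" "0 < z" "\<bar>x\<bar> \<le> z" shows "0 \<le> q t z x"
  using assms q1_nonneg[of "t / z\<^sup>2" "x / z"] by (simp add: q_scale[of z t x])

text \<open>The image pairs alternate in sign and decrease in size for |y| < 1, so by Leibniz the
  kernel lies between the first two partial sums.\<close>

lemma q1_bounds:
  assumes t: "0 < t" and y: "\<bar>y\<bar> < 1"
  shows "q t 1 y \<le> gk t y" "gk t y - gk t (2 - y) - gk t (2 + y) \<le> q t 1 y"
proof -
  define c where "c = (\<lambda>k. gk t (2 * real (Suc k) + y) + gk t (2 * real (Suc k) - y))"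
  have c0: "0 \<le> c k" for k using t by (simp add: c_def)
  have dec: "c (Suc k) \<le> c k" for k unfolding c_def using y t by (intro add_mono gk_mono) auto
  have cb: "c k \<le> 2 * gk t (2 * real k + 1)" for k
    using im_term_bound[OF t, of y k] y by (simp add: c_def del: of_nat_Suc)
  have lim: "c \<longlonglongrightarrow> 0"
    by (rule tendsto_sandwich[OF _ _ tendsto_const summable_LIMSEQ_zero[OF summable_mult[OF summable_gk_odd[OF t], of 2]]])
       (use c0 cb in auto)
  have "q t 1 y = gk t y + (\<Sum>k. - ((-1) ^ k * c k))"
    unfolding q_eq_im[OF t y] im_def c_def by simp
  also have "\<dots> = gk t y - (\<Sum>k. (-1) ^ k * c k)"
    using suminf_minus[OF summable_Leibniz'(1)[OF lim c0 dec]] by simp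
  finally have eq: "q t 1 y = gk t y - (\<Sum>k. (-1) ^ k * c k)" .
  show "q t 1 y \<le> gk t y" using summable_Leibniz'(2)[OF lim c0 dec, of 0] eq by simp
  show "gk t y - gk t (2 - y) - gk t (2 + y) \<le> q t 1 y"
    using summable_Leibniz'(4)[OF lim c0 dec, of 0] eq by (simp add: c_def)
qed

lemma q_bounds:
  assumes t: "0 < t" and z: "0 < z" and x: "\<bar>x\<bar> < z"
  shows "q t z x \<le> gk t x" "gk t x - gk t (2 * z - x) - gk t (2 * z + x) \<le> q t z x"
proof -
  have y: "\<bar>x / z\<bar> < 1" and tz: "0 < t / z\<^sup>2" using assms by auto
  have a: "2 - x / z = (2 * z - x) / z" "2 + x / z = (2 * z + x) / z" using z by (auto simp: field_simps)
  have "q (t / z\<^sup>2) 1 (x / z) \<le> z * gk t x"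
    using q1_bounds(1)[OF tz y] gk_scale[OF z t, of x] by simp
  then show "q t z x \<le> gk t x" using z by (simp add: q_scale[OF z, of t x] field_simps)
  have "z * (gk t x - gk t (2 * z - x) - gk t (2 * z + x)) \<le> q (t / z\<^sup>2) 1 (x / z)"
    using q1_bounds(2)[OF tz y] unfolding a gk_scale[OF z t] by (simp add: algebra_simps)
  then show "gk t x - gk t (2 * z - x) - gk t (2 * z + x) \<le> q t z x" using z by (simp add: q_scale[OF z, of t x] field_simps)
qed

section \<open>One Gaussian step of the kernel, with and without killing\<close>

lemma alternating_sum_bounds:
  fixes c :: "nat \<Rightarrow> real"
  assumes "\<And>n. 0 \<le> c n" "\<And>n. c (Suc n) \<le> c n"
  shows "0 \<le> (\<Sum>j<N. (-1) ^ j * c j) \<and> (\<Sum>j<N. (-1) ^ j * c j) \<le> c 0"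
  using assms
proof (induction N arbitrary: c)
  case (Suc N)
  have "(\<Sum>j<Suc N. (-1) ^ j * c j) = c 0 - (\<Sum>j<N. (-1) ^ j * c (Suc j))"
    by (subst sum.lessThan_Suc_shift) (simp add: sum_negf)
  moreover have "0 \<le> (\<Sum>j<N. (-1) ^ j * c (Suc j)) \<and> (\<Sum>j<N. (-1) ^ j * c (Suc j)) \<le> c (Suc 0)"
    by (rule Suc.IH) (rule Suc.prems)+
  moreover have "c (Suc 0) \<le> c 0" by (rule Suc.prems)
  ultimately show ?case by linarith
qed (simp add: assms)

lemma q_shift_nat:
  assumes "0 < t" "0 < z" shows "q t z (y + 2 * z * real m) = (-1) ^ m * q t z y"
proof (induction m)
  case (Suc m)
  have "y + 2 * z * real (Suc m) = (y + 2 * z * real m) + 2 * z" by (simp add: algebra_simps)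
  then have "q t z (y + 2 * z * real (Suc m)) = - q t z (y + 2 * z * real m)"
    by (simp only: q_shift[OF assms])
  then show ?case using Suc by simp
qed simp

lemma gk_shift_integrable:
  assumes "0 < d" shows "integrable lborel (\<lambda>y. gk d (x - y))" "(LINT y|lborel. gk d (x - y)) = 1"
  using gk_integrable[OF assms] lborel_integrable_real_affine[of "gk d" "-1" x]
    gk_integral[OF assms] lborel_integral_real_affine[of "-1" "gk d" x] by simp_all

text \<open>Beyond z the extended kernel consists of blocks of length 2z, copies of the positive
  kernel with alternating signs, the first one negative. The Gaussian weight decreases with the
  distance from x, so the block integrals decrease in size and the first one decides the
  sign.\<close>

lemma q_integral_right_nonpos:
  assumes d: "0 < d" and t: "0 < t" and z: "0 < z" and x: "\<bar>x\<bar> \<le> z"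
  shows "(LINT y|lborel. indicator {z<..} y * (q t z y * gk d (x - y))) \<le> 0"
proof -
  define g where "g = (\<lambda>y. q t z y * gk d (x - y))"
  have cg: "continuous_on S g" for S unfolding g_def using t z d by (intro continuous_intros)
  have int: "g integrable_on {a..b}" for a b by (rule integrable_continuous_real[OF cg])
  have gi: "integrable lborel g" using q_conv[OF d t z, of x] by (simp add: g_def has_bochner_integral_iff)
  \<comment> \<open>\<open>c j\<close> is the absolute value of the integral over block j, shifted
    back to [-z, z]; the shift is by j + 1 periods, whence the sign (-1)^(j+1) in
    \<open>piece\<close>.\<close>
  define c where "c = (\<lambda>j. integral {-z..z} (\<lambda>y. q t z y * gk d (y + 2 * z * real (Suc j) - x)))"
  have ci: "(\<lambda>y. q t z y * gk d (y + 2 * z * real (Suc j) - x)) integrable_on {-z..z}" for j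
    using t z d by (intro integrable_continuous_real continuous_intros)
  have c0: "0 \<le> c j" for j
    unfolding c_def using t z d by (intro Henstock_Kurzweil_Integration.integral_nonneg ci mult_nonneg_nonneg q_nonneg) auto
  have dec: "c (Suc j) \<le> c j" for j
    unfolding c_def
  proof (intro integral_le ci mult_left_mono)
    fix y assume "y \<in> {-z..z}"
    then have "0 \<le> y + z" "y \<le> z" by auto
    then show "0 \<le> q t z y" using t z by (intro q_nonneg) auto
    have "0 \<le> 2 * z * real j" using z by simp
    moreover have "2 * z * real (Suc j) = 2 * z * real j + 2 * z" by (simp add: algebra_simps)
    ultimately have "0 \<le> y + 2 * z * real (Suc j) - x" using \<open>0 \<le> y + z\<close> x by linarith
    then show "gk d (y + 2 * z * real (Suc (Suc j)) - x) \<le> gk d (y + 2 * z * real (Suc j) - x)"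
      using d z by (intro gk_mono) (auto simp: algebra_simps)
  qed
  have piece: "integral {z + 2 * z * real j..z + 2 * z * real (Suc j)} g = - ((-1) ^ j * c j)" for j
  proof -
    let ?m = "2 * z * real (Suc j)"
    have "(g has_integral integral {z + 2 * z * real j..z + 2 * z * real (Suc j)} g) (cbox (- z + ?m) (z + ?m))"
      using integrable_integral[OF int, of "z + 2 * z * real j" "z + 2 * z * real (Suc j)"] by (simp add: algebra_simps)
    from has_integral_affinity'[OF this, of 1 ?m]
    have "((\<lambda>y. g (y + ?m)) has_integral integral {z + 2 * z * real j..z + 2 * z * real (Suc j)} g) {-z..z}"
      by (simp only: mult_1_left add_diff_cancel_right' div_by_1 cbox_interval power_one DIM_real scaleR_one real_scaleR_def inverse_1 abs_one zero_less_one simp_thms)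
    moreover have "(\<lambda>y. g (y + ?m)) = (\<lambda>y. (-1) ^ Suc j * (q t z y * gk d (y + 2 * z * real (Suc j) - x)))"
      unfolding g_def q_shift_nat[OF t z] gk_minus_commute[of d x] by (simp only: mult.assoc)
    ultimately have "((\<lambda>y. (-1) ^ Suc j * (q t z y * gk d (y + 2 * z * real (Suc j) - x))) has_integral integral {z + 2 * z * real j..z + 2 * z * real (Suc j)} g) {-z..z}"
      by (simp only:)
    moreover have "((\<lambda>y. (-1) ^ Suc j * (q t z y * gk d (y + 2 * z * real (Suc j) - x))) has_integral (-1) ^ Suc j * c j) {-z..z}"
      unfolding c_def by (intro has_integral_mult_right integrable_integral ci)
    ultimately have "integral {z + 2 * z * real j..z + 2 * z * real (Suc j)} g = (-1) ^ Suc j * c j"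
      by (rule has_integral_unique)
    then show ?thesis by simp
  qed
  have part: "integral {z..z + 2 * z * real N} g = - (\<Sum>j<N. (-1) ^ j * c j)" for N
  proof (induction N)
    case (Suc N)
    have "integral {z..z + 2 * z * real (Suc N)} g = integral {z..z + 2 * z * real N} g + integral {z + 2 * z * real N..z + 2 * z * real (Suc N)} g"
      by (rule Henstock_Kurzweil_Integration.integral_combine[symmetric]) (use z in \<open>auto intro: int simp: algebra_simps\<close>)
    then show ?case using Suc piece by simp
  qed simp
  have "(\<lambda>N. LINT y|lborel. indicator {z..z + 2 * z * real N} y *\<^sub>R g y) \<longlonglongrightarrow> (LINT y|lborel. indicator {z<..} y *\<^sub>R g y)"
  proof (rule integral_dominated_convergence[where w="\<lambda>y. norm (g y)"])
    have "AE y in lborel. y \<noteq> z" by (rule AE_lborel_singleton)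
    then show "AE y in lborel. (\<lambda>N. indicator {z..z + 2 * z * real N} y *\<^sub>R g y) \<longlonglongrightarrow> indicator {z<..} y *\<^sub>R g y"
    proof eventually_elim
      case (elim y)
      obtain N0 where N0: "(y - z) / (2 * z) \<le> real N0" using real_arch_simple by blast
      have "indicator {z..z + 2 * z * real N} y *\<^sub>R g y = indicator {z<..} y *\<^sub>R g y" if "N0 \<le> N" for N
      proof -
        have "(y - z) / (2 * z) \<le> real N" using N0 that by linarith
        then have "y \<le> z + 2 * z * real N" using z by (simp add: field_simps)
        then show ?thesis using elim by (auto simp: indicator_def)
      qed
      then show ?case by (intro tendsto_eventually eventually_sequentiallyI[of N0])
    qed
  qed (use gi in \<open>auto simp: indicator_def\<close>)
  moreover have "(LINT y|lborel. indicator {z..z + 2 * z * real N} y *\<^sub>R g y) \<le> 0" for N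
  proof -
    have "(LINT y:{z..z + 2 * z * real N}|lborel. g y) = integral {z..z + 2 * z * real N} g"
      by (rule set_borel_integral_eq_integral) (rule borel_integrable_atLeastAtMost', rule cg)
    then show ?thesis
      using part[of N] alternating_sum_bounds[of c N, OF c0 dec] by (simp add: set_lebesgue_integral_def)
  qed
  ultimately have "(LINT y|lborel. indicator {z<..} y *\<^sub>R g y) \<le> 0"
    by (intro LIMSEQ_le_const2) auto
  then show ?thesis by (simp only: g_def real_scaleR_def)
qed

lemma q_integral_left_nonpos:
  assumes d: "0 < d" and t: "0 < t" and z: "0 < z" and x: "\<bar>x\<bar> \<le> z"
  shows "(LINT y|lborel. indicator {..<-z} y * (q t z y * gk d (x - y))) \<le> 0"
proof -
  have "(LINT y|lborel. indicator {..<-z} y * (q t z y * gk d (x - y)))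
     = (LINT y|lborel. indicator {..<-z} (0 + (-1) * y) * (q t z (0 + (-1) * y) * gk d (x - (0 + (-1) * y))))"
    using lborel_integral_real_affine[of "-1" "\<lambda>y. indicator {..<-z} y * (q t z y * gk d (x - y))" 0] by simp
  also have "\<dots> = (LINT y|lborel. indicator {z<..} y * (q t z y * gk d (- x - y)))"
  proof (rule Bochner_Integration.integral_cong)
    fix y
    have "gk d (x + y) = gk d (- x - y)" using gk_minus[of d "x + y"] by simp
    then show "indicator {..<-z} (0 + (-1) * y) * (q t z (0 + (-1) * y) * gk d (x - (0 + (-1) * y))) = indicator {z<..} y * (q t z y * gk d (- x - y))"
      by (auto simp: indicator_def)
  qed simp
  also have "\<dots> \<le> 0" using x by (intro q_integral_right_nonpos d t z) auto
  finally show ?thesis .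
qed

lemma q_integrable:
  assumes "0 < d" "0 < t" "0 < z" "A \<in> sets borel"
  shows "integrable lborel (\<lambda>y. indicator A y * (q t z y * gk d (x - y)))"
proof -
  have "integrable lborel (\<lambda>y. q t z y * gk d (x - y))"
    using q_conv[OF assms(1-3), of x] by (simp add: has_bochner_integral_iff)
  from integrable_mult_indicator[OF _ this, of A] assms(4) show ?thesis by simp
qed

text \<open>The part of the exact evolution that lies outside [-z, z] is nonpositive, so dropping it
  can only increase the value.\<close>

lemma q_step_ge:
  assumes d: "0 < d" and t: "0 < t" and z: "0 < z" and x: "\<bar>x\<bar> \<le> z"
  shows "q (t + d) z x \<le> (LINT y|lborel. indicator {-z..z} y * (q t z y * gk d (x - y)))"
proof -
  let ?g = "\<lambda>y. q t z y * gk d (x - y)"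
  have iA: "integrable lborel (\<lambda>y. indicator {-z..z} y * ?g y)" by (rule q_integrable[OF d t z]) simp
  have iB: "integrable lborel (\<lambda>y. indicator {z<..} y * ?g y)" by (rule q_integrable[OF d t z]) simp
  have iC: "integrable lborel (\<lambda>y. indicator {..<-z} y * ?g y)" by (rule q_integrable[OF d t z]) simp
  have "q (t + d) z x = (LINT y|lborel. ?g y)"
    using q_conv[OF d t z, of x] by (simp add: has_bochner_integral_iff)
  also have "\<dots> = (LINT y|lborel. (indicator {-z..z} y * ?g y + indicator {z<..} y * ?g y) + indicator {..<-z} y * ?g y)"
    using z by (intro Bochner_Integration.integral_cong) (auto simp: indicator_def)
  also have "\<dots> = (LINT y|lborel. indicator {-z..z} y * ?g y + indicator {z<..} y * ?g y) + (LINT y|lborel. indicator {..<-z} y * ?g y)"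
    by (rule Bochner_Integration.integral_add[OF Bochner_Integration.integrable_add[OF iA iB] iC])
  also have "(LINT y|lborel. indicator {-z..z} y * ?g y + indicator {z<..} y * ?g y) = (LINT y|lborel. indicator {-z..z} y * ?g y) + (LINT y|lborel. indicator {z<..} y * ?g y)"
    by (rule Bochner_Integration.integral_add[OF iA iB])
  finally show ?thesis
    using q_integral_right_nonpos[OF assms] q_integral_left_nonpos[OF assms] by linarith
qed

text \<open>The fourth moment is taken because the number of steps is of order 1/d: a tail estimate
  of order d per step, as from the variance, would not vanish in the sum, while d^2 does.\<close>

lemma gk_fourth_moment:
  assumes "0 < d" shows "has_bochner_integral lborel (\<lambda>y. gk d (x - y) * (x - y) ^ 4) (3 * d\<^sup>2)"
proof -
  have "has_bochner_integral lborel (\<lambda>y. normal_density x (sqrt d) y * (y - x) ^ (2 * 2)) (fact (2 * 2) / ((2 / (sqrt d)\<^sup>2)\<^sup>2 * fact 2))"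
    using assms by (intro normal_moment_even) auto
  also have "(\<lambda>y. normal_density x (sqrt d) y * (y - x) ^ (2 * 2)) = (\<lambda>y. gk d (x - y) * (x - y) ^ 4)"
  proof
    fix y
    have "(y - x) ^ 4 = (x - y) ^ 4" using power_even_eq[of "y - x" 2] power_even_eq[of "x - y" 2] by (simp add: power2_commute)
    then show "normal_density x (sqrt d) y * (y - x) ^ (2 * 2) = gk d (x - y) * (x - y) ^ 4"
      using assms by (simp add: gk_eq_normal_density[symmetric] gk_minus_commute[of d x])
  qed
  also have "fact (2 * 2) / ((2 / (sqrt d)\<^sup>2)\<^sup>2 * fact 2) = 3 * d\<^sup>2"
    using assms by (simp add: fact_numeral power2_eq_square field_simps)
  finally show ?thesis .
qed

text \<open>Outside [-z, z] the distance to x is at least e, so the Gaussian mass there is at most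
  its fourth moment over e^4, and the extended kernel is at most 3 / sqrt t in absolute
  value.\<close>

lemma q_step_le:
  assumes d: "0 < d" and t: "0 < t" and z: "0 < z" and e: "0 < e" and x: "\<bar>x\<bar> \<le> z - e"
  shows "(LINT y|lborel. indicator {-z..z} y * (q t z y * gk d (x - y))) \<le> q (t + d) z x + 9 * d\<^sup>2 / (sqrt t * e ^ 4)"
proof -
  let ?g = "\<lambda>y. q t z y * gk d (x - y)"
  note qi = q_integrable[OF d t z, of _ x]
  have m: "integrable lborel (\<lambda>y. gk d (x - y) * (x - y) ^ 4)" "(LINT y|lborel. gk d (x - y) * (x - y) ^ 4) = 3 * d\<^sup>2"
    using gk_fourth_moment[OF d, of x] by (auto simp: has_bochner_integral_iff)
  have "(LINT y|lborel. indicator {-z..z} y * ?g y) - q (t + d) z x = (LINT y|lborel. indicator {-z..z} y * ?g y - ?g y)"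
    using q_conv[OF d t z, of x] by (subst Bochner_Integration.integral_diff) (auto simp: qi has_bochner_integral_iff)
  also have "\<dots> \<le> (LINT y|lborel. (3 / sqrt t / e ^ 4) * (gk d (x - y) * (x - y) ^ 4))"
  proof (intro integral_mono)
    show "integrable lborel (\<lambda>y. indicator {-z..z} y * ?g y - ?g y)"
      using q_conv[OF d t z, of x] by (intro Bochner_Integration.integrable_diff qi) (auto simp: has_bochner_integral_iff)
    show "integrable lborel (\<lambda>y. (3 / sqrt t / e ^ 4) * (gk d (x - y) * (x - y) ^ 4))"
      by (intro integrable_mult_right m)
    fix y
    show "indicator {-z..z} y * ?g y - ?g y \<le> (3 / sqrt t / e ^ 4) * (gk d (x - y) * (x - y) ^ 4)"
    proof (cases "y \<in> {-z..z}")
      case True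
      then show ?thesis using t d e by simp
    next
      case False
      then have "e \<le> \<bar>x - y\<bar>" using x by (auto simp: abs_le_iff)
      then have "e ^ 4 \<le> \<bar>x - y\<bar> ^ 4" using e by (intro power_mono) auto
      then have "e ^ 4 \<le> (x - y) ^ 4" by (simp add: power_even_abs)
      then have "1 \<le> (x - y) ^ 4 / e ^ 4" using e by (simp add: field_simps)
      moreover have "- q t z y \<le> 3 / sqrt t" using q_bound[OF t z, of y] by linarith
      moreover have "3 / sqrt t * 1 \<le> 3 / sqrt t * ((x - y) ^ 4 / e ^ 4)"
        using calculation t by (intro mult_left_mono) auto
      ultimately have "- q t z y \<le> 3 / sqrt t * ((x - y) ^ 4 / e ^ 4)" by linarith
      then have "(- q t z y) * gk d (x - y) \<le> (3 / sqrt t * ((x - y) ^ 4 / e ^ 4)) * gk d (x - y)"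
        using d by (intro mult_right_mono) auto
      then show ?thesis using False by (simp add: field_simps)
    qed
  qed
  also have "\<dots> = 9 * d\<^sup>2 / (sqrt t * e ^ 4)" using m by simp
  finally show ?thesis by simp
qed

text \<open>The killed Gaussian random walk with step variance \<open>d\<close>: \<open>hc d z k\<close> is the density of the walk
  after \<open>k + 1\<close> steps, on the event that the first \<open>k\<close> positions lie in \<open>[-z, z]\<close>.\<close>

primrec hc :: "real \<Rightarrow> real \<Rightarrow> nat \<Rightarrow> real \<Rightarrow> ennreal" where
  "hc d z 0 = (\<lambda>x. ennreal (gk d x))"
| "hc d z (Suc k) = (\<lambda>x. \<integral>\<^sup>+ y. indicator {-z..z} y * hc d z k y * ennreal (gk d (x - y)) \<partial>lborel)"

lemma hc_measurable [measurable]: "hc d z k \<in> borel_measurable borel"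
  by (induction k) simp_all

lemma nn_integral_indicator_ennreal:
  assumes "integrable lborel (\<lambda>y. indicator A y * f y)" "\<And>y. y \<in> A \<Longrightarrow> 0 \<le> (f y :: real)"
  shows "(\<integral>\<^sup>+ y. indicator A y * ennreal (f y) \<partial>lborel) = ennreal (LINT y|lborel. indicator A y * f y)"
proof -
  have "(\<integral>\<^sup>+ y. indicator A y * ennreal (f y) \<partial>lborel) = (\<integral>\<^sup>+ y. ennreal (indicator A y * f y) \<partial>lborel)"
    by (intro nn_integral_cong) (auto simp: indicator_def)
  also have "\<dots> = ennreal (LINT y|lborel. indicator A y * f y)"
    using assms by (intro nn_integral_eq_integral) (auto simp: indicator_def)
  finally show ?thesis .
qed

text \<open>The walk is killed only when a grid position lies outside the interval, hence loses less
  mass than the absorbed motion. The walk has made \<open>Suc k\<close> steps, which fixes the time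
  of the kernel.\<close>

lemma hc_ge_q:
  assumes d: "0 < d" and z: "0 < z" and x: "\<bar>x\<bar> \<le> z"
  shows "ennreal (q (real (Suc k) * d) z x) \<le> hc d z k x"
  using x
proof (induction k arbitrary: x)
  case 0
  show ?case
  proof (cases "\<bar>x\<bar> = z")
    case True
    then have "x = z \<or> x = - z" by auto
    then have "q d z x = 0" using q_end[OF d z] by auto
    then show ?thesis by simp
  next
    case False
    then show ?thesis using q_bounds(1)[OF d z, of x] 0 by (simp add: ennreal_leI)
  qed
next
  case (Suc k)
  let ?t = "real (Suc k) * d"
  have t: "0 < ?t" using d by simp
  have eq: "real (Suc (Suc k)) * d = ?t + d" by (simp add: algebra_simps)
  have "ennreal (q (?t + d) z x) \<le> ennreal (LINT y|lborel. indicator {-z..z} y * (q ?t z y * gk d (x - y)))"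
    by (intro ennreal_leI q_step_ge d t z Suc.prems)
  also have "\<dots> = (\<integral>\<^sup>+ y. indicator {-z..z} y * ennreal (q ?t z y * gk d (x - y)) \<partial>lborel)"
    using d t z by (intro nn_integral_indicator_ennreal[symmetric] q_integrable mult_nonneg_nonneg q_nonneg) auto
  also have "\<dots> \<le> hc d z (Suc k) x"
    unfolding hc.simps
  proof (intro nn_integral_mono)
    fix y
    show "indicator {-z..z} y * ennreal (q ?t z y * gk d (x - y)) \<le> indicator {-z..z} y * hc d z k y * ennreal (gk d (x - y))"
    proof (cases "y \<in> {-z..z}")
      case True
      then have "\<bar>y\<bar> \<le> z" by auto
      then show ?thesis using True Suc.IH[of y] q_nonneg[OF t z, of y] d
        by (auto simp: ennreal_mult simp del: of_nat_Suc intro!: mult_right_mono)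
    qed simp
  qed
  finally show ?case unfolding eq .
qed

text \<open>The first summand comes from the two nearest images at the first step, the second from k
  later steps; their times are all at least d, which explains sqrt d.\<close>

definition herr :: "real \<Rightarrow> real \<Rightarrow> nat \<Rightarrow> real" where
  "herr d e k = 2 * gk d e + real k * (9 * d\<^sup>2 / (sqrt d * e ^ 4))"

text \<open>Enlarging the level to z + e leaves a margin e around every position the walk may
  occupy, which is what the one-step estimate asks for. Errors only add up, since a Gaussian step
  does not increase a constant.\<close>

lemma hc_le_q:
  assumes d: "0 < d" and z: "0 < z" and e: "0 < e" and x: "\<bar>x\<bar> \<le> z"
  shows "hc d z k x \<le> ennreal (q (real (Suc k) * d) (z + e) x + herr d e k)"
  using x
proof (induction k arbitrary: x)
  case 0
  have x: "\<bar>x\<bar> < z + e" using 0 e by simp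
  have "gk d (2 * (z + e) - x) \<le> gk d e" "gk d (2 * (z + e) + x) \<le> gk d e"
    using 0 e d z by (auto intro!: gk_mono)
  then show ?case using q_bounds(2)[OF d _ x] z e by (auto simp: herr_def intro!: ennreal_leI)
next
  case (Suc k)
  let ?t = "real (Suc k) * d"
  let ?z = "z + e"
  have t: "0 < ?t" and z': "0 < ?z" using d z e by auto
  have eq: "real (Suc (Suc k)) * d = ?t + d" by (simp add: algebra_simps)
  have e0: "0 \<le> herr d e k" using d e by (simp add: herr_def)
  have i1: "integrable lborel (\<lambda>y. indicator {- ?z..?z} y * (q ?t ?z y * gk d (x - y)) )"
    by (intro q_integrable d t z') auto
  have i2: "integrable lborel (\<lambda>y. herr d e k * gk d (x - y))"
    by (intro integrable_mult_right gk_shift_integrable d)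
  have "hc d z (Suc k) x \<le> (\<integral>\<^sup>+ y. ennreal (indicator {- ?z..?z} y * (q ?t ?z y * gk d (x - y)) + herr d e k * gk d (x - y)) \<partial>lborel)"
    unfolding hc.simps
  proof (intro nn_integral_mono)
    fix y
    show "indicator {-z..z} y * hc d z k y * ennreal (gk d (x - y)) \<le>
      ennreal (indicator {- ?z..?z} y * (q ?t ?z y * gk d (x - y)) + herr d e k * gk d (x - y))"
    proof (cases "y \<in> {-z..z}")
      case True
      then have y: "\<bar>y\<bar> \<le> z" by auto
      have "indicator {-z..z} y * hc d z k y * ennreal (gk d (x - y)) \<le> ennreal (q ?t ?z y + herr d e k) * ennreal (gk d (x - y))"
        using True Suc.IH[OF y] by (auto intro!: mult_right_mono)
      also have "\<dots> = ennreal ((q ?t ?z y + herr d e k) * gk d (x - y))"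
        using q_nonneg[OF t z', of y] y e e0 d by (intro ennreal_mult[symmetric]) auto
      finally show ?thesis using True e by (simp add: distrib_right)
    qed simp
  qed
  also have "\<dots> = ennreal (LINT y|lborel. indicator {- ?z..?z} y * (q ?t ?z y * gk d (x - y)) + herr d e k * gk d (x - y))"
    using e0 d q_nonneg[OF t z'] by (intro nn_integral_eq_integral Bochner_Integration.integrable_add i1 i2) (auto simp: indicator_def abs_le_iff)
  also have "(LINT y|lborel. indicator {- ?z..?z} y * (q ?t ?z y * gk d (x - y)) + herr d e k * gk d (x - y))
     = (LINT y|lborel. indicator {- ?z..?z} y * (q ?t ?z y * gk d (x - y))) + herr d e k"
    using gk_shift_integrable[OF d, of x] by (subst Bochner_Integration.integral_add[OF i1 i2]) simp
  also have "\<dots> \<le> q (?t + d) ?z x + 9 * d\<^sup>2 / (sqrt ?t * e ^ 4) + herr d e k"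
    using Suc.prems e by (intro add_right_mono q_step_le d t z') auto
  also have "\<dots> \<le> q (?t + d) ?z x + herr d e (Suc k)"
  proof -
    have "1 * d \<le> real (Suc k) * d" using d by (intro mult_right_mono) auto
    then have "9 * d\<^sup>2 / (sqrt ?t * e ^ 4) \<le> 9 * d\<^sup>2 / (sqrt d * e ^ 4)"
      using d e t by (intro divide_left_mono mult_right_mono mult_pos_pos) auto
    moreover have "herr d e (Suc k) = herr d e k + 9 * d\<^sup>2 / (sqrt d * e ^ 4)"
      unfolding herr_def by (simp add: distrib_right add_divide_distrib)
    ultimately show ?thesis by linarith
  qed
  finally show ?case unfolding eq by (simp add: ennreal_leI)
qed

text \<open>With d = T / 2^j there are fewer than 2^j steps of error of order d^(3/2), in total of
  order T sqrt d. The initial term is also at most a multiple of sqrt d, through exp (- x) \<le> 1 /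
  x.\<close>

lemma herr_tendsto:
  assumes e: "0 < e" and T: "0 < T"
  shows "(\<lambda>j. herr (T / 2 ^ j) e (2 ^ j - 1)) \<longlonglongrightarrow> 0"
proof -
  have sq: "(\<lambda>j. sqrt (T / 2 ^ j)) \<longlonglongrightarrow> 0"
    using tendsto_real_sqrt[OF LIMSEQ_divide_realpow_zero[of 2 T]] by simp
  have b1: "gk d e \<le> sqrt d / e\<^sup>2" if d: "0 < d" for d
  proof -
    have "exp (- (e\<^sup>2 / (2 * d))) \<le> 1 / (e\<^sup>2 / (2 * d))"
    proof -
      have "e\<^sup>2 / (2 * d) \<le> exp (e\<^sup>2 / (2 * d))" using exp_ge_add_one_self[of "e\<^sup>2 / (2 * d)"] by linarith
      then show ?thesis using d e by (simp add: exp_minus field_simps)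
    qed
    then have "gk d e \<le> (2 * d / e\<^sup>2) / sqrt (2 * pi * d)" unfolding gk_def using d by (intro divide_right_mono) auto
    also have "\<dots> \<le> (2 * d / e\<^sup>2) / (2 * sqrt d)"
    proof (intro divide_left_mono)
      have "4 * d \<le> 2 * pi * d" using pi_ge_two d by simp
      then have "sqrt (4 * d) \<le> sqrt (2 * pi * d)" by simp
      then show "2 * sqrt d \<le> sqrt (2 * pi * d)" by (simp add: real_sqrt_mult)
    qed (use d e in auto)
    also have "\<dots> = (d / sqrt d) / e\<^sup>2" by simp
    also have "\<dots> = sqrt d / e\<^sup>2" using d by (simp only: real_div_sqrt less_imp_le)
    finally show ?thesis .
  qed
  have le: "herr (T / 2 ^ j) e (2 ^ j - 1) \<le> sqrt (T / 2 ^ j) * (2 / e\<^sup>2 + 9 * T / e ^ 4)" for j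
  proof -
    let ?d = "T / 2 ^ j"
    have d: "0 < ?d" using T by simp
    have "real (2 ^ j - 1) * (9 * ?d\<^sup>2 / (sqrt ?d * e ^ 4)) \<le> 2 ^ j * (9 * ?d\<^sup>2 / (sqrt ?d * e ^ 4))"
      using d by (intro mult_right_mono) (auto simp: of_nat_diff)
    also have "\<dots> = (2 ^ j * ?d) * 9 / e ^ 4 * (?d / sqrt ?d)" by (simp add: power2_eq_square mult_ac)
    also have "\<dots> = (2 ^ j * ?d) * 9 / e ^ 4 * sqrt ?d"
      using d by (simp only: real_div_sqrt less_imp_le)
    also have "\<dots> = sqrt ?d * (9 * T / e ^ 4)" by simp
    finally have "real (2 ^ j - 1) * (9 * ?d\<^sup>2 / (sqrt ?d * e ^ 4)) \<le> sqrt ?d * (9 * T / e ^ 4)" .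
    moreover have "2 * gk ?d e \<le> 2 * (sqrt ?d / e\<^sup>2)" by (intro mult_left_mono b1 d) simp
    moreover have "2 * (sqrt ?d / e\<^sup>2) = sqrt ?d * (2 / e\<^sup>2)" by simp
    ultimately show ?thesis unfolding herr_def distrib_left by linarith
  qed
  have lim: "(\<lambda>j. sqrt (T / 2 ^ j) * (2 / e\<^sup>2 + 9 * T / e ^ 4)) \<longlonglongrightarrow> 0"
    using tendsto_mult_right[OF sq, of "2 / e\<^sup>2 + 9 * T / e ^ 4"] by simp
  have ge: "0 \<le> herr (T / 2 ^ j) e (2 ^ j - 1)" for j using T e by (simp add: herr_def)
  show ?thesis
    by (rule real_tendsto_sandwich[OF _ _ tendsto_const lim]) (use le ge in auto)
qed

section \<open>Independence from characteristic functions\<close>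

context prob_space begin

text \<open>Tilting the measure by the density 1 + V / L leaves the characteristic function of Y
  unchanged, so by uniqueness it leaves the law of Y unchanged; the difference of the two laws is
  the integral in question.\<close>

lemma fourier_vanish_real:
  fixes V Y :: "'a \<Rightarrow> real"
  assumes [measurable]: "V \<in> borel_measurable M" "Y \<in> borel_measurable M"
    and VK: "\<And>\<omega>. \<omega> \<in> space M \<Longrightarrow> \<bar>V \<omega>\<bar> \<le> K"
    and char0: "\<And>c. (\<integral>\<omega>. complex_of_real (V \<omega>) * iexp (c * Y \<omega>) \<partial>M) = 0"
    and [measurable]: "B \<in> sets borel"
  shows "(\<integral>\<omega>. V \<omega> * indicator B (Y \<omega>) \<partial>M) = 0"
proof -
  \<comment> \<open>The added 1 makes L positive even if K is not, and |V| \<le> L makes the density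
    nonnegative.\<close>
  define L where "L = \<bar>K\<bar> + 1"
  have L: "0 < L" by (simp add: L_def)
  have VL: "\<bar>V \<omega>\<bar> \<le> L" if "\<omega> \<in> space M" for \<omega> using VK[OF that] by (simp add: L_def)
  define R where "R = (\<lambda>\<omega>. 1 + V \<omega> / L)"
  have [measurable]: "R \<in> borel_measurable M" unfolding R_def by measurable
  have R0: "0 \<le> R \<omega>" if "\<omega> \<in> space M" for \<omega>
    using VL[OF that] L by (simp add: R_def field_simps abs_le_iff)
  have Vi: "integrable M V" using VL by (intro integrable_const_bound[where B=L]) auto
  have V0: "integral\<^sup>L M V = 0"
  proof -
    have "complex_of_real (integral\<^sup>L M V) = 0" using char0[of 0] by simp
    then show ?thesis by simp
  qed
  have Ri: "integrable M R" unfolding R_def using Vi by simp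
  have R1: "integral\<^sup>L M R = 1" unfolding R_def using Vi V0 by (simp add: prob_space)
  define N where "N = density M (\<lambda>\<omega>. ennreal (R \<omega>))"
  have [measurable_cong, simp]: "sets N = sets M" by (simp add: N_def)
  have "emeasure N (space N) = ennreal (integral\<^sup>L M R)"
    unfolding N_def using R0
    by (subst emeasure_density) (auto simp: nn_integral_eq_integral[OF Ri] intro!: nn_integral_cong cong: nn_integral_cong)
  then have pN: "prob_space N" using R1 by (intro prob_spaceI) simp
  interpret N: prob_space N by (rule pN)
  have d1: "real_distribution (distr M borel Y)" by (rule real_distribution_distr) simp
  have "Y \<in> borel_measurable N" by measurable
  then have d2: "real_distribution (distr N borel Y)" by (rule N.real_distribution_distr)
  have intN: "integral\<^sup>L N f = (\<integral>\<omega>. R \<omega> *\<^sub>R f \<omega> \<partial>M)" if "f \<in> borel_measurable M" for f :: "'a \<Rightarrow> complex"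
    unfolding N_def using R0 that by (intro integral_density) auto
  have ie: "integrable M (\<lambda>\<omega>. iexp (t * Y \<omega>))" for t by (intro integrable_const_bound[where B=1]) auto
  have Ve: "integrable M (\<lambda>\<omega>. complex_of_real (V \<omega>) * iexp (t * Y \<omega>))" for t
    using VL by (intro integrable_const_bound[where B=L]) (auto simp: norm_mult)
  have "char (distr N borel Y) = char (distr M borel Y)"
  proof
    fix t
    have "char (distr N borel Y) t = (\<integral>\<omega>. R \<omega> *\<^sub>R iexp (t * Y \<omega>) \<partial>M)"
      unfolding char_def by (subst integral_distr, measurable) (rule intN, measurable)
    also have "\<dots> = (\<integral>\<omega>. iexp (t * Y \<omega>) + (1 / L) *\<^sub>R (complex_of_real (V \<omega>) * iexp (t * Y \<omega>)) \<partial>M)"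
      by (intro Bochner_Integration.integral_cong) (auto simp: R_def scaleR_conv_of_real algebra_simps)
    also have "\<dots> = (\<integral>\<omega>. iexp (t * Y \<omega>) \<partial>M) + (1 / L) *\<^sub>R (\<integral>\<omega>. complex_of_real (V \<omega>) * iexp (t * Y \<omega>) \<partial>M)"
      using ie Ve by (subst Bochner_Integration.integral_add) auto
    also have "\<dots> = (\<integral>\<omega>. iexp (t * Y \<omega>) \<partial>M)" by (simp only: char0 scaleR_zero_right add_0_right)
    also have "\<dots> = char (distr M borel Y) t"
      unfolding char_def by (subst integral_distr) auto
    finally show "char (distr N borel Y) t = char (distr M borel Y) t" .
  qed
  from Levy_uniqueness[OF d2 d1 this] have eq: "distr N borel Y = distr M borel Y" .
  have "(\<integral>y. indicator B y \<partial>distr N borel Y) = (\<integral>\<omega>. R \<omega> *\<^sub>R (indicator B (Y \<omega>) :: real) \<partial>M)"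
  proof -
    have "(\<integral>y. indicator B y \<partial>distr N borel Y) = (\<integral>\<omega>. indicator B (Y \<omega>) \<partial>N :: real)"
      by (subst integral_distr) auto
    also have "\<dots> = (\<integral>\<omega>. R \<omega> *\<^sub>R (indicator B (Y \<omega>) :: real) \<partial>M)"
      unfolding N_def by (rule integral_density) (use R0 in auto)
    finally show ?thesis .
  qed
  also have "\<dots> = (\<integral>\<omega>. indicator B (Y \<omega>) + V \<omega> * indicator B (Y \<omega>) / L \<partial>M)"
    by (intro Bochner_Integration.integral_cong) (auto simp: R_def algebra_simps)
  also have "\<dots> = (\<integral>\<omega>. indicator B (Y \<omega>) \<partial>M) + (\<integral>\<omega>. V \<omega> * indicator B (Y \<omega>) \<partial>M) / L"
  proof (subst Bochner_Integration.integral_add)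
    show "integrable M (\<lambda>\<omega>. indicator B (Y \<omega>) :: real)" by (intro integrable_const_bound[where B=1]) auto
    show "integrable M (\<lambda>\<omega>. V \<omega> * indicator B (Y \<omega>) / L)"
      using VL L by (intro integrable_divide integrable_const_bound[where B=L]) (auto simp: indicator_def)
  qed simp
  also have "(\<integral>\<omega>. indicator B (Y \<omega>) \<partial>M) = (\<integral>y. indicator B y \<partial>distr M borel Y :: real)"
    by (subst integral_distr) auto
  finally show ?thesis using L unfolding eq by simp
qed

text \<open>Conjugation replaces c by -c, so the conjugate of W also has vanishing transform; real
  and imaginary parts are then treated by the real case.\<close>

lemma fourier_vanish:
  fixes W :: "'a \<Rightarrow> complex" and Y :: "'a \<Rightarrow> real"
  assumes W [measurable]: "W \<in> borel_measurable M" and Y [measurable]: "Y \<in> borel_measurable M"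
    and WK: "\<And>\<omega>. \<omega> \<in> space M \<Longrightarrow> cmod (W \<omega>) \<le> K"
    and char0: "\<And>c. (\<integral>\<omega>. W \<omega> * iexp (c * Y \<omega>) \<partial>M) = 0"
    and B [measurable]: "B \<in> sets borel"
  shows "(\<integral>\<omega>. W \<omega> * indicator B (Y \<omega>) \<partial>M) = 0"
proof -
  have Wi: "integrable M (\<lambda>\<omega>. W \<omega> * iexp (c * Y \<omega>))" for c
    using WK by (intro integrable_const_bound[where B=K]) (auto simp: norm_mult)
  have [measurable]: "(\<lambda>\<omega>. cnj (W \<omega>)) \<in> borel_measurable M"
    by (rule measurable_compose[OF W borel_measurable_continuous_onI]) (intro continuous_intros)
  have cnj: "(\<integral>\<omega>. cnj (W \<omega>) * iexp (c * Y \<omega>) \<partial>M) = 0" for c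
  proof -
    have "(\<integral>\<omega>. cnj (W \<omega>) * iexp (c * Y \<omega>) \<partial>M) = (\<integral>\<omega>. cnj (W \<omega> * iexp ((- c) * Y \<omega>)) \<partial>M)"
      by (intro Bochner_Integration.integral_cong) (auto simp: exp_cnj)
    also have "\<dots> = cnj (\<integral>\<omega>. W \<omega> * iexp ((- c) * Y \<omega>) \<partial>M)"
      by (rule integral_bounded_linear[OF bounded_linear_cnj Wi])
    finally show ?thesis unfolding char0 by simp
  qed
  have cWi: "integrable M (\<lambda>\<omega>. cnj (W \<omega>) * iexp (c * Y \<omega>))" for c
    using WK by (intro integrable_const_bound[where B=K]) (auto simp: norm_mult)
  have re: "(\<integral>\<omega>. complex_of_real (Re (W \<omega>)) * iexp (c * Y \<omega>) \<partial>M) = 0" for c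
  proof -
    have "(\<lambda>\<omega>. complex_of_real (Re (W \<omega>)) * iexp (c * Y \<omega>)) = (\<lambda>\<omega>. (W \<omega> * iexp (c * Y \<omega>) + cnj (W \<omega>) * iexp (c * Y \<omega>)) / 2)"
      by (simp add: fun_eq_iff distrib_right[symmetric] complex_add_cnj)
    then have "(\<integral>\<omega>. complex_of_real (Re (W \<omega>)) * iexp (c * Y \<omega>) \<partial>M) =
        (\<integral>\<omega>. W \<omega> * iexp (c * Y \<omega>) + cnj (W \<omega>) * iexp (c * Y \<omega>) \<partial>M) / 2"
      by (simp only: Bochner_Integration.integral_divide_zero)
    also have "\<dots> = 0"
      by (simp only: Bochner_Integration.integral_add[OF Wi cWi] char0 cnj add_0_left div_0)
    finally show ?thesis .
  qed
  have im: "(\<integral>\<omega>. complex_of_real (Im (W \<omega>)) * iexp (c * Y \<omega>) \<partial>M) = 0" for c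
  proof -
    have "(\<lambda>\<omega>. complex_of_real (Im (W \<omega>)) * iexp (c * Y \<omega>)) = (\<lambda>\<omega>. (W \<omega> * iexp (c * Y \<omega>) - cnj (W \<omega>) * iexp (c * Y \<omega>)) / (2 * \<i>))"
    proof
      fix \<omega>
      have "complex_of_real (Im (W \<omega>)) = (W \<omega> - cnj (W \<omega>)) / (2 * \<i>)"
        unfolding complex_diff_cnj by (simp add: complex_eq_iff)
      then show "complex_of_real (Im (W \<omega>)) * iexp (c * Y \<omega>) = (W \<omega> * iexp (c * Y \<omega>) - cnj (W \<omega>) * iexp (c * Y \<omega>)) / (2 * \<i>)"
        by (simp only: left_diff_distrib times_divide_eq_left)
    qed
    then have "(\<integral>\<omega>. complex_of_real (Im (W \<omega>)) * iexp (c * Y \<omega>) \<partial>M) =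
        (\<integral>\<omega>. W \<omega> * iexp (c * Y \<omega>) - cnj (W \<omega>) * iexp (c * Y \<omega>) \<partial>M) / (2 * \<i>)"
      by (simp only: Bochner_Integration.integral_divide_zero)
    also have "\<dots> = 0"
      by (simp only: Bochner_Integration.integral_diff[OF Wi cWi] char0 cnj diff_self div_0)
    finally show ?thesis .
  qed
  have 1: "(\<integral>\<omega>. Re (W \<omega>) * indicator B (Y \<omega>) \<partial>M) = 0"
  proof (rule fourier_vanish_real[where K=K])
    show "\<bar>Re (W \<omega>)\<bar> \<le> K" if "\<omega> \<in> space M" for \<omega>
      by (rule order_trans[OF abs_Re_le_cmod WK[OF that]])
  qed (use re in auto)
  have 2: "(\<integral>\<omega>. Im (W \<omega>) * indicator B (Y \<omega>) \<partial>M) = 0"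
  proof (rule fourier_vanish_real[where K=K])
    show "\<bar>Im (W \<omega>)\<bar> \<le> K" if "\<omega> \<in> space M" for \<omega>
      by (rule order_trans[OF abs_Im_le_cmod WK[OF that]])
  qed (use im in auto)
  have i: "integrable M (\<lambda>\<omega>. W \<omega> * indicator B (Y \<omega>))"
  proof (intro integrable_const_bound[where B="\<bar>K\<bar>"] AE_I2)
    fix \<omega> assume "\<omega> \<in> space M"
    from WK[OF this] show "cmod (W \<omega> * indicator B (Y \<omega>)) \<le> \<bar>K\<bar>" by (auto simp: indicator_def)
  qed measurable
  have "Re (\<integral>\<omega>. W \<omega> * indicator B (Y \<omega>) \<partial>M) = (\<integral>\<omega>. Re (W \<omega>) * indicator B (Y \<omega>) \<partial>M)"
    unfolding integral_Re[OF i, symmetric] by (intro Bochner_Integration.integral_cong) (auto simp: indicator_def)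
  moreover have "Im (\<integral>\<omega>. W \<omega> * indicator B (Y \<omega>) \<partial>M) = (\<integral>\<omega>. Im (W \<omega>) * indicator B (Y \<omega>) \<partial>M)"
    unfolding integral_Im[OF i, symmetric] by (intro Bochner_Integration.integral_cong) (auto simp: indicator_def)
  ultimately show ?thesis using 1 2 by (simp add: complex_eq_iff)
qed

text \<open>Mean 0 forces the location parameter to be 0, so the second moment is the variance and
  replaces the existential parameters of \<open>gaussian_rv\<close>. The formula for the
  characteristic function also covers the degenerate case.\<close>

lemma centered_gaussian:
  assumes g: "gaussian_rv M Y" and m: "integral\<^sup>L M Y = 0"
  shows "integrable M Y" "integrable M (\<lambda>\<omega>. (Y \<omega>)\<^sup>2)"
    and "(\<integral>\<omega>. iexp (Y \<omega>) \<partial>M) = exp (- ((\<integral>\<omega>. (Y \<omega>)\<^sup>2 \<partial>M) / 2))"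
    and "0 < (\<integral>\<omega>. (Y \<omega>)\<^sup>2 \<partial>M) \<Longrightarrow> distributed M lborel Y (\<lambda>x. ennreal (gk (\<integral>\<omega>. (Y \<omega>)\<^sup>2 \<partial>M) x))"
proof -
  have Y [measurable]: "Y \<in> borel_measurable M" using g by (simp add: gaussian_rv_def)
  have "integrable M Y \<and> integrable M (\<lambda>\<omega>. (Y \<omega>)\<^sup>2) \<and>
     (\<integral>\<omega>. iexp (Y \<omega>) \<partial>M) = exp (- ((\<integral>\<omega>. (Y \<omega>)\<^sup>2 \<partial>M) / 2)) \<and>
     (0 < (\<integral>\<omega>. (Y \<omega>)\<^sup>2 \<partial>M) \<longrightarrow> distributed M lborel Y (\<lambda>x. ennreal (gk (\<integral>\<omega>. (Y \<omega>)\<^sup>2 \<partial>M) x)))"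
    using g unfolding gaussian_rv_def
  proof (elim conjE exE disjE)
    fix \<mu> assume ae: "AE \<omega> in M. Y \<omega> = \<mu>"
    have "integral\<^sup>L M Y = (\<integral>\<omega>. \<mu> \<partial>M)" using ae by (intro integral_cong_AE) auto
    then have "\<mu> = 0" using m by (simp add: prob_space)
    with ae have ae0: "AE \<omega> in M. Y \<omega> = 0" by simp
    have 1: "integrable M Y"
      using ae0 by (subst integrable_cong_AE[of _ _ "\<lambda>_. 0"]) auto
    have 2: "integrable M (\<lambda>\<omega>. (Y \<omega>)\<^sup>2)"
      using ae0 by (subst integrable_cong_AE[of _ _ "\<lambda>_. 0"]) auto
    have 3: "(\<integral>\<omega>. (Y \<omega>)\<^sup>2 \<partial>M) = (\<integral>\<omega>. 0 \<partial>M)"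
      using ae0 by (intro integral_cong_AE) auto
    have 4: "(\<integral>\<omega>. iexp (Y \<omega>) \<partial>M) = (\<integral>\<omega>. 1 \<partial>M)"
      using ae0 by (intro integral_cong_AE) auto
    show ?thesis using 1 2 3 4 by (simp add: prob_space)
  next
    fix \<mu> \<sigma> :: real assume s: "0 < \<sigma>" and D: "distributed M lborel Y (\<lambda>x. ennreal (normal_density \<mu> \<sigma> x))"
    have "integral\<^sup>L M Y = \<mu>"
      using distributed_integral[OF D, of "\<lambda>x. x"] s integral_normal_moment_nz_1[OF s, of \<mu>] by simp
    with m have mu: "\<mu> = 0" by simp
    have nd: "normal_density 0 \<sigma> = gk (\<sigma>\<^sup>2)" using s by (simp add: gk_eq_normal_density_0)
    note D = D[unfolded mu nd]
    have s2: "0 < \<sigma>\<^sup>2" using s by simp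
    have m2: "has_bochner_integral lborel (\<lambda>x. gk (\<sigma>\<^sup>2) x * x ^ (2 * 1)) (\<sigma>\<^sup>2)"
      using normal_moment_even[OF s, of 0 1] by (simp add: nd fact_numeral)
    have i1: "integrable M Y"
      using distributed_integrable[OF D, of "\<lambda>x. x"] s integrable_normal_moment_nz_1[OF s, of 0] by (simp add: nd)
    have i2: "integrable M (\<lambda>\<omega>. (Y \<omega>)\<^sup>2)"
      using distributed_integrable[OF D, of "\<lambda>x. x\<^sup>2"] s m2 by (simp add: has_bochner_integral_iff)
    have e2: "(\<integral>\<omega>. (Y \<omega>)\<^sup>2 \<partial>M) = \<sigma>\<^sup>2"
      using distributed_integral[OF D, of "\<lambda>x. x\<^sup>2"] s m2 by (simp add: has_bochner_integral_iff)
    have "(\<integral>\<omega>. iexp (Y \<omega>) \<partial>M) = (\<integral>x. iexp x \<partial>distr M lborel Y)"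
      by (subst integral_distr) auto
    also have "\<dots> = (\<integral>x. gk (\<sigma>\<^sup>2) x *\<^sub>R iexp x \<partial>lborel)"
      unfolding distributed_distr_eq_density[OF D] by (subst integral_density) auto
    also have "\<dots> = exp (- (\<sigma>\<^sup>2 / 2))"
      using gk_iexp[OF s2, of 1] by (simp add: has_bochner_integral_iff)
    finally show ?thesis using i1 i2 e2 D by simp
  qed
  then show "integrable M Y" "integrable M (\<lambda>\<omega>. (Y \<omega>)\<^sup>2)"
     "(\<integral>\<omega>. iexp (Y \<omega>) \<partial>M) = exp (- ((\<integral>\<omega>. (Y \<omega>)\<^sup>2 \<partial>M) / 2))"
     "0 < (\<integral>\<omega>. (Y \<omega>)\<^sup>2 \<partial>M) \<Longrightarrow> distributed M lborel Y (\<lambda>x. ennreal (gk (\<integral>\<omega>. (Y \<omega>)\<^sup>2 \<partial>M) x))"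
    by blast+
qed

text \<open>Exponentials are exchanged for indicators one variable at a time, each time by
  \<open>fourier_vanish\<close>. Z goes first, tested against the exponential of the X's minus its
  mean; then the indicator of Z minus its probability p serves as the centred factor for the
  X's.\<close>

lemma indep_of_char_factorises:
  fixes X :: "'i \<Rightarrow> 'a \<Rightarrow> real" and Z :: "'a \<Rightarrow> real"
  assumes F: "finite F" and X [measurable]: "\<And>i. i \<in> F \<Longrightarrow> X i \<in> borel_measurable M" and Z [measurable]: "Z \<in> borel_measurable M"
    and fac: "\<And>c l. (\<integral>\<omega>. iexp ((\<Sum>i\<in>F. c i * X i \<omega>) + l * Z \<omega>) \<partial>M) =
         (\<integral>\<omega>. iexp (\<Sum>i\<in>F. c i * X i \<omega>) \<partial>M) * (\<integral>\<omega>. iexp (l * Z \<omega>) \<partial>M)"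
    and B [measurable]: "\<And>i. i \<in> F \<Longrightarrow> B i \<in> sets borel" and C [measurable]: "C \<in> sets borel"
  shows "prob {\<omega> \<in> space M. (\<forall>i\<in>F. X i \<omega> \<in> B i) \<and> Z \<omega> \<in> C} =
    prob {\<omega> \<in> space M. \<forall>i\<in>F. X i \<omega> \<in> B i} * prob {\<omega> \<in> space M. Z \<omega> \<in> C}"
proof -
  define p where "p = prob {\<omega> \<in> space M. Z \<omega> \<in> C}"
  have p: "complex_of_real p = (\<integral>\<omega>. indicator C (Z \<omega>) \<partial>M)"
  proof -
    have "p = (\<integral>\<omega>. indicator {\<omega> \<in> space M. Z \<omega> \<in> C} \<omega> \<partial>M)" by (simp add: p_def)
    also have "\<dots> = (\<integral>\<omega>. indicator C (Z \<omega>) \<partial>M)" by (intro Bochner_Integration.integral_cong) (auto simp: indicator_def)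
    finally have "complex_of_real p = (\<integral>\<omega>. complex_of_real (indicator C (Z \<omega>)) \<partial>M)" by simp
    then show ?thesis by (simp add: of_real_indicator)
  qed
  have p01: "0 \<le> p" "p \<le> 1" by (auto simp: p_def)
  have bnd: "integrable M f" if "f \<in> borel_measurable M" "\<And>\<omega>. \<omega> \<in> space M \<Longrightarrow> cmod (f \<omega>) \<le> K" for f :: "'a \<Rightarrow> complex" and K
    using that by (intro integrable_const_bound[where B=K]) auto
  have A: "(\<integral>\<omega>. iexp (\<Sum>i\<in>F. c i * X i \<omega>) * (indicator C (Z \<omega>) - complex_of_real p) \<partial>M) = 0" for c
  proof -
    define U where "U = (\<lambda>\<omega>. \<Sum>i\<in>F. c i * X i \<omega>)"
    have [measurable]: "U \<in> borel_measurable M" unfolding U_def by measurable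
    define K where "K = (\<integral>\<omega>. iexp (U \<omega>) \<partial>M)"
    have iU: "integrable M (\<lambda>\<omega>. iexp (U \<omega>))" by (rule bnd[of _ 1]) auto
    have "(\<integral>\<omega>. (iexp (U \<omega>) - K) * indicator C (Z \<omega>) \<partial>M) = 0"
    proof (rule fourier_vanish)
      show "cmod (iexp (U \<omega>) - K) \<le> 1 + cmod K" for \<omega>
        using norm_triangle_ineq4[of "iexp (U \<omega>)" K] by simp
      fix l
      have "(\<integral>\<omega>. (iexp (U \<omega>) - K) * iexp (l * Z \<omega>) \<partial>M) = (\<integral>\<omega>. iexp (U \<omega> + l * Z \<omega>) - K * iexp (l * Z \<omega>) \<partial>M)"
        by (intro Bochner_Integration.integral_cong) (auto simp: left_diff_distrib exp_add[symmetric] algebra_simps)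
      also have "\<dots> = (\<integral>\<omega>. iexp (U \<omega> + l * Z \<omega>) \<partial>M) - K * (\<integral>\<omega>. iexp (l * Z \<omega>) \<partial>M)"
      proof -
        have "integrable M (\<lambda>\<omega>. iexp (U \<omega> + l * Z \<omega>))" "integrable M (\<lambda>\<omega>. iexp (l * Z \<omega>))"
          by (rule bnd[of _ 1], auto)+
        then show ?thesis by (subst Bochner_Integration.integral_diff) auto
      qed
      also have "\<dots> = 0" using fac[of c l] by (simp add: U_def K_def)
      finally show "(\<integral>\<omega>. (iexp (U \<omega>) - K) * iexp (l * Z \<omega>) \<partial>M) = 0" .
    qed auto
    then have "(\<integral>\<omega>. iexp (U \<omega>) * indicator C (Z \<omega>) - K * indicator C (Z \<omega>) \<partial>M) = 0"
      by (simp add: left_diff_distrib)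
    moreover have i1: "integrable M (\<lambda>\<omega>. iexp (U \<omega>) * indicator C (Z \<omega>))"
      by (rule bnd[of _ 1]) (auto simp: norm_mult indicator_def)
    moreover have "integrable M (\<lambda>\<omega>. indicator C (Z \<omega>) :: complex)"
      by (rule bnd[of _ 1]) (auto simp: indicator_def)
    ultimately have "(\<integral>\<omega>. iexp (U \<omega>) * indicator C (Z \<omega>) \<partial>M) = K * p"
      by (simp add: p Bochner_Integration.integral_diff)
    then have e: "(\<integral>\<omega>. iexp (U \<omega>) * indicator C (Z \<omega>) \<partial>M) = K * p" .
    have "(\<integral>\<omega>. iexp (U \<omega>) * (indicator C (Z \<omega>) - complex_of_real p) \<partial>M) =
        (\<integral>\<omega>. iexp (U \<omega>) * indicator C (Z \<omega>) - iexp (U \<omega>) * complex_of_real p \<partial>M)"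
      by (simp only: right_diff_distrib)
    also have "\<dots> = (\<integral>\<omega>. iexp (U \<omega>) * indicator C (Z \<omega>) \<partial>M) - (\<integral>\<omega>. iexp (U \<omega>) * complex_of_real p \<partial>M)"
      by (rule Bochner_Integration.integral_diff[OF i1 integrable_mult_left[OF iU]])
    also have "(\<integral>\<omega>. iexp (U \<omega>) * complex_of_real p \<partial>M) = K * complex_of_real p"
      unfolding K_def by (rule Bochner_Integration.integral_mult_left) (rule iU)
    finally have "(\<integral>\<omega>. iexp (U \<omega>) * (indicator C (Z \<omega>) - complex_of_real p) \<partial>M) = 0"
      by (simp only: e diff_self)
    then show ?thesis by (simp only: U_def)
  qed
  \<comment> \<open>The variables in G already carry indicators and the others still exponentials;
    adding j to G uses the induction hypothesis with the coefficient of \<open>X j\<close> set to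
    the free Fourier variable l.\<close>
  have main: "(\<integral>\<omega>. (\<Prod>i\<in>G. indicator (B i) (X i \<omega>)) * (iexp (\<Sum>i\<in>F - G. c i * X i \<omega>) * (indicator C (Z \<omega>) - complex_of_real p)) \<partial>M) = 0"
    if "G \<subseteq> F" for G c
  proof -
    have "finite G" using that F finite_subset by blast
    then show ?thesis using that
    proof (induction G arbitrary: c rule: finite_induct)
      case empty
      then show ?case using A[of c] by simp
    next
      case (insert j G)
      have j: "j \<in> F" "j \<notin> G" and G: "G \<subseteq> F" using insert by auto
      have [measurable]: "X j \<in> borel_measurable M" "B j \<in> sets borel" using j by auto
      have GX [measurable]: "X i \<in> borel_measurable M" "B i \<in> sets borel" if "i \<in> G" for i using that G by auto
      have FX [measurable]: "X i \<in> borel_measurable M" if "i \<in> F - insert j G" for i using that by auto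
      define W where "W = (\<lambda>\<omega>. (\<Prod>i\<in>G. indicator (B i) (X i \<omega>)) * (iexp (\<Sum>i\<in>F - insert j G. c i * X i \<omega>) * (indicator C (Z \<omega>) - complex_of_real p)))"
      have Wm [measurable]: "W \<in> borel_measurable M" unfolding W_def by measurable
      have "(\<integral>\<omega>. W \<omega> * indicator (B j) (X j \<omega>) \<partial>M) = 0"
      proof (rule fourier_vanish)
        show "cmod (W \<omega>) \<le> 2" for \<omega>
        proof -
          have "cmod (\<Prod>i\<in>G. indicator (B i) (X i \<omega>)) \<le> 1"
            unfolding prod_norm[symmetric] by (intro prod_le_1) (auto simp: indicator_def)
          moreover have "cmod (indicator C (Z \<omega>) - complex_of_real p) \<le> 2"
            using p01 norm_triangle_ineq4[of "indicator C (Z \<omega>)" "complex_of_real p"] by (auto simp: indicator_def)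
          ultimately have "cmod (\<Prod>i\<in>G. indicator (B i) (X i \<omega>)) * cmod (indicator C (Z \<omega>) - complex_of_real p) \<le> 1 * 2"
            by (rule mult_mono) (simp_all only: norm_ge_zero zero_le_one)
          then show ?thesis unfolding W_def norm_mult norm_exp_i_times mult_1_left by (simp only:)
        qed
        fix l
        have FG: "F - G = insert j (F - insert j G)" using j by auto
        have fin: "finite (F - insert j G)" "j \<notin> F - insert j G" using F by auto
        have "(\<Sum>i\<in>F - G. (c(j := l)) i * X i \<omega>) = (c(j := l)) j * X j \<omega> + (\<Sum>i\<in>F - insert j G. (c(j := l)) i * X i \<omega>)" for \<omega>
          unfolding FG by (rule sum.insert[OF fin])
        moreover have "(\<Sum>i\<in>F - insert j G. (c(j := l)) i * X i \<omega>) = (\<Sum>i\<in>F - insert j G. c i * X i \<omega>)" for \<omega>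
          by (rule sum.cong) auto
        ultimately have "(\<Sum>i\<in>F - G. (c(j := l)) i * X i \<omega>) = l * X j \<omega> + (\<Sum>i\<in>F - insert j G. c i * X i \<omega>)" for \<omega>
          by (simp only: fun_upd_same)
        then have "iexp (\<Sum>i\<in>F - G. (c(j := l)) i * X i \<omega>) = iexp (l * X j \<omega>) * iexp (\<Sum>i\<in>F - insert j G. c i * X i \<omega>)" for \<omega>
          by (simp only: of_real_add distrib_left exp_add)
        then have "W \<omega> * iexp (l * X j \<omega>) = (\<Prod>i\<in>G. indicator (B i) (X i \<omega>)) *
            (iexp (\<Sum>i\<in>F - G. (c(j := l)) i * X i \<omega>) * (indicator C (Z \<omega>) - complex_of_real p))" for \<omega>
          unfolding W_def by (simp only: mult_ac)
        then show "(\<integral>\<omega>. W \<omega> * iexp (l * X j \<omega>) \<partial>M) = 0"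
          using insert.IH[OF G, of "c(j := l)"] by (simp only:)
      qed (rule Wm \<open>X j \<in> borel_measurable M\<close> \<open>B j \<in> sets borel\<close>)+
      moreover have "W \<omega> * indicator (B j) (X j \<omega>) = (\<Prod>i\<in>insert j G. indicator (B i) (X i \<omega>)) *
            (iexp (\<Sum>i\<in>F - insert j G. c i * X i \<omega>) * (indicator C (Z \<omega>) - complex_of_real p))" for \<omega>
        unfolding W_def prod.insert[OF insert.hyps] by (simp only: mult_ac)
      ultimately show ?case by (simp only:)
    qed
  qed
  have 0: "(\<integral>\<omega>. (\<Prod>i\<in>F. indicator (B i) (X i \<omega>)) * (indicator C (Z \<omega>) - complex_of_real p) \<partial>M) = 0"
    using main[of F] by simp
  let ?E = "{\<omega> \<in> space M. \<forall>i\<in>F. X i \<omega> \<in> B i}"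
  let ?EC = "{\<omega> \<in> space M. (\<forall>i\<in>F. X i \<omega> \<in> B i) \<and> Z \<omega> \<in> C}"
  have E: "?E \<in> sets M" using F by measurable
  have EC: "?EC \<in> sets M" using F by measurable
  have "(\<Prod>i\<in>F. indicator (B i) (X i \<omega>)) * (indicator C (Z \<omega>) - complex_of_real p) = complex_of_real (indicator ?EC \<omega> - p * indicator ?E \<omega>)"
    if "\<omega> \<in> space M" for \<omega>
  proof -
    have "(\<Prod>i\<in>F. indicator (B i) (X i \<omega>) :: complex) = (if \<forall>i\<in>F. X i \<omega> \<in> B i then 1 else 0)"
      using F by (auto simp: indicator_def intro!: prod_zero)
    then show ?thesis using that by (auto simp: indicator_def)
  qed
  then have "(\<integral>\<omega>. complex_of_real (indicator ?EC \<omega> - p * indicator ?E \<omega>) \<partial>M) = 0"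
    using 0 by (simp cong: Bochner_Integration.integral_cong)
  then have "(\<integral>\<omega>. indicator ?EC \<omega> - p * indicator ?E \<omega> \<partial>M) = 0"
    by (simp only: integral_complex_of_real of_real_eq_0_iff)
  moreover have "(\<integral>\<omega>. indicator ?EC \<omega> - p * indicator ?E \<omega> \<partial>M) = prob ?EC - p * prob ?E"
  proof -
    have "integrable M (indicator ?EC :: _ \<Rightarrow> real)" "integrable M (\<lambda>\<omega>. p * indicator ?E \<omega>)"
      using E EC by (auto intro!: integrable_mult_right integrable_real_indicator simp: emeasure_eq_measure)
    then have "(\<integral>\<omega>. indicator ?EC \<omega> - p * indicator ?E \<omega> \<partial>M) = (\<integral>\<omega>. indicator ?EC \<omega> \<partial>M) - (\<integral>\<omega>. p * indicator ?E \<omega> \<partial>M)"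
      by (rule Bochner_Integration.integral_diff)
    moreover have "space M \<inter> ?EC = ?EC" "space M \<inter> ?E = ?E" by auto
    ultimately show ?thesis by (simp add: Int_commute)
  qed
  ultimately show ?thesis by (simp add: p_def mult.commute)
qed

end

section \<open>Finite-dimensional distributions of the bridge\<close>

locale brownian_bridge =
  fixes P :: "'a measure" and b :: "real \<Rightarrow> 'a \<Rightarrow> real"
  assumes bb: "standard_brownian_bridge P b"

sublocale brownian_bridge \<subseteq> prob_space P
  using bb by (simp add: standard_brownian_bridge_def)

lemma integrable_product_of_squares:
  fixes f g :: "'a \<Rightarrow> real"
  assumes [measurable]: "f \<in> borel_measurable M" "g \<in> borel_measurable M"
    and "integrable M (\<lambda>x. (f x)\<^sup>2)" "integrable M (\<lambda>x. (g x)\<^sup>2)"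
  shows "integrable M (\<lambda>x. f x * g x)"
proof (rule Bochner_Integration.integrable_bound)
  show "integrable M (\<lambda>x. (f x)\<^sup>2 + (g x)\<^sup>2)" using assms by simp
  have "\<bar>a * c\<bar> \<le> a\<^sup>2 + c\<^sup>2" for a c :: real
  proof -
    have "2 * (\<bar>a\<bar> * \<bar>c\<bar>) \<le> a\<^sup>2 + c\<^sup>2" using sum_squares_bound[of "\<bar>a\<bar>" "\<bar>c\<bar>"] by simp
    moreover have "0 \<le> \<bar>a\<bar> * \<bar>c\<bar>" by simp
    ultimately show ?thesis unfolding abs_mult by linarith
  qed
  then show "AE x in M. norm (f x * g x) \<le> norm ((f x)\<^sup>2 + (g x)\<^sup>2)" by simp
qed simp

context brownian_bridge begin

lemma b_continuous: "\<omega> \<in> space P \<Longrightarrow> continuous_on {0..1} (\<lambda>t. b t \<omega>)"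
  using bb by (simp add: standard_brownian_bridge_def)

lemma gaussian_linear_combination:
  assumes I: "finite I" and inj: "inj_on \<tau> I" and sub: "\<tau> ` I \<subseteq> {0..1}"
  shows "gaussian_rv P (\<lambda>\<omega>. \<Sum>i\<in>I. c i * b (\<tau> i) \<omega>)"
proof -
  have "gaussian_rv P (\<lambda>\<omega>. \<Sum>t\<in>\<tau> ` I. c (inv_into I \<tau> t) * b t \<omega>)"
    using bb I sub by (auto simp: standard_brownian_bridge_def gaussian_process_def)
  also have "(\<lambda>\<omega>. \<Sum>t\<in>\<tau> ` I. c (inv_into I \<tau> t) * b t \<omega>) = (\<lambda>\<omega>. \<Sum>i\<in>I. c i * b (\<tau> i) \<omega>)"
    using inj by (simp add: sum.reindex)
  finally show ?thesis .
qed

lemma b_gaussian: "t \<in> {0..1} \<Longrightarrow> gaussian_rv P (b t)"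
  using gaussian_linear_combination[of "{()}" "\<lambda>_. t" "\<lambda>_. 1"] by simp

lemma b_measurable [measurable]: "t \<in> {0..1} \<Longrightarrow> b t \<in> borel_measurable P"
  using b_gaussian by (simp add: gaussian_rv_def)

lemma b_mean: "t \<in> {0..1} \<Longrightarrow> integral\<^sup>L P (b t) = 0"
  using bb by (simp add: standard_brownian_bridge_def)

lemma b_covariance: "s \<in> {0..1} \<Longrightarrow> t \<in> {0..1} \<Longrightarrow> (\<integral>\<omega>. b s \<omega> * b t \<omega> \<partial>P) = min s t - s * t"
  using bb by (simp add: standard_brownian_bridge_def)

lemma b_integrable: "t \<in> {0..1} \<Longrightarrow> integrable P (b t)"
  using centered_gaussian(1)[OF b_gaussian b_mean] by simp

lemma b_product_integrable:
  "s \<in> {0..1} \<Longrightarrow> t \<in> {0..1} \<Longrightarrow> integrable P (\<lambda>\<omega>. b s \<omega> * b t \<omega>)"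
  using centered_gaussian(2)[OF b_gaussian b_mean] by (intro integrable_product_of_squares) auto

lemma linear_combination_mean:
  assumes "\<tau> ` I \<subseteq> {0..1}"
  shows "(\<integral>\<omega>. (\<Sum>i\<in>I. c i * b (\<tau> i) \<omega>) \<partial>P) = 0"
proof -
  have "\<tau> i \<in> {0..1}" if "i \<in> I" for i using assms that by auto
  then show ?thesis using b_integrable b_mean by (subst Bochner_Integration.integral_sum) auto
qed

text \<open>\<open>Z\<close> is the innovation of the bridge between \<open>\<tau> k\<close> and \<open>\<tau> (Suc k)\<close>.\<close>

lemma bridge_innovation:
  fixes \<tau> :: "nat \<Rightarrow> real" and k :: nat
  assumes mono: "strict_mono \<tau>" and t0: "0 < \<tau> 0" and t1: "\<tau> (Suc k) < 1"
  defines "r \<equiv> (1 - \<tau> (Suc k)) / (1 - \<tau> k)"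
    and "v \<equiv> (1 - \<tau> (Suc k)) * ((1 - \<tau> k) - (1 - \<tau> (Suc k))) / (1 - \<tau> k)"
  defines "Z \<equiv> (\<lambda>\<omega>. b (\<tau> (Suc k)) \<omega> - r * b (\<tau> k) \<omega>)"
  shows "distributed P lborel Z (\<lambda>x. ennreal (gk v x))"
    and "(\<And>i. i \<le> k \<Longrightarrow> B i \<in> sets borel) \<Longrightarrow> C \<in> sets borel \<Longrightarrow>
      prob {\<omega> \<in> space P. (\<forall>i\<in>{..k}. b (\<tau> i) \<omega> \<in> B i) \<and> Z \<omega> \<in> C} =
      prob {\<omega> \<in> space P. \<forall>i\<in>{..k}. b (\<tau> i) \<omega> \<in> B i} * prob {\<omega> \<in> space P. Z \<omega> \<in> C}"
proof -
  have lt: "\<tau> i < \<tau> j \<longleftrightarrow> i < j" for i j using mono by (rule strict_mono_less)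
  have le: "\<tau> i \<le> \<tau> j \<longleftrightarrow> i \<le> j" for i j using mono by (rule strict_mono_less_eq)
  have T: "\<tau> i \<in> {0..1}" if "i \<le> Suc k" for i
    using le[of 0 i] le[of i "Suc k"] t0 t1 that by auto
  have tk: "\<tau> k < 1" using lt[of k "Suc k"] t1 by simp
  have inj: "inj_on \<tau> I" for I using mono by (meson inj_on_subset strict_mono_imp_inj_on subset_UNIV)
  have Zm [measurable]: "Z \<in> borel_measurable P" unfolding Z_def using T[of k] T[of "Suc k"] by measurable
  \<comment> \<open>The covariance with \<open>b (\<tau> i)\<close> is \<open>\<tau> i\<close> times
    (1 - \<open>\<tau> (Suc k)\<close>) - r (1 - \<open>\<tau> k\<close>), which the choice of r
    makes zero for all i \<le> k at once.\<close>
  have cov: "(\<integral>\<omega>. b (\<tau> i) \<omega> * Z \<omega> \<partial>P) = 0" if "i \<le> k" for i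
  proof -
    have "(\<integral>\<omega>. b (\<tau> i) \<omega> * Z \<omega> \<partial>P) = (\<integral>\<omega>. b (\<tau> i) \<omega> * b (\<tau> (Suc k)) \<omega> - r * (b (\<tau> i) \<omega> * b (\<tau> k) \<omega>) \<partial>P)"
      by (simp add: Z_def algebra_simps)
    also have "\<dots> = (\<integral>\<omega>. b (\<tau> i) \<omega> * b (\<tau> (Suc k)) \<omega> \<partial>P) - r * (\<integral>\<omega>. b (\<tau> i) \<omega> * b (\<tau> k) \<omega> \<partial>P)"
      using b_product_integrable T that by (subst Bochner_Integration.integral_diff) auto
    also have "\<dots> = (\<tau> i - \<tau> i * \<tau> (Suc k)) - r * (\<tau> i - \<tau> i * \<tau> k)"
    proof -
      have "\<tau> i \<in> {0..1}" "\<tau> k \<in> {0..1}" "\<tau> (Suc k) \<in> {0..1}" using T[of i] T[of k] T[of "Suc k"] that by auto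
      then show ?thesis using that le[of i k] le[of i "Suc k"] by (simp only: b_covariance min_absorb1)
    qed
    also have "\<dots> = 0" using tk by (simp add: r_def field_simps)
    finally show ?thesis .
  qed
  have bi: "integrable P (\<lambda>\<omega>. b (\<tau> i) \<omega> * Z \<omega>)" if "i \<le> Suc k" for i
    unfolding Z_def right_diff_distrib using b_product_integrable T that
    by (auto simp: mult.left_commute[of _ r] intro!: Bochner_Integration.integrable_diff integrable_mult_right)
  have Z2i: "integrable P (\<lambda>\<omega>. (Z \<omega>)\<^sup>2)"
  proof -
    have "(\<lambda>\<omega>. (Z \<omega>)\<^sup>2) = (\<lambda>\<omega>. b (\<tau> (Suc k)) \<omega> * Z \<omega> - r * (b (\<tau> k) \<omega> * Z \<omega>))"
      by (simp add: fun_eq_iff Z_def power2_eq_square algebra_simps)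
    then show ?thesis using bi by simp
  qed
  have Z2: "(\<integral>\<omega>. (Z \<omega>)\<^sup>2 \<partial>P) = v"
  proof -
    have "(\<integral>\<omega>. (Z \<omega>)\<^sup>2 \<partial>P) = (\<integral>\<omega>. b (\<tau> (Suc k)) \<omega> * Z \<omega> - r * (b (\<tau> k) \<omega> * Z \<omega>) \<partial>P)"
      by (simp add: Z_def power2_eq_square algebra_simps)
    also have "\<dots> = (\<integral>\<omega>. b (\<tau> (Suc k)) \<omega> * Z \<omega> \<partial>P)"
      using bi cov[of k] by (subst Bochner_Integration.integral_diff) auto
    also have "\<dots> = (\<integral>\<omega>. b (\<tau> (Suc k)) \<omega> * b (\<tau> (Suc k)) \<omega> - r * (b (\<tau> (Suc k)) \<omega> * b (\<tau> k) \<omega>) \<partial>P)"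
      by (simp add: Z_def algebra_simps)
    also have "\<dots> = (\<tau> (Suc k) - \<tau> (Suc k) * \<tau> (Suc k)) - r * (\<tau> k - \<tau> (Suc k) * \<tau> k)"
      using b_product_integrable T lt[of k "Suc k"]
      by (subst Bochner_Integration.integral_diff) (auto simp: b_covariance T min_absorb2)
    also have "\<dots> = v" using tk by (simp add: r_def v_def field_simps)
    finally show ?thesis .
  qed
  have v0: "0 < v" using tk t1 lt[of k "Suc k"] by (simp add: v_def)
  \<comment> \<open>A combination of the past and Z is itself a combination of bridge values, hence
    Gaussian: the term - r \<open>b (\<tau> k)\<close> of Z is absorbed into the coefficient at
    k.\<close>
  define c0 where "c0 = (\<lambda>(c::nat \<Rightarrow> real) l i. if i = Suc k then l else c i - (if i = k then l * r else 0))"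
  have comb: "(\<Sum>i\<in>{..k}. c i * b (\<tau> i) \<omega>) + l * Z \<omega> = (\<Sum>i\<in>{..Suc k}. c0 c l i * b (\<tau> i) \<omega>)" for c l \<omega>
  proof -
    have "(\<Sum>i\<in>{..Suc k}. c0 c l i * b (\<tau> i) \<omega>) = (\<Sum>i\<in>{..k}. (c i - (if i = k then l * r else 0)) * b (\<tau> i) \<omega>) + l * b (\<tau> (Suc k)) \<omega>"
      by (simp add: c0_def)
    also have "(\<Sum>i\<in>{..k}. (c i - (if i = k then l * r else 0)) * b (\<tau> i) \<omega>) = (\<Sum>i\<in>{..k}. c i * b (\<tau> i) \<omega> - (if i = k then l * r * b (\<tau> k) \<omega> else 0))"
      by (intro sum.cong) (auto simp: left_diff_distrib)
    also have "\<dots> = (\<Sum>i\<in>{..k}. c i * b (\<tau> i) \<omega>) - l * r * b (\<tau> k) \<omega>"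
      by (simp add: sum_subtractf)
    finally show ?thesis by (simp add: Z_def algebra_simps)
  qed
  have sub: "\<tau> ` {..Suc k} \<subseteq> {0..1}" using T by auto
  have sub': "\<tau> ` {..k} \<subseteq> {0..1}" using T by auto
  have g: "gaussian_rv P (\<lambda>\<omega>. (\<Sum>i\<in>{..k}. c i * b (\<tau> i) \<omega>) + l * Z \<omega>)" for c l
    unfolding comb by (rule gaussian_linear_combination[OF _ inj sub]) simp
  have m: "(\<integral>\<omega>. (\<Sum>i\<in>{..k}. c i * b (\<tau> i) \<omega>) + l * Z \<omega> \<partial>P) = 0" for c l
    unfolding comb by (rule linear_combination_mean[OF sub])
  have gZ: "gaussian_rv P (\<lambda>\<omega>. l * Z \<omega>)" for l using g[of "\<lambda>_. 0" l] by simp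
  have mZ: "(\<integral>\<omega>. l * Z \<omega> \<partial>P) = 0" for l using m[of "\<lambda>_. 0" l] by simp
  have gU: "gaussian_rv P (\<lambda>\<omega>. \<Sum>i\<in>{..k}. c i * b (\<tau> i) \<omega>)" for c
    by (rule gaussian_linear_combination[OF _ inj sub']) simp
  note mU = linear_combination_mean[OF sub']
  show "distributed P lborel Z (\<lambda>x. ennreal (gk v x))"
    using centered_gaussian(4)[of Z] gZ[of 1] mZ[of 1] Z2 v0 by simp
  assume B: "\<And>i. i \<le> k \<Longrightarrow> B i \<in> sets borel" and C: "C \<in> sets borel"
  show "prob {\<omega> \<in> space P. (\<forall>i\<in>{..k}. b (\<tau> i) \<omega> \<in> B i) \<and> Z \<omega> \<in> C} =
      prob {\<omega> \<in> space P. \<forall>i\<in>{..k}. b (\<tau> i) \<omega> \<in> B i} * prob {\<omega> \<in> space P. Z \<omega> \<in> C}"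
  proof (rule indep_of_char_factorises)
    fix c l
    define U where "U = (\<lambda>\<omega>. \<Sum>i\<in>{..k}. c i * b (\<tau> i) \<omega>)"
    have [measurable]: "U \<in> borel_measurable P" using gU[of c] by (simp add: U_def gaussian_rv_def)
    have U2: "integrable P (\<lambda>\<omega>. (U \<omega>)\<^sup>2)"
      unfolding U_def by (rule centered_gaussian(2)[OF gU mU])
    have UZ: "(\<integral>\<omega>. U \<omega> * Z \<omega> \<partial>P) = 0"
    proof -
      have "(\<integral>\<omega>. U \<omega> * Z \<omega> \<partial>P) = (\<integral>\<omega>. (\<Sum>i\<in>{..k}. c i * (b (\<tau> i) \<omega> * Z \<omega>)) \<partial>P)"
        by (simp add: U_def sum_distrib_right mult.assoc)
      also have "\<dots> = (\<Sum>i\<in>{..k}. c i * (\<integral>\<omega>. b (\<tau> i) \<omega> * Z \<omega> \<partial>P))"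
        using bi by (subst Bochner_Integration.integral_sum) auto
      finally show ?thesis using cov by simp
    qed
    have UZi: "integrable P (\<lambda>\<omega>. U \<omega> * Z \<omega>)"
      using U2 Z2i by (intro integrable_product_of_squares) auto
    have "(\<integral>\<omega>. (U \<omega> + l * Z \<omega>)\<^sup>2 \<partial>P) = (\<integral>\<omega>. ((U \<omega>)\<^sup>2 + 2 * l * (U \<omega> * Z \<omega>)) + l\<^sup>2 * (Z \<omega>)\<^sup>2 \<partial>P)"
      by (simp add: power2_eq_square algebra_simps)
    also have "\<dots> = (\<integral>\<omega>. (U \<omega>)\<^sup>2 \<partial>P) + (\<integral>\<omega>. (l * Z \<omega>)\<^sup>2 \<partial>P)"
      using U2 UZi Z2i UZ by (simp add: Bochner_Integration.integral_add power_mult_distrib)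
    finally have var: "(\<integral>\<omega>. (U \<omega> + l * Z \<omega>)\<^sup>2 \<partial>P) = (\<integral>\<omega>. (U \<omega>)\<^sup>2 \<partial>P) + (\<integral>\<omega>. (l * Z \<omega>)\<^sup>2 \<partial>P)" .
    have 1: "(\<integral>\<omega>. iexp (U \<omega> + l * Z \<omega>) \<partial>P) = exp (- ((\<integral>\<omega>. (U \<omega> + l * Z \<omega>)\<^sup>2 \<partial>P) / 2))"
      unfolding U_def by (rule centered_gaussian(3)[OF g m])
    have 2: "(\<integral>\<omega>. iexp (U \<omega>) \<partial>P) = exp (- ((\<integral>\<omega>. (U \<omega>)\<^sup>2 \<partial>P) / 2))"
      unfolding U_def by (rule centered_gaussian(3)[OF gU mU])
    have 3: "(\<integral>\<omega>. iexp (l * Z \<omega>) \<partial>P) = exp (- ((\<integral>\<omega>. (l * Z \<omega>)\<^sup>2 \<partial>P) / 2))"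
      by (rule centered_gaussian(3)[OF gZ mZ])
    have "exp (- (((\<integral>\<omega>. (U \<omega>)\<^sup>2 \<partial>P) + (\<integral>\<omega>. (l * Z \<omega>)\<^sup>2 \<partial>P)) / 2)) = exp (- ((\<integral>\<omega>. (U \<omega>)\<^sup>2 \<partial>P) / 2)) * exp (- ((\<integral>\<omega>. (l * Z \<omega>)\<^sup>2 \<partial>P) / 2))"
      by (simp add: exp_add[symmetric] add_divide_distrib)
    then have "(\<integral>\<omega>. iexp (U \<omega> + l * Z \<omega>) \<partial>P) = (\<integral>\<omega>. iexp (U \<omega>) \<partial>P) * (\<integral>\<omega>. iexp (l * Z \<omega>) \<partial>P)"
      unfolding 1 2 3 var by (simp only: of_real_mult)
    then show "(\<integral>\<omega>. iexp ((\<Sum>i\<in>{..k}. c i * b (\<tau> i) \<omega>) + l * Z \<omega>) \<partial>P) =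
         (\<integral>\<omega>. iexp (\<Sum>i\<in>{..k}. c i * b (\<tau> i) \<omega>) \<partial>P) * (\<integral>\<omega>. iexp (l * Z \<omega>) \<partial>P)"
      by (simp only: U_def)
  qed (use B C T in auto)
qed

end

text \<open>With a and c the times left until 1, this is the h-transform: the bridge moves from x to
  w by the free Gaussian step times the ratio \<open>gk c w\<close> / \<open>gk a x\<close> of the
  weights for reaching 0 at the end. The proof completes the square.\<close>

lemma gk_bridge_identity:
  assumes "0 < c" "c < a"
  shows "gk a x * gk (c * (a - c) / a) (w - c / a * x) = gk (a - c) (w - x) * gk c w"
proof -
  have "x\<^sup>2 / (2 * a) + (w - c / a * x)\<^sup>2 / (2 * (c * (a - c) / a)) = (w - x)\<^sup>2 / (2 * (a - c)) + w\<^sup>2 / (2 * c)"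
  proof -
    define d where "d = a - c"
    have d: "0 < d" "a = c + d" using assms by (auto simp: d_def)
    have "c + d \<noteq> 0" using assms(1) d(1) by linarith
    then show ?thesis using assms(1) d(1) unfolding d(2)
      by (simp add: divide_simps) algebra
  qed
  then have "exp (- (x\<^sup>2 / (2 * a))) * exp (- ((w - c / a * x)\<^sup>2 / (2 * (c * (a - c) / a)))) = exp (- ((w - x)\<^sup>2 / (2 * (a - c)))) * exp (- (w\<^sup>2 / (2 * c)))"
    by (simp add: exp_add[symmetric])
  moreover have "sqrt (2 * pi * a) * sqrt (2 * pi * (c * (a - c) / a)) = sqrt (2 * pi * (a - c)) * sqrt (2 * pi * c)"
    using assms by (simp add: real_sqrt_mult[symmetric] field_simps)
  ultimately show ?thesis unfolding gk_def by (simp add: times_divide_times_eq)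
qed

lemma gk_1_0: "gk 1 0 = 1 / sqrt (2 * pi)"
  by (simp add: gk_def)

text \<open>The density at \<open>\<tau> k\<close> of free Brownian motion from 0 on the event that
  it is in \<open>B i\<close> at each earlier time \<open>\<tau> i\<close>.\<close>

primrec hg :: "(nat \<Rightarrow> real) \<Rightarrow> (nat \<Rightarrow> real set) \<Rightarrow> nat \<Rightarrow> real \<Rightarrow> ennreal" where
  "hg \<tau> B 0 = (\<lambda>x. ennreal (gk (\<tau> 0) x))"
| "hg \<tau> B (Suc k) = (\<lambda>x. \<integral>\<^sup>+ y. indicator (B k) y * hg \<tau> B k y * ennreal (gk (\<tau> (Suc k) - \<tau> k) (x - y)) \<partial>lborel)"

lemma hg_measurable [measurable]:
  assumes [measurable]: "\<And>k. B k \<in> sets borel"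
  shows "hg \<tau> B k \<in> borel_measurable borel"
  by (induction k) simp_all

context brownian_bridge begin

text \<open>On a grid the bridge is free Brownian motion reweighted by
  \<open>gk (1 - \<tau> k) x\<close> / \<open>gk 1 0\<close>, and sqrt (2 pi) = 1 /
  \<open>gk 1 0\<close>. In the induction the intermediate weight disappears by
  \<open>gk_bridge_identity\<close>, so only the weight at the last time remains.\<close>

lemma bridge_chain:
  fixes \<tau> :: "nat \<Rightarrow> real"
  assumes mono: "strict_mono \<tau>" and t0: "0 < \<tau> 0" and tk: "\<tau> k < 1"
    and B [measurable]: "\<And>k. B k \<in> sets borel" and C: "C \<in> sets borel"
  shows "emeasure P {\<omega> \<in> space P. (\<forall>i<k. b (\<tau> i) \<omega> \<in> B i) \<and> b (\<tau> k) \<omega> \<in> C} =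
    (\<integral>\<^sup>+ x. indicator C x * (hg \<tau> B k x * ennreal (sqrt (2 * pi) * gk (1 - \<tau> k) x)) \<partial>lborel)"
  using tk C
proof (induction k arbitrary: C)
  case 0
  note [measurable] = \<open>C \<in> sets borel\<close>
  let ?t = "\<tau> 0"
  have T: "?t \<in> {0..1}" using 0 t0 by auto
  have e2: "(\<integral>\<omega>. (b ?t \<omega>)\<^sup>2 \<partial>P) = ?t * (1 - ?t)"
    using b_covariance[OF T T] by (simp add: power2_eq_square algebra_simps)
  have "distributed P lborel (b ?t) (\<lambda>x. ennreal (gk (?t * (1 - ?t)) x))"
    using centered_gaussian(4)[OF b_gaussian[OF T] b_mean[OF T]] e2 0 t0 by simp
  from distributed_emeasure[OF this, of C]
  have "emeasure P (b ?t -` C \<inter> space P) = (\<integral>\<^sup>+ x. ennreal (gk (?t * (1 - ?t)) x) * indicator C x \<partial>lborel)" by simp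
  also have "b ?t -` C \<inter> space P = {\<omega> \<in> space P. (\<forall>i<0. b (\<tau> i) \<omega> \<in> B i) \<and> b ?t \<omega> \<in> C}" by auto
  also have "(\<integral>\<^sup>+ x. ennreal (gk (?t * (1 - ?t)) x) * indicator C x \<partial>lborel) =
     (\<integral>\<^sup>+ x. indicator C x * (hg \<tau> B 0 x * ennreal (sqrt (2 * pi) * gk (1 - ?t) x)) \<partial>lborel)"
  proof (intro nn_integral_cong)
    fix x
    have "gk 1 0 * gk ((1 - ?t) * (1 - (1 - ?t)) / 1) (x - (1 - ?t) / 1 * 0) = gk (1 - (1 - ?t)) (x - 0) * gk (1 - ?t) x"
      using 0 t0 by (intro gk_bridge_identity) auto
    then have "gk (?t * (1 - ?t)) x = gk ?t x * (sqrt (2 * pi) * gk (1 - ?t) x)"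
      by (simp add: gk_1_0 mult.commute field_simps)
    then show "ennreal (gk (?t * (1 - ?t)) x) * indicator C x = indicator C x * (hg \<tau> B 0 x * ennreal (sqrt (2 * pi) * gk (1 - ?t) x))"
      using 0 t0 by (simp add: ennreal_mult mult.commute)
  qed
  finally show ?case .
next
  case (Suc k)
  note [measurable] = \<open>C \<in> sets borel\<close>
  define r where "r = (1 - \<tau> (Suc k)) / (1 - \<tau> k)"
  define v where "v = (1 - \<tau> (Suc k)) * ((1 - \<tau> k) - (1 - \<tau> (Suc k))) / (1 - \<tau> k)"
  define Z where "Z = (\<lambda>\<omega>. b (\<tau> (Suc k)) \<omega> - r * b (\<tau> k) \<omega>)"
  have lt: "\<tau> k < \<tau> (Suc k)" using mono by (simp add: strict_mono_less)
  have le: "\<tau> i \<le> \<tau> j \<longleftrightarrow> i \<le> j" for i j using mono by (rule strict_mono_less_eq)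
  have tk: "\<tau> k < 1" using lt Suc.prems by simp
  have T: "\<tau> i \<in> {0..1}" if "i \<le> Suc k" for i
    using le[of 0 i] le[of i "Suc k"] t0 Suc.prems that by auto
  have bm [measurable]: "b (\<tau> i) \<in> borel_measurable P" if "i \<le> Suc k" for i using T[OF that] by simp
  have bk [measurable]: "b (\<tau> k) \<in> borel_measurable P" and bsk [measurable]: "b (\<tau> (Suc k)) \<in> borel_measurable P" by (auto intro: bm)
  have Zm [measurable]: "Z \<in> borel_measurable P" unfolding Z_def by measurable
  have v0: "0 < v" using tk lt Suc.prems by (simp add: v_def)
  note innov = bridge_innovation[OF mono t0 Suc.prems(1), folded r_def v_def, folded Z_def]
  define \<psi> where "\<psi> = (\<lambda>x. hg \<tau> B k x * ennreal (sqrt (2 * pi) * gk (1 - \<tau> k) x))"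
  have [measurable]: "\<psi> \<in> borel_measurable borel" unfolding \<psi>_def by measurable
  \<comment> \<open>\<nu> is the law of \<open>b (\<tau> k)\<close> restricted to the event
    \<open>A\<close> that all constraints up to k hold, and \<open>G\<close> is the law of the
    innovation.\<close>
  define \<nu> where "\<nu> = density lborel (\<lambda>x. indicator (B k) x * \<psi> x)"
  define G where "G = density lborel (\<lambda>x. ennreal (gk v x))"
  have [measurable_cong, simp]: "sets \<nu> = sets borel" "sets G = sets borel" by (auto simp: \<nu>_def G_def)
  define A where "A = {\<omega> \<in> space P. \<forall>i\<le>k. b (\<tau> i) \<omega> \<in> B i}"
  have Am [measurable]: "A \<in> sets P"
  proof -
    have "A = {\<omega> \<in> space P. \<forall>i\<in>{..k}. b (\<tau> i) \<omega> \<in> B i}" by (auto simp: A_def)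
    also have "\<dots> \<in> sets P"
    proof (intro sets.sets_Collect_finite_All)
      fix i assume "i \<in> {..k}"
      then have [measurable]: "b (\<tau> i) \<in> borel_measurable P" by (intro bm) auto
      show "{\<omega> \<in> space P. b (\<tau> i) \<omega> \<in> B i} \<in> sets P" by measurable
    qed simp
    finally show ?thesis .
  qed
  have nu: "emeasure \<nu> D = emeasure P {\<omega> \<in> A. b (\<tau> k) \<omega> \<in> D}" if D [measurable]: "D \<in> sets borel" for D
  proof -
    have "emeasure \<nu> D = (\<integral>\<^sup>+ x. indicator (B k \<inter> D) x * \<psi> x \<partial>lborel)"
      unfolding \<nu>_def by (subst emeasure_density) (auto intro!: nn_integral_cong simp: indicator_def)
    also have "\<dots> = emeasure P {\<omega> \<in> space P. (\<forall>i<k. b (\<tau> i) \<omega> \<in> B i) \<and> b (\<tau> k) \<omega> \<in> B k \<inter> D}"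
      unfolding \<psi>_def by (rule Suc.IH[symmetric]) (use tk in auto)
    also have "{\<omega> \<in> space P. (\<forall>i<k. b (\<tau> i) \<omega> \<in> B i) \<and> b (\<tau> k) \<omega> \<in> B k \<inter> D} = {\<omega> \<in> A. b (\<tau> k) \<omega> \<in> D}"
      by (auto simp: A_def le_less)
    finally show ?thesis .
  qed
  have Ge: "emeasure G D = emeasure P {\<omega> \<in> space P. Z \<omega> \<in> D}" if D [measurable]: "D \<in> sets borel" for D
  proof -
    have "emeasure P (Z -` D \<inter> space P) = (\<integral>\<^sup>+ x. ennreal (gk v x) * indicator D x \<partial>lborel)"
      using distributed_emeasure[OF innov(1), of D] by simp
    also have "\<dots> = emeasure G D" unfolding G_def by (subst emeasure_density) auto
    also have "Z -` D \<inter> space P = {\<omega> \<in> space P. Z \<omega> \<in> D}" by auto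
    finally show ?thesis by simp
  qed
  have sf: "sigma_finite_measure \<nu>" "sigma_finite_measure G"
  proof -
    have "emeasure \<nu> (space \<nu>) \<noteq> \<infinity>" using nu[of UNIV] by (simp add: \<nu>_def emeasure_eq_measure)
    then have "finite_measure \<nu>" by (rule finite_measureI)
    then show "sigma_finite_measure \<nu>" by (simp add: finite_measure_def)
    have "emeasure G (space G) \<noteq> \<infinity>" using Ge[of UNIV] by (simp add: G_def emeasure_eq_measure)
    then have "finite_measure G" by (rule finite_measureI)
    then show "sigma_finite_measure G" by (simp add: finite_measure_def)
  qed
  interpret G: sigma_finite_measure G by (rule sf)
  define Q where "Q = distr (density P (indicator A)) (borel \<Otimes>\<^sub>M borel) (\<lambda>\<omega>. (b (\<tau> k) \<omega>, Z \<omega>))"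
  have Qe: "emeasure Q S = emeasure P {\<omega> \<in> A. (b (\<tau> k) \<omega>, Z \<omega>) \<in> S}" if S [measurable]: "S \<in> sets (borel \<Otimes>\<^sub>M borel)" for S
  proof -
    have "emeasure Q S = emeasure (density P (indicator A)) ((\<lambda>\<omega>. (b (\<tau> k) \<omega>, Z \<omega>)) -` S \<inter> space P)"
      unfolding Q_def by (subst emeasure_distr) auto
    also have "\<dots> = (\<integral>\<^sup>+ \<omega>. indicator A \<omega> * indicator ((\<lambda>\<omega>. (b (\<tau> k) \<omega>, Z \<omega>)) -` S \<inter> space P) \<omega> \<partial>P)"
      by (rule emeasure_density) measurable
    also have "\<dots> = (\<integral>\<^sup>+ \<omega>. indicator (A \<inter> ((\<lambda>\<omega>. (b (\<tau> k) \<omega>, Z \<omega>)) -` S \<inter> space P)) \<omega> \<partial>P)"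
      by (simp only: indicator_inter_arith)
    also have "\<dots> = emeasure P (A \<inter> ((\<lambda>\<omega>. (b (\<tau> k) \<omega>, Z \<omega>)) -` S \<inter> space P))"
      by (rule nn_integral_indicator) measurable
    also have "A \<inter> ((\<lambda>\<omega>. (b (\<tau> k) \<omega>, Z \<omega>)) -` S \<inter> space P) = {\<omega> \<in> A. (b (\<tau> k) \<omega>, Z \<omega>) \<in> S}"
      by (auto simp: A_def)
    finally show ?thesis .
  qed
  have prod: "\<nu> \<Otimes>\<^sub>M G = Q"
  proof (rule pair_measure_eqI[OF sf])
    show "sets (\<nu> \<Otimes>\<^sub>M G) = sets Q" by (simp add: Q_def cong: sets_pair_measure_cong)
    fix D1 D2 assume "D1 \<in> sets \<nu>" "D2 \<in> sets G"
    then have [measurable]: "D1 \<in> sets borel" "D2 \<in> sets borel" by auto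
    \<comment> \<open>The test set D1 is merged into the constraint at the last index, so the
      independence statement for product sets applies verbatim.\<close>
    let ?B = "\<lambda>i. if i = k then B k \<inter> D1 else B i"
    have "prob {\<omega> \<in> space P. (\<forall>i\<in>{..k}. b (\<tau> i) \<omega> \<in> ?B i) \<and> Z \<omega> \<in> D2} =
        prob {\<omega> \<in> space P. \<forall>i\<in>{..k}. b (\<tau> i) \<omega> \<in> ?B i} * prob {\<omega> \<in> space P. Z \<omega> \<in> D2}"
      unfolding Z_def r_def by (rule bridge_innovation(2)[OF mono t0 Suc.prems(1)]) auto
    moreover have "{\<omega> \<in> space P. (\<forall>i\<in>{..k}. b (\<tau> i) \<omega> \<in> ?B i) \<and> Z \<omega> \<in> D2} = {\<omega> \<in> A. (b (\<tau> k) \<omega>, Z \<omega>) \<in> D1 \<times> D2}"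
      by (auto simp: A_def split: if_splits)
    moreover have "{\<omega> \<in> space P. \<forall>i\<in>{..k}. b (\<tau> i) \<omega> \<in> ?B i} = {\<omega> \<in> A. b (\<tau> k) \<omega> \<in> D1}"
      by (auto simp: A_def split: if_splits)
    ultimately have "emeasure P {\<omega> \<in> A. (b (\<tau> k) \<omega>, Z \<omega>) \<in> D1 \<times> D2} = emeasure P {\<omega> \<in> A. b (\<tau> k) \<omega> \<in> D1} * emeasure P {\<omega> \<in> space P. Z \<omega> \<in> D2}"
      by (simp add: emeasure_eq_measure ennreal_mult)
    then show "emeasure \<nu> D1 * emeasure G D2 = emeasure Q (D1 \<times> D2)"
      by (simp add: nu Ge Qe)
  qed
  let ?S = "{xy. r * fst xy + snd xy \<in> C} :: (real \<times> real) set"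
  have Sm [measurable]: "?S \<in> sets (borel \<Otimes>\<^sub>M borel)"
  proof -
    have "(\<lambda>xy. r * fst xy + snd xy) -` C \<inter> space (borel \<Otimes>\<^sub>M borel) \<in> sets (borel \<Otimes>\<^sub>M borel)"
      by (rule measurable_sets[of _ _ borel]) auto
    then show ?thesis by (simp add: vimage_def space_pair_measure)
  qed
  have "{\<omega> \<in> space P. (\<forall>i<Suc k. b (\<tau> i) \<omega> \<in> B i) \<and> b (\<tau> (Suc k)) \<omega> \<in> C} = {\<omega> \<in> A. (b (\<tau> k) \<omega>, Z \<omega>) \<in> ?S}"
    by (auto simp: A_def Z_def less_Suc_eq_le)
  then have "emeasure P {\<omega> \<in> space P. (\<forall>i<Suc k. b (\<tau> i) \<omega> \<in> B i) \<and> b (\<tau> (Suc k)) \<omega> \<in> C} = emeasure (\<nu> \<Otimes>\<^sub>M G) ?S"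
    by (simp add: Qe prod)
  also have "\<dots> = (\<integral>\<^sup>+ x. emeasure G (Pair x -` ?S) \<partial>\<nu>)"
    by (rule G.emeasure_pair_measure_alt) measurable
  also have "\<dots> = (\<integral>\<^sup>+ x. (indicator (B k) x * \<psi> x) * emeasure G (Pair x -` ?S) \<partial>lborel)"
  proof -
    have "(\<lambda>x. emeasure G (Pair x -` ?S)) \<in> borel_measurable \<nu>"
      by (rule G.measurable_emeasure_Pair) measurable
    then have "(\<lambda>x. emeasure G (Pair x -` ?S)) \<in> borel_measurable borel"
      by (simp cong: measurable_cong_sets)
    then show ?thesis unfolding \<nu>_def by (subst nn_integral_density) auto
  qed
  also have "\<dots> = (\<integral>\<^sup>+ x. (\<integral>\<^sup>+ w. indicator C w * (indicator (B k) x * \<psi> x * ennreal (gk v (w - r * x))) \<partial>lborel) \<partial>lborel)"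
  proof (intro nn_integral_cong)
    fix x
    have [measurable]: "Pair x -` ?S \<in> sets borel" using sets_Pair1[OF Sm, of x] by simp
    have "emeasure G (Pair x -` ?S) = (\<integral>\<^sup>+ y. ennreal (gk v y) * indicator C (r * x + y) \<partial>lborel)"
      unfolding G_def by (subst emeasure_density) (auto intro!: nn_integral_cong simp: indicator_def)
    also have "\<dots> = (\<integral>\<^sup>+ w. ennreal (gk v (- (r * x) + 1 * w)) * indicator C (r * x + (- (r * x) + 1 * w)) \<partial>lborel)"
      by (subst nn_integral_real_affine[where c=1 and t="- (r * x)"]) auto
    also have "\<dots> = (\<integral>\<^sup>+ w. indicator C w * ennreal (gk v (w - r * x)) \<partial>lborel)"
      by (intro nn_integral_cong) (simp add: mult.commute add.commute)
    finally show "(indicator (B k) x * \<psi> x) * emeasure G (Pair x -` ?S) = (\<integral>\<^sup>+ w. indicator C w * (indicator (B k) x * \<psi> x * ennreal (gk v (w - r * x))) \<partial>lborel)"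
      by (simp add: nn_integral_cmult[symmetric] mult_ac)
  qed
  also have "\<dots> = (\<integral>\<^sup>+ w. (\<integral>\<^sup>+ x. indicator C w * (indicator (B k) x * \<psi> x * ennreal (gk v (w - r * x))) \<partial>lborel) \<partial>lborel)"
    by (intro lborel_pair.Fubini'[symmetric]) measurable
  also have "\<dots> = (\<integral>\<^sup>+ w. indicator C w * (hg \<tau> B (Suc k) w * ennreal (sqrt (2 * pi) * gk (1 - \<tau> (Suc k)) w)) \<partial>lborel)"
  proof (intro nn_integral_cong)
    fix w
    have id: "ennreal (sqrt (2 * pi) * gk (1 - \<tau> k) x) * ennreal (gk v (w - r * x)) = ennreal (gk (\<tau> (Suc k) - \<tau> k) (w - x)) * ennreal (sqrt (2 * pi) * gk (1 - \<tau> (Suc k)) w)" for x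
    proof -
      have "gk (1 - \<tau> k) x * gk v (w - r * x) = gk ((1 - \<tau> k) - (1 - \<tau> (Suc k))) (w - x) * gk (1 - \<tau> (Suc k)) w"
        unfolding v_def r_def using Suc.prems lt by (intro gk_bridge_identity) auto
      then have "(sqrt (2 * pi) * gk (1 - \<tau> k) x) * gk v (w - r * x) = gk (\<tau> (Suc k) - \<tau> k) (w - x) * (sqrt (2 * pi) * gk (1 - \<tau> (Suc k)) w)"
        by (simp add: mult.assoc mult.left_commute)
      then show ?thesis using lt tk Suc.prems v0 by (simp add: ennreal_mult[symmetric])
    qed
    have "indicator C w * (indicator (B k) x * \<psi> x * ennreal (gk v (w - r * x))) =
       (indicator C w * ennreal (sqrt (2 * pi) * gk (1 - \<tau> (Suc k)) w)) * (indicator (B k) x * hg \<tau> B k x * ennreal (gk (\<tau> (Suc k) - \<tau> k) (w - x)))" for x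
    proof -
      have "indicator C w * (indicator (B k) x * \<psi> x * ennreal (gk v (w - r * x))) =
        indicator C w * indicator (B k) x * hg \<tau> B k x * (ennreal (sqrt (2 * pi) * gk (1 - \<tau> k) x) * ennreal (gk v (w - r * x)))"
        by (simp add: \<psi>_def mult_ac)
      then show ?thesis unfolding id by (simp add: mult_ac)
    qed
    then have "(\<integral>\<^sup>+ x. indicator C w * (indicator (B k) x * \<psi> x * ennreal (gk v (w - r * x))) \<partial>lborel) =
      (\<integral>\<^sup>+ x. (indicator C w * ennreal (sqrt (2 * pi) * gk (1 - \<tau> (Suc k)) w)) * (indicator (B k) x * hg \<tau> B k x * ennreal (gk (\<tau> (Suc k) - \<tau> k) (w - x))) \<partial>lborel)"
      by (simp only:)
    also have "\<dots> = (indicator C w * ennreal (sqrt (2 * pi) * gk (1 - \<tau> (Suc k)) w)) * hg \<tau> B (Suc k) w"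
      unfolding hg.simps by (rule nn_integral_cmult) measurable
    also have "\<dots> = indicator C w * (hg \<tau> B (Suc k) w * ennreal (sqrt (2 * pi) * gk (1 - \<tau> (Suc k)) w))"
      by (simp only: mult_ac)
    finally show "(\<integral>\<^sup>+ x. indicator C w * (indicator (B k) x * \<psi> x * ennreal (gk v (w - r * x))) \<partial>lborel) =
      indicator C w * (hg \<tau> B (Suc k) w * ennreal (sqrt (2 * pi) * gk (1 - \<tau> (Suc k)) w))" .
  qed
  finally show ?case .
qed

end

section \<open>Dependence of the kernel on the interval\<close>

text \<open>Continuity is local, so it suffices to have a summable majorant on each bounded
  rectangle that keeps away from z = 0.\<close>

lemma continuous_on_two_parameter_series:
  fixes F :: "nat \<Rightarrow> real \<Rightarrow> real \<Rightarrow> real"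
  assumes cont: "\<And>n. continuous_on ({0<..} \<times> UNIV) (\<lambda>(z, x). F n z x)"
    and bd: "\<And>a B. 0 < a \<Longrightarrow> 0 < B \<Longrightarrow> \<exists>K. summable K \<and> (\<forall>n z x. a < z \<longrightarrow> z < B \<longrightarrow> \<bar>x\<bar> < B \<longrightarrow> \<bar>F n z x\<bar> \<le> K n)"
  shows "continuous_on ({0<..} \<times> UNIV) (\<lambda>(z, x). \<Sum>n. F n z x)"
proof (rule continuous_at_imp_continuous_on, rule ballI)
  fix p :: "real \<times> real" assume p: "p \<in> {0<..} \<times> UNIV"
  obtain z0 x0 where zx: "p = (z0, x0)" by (cases p)
  with p have z0: "0 < z0" by simp
  define a where "a = z0 / 2"
  define B where "B = 2 * z0 + \<bar>x0\<bar> + 1"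
  have aB: "0 < a" "0 < B" "a < z0" "z0 < B" "\<bar>x0\<bar> < B" using z0 by (auto simp: a_def B_def)
  obtain K where K: "summable K" "\<And>n z x. a < z \<Longrightarrow> z < B \<Longrightarrow> \<bar>x\<bar> < B \<Longrightarrow> \<bar>F n z x\<bar> \<le> K n"
    using bd[OF aB(1,2)] by blast
  let ?S = "{a<..<B} \<times> {-B<..<B}"
  have "continuous_on ?S (\<lambda>p. \<Sum>n. case p of (z, x) \<Rightarrow> F n z x)"
  proof (rule continuous_on_suminf_bounded[OF _ _ K(1)])
    show "continuous_on ?S (\<lambda>p. case p of (z, x) \<Rightarrow> F n z x)" for n
      by (rule continuous_on_subset[OF cont]) (use aB in auto)
    show "\<bar>case p of (z, x) \<Rightarrow> F n z x\<bar> \<le> K n" if "p \<in> ?S" for n p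
      using that K(2) by (auto simp: abs_less_iff)
  qed
  moreover have "(\<lambda>p. \<Sum>n. case p of (z, x) \<Rightarrow> F n z x) = (\<lambda>(z, x). \<Sum>n. F n z x)" by auto
  moreover have "open ?S" by (intro open_Times) auto
  moreover have "p \<in> ?S" using aB zx by (auto simp: abs_less_iff)
  ultimately show "isCont (\<lambda>(z, x). \<Sum>n. F n z x) p"
    using continuous_on_eq_continuous_at[of ?S "\<lambda>(z, x). \<Sum>n. F n z x"] by (metis (no_types, lifting))
qed

lemma mode_exp_le:
  assumes "0 < t" "0 < z" "z < B"
  shows "exp (- ((hf n * pi / z)\<^sup>2 * t / 2)) \<le> exp (- ((pi / B)\<^sup>2 * t / 2 * (hf n)\<^sup>2))"
proof -
  have "(pi / B)\<^sup>2 \<le> (pi / z)\<^sup>2" using assms by (intro power_mono divide_left_mono) auto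
  then have "(pi / B)\<^sup>2 * t / 2 * (hf n)\<^sup>2 \<le> (pi / z)\<^sup>2 * t / 2 * (hf n)\<^sup>2"
    using assms by (intro mult_right_mono divide_right_mono) auto
  then show ?thesis unfolding q_exponent by simp
qed

lemma continuous_on_q_joint:
  assumes t: "0 < t"
  shows "continuous_on ({0<..} \<times> UNIV) (\<lambda>(z, x). q t z x)"
proof -
  have c: "continuous_on ({0<..} \<times> UNIV) (\<lambda>(z, x). \<Sum>n. exp (- ((hf n * pi / z)\<^sup>2 * t / 2)) * cos (hf n * pi / z * x))"
  proof (rule continuous_on_two_parameter_series)
    show "continuous_on ({0<..} \<times> UNIV) (\<lambda>(z, x). exp (- ((hf n * pi / z)\<^sup>2 * t / 2)) * cos (hf n * pi / z * x))" for n
      unfolding split_beta by (intro continuous_intros) auto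
    fix a B :: real assume a: "0 < a" and B: "0 < B"
    show "\<exists>K. summable K \<and> (\<forall>n z x. a < z \<longrightarrow> z < B \<longrightarrow> \<bar>x\<bar> < B \<longrightarrow> \<bar>exp (- ((hf n * pi / z)\<^sup>2 * t / 2)) * cos (hf n * pi / z * x)\<bar> \<le> K n)"
    proof (intro exI[of _ "\<lambda>n. exp (- ((pi / B)\<^sup>2 * t / 2 * (hf n)\<^sup>2))"] conjI allI impI)
      show "summable (\<lambda>n. exp (- ((pi / B)\<^sup>2 * t / 2 * (hf n)\<^sup>2)))" using t B by (intro summable_exp_hf) auto
      fix n z x assume "a < z" "z < B"
      then show "\<bar>exp (- ((hf n * pi / z)\<^sup>2 * t / 2)) * cos (hf n * pi / z * x)\<bar> \<le> exp (- ((pi / B)\<^sup>2 * t / 2 * (hf n)\<^sup>2))"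
        using a by (intro order_trans[OF abs_mult_cos_le mode_exp_le[OF t]]) auto
    qed
  qed
  show ?thesis
    unfolding q_def split_beta
    by (rule continuous_on_divide[OF c[unfolded split_beta]]) (auto intro!: continuous_intros)
qed

lemma continuous_on_q2 [continuous_intros]:
  assumes "0 < t" "continuous_on S f" "\<And>x. x \<in> S \<Longrightarrow> 0 < f x" "continuous_on S g"
  shows "continuous_on S (\<lambda>x. q t (f x) (g x))"
proof -
  have "continuous_on S (\<lambda>x. (\<lambda>(z, x). q t z x) (f x, g x))"
    by (rule continuous_on_compose2[OF continuous_on_q_joint[OF assms(1)]])
       (use assms in \<open>auto intro!: continuous_intros\<close>)
  then show ?thesis by simp
qed

text \<open>The derivative in the level z of the n-th summand of \<open>q\<close>, the prefactor 1/z
  included.\<close>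

definition dmode :: "nat \<Rightarrow> real \<Rightarrow> real \<Rightarrow> real \<Rightarrow> real" where
  "dmode n t z x = exp (- ((hf n * pi / z)\<^sup>2 * t / 2)) *
     ((((hf n * pi / z)\<^sup>2 * t - 1) * cos (hf n * pi / z * x) + (hf n * pi / z) * x * sin (hf n * pi / z * x)) / z\<^sup>2)"

definition dq :: "real \<Rightarrow> real \<Rightarrow> real \<Rightarrow> real" where
  "dq t z x = (\<Sum>n. dmode n t z x)"

lemma mode_deriv:
  assumes z: "0 < z"
  shows "((\<lambda>z. exp (- ((hf n * pi / z)\<^sup>2 * t / 2)) * cos (hf n * pi / z * x) / z) has_field_derivative dmode n t z x) (at z)"
proof -
  have 1: "((\<lambda>z. - ((hf n * pi / z)\<^sup>2 * t / 2)) has_field_derivative ((hf n * pi / z)\<^sup>2 * t / z)) (at z)"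
    using z by (auto intro!: derivative_eq_intros simp: power2_eq_square field_simps)
  have 2: "((\<lambda>z. hf n * pi / z * x) has_field_derivative (- (hf n * pi / z) * x / z)) (at z)"
    using z by (auto intro!: derivative_eq_intros simp: power2_eq_square field_simps)
  let ?e = "exp (- ((hf n * pi / z)\<^sup>2 * t / 2))" and ?w = "hf n * pi / z"
  have "((\<lambda>z. exp (- ((hf n * pi / z)\<^sup>2 * t / 2)) * cos (hf n * pi / z * x) / z) has_field_derivative
     (((?e * (?w\<^sup>2 * t / z)) * cos (?w * x) + (- sin (?w * x) * (- ?w * x / z)) * ?e) * z - ?e * cos (?w * x) * 1) / (z * z)) (at z)"
    using z by (intro DERIV_divide DERIV_mult' DERIV_mult DERIV_chain2[OF DERIV_exp 1] DERIV_chain2[OF DERIV_cos 2] DERIV_ident) auto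
  moreover have "(((?e * (?w\<^sup>2 * t / z)) * cos (?w * x) + (- sin (?w * x) * (- ?w * x / z)) * ?e) * z - ?e * cos (?w * x) * 1) / (z * z) = dmode n t z x"
  proof -
    have "((?e * (?w\<^sup>2 * t / z)) * cos (?w * x) + (- sin (?w * x) * (- ?w * x / z)) * ?e) * z = ?e * (?w\<^sup>2 * t * cos (?w * x) + ?w * x * sin (?w * x))"
      using z by (simp add: distrib_left distrib_right mult_ac)
    then show ?thesis unfolding dmode_def by (simp add: power2_eq_square[of z] algebra_simps)
  qed
  ultimately show ?thesis by simp
qed

lemma dmode_bound:
  assumes t: "0 < t" and a: "0 < a" and B: "0 < B"
  obtains K where "summable K" "\<And>n z x. a < z \<Longrightarrow> z < B \<Longrightarrow> \<bar>x\<bar> < B \<Longrightarrow> \<bar>dmode n t z x\<bar> \<le> K n"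
proof
  let ?c = "(pi / B)\<^sup>2 * t / 2"
  define K where "K = (\<lambda>n. ((pi / a)\<^sup>2 * t) / a\<^sup>2 * (hf n ^ 2 * exp (- (?c * (hf n)\<^sup>2))) + 1 / a\<^sup>2 * (hf n ^ 0 * exp (- (?c * (hf n)\<^sup>2)))
     + (pi / a * B) / a\<^sup>2 * (hf n ^ 1 * exp (- (?c * (hf n)\<^sup>2))))"
  have c: "0 < ?c" using t B by simp
  show "summable K" unfolding K_def
    by (intro summable_add summable_mult summable_power_exp_hf c)
  fix n z x assume zx: "a < z" "z < B" "\<bar>x\<bar> < B"
  define w where "w = hf n * pi / z"
  define e where "e = exp (- (?c * (hf n)\<^sup>2))"
  have z: "0 < z" using zx a by simp
  have w: "0 \<le> w" "w \<le> hf n * (pi / a)" using z zx a by (auto simp: w_def intro!: divide_left_mono mult_nonneg_nonneg)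
  have w2: "w\<^sup>2 \<le> (hf n)\<^sup>2 * (pi / a)\<^sup>2" using power_mono[OF w(2,1), of 2] by (simp only: power_mult_distrib)
  have "\<bar>(w\<^sup>2 * t - 1) * cos (w * x) + w * x * sin (w * x)\<bar> \<le> \<bar>(w\<^sup>2 * t - 1) * cos (w * x)\<bar> + \<bar>w * x * sin (w * x)\<bar>"
    by (rule abs_triangle_ineq)
  also have "\<dots> \<le> (w\<^sup>2 * t + 1) * 1 + w * B * 1"
  proof (rule add_mono)
    have "\<bar>w\<^sup>2 * t - 1\<bar> \<le> w\<^sup>2 * t + 1" using t by (auto simp: abs_le_iff)
    then show "\<bar>(w\<^sup>2 * t - 1) * cos (w * x)\<bar> \<le> (w\<^sup>2 * t + 1) * 1"
      unfolding abs_mult by (intro mult_mono) auto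
    show "\<bar>w * x * sin (w * x)\<bar> \<le> w * B * 1"
      unfolding abs_mult using w zx by (intro mult_mono) auto
  qed
  also have "\<dots> \<le> ((hf n)\<^sup>2 * (pi / a)\<^sup>2) * t + 1 + (hf n * (pi / a)) * B"
  proof -
    have A: "w\<^sup>2 * t \<le> ((hf n)\<^sup>2 * (pi / a)\<^sup>2) * t" using w2 t by (intro mult_right_mono) auto
    have C: "w * B \<le> (hf n * (pi / a)) * B" using w(2) B by (intro mult_right_mono) auto
    show ?thesis unfolding mult_1_right by (rule add_mono[OF add_mono[OF A order_refl] C])
  qed
  finally have 1: "\<bar>(w\<^sup>2 * t - 1) * cos (w * x) + w * x * sin (w * x)\<bar> \<le> ((hf n)\<^sup>2 * (pi / a)\<^sup>2) * t + 1 + (hf n * (pi / a)) * B" .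
  have a2: "a\<^sup>2 \<le> z\<^sup>2" using zx a by (intro power_mono) auto
  have "\<bar>((w\<^sup>2 * t - 1) * cos (w * x) + w * x * sin (w * x)) / z\<^sup>2\<bar> \<le> (((hf n)\<^sup>2 * (pi / a)\<^sup>2) * t + 1 + (hf n * (pi / a)) * B) / a\<^sup>2"
    unfolding abs_divide using 1 a2 a by (intro frac_le) auto
  then have "\<bar>dmode n t z x\<bar> \<le> e * ((((hf n)\<^sup>2 * (pi / a)\<^sup>2) * t + 1 + (hf n * (pi / a)) * B) / a\<^sup>2)"
    unfolding dmode_def w_def[symmetric] abs_mult[of "exp _"]
    using mode_exp_le[OF t z zx(2), of n] by (intro mult_mono) (auto simp: e_def w_def)
  also have "\<dots> = K n" unfolding K_def e_def[symmetric] by (simp add: add_divide_distrib distrib_left distrib_right mult_ac)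
  finally show "\<bar>dmode n t z x\<bar> \<le> K n" .
qed

lemma continuous_on_dmode:
  "continuous_on ({0<..} \<times> UNIV) (\<lambda>(z, x). dmode n t z x)"
  unfolding dmode_def split_beta by (intro continuous_intros) auto

lemma continuous_on_dq2 [continuous_intros]:
  assumes t: "0 < t" and "continuous_on S f" "\<And>x. x \<in> S \<Longrightarrow> 0 < f x" "continuous_on S g"
  shows "continuous_on S (\<lambda>x. dq t (f x) (g x))"
proof -
  have c: "continuous_on ({0<..} \<times> UNIV) (\<lambda>(z, x). dq t z x)"
    unfolding dq_def
  proof (rule continuous_on_two_parameter_series[OF continuous_on_dmode])
    fix a B :: real assume "0 < a" "0 < B"
    from dmode_bound[OF t this] show "\<exists>K. summable K \<and> (\<forall>n z x. a < z \<longrightarrow> z < B \<longrightarrow> \<bar>x\<bar> < B \<longrightarrow> \<bar>dmode n t z x\<bar> \<le> K n)"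
      by metis
  qed
  have "continuous_on S (\<lambda>x. (\<lambda>(z, x). dq t z x) (f x, g x))"
    by (rule continuous_on_compose2[OF c]) (use assms in \<open>auto intro!: continuous_intros\<close>)
  then show ?thesis by simp
qed

lemma q_deriv_z:
  assumes t: "0 < t" and z: "0 < z"
  shows "((\<lambda>z. q t z x) has_field_derivative dq t z x) (at z)"
proof -
  define a where "a = z / 2"
  define B where "B = 2 * z + \<bar>x\<bar> + 1"
  have aB: "0 < a" "0 < B" "a < z" "z < B" "\<bar>x\<bar> < B" using z by (auto simp: a_def B_def)
  obtain K where K: "summable K" "\<And>n z x. a < z \<Longrightarrow> z < B \<Longrightarrow> \<bar>x\<bar> < B \<Longrightarrow> \<bar>dmode n t z x\<bar> \<le> K n"
    using dmode_bound[OF t aB(1,2)] by blast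
  let ?S = "{a<..<B}"
  let ?f = "\<lambda>n z. exp (- ((hf n * pi / z)\<^sup>2 * t / 2)) * cos (hf n * pi / z * x) / z"
  have "((\<lambda>z. \<Sum>n. ?f n z) has_field_derivative (\<Sum>n. dmode n t z x)) (at z)"
  proof (rule has_field_derivative_series'(2)[where S = ?S and x0 = z])
    show "(?f n has_field_derivative dmode n t y x) (at y within ?S)" if "y \<in> ?S" for n y
      using mode_deriv[of y n t x] that aB by (auto intro: has_field_derivative_at_within)
    show "uniformly_convergent_on ?S (\<lambda>n y. \<Sum>i<n. dmode i t y x)"
      by (rule Weierstrass_m_test'[OF _ K(1)]) (use K(2) aB in auto)
    show "summable (\<lambda>n. ?f n z)" by (rule summable_divide[OF summable_q_term[OF t z]])
    show "z \<in> ?S" using aB by simp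
    show "z \<in> interior ?S" using aB by (simp add: interior_open)
  qed simp
  then have "((\<lambda>y. q t y x) has_field_derivative dq t z x) (at z)"
  proof (rule DERIV_cong_ev[THEN iffD1, rotated -1])
    have "\<forall>\<^sub>F y in nhds z. y \<in> {0<..}" using z by (intro eventually_nhds_in_open) auto
    then show "\<forall>\<^sub>F y in nhds z. (\<Sum>n. ?f n y) = q t y x"
    proof eventually_elim
      case (elim y)
      then show ?case using suminf_divide[OF summable_q_term[OF t, of y x], of y] by (simp add: q_def)
    qed
  qed (auto simp: dq_def)
  then show ?thesis .
qed

subsection \<open>Derivative with respect to the level on the first time interval\<close>

text \<open>The integral of \<open>q u z1\<close> times \<open>q (1 - u) z2\<close> over [-z2, z2],
  rescaled to a fixed interval so that the levels enter the integrand only. The range follows z2 and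
  not the minimum: for z1 < z2 the odd extension of \<open>q u z1\<close> is integrated as well,
  which keeps the expression differentiable in z1 across z1 = z2.\<close>

definition Ht :: "real \<Rightarrow> real \<Rightarrow> real \<Rightarrow> real" where
  "Ht u z1 z2 = integral {-1..1} (\<lambda>y. q u z1 (z2 * y) * (z2 * q (1 - u) z2 (z2 * y)))"

definition Ps :: "real \<Rightarrow> real \<Rightarrow> real \<Rightarrow> real" where
  "Ps u z1 z2 = integral {-1..1} (\<lambda>y. dq u z1 (z2 * y) * (z2 * q (1 - u) z2 (z2 * y)))"

lemma Ht_eq:
  assumes u: "0 < u" "u < 1" and z: "0 < z1" "0 < z2"
  shows "Ht u z1 z2 = integral {-z2..z2} (\<lambda>x. q u z1 x * q (1 - u) z2 x)"
proof -
  let ?f = "\<lambda>x. q u z1 x * q (1 - u) z2 x"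
  have "?f integrable_on {-z2..z2}" using u z by (intro integrable_continuous_real continuous_intros) auto
  then have "(?f has_integral integral {-z2..z2} ?f) (cbox (z2 * (-1) + 0) (z2 * 1 + 0))"
    by (simp add: integrable_integral)
  from has_integral_affinity'[OF this, of z2 0]
  have "((\<lambda>y. ?f (z2 * y)) has_integral integral {-z2..z2} ?f / z2) {-1..1}"
    using z by (simp add: divide_inverse_commute)
  from has_integral_mult_right[OF this, of z2]
  have "((\<lambda>y. z2 * ?f (z2 * y)) has_integral integral {-z2..z2} ?f) {-1..1}"
    using z by simp
  moreover have "(\<lambda>y. z2 * ?f (z2 * y)) = (\<lambda>y. q u z1 (z2 * y) * (z2 * q (1 - u) z2 (z2 * y)))"
    by (simp add: fun_eq_iff)
  ultimately show ?thesis unfolding Ht_def by (simp add: integral_unique)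
qed

lemma Ht_deriv:
  assumes u: "0 < u" "u < 1" and z: "0 < z1" "0 < z2"
  shows "((\<lambda>z. Ht u z z2) has_field_derivative Ps u z1 z2) (at z1)"
proof -
  have "((\<lambda>z. integral (cbox (-1) 1) (\<lambda>y. q u z (z2 * y) * (z2 * q (1 - u) z2 (z2 * y)))) has_field_derivative
     integral (cbox (-1) 1) (\<lambda>y. dq u z1 (z2 * y) * (z2 * q (1 - u) z2 (z2 * y)))) (at z1 within {0<..})"
  proof (rule leibniz_rule_field_derivative)
    show "((\<lambda>z. q u z (z2 * y) * (z2 * q (1 - u) z2 (z2 * y))) has_field_derivative dq u z (z2 * y) * (z2 * q (1 - u) z2 (z2 * y))) (at z within {0<..})"
      if "z \<in> {0<..}" for z y
      using that u by (intro DERIV_cmult_right has_field_derivative_at_within[OF q_deriv_z]) auto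
    show "(\<lambda>y. q u z (z2 * y) * (z2 * q (1 - u) z2 (z2 * y))) integrable_on cbox (-1) 1" if "z \<in> {0<..}" for z
      using that u z by (intro integrable_continuous continuous_intros) auto
    show "continuous_on ({0<..} \<times> cbox (-1) 1) (\<lambda>(z, y). dq u z (z2 * y) * (z2 * q (1 - u) z2 (z2 * y)))"
      unfolding split_beta using u z by (intro continuous_intros) auto
  qed (use z in auto)
  then show ?thesis using z by (simp add: Ht_def Ps_def at_within_open[of z1 "{0<..}"])
qed

lemma Ps_continuous:
  assumes u: "0 < u" "u < 1"
  shows "continuous_on ({0<..} \<times> {0<..}) (\<lambda>(z1, z2). Ps u z1 z2)"
proof -
  have "continuous_on ({0<..} \<times> {0<..}) (\<lambda>p. integral (cbox (-1) 1) (\<lambda>y. dq u (fst p) (snd p * y) * (snd p * q (1 - u) (snd p) (snd p * y))))"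
  proof (rule integral_continuous_on_param)
    show "continuous_on (({0<..} \<times> {0<..}) \<times> cbox (-1) 1) (\<lambda>(p, y). dq u (fst p) (snd p * y) * (snd p * q (1 - u) (snd p) (snd p * y)))"
      unfolding split_beta using u by (intro continuous_intros) auto
  qed
  then show ?thesis by (simp add: Ps_def split_beta)
qed

section \<open>The joint law of the two partial maxima\<close>

text \<open>The Gaussian step is self-adjoint, so one step can be moved from the left factor of a
  pairing to the right one.\<close>

lemma nn_integral_gk_symmetric:
  assumes [measurable]: "f \<in> borel_measurable borel" "g \<in> borel_measurable borel" "A \<in> sets borel" "B \<in> sets borel"
  shows "(\<integral>\<^sup>+ x. indicator A x * (\<integral>\<^sup>+ y. indicator B y * f y * ennreal (gk d (x - y)) \<partial>lborel) * g x \<partial>lborel) =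
    (\<integral>\<^sup>+ y. indicator B y * f y * (\<integral>\<^sup>+ x. indicator A x * g x * ennreal (gk d (y - x)) \<partial>lborel) \<partial>lborel)"
proof -
  have "(\<integral>\<^sup>+ x. indicator A x * (\<integral>\<^sup>+ y. indicator B y * f y * ennreal (gk d (x - y)) \<partial>lborel) * g x \<partial>lborel) =
     (\<integral>\<^sup>+ x. (\<integral>\<^sup>+ y. (indicator A x * g x) * (indicator B y * f y * ennreal (gk d (x - y))) \<partial>lborel) \<partial>lborel)"
  proof (intro nn_integral_cong)
    fix x
    have "(\<integral>\<^sup>+ y. (indicator A x * g x) * (indicator B y * f y * ennreal (gk d (x - y))) \<partial>lborel) =
      (indicator A x * g x) * (\<integral>\<^sup>+ y. indicator B y * f y * ennreal (gk d (x - y)) \<partial>lborel)"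
      by (rule nn_integral_cmult) measurable
    then show "indicator A x * (\<integral>\<^sup>+ y. indicator B y * f y * ennreal (gk d (x - y)) \<partial>lborel) * g x =
       (\<integral>\<^sup>+ y. (indicator A x * g x) * (indicator B y * f y * ennreal (gk d (x - y))) \<partial>lborel)"
      by (simp only: mult_ac)
  qed
  also have "\<dots> = (\<integral>\<^sup>+ y. (\<integral>\<^sup>+ x. (indicator A x * g x) * (indicator B y * f y * ennreal (gk d (x - y))) \<partial>lborel) \<partial>lborel)"
    by (intro lborel_pair.Fubini'[symmetric]) measurable
  also have "\<dots> = (\<integral>\<^sup>+ y. indicator B y * f y * (\<integral>\<^sup>+ x. indicator A x * g x * ennreal (gk d (y - x)) \<partial>lborel) \<partial>lborel)"
  proof (intro nn_integral_cong)
    fix y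
    have "(\<integral>\<^sup>+ x. (indicator A x * g x) * (indicator B y * f y * ennreal (gk d (x - y))) \<partial>lborel) =
      (\<integral>\<^sup>+ x. (indicator B y * f y) * (indicator A x * g x * ennreal (gk d (y - x))) \<partial>lborel)"
      unfolding gk_minus_commute[of d y] by (simp only: mult_ac)
    also have "\<dots> = indicator B y * f y * (\<integral>\<^sup>+ x. indicator A x * g x * ennreal (gk d (y - x)) \<partial>lborel)"
      by (rule nn_integral_cmult) measurable
    finally show "(\<integral>\<^sup>+ x. (indicator A x * g x) * (indicator B y * f y * ennreal (gk d (x - y))) \<partial>lborel) =
       indicator B y * f y * (\<integral>\<^sup>+ x. indicator A x * g x * ennreal (gk d (y - x)) \<partial>lborel)" .
  qed
  finally show ?thesis .
qed

text \<open>The endpoints \<open>0\<close> and \<open>1\<close> are left out, since the bridge is degenerate there.\<close>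

definition gtime :: "real \<Rightarrow> nat \<Rightarrow> nat \<Rightarrow> real" where
  "gtime u N i = (if i < N then real (Suc i) * (u / real N) else u + real (Suc i - N) * ((1 - u) / real N))"

text \<open>Index N - 1 is the time u, which belongs to both halves; both constraints hold there,
  hence the minimum.\<close>

definition gset :: "nat \<Rightarrow> real \<Rightarrow> real \<Rightarrow> nat \<Rightarrow> real set" where
  "gset N z1 z2 i = (if Suc i < N then {-z1..z1} else if Suc i = N then {-min z1 z2..min z1 z2} else {-z2..z2})"

lemma gtime_Suc:
  assumes "0 < N"
  shows "gtime u N (Suc i) - gtime u N i = (if Suc i < N then u / real N else (1 - u) / real N)"
proof -
  consider "Suc i < N" | "Suc i = N" | "N \<le> i" by linarith
  then show ?thesis
  proof cases
    case 1
    have "real (Suc (Suc i)) * (u / real N) = real (Suc i) * (u / real N) + u / real N"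
      by (simp only: of_nat_Suc[of "Suc i"] distrib_right mult_1_left add.commute)
    then show ?thesis using 1 by (simp only: gtime_def) simp
  next
    case 2
    then show ?thesis by (auto simp: gtime_def)
  next
    case 3
    define c where "c = Suc i - N"
    have "Suc (Suc i) - N = Suc c" using 3 by (simp add: c_def Suc_diff_le)
    then have "gtime u N (Suc i) = u + real (Suc c) * ((1 - u) / real N)" "gtime u N i = u + real c * ((1 - u) / real N)"
      using 3 by (auto simp: gtime_def c_def)
    then have "gtime u N (Suc i) - gtime u N i = (1 - u) / real N"
      by (simp only: of_nat_Suc distrib_right)
    then show ?thesis using 3 by simp
  qed
qed

lemma gtime_strict_mono:
  assumes "0 < N" "0 < u" "u < 1" shows "strict_mono (gtime u N)"
  unfolding strict_mono_Suc_iff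
proof
  fix i
  have "0 < gtime u N (Suc i) - gtime u N i" unfolding gtime_Suc[OF assms(1)] using assms by auto
  then show "gtime u N i < gtime u N (Suc i)" by simp
qed

lemma gtime_last:
  assumes "0 < N" shows "gtime u N (2 * N - 2) = 1 - (1 - u) / real N"
proof (cases "N = 1")
  case False
  then have N: "2 \<le> N" using assms by simp
  then have "real (Suc (2 * N - 2) - N) = real N - 1" by (simp add: of_nat_diff)
  moreover have "\<not> 2 * N - 2 < N" using N by simp
  ultimately show ?thesis using assms by (simp add: gtime_def field_simps)
qed (simp add: gtime_def)

lemma gset_measurable [measurable]: "gset N z1 z2 i \<in> sets borel"
  by (simp add: gset_def)

lemma hg_eq_hc:
  assumes N: "0 < N" and k: "k < N"
  shows "hg (gtime u N) (gset N z1 z2) k = hc (u / real N) z1 k"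
  using k
proof (induction k)
  case 0
  then show ?case by (simp add: gtime_def)
next
  case (Suc k)
  then show ?case using gtime_Suc[OF N, of u k] by (simp add: gset_def)
qed

text \<open>The pairing does not depend on j. Each step of the second half is moved from the forward
  density to a walk that runs backwards from the pinned end, until at j = 0 both factors meet at
  time u.\<close>

lemma hg_duality:
  assumes N: "0 < N" and j: "j < N"
  shows "(\<integral>\<^sup>+ x. indicator (gset N z1 z2 (N - 1 + j)) x * hg (gtime u N) (gset N z1 z2) (N - 1 + j) x * hc ((1 - u) / real N) z2 (N - 1 - j) x \<partial>lborel)
    = (\<integral>\<^sup>+ x. indicator {-min z1 z2..min z1 z2} x * hc (u / real N) z1 (N - 1) x * hc ((1 - u) / real N) z2 (N - 1) x \<partial>lborel)"
  using j
proof (induction j)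
  case 0
  have "gset N z1 z2 (N - 1) = {-min z1 z2..min z1 z2}" using N by (simp add: gset_def)
  then show ?case using N by (simp add: hg_eq_hc)
next
  case (Suc j)
  let ?k = "N - 1 + j" and ?d = "(1 - u) / real N"
  have k: "N - 1 + Suc j = Suc ?k" by simp
  have A: "gset N z1 z2 (Suc ?k) = {-z2..z2}" using N by (auto simp: gset_def)
  have d: "gtime u N (Suc ?k) - gtime u N ?k = ?d" using gtime_Suc[OF N, of u ?k] by simp
  have h: "hc ?d z2 (N - 1 - j) = (\<lambda>x. \<integral>\<^sup>+ y. indicator {-z2..z2} y * hc ?d z2 (N - 1 - Suc j) y * ennreal (gk ?d (x - y)) \<partial>lborel)"
  proof -
    have "N - 1 - j = Suc (N - 1 - Suc j)" using Suc.prems by simp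
    then show ?thesis by (simp only: hc.simps)
  qed
  have "(\<integral>\<^sup>+ x. indicator (gset N z1 z2 (Suc ?k)) x * hg (gtime u N) (gset N z1 z2) (Suc ?k) x * hc ?d z2 (N - 1 - Suc j) x \<partial>lborel)
    = (\<integral>\<^sup>+ x. indicator (gset N z1 z2 ?k) x * hg (gtime u N) (gset N z1 z2) ?k x * hc ?d z2 (N - 1 - j) x \<partial>lborel)"
    unfolding A h hg.simps d by (rule nn_integral_gk_symmetric) measurable
  then show ?case unfolding k using Suc by simp
qed

context brownian_bridge begin

text \<open>The remaining weight in \<open>bridge_chain\<close> is a Gaussian over the last gap (1 -
  u) / N, hence the start \<open>hc ?d z2 0\<close> of the backward walk; duality then takes both
  walks to time u, each after N steps.\<close>

lemma grid_probability:
  assumes N: "0 < N" and u: "0 < u" "u < 1"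
  shows "emeasure P {\<omega> \<in> space P. \<forall>i\<le>2 * N - 2. b (gtime u N i) \<omega> \<in> gset N z1 z2 i} =
     ennreal (sqrt (2 * pi)) * (\<integral>\<^sup>+ x. indicator {-min z1 z2..min z1 z2} x * hc (u / real N) z1 (N - 1) x * hc ((1 - u) / real N) z2 (N - 1) x \<partial>lborel)"
proof -
  let ?k = "2 * N - 2" and ?d = "(1 - u) / real N"
  have d: "0 < ?d" using N u by simp
  have "{\<omega> \<in> space P. \<forall>i\<le>?k. b (gtime u N i) \<omega> \<in> gset N z1 z2 i} =
    {\<omega> \<in> space P. (\<forall>i<?k. b (gtime u N i) \<omega> \<in> gset N z1 z2 i) \<and> b (gtime u N ?k) \<omega> \<in> gset N z1 z2 ?k}"
    by (auto simp: le_less)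
  then have "emeasure P {\<omega> \<in> space P. \<forall>i\<le>?k. b (gtime u N i) \<omega> \<in> gset N z1 z2 i} =
     (\<integral>\<^sup>+ x. indicator (gset N z1 z2 ?k) x * (hg (gtime u N) (gset N z1 z2) ?k x * ennreal (sqrt (2 * pi) * gk (1 - gtime u N ?k) x)) \<partial>lborel)"
    using N u by (simp only:) (rule bridge_chain, auto intro!: gtime_strict_mono simp: gtime_last, simp add: gtime_def)
  also have "\<dots> = (\<integral>\<^sup>+ x. ennreal (sqrt (2 * pi)) * (indicator (gset N z1 z2 ?k) x * hg (gtime u N) (gset N z1 z2) ?k x * hc ?d z2 0 x) \<partial>lborel)"
  proof (intro nn_integral_cong)
    fix x
    have "ennreal (sqrt (2 * pi) * gk (1 - gtime u N ?k) x) = ennreal (sqrt (2 * pi)) * hc ?d z2 0 x"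
      unfolding gtime_last[OF N] using d by (simp add: ennreal_mult)
    then show "indicator (gset N z1 z2 ?k) x * (hg (gtime u N) (gset N z1 z2) ?k x * ennreal (sqrt (2 * pi) * gk (1 - gtime u N ?k) x)) =
       ennreal (sqrt (2 * pi)) * (indicator (gset N z1 z2 ?k) x * hg (gtime u N) (gset N z1 z2) ?k x * hc ?d z2 0 x)"
      by (simp only: mult_ac)
  qed
  also have "\<dots> = ennreal (sqrt (2 * pi)) * (\<integral>\<^sup>+ x. indicator (gset N z1 z2 ?k) x * hg (gtime u N) (gset N z1 z2) ?k x * hc ?d z2 0 x \<partial>lborel)"
    by (rule nn_integral_cmult) measurable
  also have "(\<integral>\<^sup>+ x. indicator (gset N z1 z2 ?k) x * hg (gtime u N) (gset N z1 z2) ?k x * hc ?d z2 0 x \<partial>lborel) =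
    (\<integral>\<^sup>+ x. indicator {-min z1 z2..min z1 z2} x * hc (u / real N) z1 (N - 1) x * hc ((1 - u) / real N) z2 (N - 1) x \<partial>lborel)"
  proof -
    have "N - 1 + (N - 1) = ?k" "N - 1 < N" using N by auto
    then show ?thesis using hg_duality[OF N, of "N - 1" z1 z2 u] by simp
  qed
  finally show ?thesis .
qed

definition Ev :: "real \<Rightarrow> real \<Rightarrow> real \<Rightarrow> 'a set" where
  "Ev u z1 z2 = {\<omega> \<in> space P. (\<forall>s\<in>{0..u}. \<bar>b s \<omega>\<bar> \<le> z1) \<and> (\<forall>s\<in>{u..1}. \<bar>b s \<omega>\<bar> \<le> z2)}"

text \<open>The grid event in terms of the fractions i / N, which makes the nesting along N = 2^j
  visible. The times 0 and 1 are absent, while u occurs in both families.\<close>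

definition Gr :: "real \<Rightarrow> real \<Rightarrow> real \<Rightarrow> nat \<Rightarrow> 'a set" where
  "Gr u z1 z2 N = {\<omega> \<in> space P. (\<forall>i\<in>{1..N}. \<bar>b (u * (real i / real N)) \<omega>\<bar> \<le> z1) \<and> (\<forall>i\<in>{..<N}. \<bar>b (u + (1 - u) * (real i / real N)) \<omega>\<bar> \<le> z2)}"

lemma Gr_eq:
  assumes N: "0 < N"
  shows "Gr u z1 z2 N = {\<omega> \<in> space P. \<forall>i\<le>2 * N - 2. b (gtime u N i) \<omega> \<in> gset N z1 z2 i}"
proof -
  have g1: "gtime u N i = u * (real (Suc i) / real N)" if "i < N" for i
    using that by (simp add: gtime_def)
  have g2: "gtime u N (N - 1 + i) = u + (1 - u) * (real i / real N)" for i
  proof (cases i)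
    case 0
    then show ?thesis using N by (simp add: gtime_def)
  next
    case (Suc k)
    then have "\<not> N - 1 + i < N" "Suc (N - 1 + i) - N = i" using N by auto
    then show ?thesis by (simp add: gtime_def)
  qed
  have "(\<forall>i\<le>2 * N - 2. b (gtime u N i) \<omega> \<in> gset N z1 z2 i) \<longleftrightarrow>
     (\<forall>i<N. \<bar>b (gtime u N i) \<omega>\<bar> \<le> z1) \<and> (\<forall>i<N. \<bar>b (gtime u N (N - 1 + i)) \<omega>\<bar> \<le> z2)" (is "?L \<longleftrightarrow> ?R1 \<and> ?R2") for \<omega>
  proof
    assume L: ?L
    have "\<bar>b (gtime u N i) \<omega>\<bar> \<le> z1" if "i < N" for i
    proof -
      have "b (gtime u N i) \<omega> \<in> gset N z1 z2 i" using L that by auto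
      then show ?thesis using that by (auto simp: gset_def split: if_splits)
    qed
    moreover have "\<bar>b (gtime u N (N - 1 + i)) \<omega>\<bar> \<le> z2" if "i < N" for i
    proof -
      have "b (gtime u N (N - 1 + i)) \<omega> \<in> gset N z1 z2 (N - 1 + i)" using L that by auto
      moreover have "\<not> Suc (N - 1 + i) < N" using N by auto
      ultimately show ?thesis by (auto simp: gset_def split: if_splits)
    qed
    ultimately show "?R1 \<and> ?R2" by blast
  next
    assume R: "?R1 \<and> ?R2"
    show ?L
    proof (intro allI impI)
      fix i assume i: "i \<le> 2 * N - 2"
      have a: "\<bar>b (gtime u N i) \<omega>\<bar> \<le> z1" if "i < N" using R that by blast
      have c: "\<bar>b (gtime u N i) \<omega>\<bar> \<le> z2" if "N - 1 \<le> i"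
      proof -
        have "i - (N - 1) < N" "N - 1 + (i - (N - 1)) = i" using that i N by auto
        then show ?thesis using R by metis
      qed
      show "b (gtime u N i) \<omega> \<in> gset N z1 z2 i"
      proof -
        consider "Suc i < N" | "Suc i = N" | "\<not> Suc i < N" "Suc i \<noteq> N" by blast
        then show ?thesis
        proof cases
          case 1
          then show ?thesis using a unfolding gset_def by (auto simp: abs_le_iff)
        next
          case 2
          then have "i < N" "N - 1 \<le> i" by auto
          from a[OF this(1)] c[OF this(2)] 2 show ?thesis unfolding gset_def by (auto simp: abs_le_iff)
        next
          case 3
          then have "N - 1 \<le> i" by auto
          from c[OF this] 3 show ?thesis unfolding gset_def by (auto simp: abs_le_iff)
        qed
      qed
    qed
  qed
  moreover have "(\<forall>i<N. \<bar>b (gtime u N i) \<omega>\<bar> \<le> z1) \<longleftrightarrow> (\<forall>i\<in>{1..N}. \<bar>b (u * (real i / real N)) \<omega>\<bar> \<le> z1)" for \<omega>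
  proof -
    have "{1..N} = Suc ` {..<N}" by (simp add: image_Suc_lessThan)
    then show ?thesis using g1 by auto
  qed
  moreover have "(\<forall>i<N. \<bar>b (gtime u N (N - 1 + i)) \<omega>\<bar> \<le> z2) \<longleftrightarrow> (\<forall>i\<in>{..<N}. \<bar>b (u + (1 - u) * (real i / real N)) \<omega>\<bar> \<le> z2)" for \<omega>
    unfolding g2 by auto
  ultimately show ?thesis unfolding Gr_def by presburger
qed

lemma Gr_sets [measurable]:
  assumes u: "0 < u" "u < 1" shows "Gr u z1 z2 N \<in> sets P"
proof -
  have 1: "u * (real i / real N) \<in> {0..1}" if "i \<in> {1..N}" for i
  proof -
    have "u * (real i / real N) \<le> 1 * 1" using that u by (intro mult_mono) auto
    then show ?thesis using u by simp
  qed
  have 2: "u + (1 - u) * (real i / real N) \<in> {0..1}" if "i \<in> {..<N}" for i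
  proof -
    have "(1 - u) * (real i / real N) \<le> (1 - u) * 1" using that u by (intro mult_left_mono) auto
    then show ?thesis using u by simp
  qed
  have "{\<omega> \<in> space P. \<forall>i\<in>{1..N}. \<bar>b (u * (real i / real N)) \<omega>\<bar> \<le> z1} \<in> sets P"
  proof (intro sets.sets_Collect_finite_All)
    fix i assume "i \<in> {1..N}"
    then have [measurable]: "b (u * (real i / real N)) \<in> borel_measurable P" by (intro b_measurable 1)
    show "{\<omega> \<in> space P. \<bar>b (u * (real i / real N)) \<omega>\<bar> \<le> z1} \<in> sets P" by measurable
  qed simp
  moreover have "{\<omega> \<in> space P. \<forall>i\<in>{..<N}. \<bar>b (u + (1 - u) * (real i / real N)) \<omega>\<bar> \<le> z2} \<in> sets P"
  proof (intro sets.sets_Collect_finite_All)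
    fix i assume "i \<in> {..<N}"
    then have [measurable]: "b (u + (1 - u) * (real i / real N)) \<in> borel_measurable P" by (intro b_measurable 2)
    show "{\<omega> \<in> space P. \<bar>b (u + (1 - u) * (real i / real N)) \<omega>\<bar> \<le> z2} \<in> sets P" by measurable
  qed simp
  moreover have "Gr u z1 z2 N = {\<omega> \<in> space P. \<forall>i\<in>{1..N}. \<bar>b (u * (real i / real N)) \<omega>\<bar> \<le> z1} \<inter>
      {\<omega> \<in> space P. \<forall>i\<in>{..<N}. \<bar>b (u + (1 - u) * (real i / real N)) \<omega>\<bar> \<le> z2}"
    by (auto simp: Gr_def)
  ultimately show ?thesis by (simp only: sets.Int)
qed

end

section \<open>From dyadic grids to all times\<close>

lemma continuous_le_on_dyadic:
  fixes f :: "real \<Rightarrow> real"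
  assumes c: "continuous_on {0..1} f" and s: "s \<in> {0..1}"
    and t: "\<And>j. r j \<in> {0..1}" "r \<longlonglongrightarrow> s" and le: "\<And>j. f (r j) \<le> z"
  shows "f s \<le> z"
proof -
  have "(\<lambda>j. f (r j)) \<longlonglongrightarrow> f s"
    by (rule continuous_on_tendsto_compose[OF c t(2) s]) (use t in auto)
  then show ?thesis by (rule LIMSEQ_le_const2) (use le in auto)
qed

text \<open>The truncations keep the approximating indices inside the two grids: the first half
  starts at index 1, the second stops before 2^j. Both change the quotient by at most
  2^(-j).\<close>

lemma dyadic_floor_tendsto:
  fixes x :: real
  assumes x: "0 \<le> x" "x \<le> 1"
  shows "(\<lambda>j. real (min (nat \<lfloor>x * 2 ^ j\<rfloor>) (2 ^ j - 1)) / 2 ^ j) \<longlonglongrightarrow> x"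
    and "(\<lambda>j. real (max 1 (nat \<lfloor>x * 2 ^ j\<rfloor>)) / 2 ^ j) \<longlonglongrightarrow> x"
    and "max 1 (nat \<lfloor>x * 2 ^ j\<rfloor>) \<in> {1..2 ^ j}" "min (nat \<lfloor>x * 2 ^ j\<rfloor>) (2 ^ j - 1) \<in> {..<2 ^ j}"
proof -
  have z: "(\<lambda>j. 1 / 2 ^ j :: real) \<longlonglongrightarrow> 0" using LIMSEQ_divide_realpow_zero[of 2 1] by simp
  have lo: "(\<lambda>j. x - 1 / 2 ^ j) \<longlonglongrightarrow> x" using tendsto_diff[OF tendsto_const z, of x] by simp
  have hi: "(\<lambda>j. x + 1 / 2 ^ j) \<longlonglongrightarrow> x" using tendsto_add[OF tendsto_const z, of x] by simp
  have fl: "real (nat \<lfloor>x * 2 ^ j\<rfloor>) = of_int \<lfloor>x * 2 ^ j\<rfloor>" for j using x by simp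
  have fb: "x * 2 ^ j - 1 \<le> real (nat \<lfloor>x * 2 ^ j\<rfloor>)" "real (nat \<lfloor>x * 2 ^ j\<rfloor>) \<le> x * 2 ^ j" for j
    unfolding fl by linarith+
  have x2: "x * 2 ^ j \<le> 2 ^ j" for j using x by simp
  have m1: "x * 2 ^ j - 1 \<le> real (min (nat \<lfloor>x * 2 ^ j\<rfloor>) (2 ^ j - 1))" for j
    using fb(1)[of j] x2[of j] by (auto simp: min_def of_nat_diff)
  have m2: "real (min (nat \<lfloor>x * 2 ^ j\<rfloor>) (2 ^ j - 1)) \<le> x * 2 ^ j + 1" for j
  proof -
    have "real (min (nat \<lfloor>x * 2 ^ j\<rfloor>) (2 ^ j - 1)) \<le> real (nat \<lfloor>x * 2 ^ j\<rfloor>)"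
      by (simp only: of_nat_le_iff min.cobounded1)
    then show ?thesis using fb(2)[of j] by linarith
  qed
  have m3: "x * 2 ^ j - 1 \<le> real (max 1 (nat \<lfloor>x * 2 ^ j\<rfloor>))" for j
    using fb(1)[of j] by (auto simp: max_def)
  have m4: "real (max 1 (nat \<lfloor>x * 2 ^ j\<rfloor>)) \<le> x * 2 ^ j + 1" for j
  proof (cases "1 \<le> nat \<lfloor>x * 2 ^ j\<rfloor>")
    case True
    then have "max 1 (nat \<lfloor>x * 2 ^ j\<rfloor>) = nat \<lfloor>x * 2 ^ j\<rfloor>" by simp
    then have "real (max 1 (nat \<lfloor>x * 2 ^ j\<rfloor>)) = real (nat \<lfloor>x * 2 ^ j\<rfloor>)" by (simp only:)
    then show ?thesis using fb(2)[of j] by linarith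
  next
    case False
    then have "max 1 (nat \<lfloor>x * 2 ^ j\<rfloor>) = 1" by simp
    then have "real (max 1 (nat \<lfloor>x * 2 ^ j\<rfloor>)) = 1" by simp
    moreover have "0 \<le> x * 2 ^ j" using x by simp
    ultimately show ?thesis by linarith
  qed
  show "(\<lambda>j. real (min (nat \<lfloor>x * 2 ^ j\<rfloor>) (2 ^ j - 1)) / 2 ^ j) \<longlonglongrightarrow> x"
  proof (rule real_tendsto_sandwich[OF _ _ lo hi]; rule always_eventually; rule allI)
    fix j
    show "x - 1 / 2 ^ j \<le> real (min (nat \<lfloor>x * 2 ^ j\<rfloor>) (2 ^ j - 1)) / 2 ^ j"
      using divide_right_mono[OF m1[of j], of "2 ^ j"] by (simp add: diff_divide_distrib)
    show "real (min (nat \<lfloor>x * 2 ^ j\<rfloor>) (2 ^ j - 1)) / 2 ^ j \<le> x + 1 / 2 ^ j"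
      using divide_right_mono[OF m2[of j], of "2 ^ j"] by (simp add: add_divide_distrib)
  qed
  show "(\<lambda>j. real (max 1 (nat \<lfloor>x * 2 ^ j\<rfloor>)) / 2 ^ j) \<longlonglongrightarrow> x"
  proof (rule real_tendsto_sandwich[OF _ _ lo hi]; rule always_eventually; rule allI)
    fix j
    show "x - 1 / 2 ^ j \<le> real (max 1 (nat \<lfloor>x * 2 ^ j\<rfloor>)) / 2 ^ j"
      using divide_right_mono[OF m3[of j], of "2 ^ j"] by (simp add: diff_divide_distrib)
    show "real (max 1 (nat \<lfloor>x * 2 ^ j\<rfloor>)) / 2 ^ j \<le> x + 1 / 2 ^ j"
      using divide_right_mono[OF m4[of j], of "2 ^ j"] by (simp add: add_divide_distrib)
  qed
  have "real (nat \<lfloor>x * 2 ^ j\<rfloor>) \<le> real (2 ^ j)"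
    unfolding of_nat_power of_nat_numeral by (rule order_trans[OF fb(2) x2])
  then have "nat \<lfloor>x * 2 ^ j\<rfloor> \<le> 2 ^ j" by (simp only: of_nat_le_iff)
  then show "max 1 (nat \<lfloor>x * 2 ^ j\<rfloor>) \<in> {1..2 ^ j}" by auto
  have "0 < (2::nat) ^ j" by simp
  then have "(2::nat) ^ j - 1 < 2 ^ j" by simp
  then show "min (nat \<lfloor>x * 2 ^ j\<rfloor>) (2 ^ j - 1) \<in> {..<2 ^ j}"
    unfolding lessThan_iff by (rule le_less_trans[OF min.cobounded2])
qed

context brownian_bridge begin

lemma Ev_eq:
  assumes u: "0 < u" "u < 1"
  shows "Ev u z1 z2 = (\<Inter>j. Gr u z1 z2 (2 ^ j))"
proof (intro equalityI subsetI)
  fix \<omega> assume "\<omega> \<in> Ev u z1 z2"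
  then have \<omega>: "\<omega> \<in> space P" "\<And>s. 0 \<le> s \<Longrightarrow> s \<le> u \<Longrightarrow> \<bar>b s \<omega>\<bar> \<le> z1" "\<And>s. u \<le> s \<Longrightarrow> s \<le> 1 \<Longrightarrow> \<bar>b s \<omega>\<bar> \<le> z2"
    by (auto simp: Ev_def)
  have "\<omega> \<in> Gr u z1 z2 N" for N
    unfolding Gr_def
  proof (intro CollectI conjI ballI \<omega>)
    fix i assume "i \<in> {1..N}"
    then have i: "real i / real N \<le> 1" by auto
    show "0 \<le> u * (real i / real N)" using u by simp
    show "u * (real i / real N) \<le> u" using mult_left_mono[OF i, of u] u by simp
  next
    fix i assume "i \<in> {..<N}"
    then have i: "real i / real N \<le> 1" by auto
    show "u \<le> u + (1 - u) * (real i / real N)" using u by simp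
    show "u + (1 - u) * (real i / real N) \<le> 1" using mult_left_mono[OF i, of "1 - u"] u by simp
  qed
  then show "\<omega> \<in> (\<Inter>j. Gr u z1 z2 (2 ^ j))" by blast
next
  fix \<omega> assume "\<omega> \<in> (\<Inter>j. Gr u z1 z2 (2 ^ j))"
  then have G: "\<omega> \<in> Gr u z1 z2 (2 ^ j)" for j by blast
  then have sp: "\<omega> \<in> space P" by (auto simp: Gr_def)
  have c: "continuous_on {0..1} (\<lambda>t. \<bar>b t \<omega>\<bar>)" using b_continuous[OF sp] by (rule continuous_on_rabs)
  have G1: "\<bar>b (u * (real i / 2 ^ j)) \<omega>\<bar> \<le> z1" if "i \<in> {1..2 ^ j}" for i j
    using G[of j] that by (simp add: Gr_def)
  have G2: "\<bar>b (u + (1 - u) * (real i / 2 ^ j)) \<omega>\<bar> \<le> z2" if "i \<in> {..<2 ^ j}" for i j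
    using G[of j] that by (simp add: Gr_def)
  have "\<bar>b s \<omega>\<bar> \<le> z1" if s: "s \<in> {0..u}" for s
  proof -
    define x where "x = s / u"
    have x: "0 \<le> x" "x \<le> 1" "s = u * x" using s u by (auto simp: x_def)
    define i where "i = (\<lambda>j. max 1 (nat \<lfloor>x * 2 ^ j\<rfloor>))"
    have i: "i j \<in> {1..2 ^ j}" for j unfolding i_def by (rule dyadic_floor_tendsto(3)[OF x(1,2)])
    show ?thesis
    proof (rule continuous_le_on_dyadic[OF c, where r="\<lambda>j. u * (real (i j) / 2 ^ j)"])
      show "s \<in> {0..1}" using s u by auto
      show "(\<lambda>j. u * (real (i j) / 2 ^ j)) \<longlonglongrightarrow> s"
        unfolding x(3) i_def by (rule tendsto_mult_left[OF dyadic_floor_tendsto(2)[OF x(1,2)]])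
      show "\<bar>b (u * (real (i j) / 2 ^ j)) \<omega>\<bar> \<le> z1" for j by (rule G1[OF i])
      fix j
      have "real (i j) \<le> real (2 ^ j)" using i[of j] by (simp only: of_nat_le_iff) auto
      then have "real (i j) / 2 ^ j \<le> 1" by simp
      then have "u * (real (i j) / 2 ^ j) \<le> 1 * 1" using u by (intro mult_mono) auto
      then show "u * (real (i j) / 2 ^ j) \<in> {0..1}" using u by simp
    qed
  qed
  moreover have "\<bar>b s \<omega>\<bar> \<le> z2" if s: "s \<in> {u..1}" for s
  proof -
    define x where "x = (s - u) / (1 - u)"
    have x: "0 \<le> x" "x \<le> 1" "s = u + (1 - u) * x" using s u by (auto simp: x_def)
    define i where "i = (\<lambda>j. min (nat \<lfloor>x * 2 ^ j\<rfloor>) (2 ^ j - 1))"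
    have i: "i j \<in> {..<2 ^ j}" for j unfolding i_def by (rule dyadic_floor_tendsto(4)[OF x(1,2)])
    show ?thesis
    proof (rule continuous_le_on_dyadic[OF c, where r="\<lambda>j. u + (1 - u) * (real (i j) / 2 ^ j)"])
      show "s \<in> {0..1}" using s u by auto
      show "(\<lambda>j. u + (1 - u) * (real (i j) / 2 ^ j)) \<longlonglongrightarrow> s"
        unfolding x(3) i_def by (intro tendsto_add tendsto_const tendsto_mult_left dyadic_floor_tendsto(1)[OF x(1,2)])
      show "\<bar>b (u + (1 - u) * (real (i j) / 2 ^ j)) \<omega>\<bar> \<le> z2" for j by (rule G2[OF i])
      fix j
      have "real (i j) \<le> real (2 ^ j)" using i[of j] by (simp only: of_nat_le_iff) auto
      then have "real (i j) / 2 ^ j \<le> 1" by simp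
      then have "(1 - u) * (real (i j) / 2 ^ j) \<le> (1 - u) * 1" using u by (intro mult_left_mono) auto
      then show "u + (1 - u) * (real (i j) / 2 ^ j) \<in> {0..1}" using u by simp
    qed
  qed
  ultimately show "\<omega> \<in> Ev u z1 z2" using sp by (auto simp: Ev_def)
qed

lemma Gr_decseq:
  "decseq (\<lambda>j. Gr u z1 z2 (2 ^ j))"
  unfolding decseq_Suc_iff
proof (intro allI subsetI)
  fix j \<omega> assume G: "\<omega> \<in> Gr u z1 z2 (2 ^ Suc j)"
  have e: "real i / real (2 ^ j) = real (2 * i) / real (2 ^ Suc j)" for i by simp
  show "\<omega> \<in> Gr u z1 z2 (2 ^ j)"
    unfolding Gr_def
  proof (intro CollectI conjI ballI)
    show "\<omega> \<in> space P" using G by (simp add: Gr_def)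
    fix i assume "i \<in> {1..2 ^ j::nat}"
    then have "2 * i \<in> {1..2 ^ Suc j}" by auto
    then show "\<bar>b (u * (real i / real (2 ^ j))) \<omega>\<bar> \<le> z1" using G unfolding e Gr_def by blast
  next
    fix i assume "i \<in> {..<2 ^ j::nat}"
    then have "2 * i \<in> {..<2 ^ Suc j}" by auto
    then show "\<bar>b (u + (1 - u) * (real i / real (2 ^ j))) \<omega>\<bar> \<le> z2" using G unfolding e Gr_def by blast
  qed
qed

lemma Ev_sets [measurable]:
  assumes "0 < u" "u < 1" shows "Ev u z1 z2 \<in> sets P"
  unfolding Ev_eq[OF assms] using Gr_sets[OF assms] by auto

end

section \<open>Confinement probabilities in continuous time\<close>

lemma nn_integral_Icc_continuous:
  fixes f :: "real \<Rightarrow> real"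
  assumes c: "continuous_on {a..b} f" and f: "\<And>x. x \<in> {a..b} \<Longrightarrow> 0 \<le> f x"
  shows "(\<integral>\<^sup>+ x. indicator {a..b} x * ennreal (f x) \<partial>lborel) = ennreal (integral {a..b} f)"
proof -
  have si: "set_integrable lborel {a..b} f" by (rule borel_integrable_atLeastAtMost'[OF c])
  then have "integrable lborel (\<lambda>x. indicator {a..b} x * f x)" by (simp add: set_integrable_def)
  then have "(\<integral>\<^sup>+ x. indicator {a..b} x * ennreal (f x) \<partial>lborel) = ennreal (LINT x|lborel. indicator {a..b} x * f x)"
    by (rule nn_integral_indicator_ennreal) (rule f)
  also have "(LINT x|lborel. indicator {a..b} x * f x) = integral {a..b} f"
    using set_borel_integral_eq_integral(2)[OF si] by (simp add: set_lebesgue_integral_def)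
  finally show ?thesis .
qed

context brownian_bridge begin

lemma Gr_ge:
  assumes u: "0 < u" "u < 1" and z: "0 < z1" "0 < z2" and N: "0 < N"
  shows "sqrt (2 * pi) * integral {-min z1 z2..min z1 z2} (\<lambda>x. q u z1 x * q (1 - u) z2 x) \<le> prob (Gr u z1 z2 N)"
proof -
  let ?m = "min z1 z2"
  have dd: "0 < u / real N" "0 < (1 - u) / real N" using u N by auto
  have n: "real (Suc (N - 1)) * (u / real N) = u" "real (Suc (N - 1)) * ((1 - u) / real N) = 1 - u" using N by auto
  have nn: "0 \<le> q u z1 x * q (1 - u) z2 x" if "x \<in> {-?m..?m}" for x
    using that u z by (intro mult_nonneg_nonneg q_nonneg) (auto simp: abs_le_iff)
  have "ennreal (integral {-?m..?m} (\<lambda>x. q u z1 x * q (1 - u) z2 x)) =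
     (\<integral>\<^sup>+ x. indicator {-?m..?m} x * ennreal (q u z1 x * q (1 - u) z2 x) \<partial>lborel)"
    using u z nn by (intro nn_integral_Icc_continuous[symmetric] continuous_intros) auto
  also have "\<dots> \<le> (\<integral>\<^sup>+ x. indicator {-?m..?m} x * hc (u / real N) z1 (N - 1) x * hc ((1 - u) / real N) z2 (N - 1) x \<partial>lborel)"
  proof (rule nn_integral_mono)
    fix x
    show "indicator {-?m..?m} x * ennreal (q u z1 x * q (1 - u) z2 x) \<le> indicator {-?m..?m} x * hc (u / real N) z1 (N - 1) x * hc ((1 - u) / real N) z2 (N - 1) x"
    proof (cases "x \<in> {-?m..?m}")
      case True
      then have x: "\<bar>x\<bar> \<le> z1" "\<bar>x\<bar> \<le> z2" by (auto simp: abs_le_iff)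
      have "ennreal (q u z1 x) * ennreal (q (1 - u) z2 x) \<le> hc (u / real N) z1 (N - 1) x * hc ((1 - u) / real N) z2 (N - 1) x"
        using hc_ge_q[OF dd(1) z(1) x(1), of "N - 1"] hc_ge_q[OF dd(2) z(2) x(2), of "N - 1"]
        unfolding n by (rule mult_mono) auto
      then show ?thesis using True u z x by (simp add: ennreal_mult q_nonneg)
    qed simp
  qed
  finally have "ennreal (sqrt (2 * pi)) * ennreal (integral {-?m..?m} (\<lambda>x. q u z1 x * q (1 - u) z2 x)) \<le> emeasure P (Gr u z1 z2 N)"
    unfolding Gr_eq[OF N] grid_probability[OF N u] by (rule mult_left_mono) simp
  then have "ennreal (sqrt (2 * pi) * integral {-?m..?m} (\<lambda>x. q u z1 x * q (1 - u) z2 x)) \<le> ennreal (prob (Gr u z1 z2 N))"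
    by (simp add: ennreal_mult' emeasure_eq_measure)
  then show ?thesis by (simp add: ennreal_le_iff)
qed

lemma Gr_le:
  assumes u: "0 < u" "u < 1" and z: "0 < z1" "0 < z2" and N: "0 < N" and e: "0 < e"
  shows "prob (Gr u z1 z2 N) \<le> sqrt (2 * pi) * integral {-min z1 z2..min z1 z2}
     (\<lambda>x. (q u (z1 + e) x + herr (u / real N) e (N - 1)) * (q (1 - u) (z2 + e) x + herr ((1 - u) / real N) e (N - 1)))"
proof -
  let ?m = "min z1 z2"
  have dd: "0 < u / real N" "0 < (1 - u) / real N" using u N by auto
  have n: "real (Suc (N - 1)) * (u / real N) = u" "real (Suc (N - 1)) * ((1 - u) / real N) = 1 - u" using N by auto
  define A where "A = (\<lambda>x. q u (z1 + e) x + herr (u / real N) e (N - 1))"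
  define B where "B = (\<lambda>x. q (1 - u) (z2 + e) x + herr ((1 - u) / real N) e (N - 1))"
  have h: "0 \<le> herr (u / real N) e (N - 1)" "0 \<le> herr ((1 - u) / real N) e (N - 1)"
    using dd e by (auto simp: herr_def)
  have nn: "0 \<le> A x" "0 \<le> B x" if "x \<in> {-?m..?m}" for x
    using that u z e h unfolding A_def B_def by (auto intro!: add_nonneg_nonneg q_nonneg simp: abs_le_iff)
  have cAB: "continuous_on S A" "continuous_on S B" for S
    unfolding A_def B_def using u z e by (auto intro!: continuous_intros)
  have "(\<integral>\<^sup>+ x. indicator {-?m..?m} x * hc (u / real N) z1 (N - 1) x * hc ((1 - u) / real N) z2 (N - 1) x \<partial>lborel) \<le>
     (\<integral>\<^sup>+ x. indicator {-?m..?m} x * ennreal (A x * B x) \<partial>lborel)"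
  proof (rule nn_integral_mono)
    fix x
    show "indicator {-?m..?m} x * hc (u / real N) z1 (N - 1) x * hc ((1 - u) / real N) z2 (N - 1) x \<le> indicator {-?m..?m} x * ennreal (A x * B x)"
    proof (cases "x \<in> {-?m..?m}")
      case True
      then have x: "\<bar>x\<bar> \<le> z1" "\<bar>x\<bar> \<le> z2" by (auto simp: abs_le_iff)
      have "hc (u / real N) z1 (N - 1) x * hc ((1 - u) / real N) z2 (N - 1) x \<le> ennreal (A x) * ennreal (B x)"
        using hc_le_q[OF dd(1) z(1) e x(1), of "N - 1"] hc_le_q[OF dd(2) z(2) e x(2), of "N - 1"]
        unfolding n A_def B_def by (rule mult_mono) auto
      then show ?thesis using True nn[OF True] by (simp add: ennreal_mult)
    qed simp
  qed
  also have "\<dots> = ennreal (integral {-?m..?m} (\<lambda>x. A x * B x))"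
    using nn by (intro nn_integral_Icc_continuous continuous_intros cAB) auto
  finally have "emeasure P (Gr u z1 z2 N) \<le> ennreal (sqrt (2 * pi)) * ennreal (integral {-?m..?m} (\<lambda>x. A x * B x))"
    unfolding Gr_eq[OF N] grid_probability[OF N u] by (rule mult_left_mono) simp
  then have "ennreal (prob (Gr u z1 z2 N)) \<le> ennreal (sqrt (2 * pi) * integral {-?m..?m} (\<lambda>x. A x * B x))"
    by (simp add: ennreal_mult' emeasure_eq_measure)
  moreover have "0 \<le> integral {-?m..?m} (\<lambda>x. A x * B x)"
    using nn by (intro Henstock_Kurzweil_Integration.integral_nonneg integrable_continuous_real continuous_intros cAB) auto
  ultimately show ?thesis unfolding A_def B_def by (simp add: ennreal_le_iff)
qed

text \<open>The lower bound is free of the grid and passes to the intersection. In the upper bound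
  the grid is refined while e stays fixed, because \<open>herr\<close> contains e^(-4) and vanishes
  only for fixed e; afterwards e tends to 0 by continuity of the kernel in the level.\<close>

theorem Ev_prob:
  assumes u: "0 < u" "u < 1" and z: "0 < z1" "0 < z2"
  shows "prob (Ev u z1 z2) = sqrt (2 * pi) * integral {-min z1 z2..min z1 z2} (\<lambda>x. q u z1 x * q (1 - u) z2 x)"
proof (rule antisym)
  let ?m = "min z1 z2"
  have lim: "(\<lambda>j. prob (Gr u z1 z2 (2 ^ j))) \<longlonglongrightarrow> prob (Ev u z1 z2)"
    unfolding Ev_eq[OF u] using Gr_sets[OF u] Gr_decseq by (intro finite_Lim_measure_decseq) auto
  show "sqrt (2 * pi) * integral {-?m..?m} (\<lambda>x. q u z1 x * q (1 - u) z2 x) \<le> prob (Ev u z1 z2)"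
    by (rule LIMSEQ_le_const[OF lim]) (use Gr_ge[OF u z] in auto)
  have up: "prob (Ev u z1 z2) \<le> sqrt (2 * pi) * integral {-?m..?m} (\<lambda>x. q u (z1 + e) x * q (1 - u) (z2 + e) x)"
    if e: "0 < e" for e
  proof -
    define A where "A = q u (z1 + e)"
    define B where "B = q (1 - u) (z2 + e)"
    define h where "h = (\<lambda>j. herr (u / 2 ^ j) e (2 ^ j - 1))"
    define k where "k = (\<lambda>j. herr ((1 - u) / 2 ^ j) e (2 ^ j - 1))"
    have h: "h \<longlonglongrightarrow> 0" unfolding h_def using e u by (intro herr_tendsto) auto
    have k: "k \<longlonglongrightarrow> 0" unfolding k_def using e u by (intro herr_tendsto) auto
    have cA: "continuous_on S A" and cB: "continuous_on S B" for S
      unfolding A_def B_def using u z e by (auto intro!: continuous_intros)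
    have iA: "A integrable_on {-?m..?m}" and iB: "B integrable_on {-?m..?m}" and iAB: "(\<lambda>x. A x * B x) integrable_on {-?m..?m}"
      by (intro integrable_continuous_real continuous_intros cA cB)+
    let ?I = "integral {-?m..?m}"
    have eq: "?I (\<lambda>x. (A x + h j) * (B x + k j)) = ?I (\<lambda>x. A x * B x) + k j * ?I A + h j * ?I B + h j * k j * ?I (\<lambda>_. 1)" for j
    proof -
      have "((\<lambda>x. A x * B x + k j * A x + h j * B x + h j * k j * 1) has_integral
         (?I (\<lambda>x. A x * B x) + k j * ?I A + h j * ?I B + h j * k j * ?I (\<lambda>_. 1))) {-?m..?m}"
        by (intro has_integral_add has_integral_mult_right integrable_integral iA iB iAB integrable_const_ivl)
      moreover have "(\<lambda>x. A x * B x + k j * A x + h j * B x + h j * k j * 1) = (\<lambda>x. (A x + h j) * (B x + k j))"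
        by (simp add: fun_eq_iff algebra_simps)
      ultimately show ?thesis by (simp add: integral_unique)
    qed
    have "(\<lambda>j. sqrt (2 * pi) * (?I (\<lambda>x. A x * B x) + k j * ?I A + h j * ?I B + h j * k j * ?I (\<lambda>_. 1))) \<longlonglongrightarrow>
       sqrt (2 * pi) * (?I (\<lambda>x. A x * B x) + 0 * ?I A + 0 * ?I B + 0 * 0 * ?I (\<lambda>_. 1))"
      by (intro tendsto_intros h k)
    then have L2: "(\<lambda>j. sqrt (2 * pi) * ?I (\<lambda>x. (A x + h j) * (B x + k j))) \<longlonglongrightarrow> sqrt (2 * pi) * ?I (\<lambda>x. A x * B x)"
      unfolding eq by simp
    have "prob (Gr u z1 z2 (2 ^ j)) \<le> sqrt (2 * pi) * ?I (\<lambda>x. (A x + h j) * (B x + k j))" for j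
      using Gr_le[OF u z _ e, of "2 ^ j"] unfolding A_def B_def h_def k_def by simp
    then have "prob (Ev u z1 z2) \<le> sqrt (2 * pi) * ?I (\<lambda>x. A x * B x)"
      using LIMSEQ_le[OF lim L2] by blast
    then show ?thesis unfolding A_def B_def .
  qed
  define \<phi> where "\<phi> = (\<lambda>e. integral (cbox (-?m) ?m) (\<lambda>x. q u (z1 + e) x * q (1 - u) (z2 + e) x))"
  have c: "continuous_on {0..1} \<phi>"
    unfolding \<phi>_def
  proof (rule integral_continuous_on_param)
    show "continuous_on ({0..1} \<times> cbox (-?m) ?m) (\<lambda>(e, x). q u (z1 + e) x * q (1 - u) (z2 + e) x)"
      unfolding split_beta using u z by (intro continuous_intros) auto
  qed
  have "(\<lambda>n. inverse (real (Suc n))) \<longlonglongrightarrow> 0" by (rule LIMSEQ_inverse_real_of_nat)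
  then have "(\<lambda>n. \<phi> (inverse (real (Suc n)))) \<longlonglongrightarrow> \<phi> 0"
    by (rule continuous_on_tendsto_compose[OF c]) (auto simp: field_simps)
  then have "(\<lambda>n. sqrt (2 * pi) * \<phi> (inverse (real (Suc n)))) \<longlonglongrightarrow> sqrt (2 * pi) * \<phi> 0"
    by (rule tendsto_mult_left)
  then have "prob (Ev u z1 z2) \<le> sqrt (2 * pi) * \<phi> 0"
    by (rule LIMSEQ_le_const) (use up in \<open>auto simp: \<phi>_def\<close>)
  then show "prob (Ev u z1 z2) \<le> sqrt (2 * pi) * integral {-?m..?m} (\<lambda>x. q u z1 x * q (1 - u) z2 x)"
    by (simp add: \<phi>_def)
qed

lemma Ev_prob_le:
  assumes "0 < u" "u < 1" "0 < z2" "z2 \<le> z1"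
  shows "prob (Ev u z1 z2) = sqrt (2 * pi) * Ht u z1 z2"
  using Ev_prob[of u z1 z2] Ht_eq[of u z1 z2] assms by simp

text \<open>\<open>Ht\<close> exceeds the range of the true integral by z1 \<le> |x| \<le> z2, where
  the odd extension of \<open>q u z1\<close> is nonpositive. The condition z2 \<le> 3 z1 keeps |x| -
  2 z1 within [-z1, z1], so that only the first negative block is met.\<close>

lemma Ev_prob_ge:
  assumes u: "0 < u" "u < 1" and z: "0 < z1" "z1 < z2" "z2 \<le> 3 * z1"
  shows "sqrt (2 * pi) * Ht u z1 z2 \<le> prob (Ev u z1 z2)"
proof -
  let ?f = "\<lambda>x. q u z1 x * q (1 - u) z2 x"
  have i: "?f integrable_on {a..b}" for a b using u z by (intro integrable_continuous_real continuous_intros) auto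
  have neg: "?f x \<le> 0" if "z1 \<le> \<bar>x\<bar>" "\<bar>x\<bar> \<le> z2" for x
  proof -
    have "q u z1 x = q u z1 \<bar>x\<bar>" by (auto simp: abs_if)
    also have "\<bar>x\<bar> = (\<bar>x\<bar> - 2 * z1) + 2 * z1" by simp
    also have "q u z1 ((\<bar>x\<bar> - 2 * z1) + 2 * z1) = - q u z1 (\<bar>x\<bar> - 2 * z1)"
      using u z by (intro q_shift) auto
    finally have "q u z1 x = - q u z1 (\<bar>x\<bar> - 2 * z1)" .
    moreover have "0 \<le> q u z1 (\<bar>x\<bar> - 2 * z1)" using u z that by (intro q_nonneg) (auto simp: abs_le_iff)
    moreover have "0 \<le> q (1 - u) z2 x" using u z that by (intro q_nonneg) auto
    ultimately show ?thesis by (simp add: mult_nonpos_nonneg)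
  qed
  have "Ht u z1 z2 = integral {-z2..z2} ?f" using u z by (intro Ht_eq) auto
  also have "\<dots> = integral {-z2..-z1} ?f + integral {-z1..z2} ?f"
    using z by (intro Henstock_Kurzweil_Integration.integral_combine[symmetric] i) auto
  also have "integral {-z1..z2} ?f = integral {-z1..z1} ?f + integral {z1..z2} ?f"
    using z by (intro Henstock_Kurzweil_Integration.integral_combine[symmetric] i) auto
  finally have "Ht u z1 z2 = integral {-z2..-z1} ?f + (integral {-z1..z1} ?f + integral {z1..z2} ?f)" .
  moreover have "integral {-z2..-z1} ?f \<le> integral {-z2..-z1} (\<lambda>_. 0)"
    using z by (intro integral_le i neg) auto
  moreover have "integral {z1..z2} ?f \<le> integral {z1..z2} (\<lambda>_. 0)"
    using z by (intro integral_le i neg) auto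
  ultimately have "Ht u z1 z2 \<le> integral {-z1..z1} ?f" by simp
  then show ?thesis using Ev_prob[of u z1 z2] u z by (simp add: min_absorb1)
qed

end

section \<open>Maximum and location of the maximum\<close>

lemma path_sup_props:
  fixes f :: "real \<Rightarrow> real"
  assumes c: "continuous_on {0..1} f"
  shows path_sup_upper: "\<And>s. s \<in> {0..1} \<Longrightarrow> f s \<le> path_sup f"
    and path_sup_time_in: "path_sup_time f \<in> {0..1}"
    and path_sup_time_attains: "f (path_sup_time f) = path_sup f"
    and path_sup_time_le: "\<And>s. s \<in> {0..1} \<Longrightarrow> f s = path_sup f \<Longrightarrow> path_sup_time f \<le> s"
    and path_sup_le_iff: "\<And>z. path_sup f \<le> z \<longleftrightarrow> (\<forall>s\<in>{0..1}. f s \<le> z)"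
proof -
  have bdd: "bdd_above (f ` {0..1})"
    by (intro bounded_imp_bdd_above compact_imp_bounded compact_continuous_image c compact_Icc)
  show up: "f s \<le> path_sup f" if "s \<in> {0..1}" for s
    unfolding path_sup_def using that bdd by (rule cSUP_upper)
  show iff: "path_sup f \<le> z \<longleftrightarrow> (\<forall>s\<in>{0..1}. f s \<le> z)" for z
  proof
    assume "path_sup f \<le> z"
    then show "\<forall>s\<in>{0..1}. f s \<le> z" using up by force
  next
    assume "\<forall>s\<in>{0..1}. f s \<le> z"
    then show "path_sup f \<le> z" unfolding path_sup_def by (intro cSUP_least) auto
  qed
  define S where "S = {u\<in>{0..1}. f u = path_sup f}"
  obtain s0 where s0: "s0 \<in> {0..1}" "\<And>s. s \<in> {0..1} \<Longrightarrow> f s \<le> f s0"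
    using continuous_attains_sup[OF compact_Icc _ c] by auto
  have "path_sup f = f s0" using up[OF s0(1)] iff[of "f s0"] s0(2) by fastforce
  then have ne: "S \<noteq> {}" using s0(1) by (auto simp: S_def)
  have "S = {0..1} \<inter> f -` {path_sup f}" by (auto simp: S_def)
  then have cl: "closed S" using continuous_closed_preimage[OF c closed_atLeastAtMost, of "{path_sup f}"] by simp
  have bb: "bdd_below S" by (rule bdd_belowI[of _ 0]) (auto simp: S_def)
  have eq: "path_sup_time f = Inf S" by (simp add: path_sup_time_def S_def)
  have "Inf S \<in> S" by (rule closed_contains_Inf[OF ne bb cl])
  then show "path_sup_time f \<in> {0..1}" "f (path_sup_time f) = path_sup f"
    unfolding eq by (auto simp: S_def)
  show "path_sup_time f \<le> s" if "s \<in> {0..1}" "f s = path_sup f" for s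
    unfolding eq using that by (intro cInf_lower bb) (auto simp: S_def)
qed

context brownian_bridge begin

definition Mx :: "'a \<Rightarrow> real" where "Mx \<omega> = path_sup (\<lambda>s. \<bar>b s \<omega>\<bar>)"
definition Rh :: "'a \<Rightarrow> real" where "Rh \<omega> = path_sup_time (\<lambda>s. \<bar>b s \<omega>\<bar>)"

lemma abs_b_continuous: "\<omega> \<in> space P \<Longrightarrow> continuous_on {0..1} (\<lambda>s. \<bar>b s \<omega>\<bar>)"
  using b_continuous by (intro continuous_on_rabs)

lemmas Mx_upper = path_sup_upper[OF abs_b_continuous, folded Mx_def]
  and Mx_le_iff = path_sup_le_iff[OF abs_b_continuous, folded Mx_def]
  and Rh_in = path_sup_time_in[OF abs_b_continuous, folded Rh_def]
  and Rh_attains = path_sup_time_attains[OF abs_b_continuous, folded Rh_def Mx_def]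
  and Rh_le = path_sup_time_le[OF abs_b_continuous, folded Rh_def Mx_def]

lemma Ev_iff_Mx:
  assumes "0 < u" "u < 1" shows "Ev u z z = {\<omega> \<in> space P. Mx \<omega> \<le> z}"
proof -
  have "\<omega> \<in> Ev u z z \<longleftrightarrow> \<omega> \<in> space P \<and> Mx \<omega> \<le> z" for \<omega>
  proof (cases "\<omega> \<in> space P")
    case True
    have "{0..1} = {0..u} \<union> {u..1}" using assms by auto
    then have "Mx \<omega> \<le> z \<longleftrightarrow> (\<forall>s\<in>{0..u}. \<bar>b s \<omega>\<bar> \<le> z) \<and> (\<forall>s\<in>{u..1}. \<bar>b s \<omega>\<bar> \<le> z)"
      unfolding Mx_le_iff[OF True] by (simp only: ball_Un)
    then show ?thesis using True by (simp add: Ev_def)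
  qed (simp add: Ev_def)
  then show ?thesis by blast
qed

lemma Mx_measurable [measurable]: "Mx \<in> borel_measurable P"
  unfolding borel_measurable_iff_le using Ev_sets[of "1/2"] by (simp add: Ev_iff_Mx[of "1/2", symmetric])

text \<open>The maximum is first attained after u exactly if the supremum over [0, u] is strictly
  below \<open>Mx\<close>. A rational level in between makes this a countable union of measurable
  events.\<close>

lemma Rh_le_iff:
  assumes \<omega>: "\<omega> \<in> space P" and u: "0 \<le> u" "u < 1"
  shows "Rh \<omega> \<le> u \<longleftrightarrow> \<not> (\<exists>r\<in>\<rat>. (\<forall>s\<in>{0..u}. \<bar>b s \<omega>\<bar> \<le> r) \<and> r < Mx \<omega>)"
proof
  assume R: "Rh \<omega> \<le> u"
  then have "Rh \<omega> \<in> {0..u}" using Rh_in[OF \<omega>] by auto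
  then show "\<not> (\<exists>r\<in>\<rat>. (\<forall>s\<in>{0..u}. \<bar>b s \<omega>\<bar> \<le> r) \<and> r < Mx \<omega>)"
    using Rh_attains[OF \<omega>] by force
next
  assume N: "\<not> (\<exists>r\<in>\<rat>. (\<forall>s\<in>{0..u}. \<bar>b s \<omega>\<bar> \<le> r) \<and> r < Mx \<omega>)"
  show "Rh \<omega> \<le> u"
  proof (rule ccontr)
    assume R: "\<not> Rh \<omega> \<le> u"
    have "continuous_on {0..u} (\<lambda>s. \<bar>b s \<omega>\<bar>)"
      using abs_b_continuous[OF \<omega>] by (rule continuous_on_subset) (use u in auto)
    moreover have "{0..u} \<noteq> {}" using u by simp
    ultimately obtain s0 where s0: "s0 \<in> {0..u}" "\<And>s. s \<in> {0..u} \<Longrightarrow> \<bar>b s \<omega>\<bar> \<le> \<bar>b s0 \<omega>\<bar>"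
      using continuous_attains_sup[OF compact_Icc] by blast
    have s01: "s0 \<in> {0..1}" using s0(1) u by auto
    have "\<bar>b s0 \<omega>\<bar> \<noteq> Mx \<omega>" using Rh_le[OF \<omega> s01] R s0(1) by auto
    then have "\<bar>b s0 \<omega>\<bar> < Mx \<omega>" using Mx_upper[OF \<omega> s01] by simp
    then obtain r where "r \<in> \<rat>" "\<bar>b s0 \<omega>\<bar> < r" "r < Mx \<omega>" using Rats_dense_in_real by blast
    then show False using N s0(2) by (meson less_imp_le order_trans)
  qed
qed

lemma Rh_set_interior:
  assumes u: "0 < u" "u < 1" shows "{\<omega> \<in> space P. Rh \<omega> \<le> u} \<in> sets P"
proof -
  \<comment> \<open>A condition on [0, u] alone is not of the form \<open>Ev\<close>, but every path
    is bounded, so letting the second level run through the integers produces it.\<close>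
  have E: "{\<omega> \<in> space P. \<forall>s\<in>{0..u}. \<bar>b s \<omega>\<bar> \<le> r} = (\<Union>n::nat. Ev u r (real n))" for r
  proof (intro equalityI subsetI)
    fix \<omega> assume "\<omega> \<in> {\<omega> \<in> space P. \<forall>s\<in>{0..u}. \<bar>b s \<omega>\<bar> \<le> r}"
    then have \<omega>: "\<omega> \<in> space P" "\<forall>s\<in>{0..u}. \<bar>b s \<omega>\<bar> \<le> r" by auto
    obtain n :: nat where n: "Mx \<omega> \<le> real n" using real_arch_simple by blast
    have "\<bar>b s \<omega>\<bar> \<le> real n" if "s \<in> {u..1}" for s
      using Mx_upper[OF \<omega>(1), of s] n that u by auto
    then have "\<omega> \<in> Ev u r (real n)" using \<omega> by (auto simp: Ev_def)
    then show "\<omega> \<in> (\<Union>n::nat. Ev u r (real n))" by blast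
  qed (auto simp: Ev_def)
  have m [measurable]: "{\<omega> \<in> space P. \<forall>s\<in>{0..u}. \<bar>b s \<omega>\<bar> \<le> r} \<in> sets P" for r
    unfolding E using Ev_sets[OF u] by auto
  have "{\<omega> \<in> space P. Rh \<omega> \<le> u} = space P - (\<Union>r\<in>\<rat>. {\<omega> \<in> space P. \<forall>s\<in>{0..u}. \<bar>b s \<omega>\<bar> \<le> r} \<inter> {\<omega> \<in> space P. r < Mx \<omega>})"
    using Rh_le_iff[of _ u] u by auto
  also have "\<dots> \<in> sets P"
  proof (intro sets.Diff sets.top sets.countable_UN'[OF countable_rat] image_subsetI sets.Int m)
    show "{\<omega> \<in> space P. r < Mx \<omega>} \<in> sets P" for r by measurable
  qed
  finally show ?thesis .
qed

lemma Rh_measurable [measurable]: "Rh \<in> borel_measurable P"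
  unfolding borel_measurable_iff_le
proof
  fix u :: real
  consider "u < 0" | "u = 0" | "0 < u" "u < 1" | "1 \<le> u" by linarith
  then show "{\<omega> \<in> space P. Rh \<omega> \<le> u} \<in> sets P"
  proof cases
    case 1
    then have "{\<omega> \<in> space P. Rh \<omega> \<le> u} = {}" using Rh_in by force
    then show ?thesis by (simp only: sets.empty_sets)
  next
    case 2
    have "{\<omega> \<in> space P. Rh \<omega> \<le> u} = (\<Inter>n. {\<omega> \<in> space P. Rh \<omega> \<le> inverse (real (Suc (Suc n)))})"
    proof (intro equalityI subsetI)
      fix \<omega> assume "\<omega> \<in> (\<Inter>n. {\<omega> \<in> space P. Rh \<omega> \<le> inverse (real (Suc (Suc n)))})"
      then have "\<omega> \<in> space P" and le: "Rh \<omega> \<le> inverse (real (Suc (Suc n)))" for n by auto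
      have "Rh \<omega> \<le> 0"
        by (rule LIMSEQ_le_const[OF LIMSEQ_Suc[OF LIMSEQ_inverse_real_of_nat]]) (use le in auto)
      then show "\<omega> \<in> {\<omega> \<in> space P. Rh \<omega> \<le> u}" using 2 \<open>\<omega> \<in> space P\<close> by simp
    next
      fix \<omega> assume "\<omega> \<in> {\<omega> \<in> space P. Rh \<omega> \<le> u}"
      then have "\<omega> \<in> space P" "Rh \<omega> \<le> 0" using 2 by auto
      moreover have "0 \<le> inverse (real (Suc (Suc n)))" for n by simp
      ultimately show "\<omega> \<in> (\<Inter>n. {\<omega> \<in> space P. Rh \<omega> \<le> inverse (real (Suc (Suc n)))})"
        using order_trans by blast
    qed
    also have "\<dots> \<in> sets P"
    proof (intro sets.countable_INT image_subsetI Rh_set_interior)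
      show "inverse (real (Suc (Suc n))) < 1" for n by (simp add: inverse_eq_divide)
    qed auto
    finally show ?thesis .
  next
    case 3
    then show ?thesis by (rule Rh_set_interior)
  next
    case 4
    then have "{\<omega> \<in> space P. Rh \<omega> \<le> u} = space P" using Rh_in by force
    then show ?thesis by (simp only: sets.top)
  qed
qed

lemma endpoint_zero: "AE \<omega> in P. b 0 \<omega> = 0" "AE \<omega> in P. b 1 \<omega> = 0"
proof -
  have "AE \<omega> in P. b t \<omega> = 0" if t: "t = 0 \<or> t = 1" for t
  proof -
    have T: "t \<in> {0..1}" using t by auto
    have i: "integrable P (\<lambda>\<omega>. b t \<omega> * b t \<omega>)" by (rule b_product_integrable[OF T T])
    have "(\<integral>\<omega>. b t \<omega> * b t \<omega> \<partial>P) = 0" using b_covariance[OF T T] t by auto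
    then have "AE \<omega> in P. b t \<omega> * b t \<omega> = 0"
      using integral_nonneg_eq_0_iff_AE[OF i] by simp
    then show ?thesis by simp
  qed
  then show "AE \<omega> in P. b 0 \<omega> = 0" "AE \<omega> in P. b 1 \<omega> = 0" by auto
qed

text \<open>The value at 1/2 has variance 1/4 and thus a density, so the path is almost surely not
  identically 0; since it vanishes at both ends, the maximum is attained inside.\<close>

lemma Mx_pos_Rh_interior: "AE \<omega> in P. 0 < Mx \<omega> \<and> 0 < Rh \<omega> \<and> Rh \<omega> < 1"
proof -
  have h: "(1/2::real) \<in> {0..1}" by simp
  have e2: "(\<integral>\<omega>. (b (1/2) \<omega>)\<^sup>2 \<partial>P) = 1/4"
    using b_covariance[OF h h] by (simp add: power2_eq_square)
  have D: "distributed P lborel (b (1/2)) (\<lambda>x. ennreal (gk (1/4) x))"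
    using centered_gaussian(4)[OF b_gaussian[OF h] b_mean[OF h]] e2 by simp
  have "AE \<omega> in P. b (1/2) \<omega> \<noteq> 0"
    using distributed_AE2[OF D, of "\<lambda>x. x \<noteq> 0"] AE_lborel_singleton[of "0::real"] by auto
  with endpoint_zero AE_space show ?thesis
  proof eventually_elim
    case (elim \<omega>)
    have M: "0 < Mx \<omega>" using Mx_upper[OF elim(3) h] elim(4) by simp
    have "Rh \<omega> \<noteq> 0" "Rh \<omega> \<noteq> 1" using Rh_attains[OF elim(3)] elim(1,2) M by auto
    then show ?case using M Rh_in[OF elim(3)] by auto
  qed
qed

text \<open>The partial maxima on \<open>[0, u]\<close> and \<open>[u, 1]\<close> compare as the event \<open>Rh \<le> u\<close> prescribes, up to an event on
  which both lie in \<open>(a, c]\<close>.\<close>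

definition Gf :: "real \<Rightarrow> real \<Rightarrow> real" where "Gf u z = prob {\<omega> \<in> space P. Rh \<omega> \<le> u \<and> Mx \<omega> \<le> z}"

lemma Gf_diff:
  assumes "a \<le> c"
  shows "Gf u c - Gf u a = prob {\<omega> \<in> space P. Rh \<omega> \<le> u \<and> a < Mx \<omega> \<and> Mx \<omega> \<le> c}"
proof -
  have "{\<omega> \<in> space P. Rh \<omega> \<le> u \<and> a < Mx \<omega> \<and> Mx \<omega> \<le> c} =
     {\<omega> \<in> space P. Rh \<omega> \<le> u \<and> Mx \<omega> \<le> c} - {\<omega> \<in> space P. Rh \<omega> \<le> u \<and> Mx \<omega> \<le> a}" by auto
  also have "prob \<dots> = Gf u c - Gf u a"
    unfolding Gf_def using assms by (intro finite_measure_Diff) auto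
  finally show ?thesis by simp
qed

text \<open>If all values after u are at most a < \<open>Mx\<close>, the maximum must occur before
  u, which gives the lower bound; if it occurs by u and exceeds a, the path is not confined by a on
  [0, u], which gives the upper one. Both are increments of \<open>Ht\<close> in its first argument
  alone; c \<le> 3a is the condition of \<open>Ev_prob_ge\<close>.\<close>

lemma Gf_increment_bounds:
  assumes u: "0 < u" "u < 1" and a: "0 < a" "a < c" "c \<le> 3 * a"
  shows "sqrt (2 * pi) * (Ht u c a - Ht u a a) \<le> Gf u c - Gf u a"
    and "Gf u c - Gf u a \<le> sqrt (2 * pi) * (Ht u c c - Ht u a c)"
proof -
  let ?D = "{\<omega> \<in> space P. Rh \<omega> \<le> u \<and> a < Mx \<omega> \<and> Mx \<omega> \<le> c}"
  have Dm: "?D \<in> sets P" by measurable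
  have d: "Gf u c - Gf u a = prob ?D" using a by (intro Gf_diff) simp
  have "Ev u c a - Ev u a a \<subseteq> ?D"
  proof
    fix \<omega> assume A: "\<omega> \<in> Ev u c a - Ev u a a"
    then have \<omega>: "\<omega> \<in> space P" by (auto simp: Ev_def)
    have c1: "\<And>s. s \<in> {0..u} \<Longrightarrow> \<bar>b s \<omega>\<bar> \<le> c" and a1: "\<And>s. s \<in> {u..1} \<Longrightarrow> \<bar>b s \<omega>\<bar> \<le> a"
      using A by (auto simp: Ev_def)
    have aM: "a < Mx \<omega>" using A \<omega> Ev_iff_Mx[OF u, of a] by auto
    have "Mx \<omega> \<le> c" unfolding Mx_le_iff[OF \<omega>]
    proof
      fix s assume "s \<in> {0..1::real}"
      then consider "s \<in> {0..u}" | "s \<in> {u..1}" by fastforce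
      then show "\<bar>b s \<omega>\<bar> \<le> c" using c1[of s] a1[of s] a by cases auto
    qed
    moreover have "Rh \<omega> \<le> u"
    proof (rule ccontr)
      assume "\<not> Rh \<omega> \<le> u"
      then have "Rh \<omega> \<in> {u..1}" using Rh_in[OF \<omega>] by auto
      from a1[OF this] show False using Rh_attains[OF \<omega>] aM by simp
    qed
    ultimately show "\<omega> \<in> ?D" using \<omega> aM by simp
  qed
  then have "prob (Ev u c a - Ev u a a) \<le> prob ?D" by (intro finite_measure_mono Dm)
  moreover have "Ev u a a \<subseteq> Ev u c a" using a by (force simp: Ev_def)
  then have "prob (Ev u c a - Ev u a a) = prob (Ev u c a) - prob (Ev u a a)"
    using Ev_sets[OF u] by (intro finite_measure_Diff) auto
  moreover have "prob (Ev u c a) = sqrt (2 * pi) * Ht u c a" "prob (Ev u a a) = sqrt (2 * pi) * Ht u a a"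
    using u a by (auto intro!: Ev_prob_le)
  ultimately show "sqrt (2 * pi) * (Ht u c a - Ht u a a) \<le> Gf u c - Gf u a"
    unfolding d by (simp add: right_diff_distrib)
  have "?D \<subseteq> Ev u c c - Ev u a c"
  proof
    fix \<omega> assume "\<omega> \<in> ?D"
    then have \<omega>: "\<omega> \<in> space P" "Rh \<omega> \<le> u" "a < Mx \<omega>" "Mx \<omega> \<le> c" by auto
    have "\<omega> \<in> Ev u c c" using \<omega> Ev_iff_Mx[OF u, of c] by auto
    moreover have "Rh \<omega> \<in> {0..u}" using Rh_in[OF \<omega>(1)] \<omega>(2) by auto
    then have "\<omega> \<notin> Ev u a c" using Rh_attains[OF \<omega>(1)] \<omega>(3) by (force simp: Ev_def)
    ultimately show "\<omega> \<in> Ev u c c - Ev u a c" by simp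
  qed
  then have "prob ?D \<le> prob (Ev u c c - Ev u a c)"
    using Ev_sets[OF u] by (intro finite_measure_mono) auto
  moreover have "Ev u a c \<subseteq> Ev u c c" using a by (force simp: Ev_def)
  then have "prob (Ev u c c - Ev u a c) = prob (Ev u c c) - prob (Ev u a c)"
    using Ev_sets[OF u] by (intro finite_measure_Diff) auto
  moreover have "prob (Ev u c c) = sqrt (2 * pi) * Ht u c c" using u a by (intro Ev_prob_le) auto
  moreover have "sqrt (2 * pi) * Ht u a c \<le> prob (Ev u a c)" using u a by (intro Ev_prob_ge) auto
  ultimately show "Gf u c - Gf u a \<le> sqrt (2 * pi) * (Ht u c c - Ht u a c)"
    unfolding d by (simp add: right_diff_distrib)
qed

text \<open>The mean value theorem turns both bounds into (c - a) times \<open>Ps u\<close> at a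
  point near (z, z), and joint continuity of \<open>Ps u\<close> squeezes the difference quotient.
  The levels a and c take the roles of z and the moving point in either order.\<close>

lemma Gf_deriv:
  assumes u: "0 < u" "u < 1" and z: "0 < z"
  shows "(Gf u has_real_derivative sqrt (2 * pi) * Ps u z z) (at z)"
  unfolding has_field_derivative_iff
proof (rule tendstoI)
  fix e :: real assume e: "0 < e"
  have sp: "0 < sqrt (2 * pi)" by simp
  have "isCont (\<lambda>(z1, z2). Ps u z1 z2) (z, z)"
    using Ps_continuous[OF u] z by (simp add: continuous_on_eq_continuous_at open_Times)
  then obtain d where d: "0 < d" "\<And>p. dist p (z, z) < d \<Longrightarrow> dist ((\<lambda>(z1, z2). Ps u z1 z2) p) ((\<lambda>(z1, z2). Ps u z1 z2) (z, z)) < e / sqrt (2 * pi)"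
    unfolding continuous_at_eps_delta using divide_pos_pos[OF e sp] by blast
  have near: "\<bar>sqrt (2 * pi) * Ps u z1 z2 - sqrt (2 * pi) * Ps u z z\<bar> < e" if "\<bar>z1 - z\<bar> < d / 2" "\<bar>z2 - z\<bar> < d / 2" for z1 z2
  proof -
    have "dist (z1, z2) (z, z) \<le> dist z1 z + dist z2 z"
      unfolding dist_Pair_Pair by (rule sqrt_sum_squares_le_sum) auto
    also have "\<dots> < d" using that by (simp add: dist_real_def)
    finally have "\<bar>Ps u z1 z2 - Ps u z z\<bar> < e / sqrt (2 * pi)" using d(2)[of "(z1, z2)"] by (simp add: dist_real_def)
    then have "sqrt (2 * pi) * \<bar>Ps u z1 z2 - Ps u z z\<bar> < e" using sp by (simp add: pos_less_divide_eq mult.commute)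
    then show ?thesis by (simp only: right_diff_distrib[symmetric] abs_mult) simp
  qed
  \<comment> \<open>Within z / 2 of z one has c < 3z/2 < 3a, as the increment bounds
    require.\<close>
  define r where "r = min (d / 2) (z / 2)"
  have r: "0 < r" "r \<le> d / 2" "r \<le> z / 2" using d z by (auto simp: r_def)
  have quot: "\<bar>(Gf u c - Gf u a) / (c - a) - sqrt (2 * pi) * Ps u z z\<bar> < e" if ac: "a < c" "\<bar>a - z\<bar> < r" "\<bar>c - z\<bar> < r" for a c
  proof -
    have ac': "0 < a" "c \<le> 3 * a" using ac r z by (auto simp: abs_less_iff)
    have c0: "0 < c" using ac(1) ac'(1) by simp
    have "\<exists>x>a. x < c \<and> Ht u c a - Ht u a a = (c - a) * Ps u x a"
      by (rule MVT2[OF ac(1)]) (rule Ht_deriv[OF u _ ac'(1)], use ac' in simp)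
    then obtain x where x: "a < x" "x < c" "Ht u c a - Ht u a a = (c - a) * Ps u x a" by blast
    have "\<exists>y>a. y < c \<and> Ht u c c - Ht u a c = (c - a) * Ps u y c"
      by (rule MVT2[OF ac(1)]) (rule Ht_deriv[OF u _ c0], use ac' in simp)
    then obtain y where y: "a < y" "y < c" "Ht u c c - Ht u a c = (c - a) * Ps u y c" by blast
    have "sqrt (2 * pi) * ((c - a) * Ps u x a) \<le> Gf u c - Gf u a" "Gf u c - Gf u a \<le> sqrt (2 * pi) * ((c - a) * Ps u y c)"
      using Gf_increment_bounds[OF u ac'(1) ac(1) ac'(2)] unfolding x(3) y(3) by auto
    then have "sqrt (2 * pi) * Ps u x a \<le> (Gf u c - Gf u a) / (c - a)" "(Gf u c - Gf u a) / (c - a) \<le> sqrt (2 * pi) * Ps u y c"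
      using ac(1) by (simp_all only: pos_le_divide_eq pos_divide_le_eq diff_gt_0_iff_gt mult.assoc mult.commute mult.left_commute)
    moreover have "\<bar>sqrt (2 * pi) * Ps u x a - sqrt (2 * pi) * Ps u z z\<bar> < e"
    proof (rule near)
      show "\<bar>x - z\<bar> < d / 2" "\<bar>a - z\<bar> < d / 2" using x(1,2) ac r unfolding abs_less_iff by linarith+
    qed
    moreover have "\<bar>sqrt (2 * pi) * Ps u y c - sqrt (2 * pi) * Ps u z z\<bar> < e"
    proof (rule near)
      show "\<bar>y - z\<bar> < d / 2" "\<bar>c - z\<bar> < d / 2" using y(1,2) ac r unfolding abs_less_iff by linarith+
    qed
    ultimately show ?thesis by linarith
  qed
  show "\<forall>\<^sub>F y in at z. dist ((Gf u y - Gf u z) / (y - z)) (sqrt (2 * pi) * Ps u z z) < e"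
    unfolding eventually_at
  proof (intro exI[of _ r] conjI ballI impI r(1))
    fix y assume "y \<noteq> z \<and> dist y z < r"
    then have y: "y \<noteq> z" "\<bar>y - z\<bar> < r" by (auto simp: dist_real_def)
    show "dist ((Gf u y - Gf u z) / (y - z)) (sqrt (2 * pi) * Ps u z z) < e"
    proof (cases "y < z")
      case True
      have "(Gf u y - Gf u z) / (y - z) = (Gf u z - Gf u y) / (z - y)" using minus_divide_divide[of "Gf u z - Gf u y" "z - y"] by simp
      then show ?thesis using quot[of y z] True y r by (simp add: dist_real_def)
    next
      case False
      then show ?thesis using quot[of z y] y r by (simp add: dist_real_def)
    qed
  qed
qed

text \<open>For each of the two times the increment of \<open>Gf\<close> in the level is the
  integral of its derivative; the rectangle is the difference of the two events.\<close>

lemma rectangle_probability: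
  assumes u: "0 < u1" "u1 \<le> u2" "u2 < 1" and a: "0 < a" "a \<le> c"
  shows "((\<lambda>z. sqrt (2 * pi) * (Ps u2 z z - Ps u1 z z)) has_integral
     prob {\<omega> \<in> space P. u1 < Rh \<omega> \<and> Rh \<omega> \<le> u2 \<and> a < Mx \<omega> \<and> Mx \<omega> \<le> c}) {a..c}"
proof -
  have FTC: "((\<lambda>z. sqrt (2 * pi) * Ps u z z) has_integral (Gf u c - Gf u a)) {a..c}" if "0 < u" "u < 1" for u
  proof (rule fundamental_theorem_of_calculus[OF a(2)])
    fix z assume "z \<in> {a..c}"
    then have "(Gf u has_real_derivative sqrt (2 * pi) * Ps u z z) (at z within {a..c})"
      using a by (intro has_field_derivative_at_within[OF Gf_deriv[OF that]]) auto
    then show "(Gf u has_vector_derivative sqrt (2 * pi) * Ps u z z) (at z within {a..c})"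
      by (simp only: has_real_derivative_iff_has_vector_derivative)
  qed
  have u12: "0 < u2" "u1 < 1" using u by auto
  have I: "((\<lambda>z. sqrt (2 * pi) * Ps u2 z z - sqrt (2 * pi) * Ps u1 z z) has_integral ((Gf u2 c - Gf u2 a) - (Gf u1 c - Gf u1 a))) {a..c}"
    by (rule has_integral_diff[OF FTC[OF u12(1) u(3)] FTC[OF u(1) u12(2)]])
  define A where "A = (\<lambda>u. {\<omega> \<in> space P. Rh \<omega> \<le> u \<and> a < Mx \<omega> \<and> Mx \<omega> \<le> c})"
  have Am: "A u \<in> sets P" for u unfolding A_def by measurable
  have S: "{\<omega> \<in> space P. u1 < Rh \<omega> \<and> Rh \<omega> \<le> u2 \<and> a < Mx \<omega> \<and> Mx \<omega> \<le> c} = A u2 - A u1"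
    unfolding A_def by auto
  have "A u1 \<subseteq> A u2" unfolding A_def using u(2) by auto
  then have "prob (A u2 - A u1) = prob (A u2) - prob (A u1)" by (rule finite_measure_Diff[OF Am Am])
  moreover have "Gf u c - Gf u a = prob (A u)" for u unfolding A_def by (rule Gf_diff[OF a(2)])
  ultimately show ?thesis using I unfolding S by (simp only: right_diff_distrib)
qed

end

section \<open>The joint density of the maximum and its location\<close>

text \<open>The damping sits in the power of - \<alpha>, so weighting the modes of
  \<open>hser 1\<close> by Abel factors only changes the parameter.\<close>

definition hser :: "real \<Rightarrow> real \<Rightarrow> real" where
  "hser \<alpha> s = (\<Sum>m. (- \<alpha>) ^ m * (hf m * exp (- (s * (hf m)\<^sup>2))))"

lemma mode_pair_deriv_s:
  fixes w \<mu> z :: real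
  defines "E \<equiv> \<lambda>s. exp (- (w\<^sup>2 * s / 2)) * exp (- (\<mu>\<^sup>2 * (1 - s) / 2))"
    and "a \<equiv> \<lambda>s x. (w\<^sup>2 * s - 1) * cos (w * x) + w * x * sin (w * x)"
  shows "((\<lambda>s. E s * (a s x * cos (\<mu> * x))) has_real_derivative
      E s * (((\<mu>\<^sup>2 - w\<^sup>2) / 2 * a s x + w\<^sup>2 * cos (w * x)) * cos (\<mu> * x))) (at s within S)"
proof -
  have E': "(E has_real_derivative E s * ((\<mu>\<^sup>2 - w\<^sup>2) / 2)) (at s within S)"
    unfolding E_def by (auto intro!: derivative_eq_intros simp: field_simps)
  have a': "((\<lambda>s. a s x * cos (\<mu> * x)) has_real_derivative w\<^sup>2 * cos (w * x) * cos (\<mu> * x)) (at s within S)"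
    unfolding a_def by (auto intro!: derivative_eq_intros)
  show ?thesis using DERIV_mult[OF E' a'] by (rule DERIV_cong) (simp add: algebra_simps)
qed

text \<open>A Wronskian identity: the cross terms cancel in the derivative of \<open>a'\<close> cos
  + \<mu> \<open>a\<close> sin. The function \<open>a\<close> is not quite an eigenfunction; its
  second derivative is - w^2 \<open>a\<close> + 2 w^2 cos (w x), and the extra term is precisely the
  one produced by differentiating \<open>a\<close> in time.\<close>

lemma mode_pair_deriv_x:
  fixes w \<mu> z :: real
  defines "a \<equiv> \<lambda>s x. (w\<^sup>2 * s - 1) * cos (w * x) + w * x * sin (w * x)"
    and "a' \<equiv> \<lambda>s x. w * (2 - w\<^sup>2 * s) * sin (w * x) + w\<^sup>2 * x * cos (w * x)"
  shows "((\<lambda>x. (a' s x * cos (\<mu> * x) + \<mu> * a s x * sin (\<mu> * x)) / 2) has_real_derivative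
      ((\<mu>\<^sup>2 - w\<^sup>2) / 2 * a s x + w\<^sup>2 * cos (w * x)) * cos (\<mu> * x)) (at x within S)"
proof -
  have 1: "(a s has_real_derivative a' s x) (at x within S)"
    unfolding a_def a'_def by (auto intro!: derivative_eq_intros simp: power2_eq_square algebra_simps)
  have 2: "(a' s has_real_derivative (2 * w\<^sup>2 * cos (w * x) - w\<^sup>2 * a s x)) (at x within S)"
    unfolding a_def a'_def by (auto intro!: derivative_eq_intros simp: power2_eq_square algebra_simps)
  have c: "((\<lambda>x. cos (\<mu> * x)) has_real_derivative - \<mu> * sin (\<mu> * x)) (at x within S)"
    by (auto intro!: derivative_eq_intros)
  have s: "((\<lambda>x. sin (\<mu> * x)) has_real_derivative \<mu> * cos (\<mu> * x)) (at x within S)"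
    by (auto intro!: derivative_eq_intros)
  show ?thesis
    by (rule DERIV_cong[OF DERIV_cdivide[OF DERIV_add[OF DERIV_mult[OF 2 c] DERIV_mult[OF DERIV_cmult[OF 1, of \<mu>] s]], of 2]])
       (simp add: power2_eq_square algebra_simps add_divide_distrib diff_divide_distrib)
qed

lemma sin_hf_pi: "sin (hf n * pi) = (-1) ^ n"
proof -
  have "sin (hf n * pi) = sin (pi / 2 + real n * pi)" by (simp add: hf_def algebra_simps)
  also have "\<dots> = (-1) ^ n" by (simp add: sin_add)
  finally show ?thesis .
qed

lemma cos_hf_pi: "cos (hf n * pi) = 0"
proof -
  have "cos (hf n * pi) = cos (pi / 2 + real n * pi)" by (simp add: hf_def algebra_simps)
  also have "\<dots> = 0" by (simp add: cos_add)
  finally show ?thesis .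
qed

definition qmode :: "nat \<Rightarrow> real \<Rightarrow> real \<Rightarrow> real \<Rightarrow> real" where
  "qmode n t z x = exp (- ((hf n * pi / z)\<^sup>2 * t / 2)) * cos (hf n * pi / z * x) / z"

definition hmode :: "nat \<Rightarrow> real \<Rightarrow> real" where
  "hmode n s = (-1) ^ n * (hf n * exp (- (s * (hf n)\<^sup>2)))"

lemma continuous_on_dmode_x [continuous_intros]:
  fixes f :: "real \<Rightarrow> real"
  shows "0 < z \<Longrightarrow> continuous_on S f \<Longrightarrow> continuous_on S (\<lambda>x. dmode m t z (f x))"
  unfolding dmode_def by (intro continuous_intros) auto

lemma continuous_on_qmode [continuous_intros]:
  fixes f :: "real \<Rightarrow> real"
  shows "0 < z \<Longrightarrow> continuous_on S f \<Longrightarrow> continuous_on S (\<lambda>x. qmode n t z (f x))"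
  unfolding qmode_def by (intro continuous_on_divide continuous_on_mult continuous_on_cos continuous_on_const) auto

text \<open>A mode of \<open>dq u\<close> solves the heat equation and a mode of \<open>q (1 - u)\<close> the backward one, so the time
  derivative of their product is an exact derivative in \<open>x\<close> and only a boundary term remains.\<close>

lemma mode_pair_increment:
  assumes z: "0 < z" and u: "u1 \<le> u2"
  shows "integral {-z..z} (\<lambda>x. dmode m u2 z x * qmode n (1 - u2) z x) - integral {-z..z} (\<lambda>x. dmode m u1 z x * qmode n (1 - u1) z x)
    = integral {u1..u2} (\<lambda>s. pi\<^sup>2 / z ^ 4 * (hmode m (pi\<^sup>2 / (2 * z\<^sup>2) * s) * hmode n (pi\<^sup>2 / (2 * z\<^sup>2) * (1 - s))))"
proof -
  define w where "w = hf m * pi / z"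
  define \<mu> where "\<mu> = hf n * pi / z"
  define E where "E = (\<lambda>s. exp (- (w\<^sup>2 * s / 2)) * exp (- (\<mu>\<^sup>2 * (1 - s) / 2)))"
  define a where "a = (\<lambda>s x. (w\<^sup>2 * s - 1) * cos (w * x) + w * x * sin (w * x))"
  define a' where "a' = (\<lambda>s x. w * (2 - w\<^sup>2 * s) * sin (w * x) + w\<^sup>2 * x * cos (w * x))"
  define D where "D = (\<lambda>s x. E s * (((\<mu>\<^sup>2 - w\<^sup>2) / 2 * a s x + w\<^sup>2 * cos (w * x)) * cos (\<mu> * x)))"
  have prod: "dmode m s z x * qmode n (1 - s) z x = (E s * (a s x * cos (\<mu> * x))) / z ^ 3" for s x
    unfolding dmode_def qmode_def E_def a_def w_def[symmetric] \<mu>_def[symmetric]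
    by (simp add: power2_eq_square power3_eq_cube)
  have cp: "(\<lambda>x. dmode m s z x * qmode n (1 - s) z x) integrable_on {-z..z}" for s
    by (intro integrable_continuous_real continuous_on_mult continuous_on_dmode_x[OF z continuous_on_id] continuous_on_qmode[OF z continuous_on_id])
  have 1: "dmode m u2 z x * qmode n (1 - u2) z x - dmode m u1 z x * qmode n (1 - u1) z x = integral {u1..u2} (\<lambda>s. D s x) / z ^ 3" for x
  proof -
    have "((\<lambda>s. D s x) has_integral (E u2 * (a u2 x * cos (\<mu> * x)) - E u1 * (a u1 x * cos (\<mu> * x)))) {u1..u2}"
    proof (rule fundamental_theorem_of_calculus[OF u])
      fix s
      have "((\<lambda>s. E s * (a s x * cos (\<mu> * x))) has_real_derivative D s x) (at s within {u1..u2})"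
        unfolding D_def E_def a_def by (rule mode_pair_deriv_s)
      then show "((\<lambda>s. E s * (a s x * cos (\<mu> * x))) has_vector_derivative D s x) (at s within {u1..u2})"
        by (simp only: has_real_derivative_iff_has_vector_derivative)
    qed
    then show ?thesis unfolding prod by (simp add: integral_unique diff_divide_distrib)
  qed
  have cD: "continuous_on (cbox (u1, -z) (u2, z)) (\<lambda>(s, x). D s x)"
    unfolding D_def E_def a_def split_beta by (intro continuous_intros) auto
  have Jint: "integral {-z..z} (D s) = E s * w * \<mu> * (-1) ^ m * (-1) ^ n * z" for s
  proof -
    have wz: "w * z = hf m * pi" and muz: "\<mu> * z = hf n * pi" using z by (auto simp: w_def \<mu>_def)
    let ?J = "\<lambda>x. (a' s x * cos (\<mu> * x) + \<mu> * a s x * sin (\<mu> * x)) / 2"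
    have "((\<lambda>x. ((\<mu>\<^sup>2 - w\<^sup>2) / 2 * a s x + w\<^sup>2 * cos (w * x)) * cos (\<mu> * x)) has_integral (?J z - ?J (-z))) {-z..z}"
    proof (rule fundamental_theorem_of_calculus)
      show "- z \<le> z" using z by simp
      fix x
      have "(?J has_real_derivative ((\<mu>\<^sup>2 - w\<^sup>2) / 2 * a s x + w\<^sup>2 * cos (w * x)) * cos (\<mu> * x)) (at x within {-z..z})"
        unfolding a_def a'_def by (rule mode_pair_deriv_x)
      then show "(?J has_vector_derivative ((\<mu>\<^sup>2 - w\<^sup>2) / 2 * a s x + w\<^sup>2 * cos (w * x)) * cos (\<mu> * x)) (at x within {-z..z})"
        by (simp only: has_real_derivative_iff_has_vector_derivative)
    qed
    from has_integral_mult_right[OF this, of "E s"]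
    have "(D s has_integral E s * (?J z - ?J (-z))) {-z..z}" by (simp only: D_def)
    \<comment> \<open>Both cosines vanish at the endpoints, so only \<mu> \<open>a\<close> sin
      (\<mu> x) / 2 survives, and there \<open>a\<close> reduces to w x sin (w x). The expression is
      odd in x, so the two endpoints double it and cancel the 1/2.\<close>
    moreover have "?J z - ?J (-z) = w * \<mu> * (-1) ^ m * (-1) ^ n * z"
      unfolding a_def a'_def by (simp add: wz muz cos_hf_pi sin_hf_pi)
    ultimately show ?thesis by (simp only: integral_unique mult.assoc)
  qed
  have "integral {-z..z} (\<lambda>x. dmode m u2 z x * qmode n (1 - u2) z x) - integral {-z..z} (\<lambda>x. dmode m u1 z x * qmode n (1 - u1) z x)
     = integral {-z..z} (\<lambda>x. dmode m u2 z x * qmode n (1 - u2) z x - dmode m u1 z x * qmode n (1 - u1) z x)"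
    by (rule Henstock_Kurzweil_Integration.integral_diff[OF cp cp, symmetric])
  also have "\<dots> = integral {-z..z} (\<lambda>x. integral {u1..u2} (\<lambda>s. D s x)) / z ^ 3"
    unfolding 1 by simp
  also have "integral {-z..z} (\<lambda>x. integral {u1..u2} (\<lambda>s. D s x)) = integral {u1..u2} (\<lambda>s. integral {-z..z} (D s))"
    using integral_swap_continuous[OF cD] by simp
  also have "\<dots> / z ^ 3 = integral {u1..u2} (\<lambda>s. E s * w * \<mu> * (-1) ^ m * (-1) ^ n * z / z ^ 3)"
    unfolding Jint by simp
  also have "\<dots> = integral {u1..u2} (\<lambda>s. pi\<^sup>2 / z ^ 4 * (hmode m (pi\<^sup>2 / (2 * z\<^sup>2) * s) * hmode n (pi\<^sup>2 / (2 * z\<^sup>2) * (1 - s))))"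
  proof (rule Henstock_Kurzweil_Integration.integral_cong)
    fix s
    have e: "E s = exp (- (pi\<^sup>2 / (2 * z\<^sup>2) * s * (hf m)\<^sup>2)) * exp (- (pi\<^sup>2 / (2 * z\<^sup>2) * (1 - s) * (hf n)\<^sup>2))"
      unfolding E_def w_def \<mu>_def by (simp add: power_mult_distrib power_divide mult_ac)
    have c: "w * \<mu> * z / z ^ 3 = pi\<^sup>2 / z ^ 4 * (hf m * hf n)"
      using z by (simp add: w_def \<mu>_def power2_eq_square power3_eq_cube power4_eq_xxxx mult_ac)
    have "E s * w * \<mu> * (-1) ^ m * (-1) ^ n * z / z ^ 3 = E s * ((-1) ^ m * (-1) ^ n) * (w * \<mu> * z / z ^ 3)" by simp
    then show "E s * w * \<mu> * (-1) ^ m * (-1) ^ n * z / z ^ 3 = pi\<^sup>2 / z ^ 4 * (hmode m (pi\<^sup>2 / (2 * z\<^sup>2) * s) * hmode n (pi\<^sup>2 / (2 * z\<^sup>2) * (1 - s)))"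
      unfolding c e hmode_def by (simp only: mult_ac)
  qed
  finally show ?thesis .
qed

lemma hser_1: "hser 1 s = (\<Sum>n. hmode n s)"
  by (simp add: hser_def hmode_def)

lemma hmode_bound: assumes "a \<le> s" shows "\<bar>hmode n s\<bar> \<le> hf n ^ 1 * exp (- (a * (hf n)\<^sup>2))"
proof -
  have "exp (- (s * (hf n)\<^sup>2)) \<le> exp (- (a * (hf n)\<^sup>2))" using assms by (simp add: mult_right_mono)
  then show ?thesis by (simp add: hmode_def abs_mult power_abs)
qed

lemma continuous_on_hmode [continuous_intros]: "continuous_on S f \<Longrightarrow> continuous_on S (\<lambda>x. hmode n (f x))"
  unfolding hmode_def by (intro continuous_intros)

lemma continuous_on_hser1 [continuous_intros]:
  assumes "continuous_on S f" "\<And>x. x \<in> S \<Longrightarrow> 0 < f x"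
  shows "continuous_on S (\<lambda>x. hser 1 (f x))"
proof -
  have "continuous_on {0<..} (hser 1)"
  proof (rule continuous_at_imp_continuous_on, rule ballI)
    fix s :: real assume s: "s \<in> {0<..}"
    have "continuous_on {s/2<..} (\<lambda>s. \<Sum>n. hmode n s)"
      using s by (intro continuous_on_suminf_bounded[OF _ hmode_bound[of "s/2"] summable_power_exp_hf] continuous_intros) auto
    then show "isCont (hser 1) s" using s
      by (simp add: hser_1[abs_def] continuous_on_eq_continuous_at)
  qed
  then show ?thesis by (rule continuous_on_compose2) (use assms in auto)
qed

lemma Ps_eq:
  assumes u: "0 < u" "u < 1" and z: "0 < z"
  shows "Ps u z z = integral {-z..z} (\<lambda>x. dq u z x * q (1 - u) z x)"
proof -
  let ?f = "\<lambda>x. dq u z x * q (1 - u) z x"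
  have "?f integrable_on {-z..z}" using u z by (intro integrable_continuous_real continuous_intros) auto
  then have "(?f has_integral integral {-z..z} ?f) (cbox (z * (-1) + 0) (z * 1 + 0))"
    by (simp add: integrable_integral)
  from has_integral_affinity'[OF this, of z 0]
  have "((\<lambda>y. ?f (z * y)) has_integral integral {-z..z} ?f / z) {-1..1}"
    using z by (simp add: divide_inverse_commute)
  from has_integral_mult_right[OF this, of z]
  have "((\<lambda>y. z * ?f (z * y)) has_integral integral {-z..z} ?f) {-1..1}"
    using z by simp
  moreover have "(\<lambda>y. z * ?f (z * y)) = (\<lambda>y. dq u z (z * y) * (z * q (1 - u) z (z * y)))"
    by (simp add: fun_eq_iff)
  ultimately show ?thesis unfolding Ps_def by (simp add: integral_unique)
qed

text \<open>The expansion is an iterated series, over m with the second kernel kept whole, then over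
  n: at each stage one kernel is expanded and the other stays a continuous factor. Both sides are
  sums of the same series, mode pair by mode pair.\<close>

lemma Ps_increment:
  assumes u: "0 < u1" "u1 \<le> u2" "u2 < 1" and z: "0 < z"
  shows "Ps u2 z z - Ps u1 z z = integral {u1..u2} (\<lambda>s. pi\<^sup>2 / z ^ 4 * (hser 1 (pi\<^sup>2 / (2 * z\<^sup>2) * s) * hser 1 (pi\<^sup>2 / (2 * z\<^sup>2) * (1 - s))))"
proof -
  define k where "k = pi\<^sup>2 / (2 * z\<^sup>2)"
  have k: "0 < k" using z by (simp add: k_def)
  let ?h = "\<lambda>s. hser 1 (k * (1 - s))"
  have ps: "(\<lambda>m. integral {-z..z} (\<lambda>x. dmode m u z x * q (1 - u) z x)) sums Ps u z z" if u: "0 < u" "u < 1" for u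
  proof -
    obtain K where K: "summable K" "\<And>n y x. z / 2 < y \<Longrightarrow> y < 2 * z \<Longrightarrow> \<bar>x\<bar> < 2 * z \<Longrightarrow> \<bar>dmode n u y x\<bar> \<le> K n"
      using dmode_bound[of u "z/2" "2*z"] u z by auto
    show ?thesis unfolding Ps_eq[OF u z] dq_def
      by (rule sums_integral_mult[OF _ _ K(1)]) (use u z in \<open>auto intro!: continuous_intros K(2) simp: abs_less_iff\<close>)
  qed
  have inner: "(\<lambda>n. integral {-z..z} (\<lambda>x. dmode m u z x * qmode n (1 - u) z x)) sums integral {-z..z} (\<lambda>x. dmode m u z x * q (1 - u) z x)"
    if u: "0 < u" "u < 1" for u m
  proof -
    have t: "0 < 1 - u" using u by simp
    have "(\<lambda>n. integral {-z..z} (\<lambda>x. qmode n (1 - u) z x * dmode m u z x)) sums integral {-z..z} (\<lambda>x. (\<Sum>n. qmode n (1 - u) z x) * dmode m u z x)"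
    proof (rule sums_integral_mult[OF _ _ summable_divide[OF summable_q_exp[OF t z]]])
      show "\<bar>qmode n (1 - u) z x\<bar> \<le> exp (- ((hf n * pi / z)\<^sup>2 * (1 - u) / 2)) / z" for n x
        unfolding qmode_def abs_divide using z by (intro frac_le abs_mult_cos_le) auto
    qed (use z in \<open>auto intro!: continuous_intros\<close>)
    moreover have "(\<Sum>n. qmode n (1 - u) z x) = q (1 - u) z x" for x
      unfolding qmode_def q_def by (rule suminf_divide[OF summable_q_term[OF t z]])
    ultimately show ?thesis by (simp add: mult.commute)
  qed
  have outer_h: "(\<lambda>m. integral {u1..u2} (\<lambda>s. hmode m (k * s) * ?h s)) sums integral {u1..u2} (\<lambda>s. hser 1 (k * s) * ?h s)"
    unfolding hser_1[of "k * _"]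
  proof (rule sums_integral_mult)
    show "\<bar>hmode m (k * s)\<bar> \<le> hf m ^ 1 * exp (- ((k * u1) * (hf m)\<^sup>2))" if "s \<in> {u1..u2}" for m s
      using that k by (intro hmode_bound) auto
    show "summable (\<lambda>m. hf m ^ 1 * exp (- ((k * u1) * (hf m)\<^sup>2)))" using k u by (intro summable_power_exp_hf) auto
    have "continuous_on {u1..u2} ?h" using k u by (intro continuous_intros) auto
    then show "continuous_on {u1..u2} (\<lambda>s. \<Sum>n. hmode n (k * (1 - s)))" by (simp only: hser_1)
  qed (intro continuous_intros)
  have inner_h: "(\<lambda>n. integral {u1..u2} (\<lambda>s. hmode m (k * s) * hmode n (k * (1 - s)))) sums integral {u1..u2} (\<lambda>s. hmode m (k * s) * ?h s)" for m
  proof -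
    have "(\<lambda>n. integral {u1..u2} (\<lambda>s. hmode n (k * (1 - s)) * hmode m (k * s))) sums integral {u1..u2} (\<lambda>s. (\<Sum>n. hmode n (k * (1 - s))) * hmode m (k * s))"
    proof (rule sums_integral_mult)
      show "\<bar>hmode n (k * (1 - s))\<bar> \<le> hf n ^ 1 * exp (- ((k * (1 - u2)) * (hf n)\<^sup>2))" if "s \<in> {u1..u2}" for n s
        using that k by (intro hmode_bound) auto
      show "summable (\<lambda>m. hf m ^ 1 * exp (- ((k * (1 - u2)) * (hf m)\<^sup>2)))" using k u by (intro summable_power_exp_hf) auto
    qed (intro continuous_intros)+
    then show ?thesis by (simp only: hser_1 mult.commute)
  qed
  let ?c = "pi\<^sup>2 / z ^ 4"
  have um: "0 < u2" "u1 < 1" using u by auto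
  have e: "integral {-z..z} (\<lambda>x. dmode m u2 z x * q (1 - u2) z x) - integral {-z..z} (\<lambda>x. dmode m u1 z x * q (1 - u1) z x)
      = ?c * integral {u1..u2} (\<lambda>s. hmode m (k * s) * ?h s)" for m
  proof (rule sums_unique2)
    show "(\<lambda>n. integral {-z..z} (\<lambda>x. dmode m u2 z x * qmode n (1 - u2) z x) - integral {-z..z} (\<lambda>x. dmode m u1 z x * qmode n (1 - u1) z x))
       sums (integral {-z..z} (\<lambda>x. dmode m u2 z x * q (1 - u2) z x) - integral {-z..z} (\<lambda>x. dmode m u1 z x * q (1 - u1) z x))"
      by (intro sums_diff inner u um)
    show "(\<lambda>n. integral {-z..z} (\<lambda>x. dmode m u2 z x * qmode n (1 - u2) z x) - integral {-z..z} (\<lambda>x. dmode m u1 z x * qmode n (1 - u1) z x))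
       sums (?c * integral {u1..u2} (\<lambda>s. hmode m (k * s) * ?h s))"
      unfolding mode_pair_increment[OF z u(2)] k_def[symmetric] Henstock_Kurzweil_Integration.integral_mult_right
      by (intro sums_mult inner_h)
  qed
  have "Ps u2 z z - Ps u1 z z = ?c * integral {u1..u2} (\<lambda>s. hser 1 (k * s) * ?h s)"
  proof (rule sums_unique2)
    show "(\<lambda>m. integral {-z..z} (\<lambda>x. dmode m u2 z x * q (1 - u2) z x) - integral {-z..z} (\<lambda>x. dmode m u1 z x * q (1 - u1) z x)) sums (Ps u2 z z - Ps u1 z z)"
      by (intro sums_diff ps u um)
    show "(\<lambda>m. integral {-z..z} (\<lambda>x. dmode m u2 z x * q (1 - u2) z x) - integral {-z..z} (\<lambda>x. dmode m u1 z x * q (1 - u1) z x)) sums (?c * integral {u1..u2} (\<lambda>s. hser 1 (k * s) * ?h s))"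
      unfolding e by (intro sums_mult outer_h)
  qed
  then show ?thesis unfolding k_def by simp
qed

text \<open>\<open>hser 1\<close> is, up to a factor, minus the derivative of the nonnegative kernel at the absorbing endpoint.\<close>

lemma hser1_nonneg:
  assumes s: "0 < s" shows "0 \<le> hser 1 s"
proof -
  \<comment> \<open>The time at which the exponents of the kernel on [-1, 1] become s
    \<open>hf n\<close>^2.\<close>
  define t where "t = 2 * s / pi\<^sup>2"
  have t: "0 < t" using s by (simp add: t_def)
  have ex: "exp (- ((hf n * pi)\<^sup>2 * t / 2)) = exp (- (s * (hf n)\<^sup>2))" for n
    by (simp add: t_def power_mult_distrib mult_ac)
  define \<epsilon> where "\<epsilon> = (\<lambda>k. inverse (real (Suc k)))"
  have \<epsilon>: "0 < \<epsilon> k" "\<epsilon> k \<le> 1" for k by (auto simp: \<epsilon>_def field_simps)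
  have \<epsilon>0: "\<epsilon> \<longlonglongrightarrow> 0" unfolding \<epsilon>_def by (rule LIMSEQ_inverse_real_of_nat)
  \<comment> \<open>The summands of \<open>q t 1 (1 - y)\<close> / y, continued to y = 0 by their
    limit. The linear bound on the sine gives a summable majorant uniform in y, so the limit passes
    through the sum and inherits the sign of the kernel.\<close>
  define f where "f = (\<lambda>n y. exp (- (s * (hf n)\<^sup>2)) * ((-1) ^ n * (if y = 0 then hf n * pi else sin (hf n * pi * y) / y)))"
  have fq: "(\<Sum>n. f n y) = q t 1 (1 - y) / y" if "y \<noteq> 0" for y
  proof -
    have "exp (- ((hf n * pi)\<^sup>2 * t / 2)) * cos (hf n * pi * (1 - y)) / y = f n y" for n
    proof -
      have "cos (hf n * pi * (1 - y)) = cos (hf n * pi - hf n * pi * y)" by (simp add: algebra_simps)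
      also have "\<dots> = (-1) ^ n * sin (hf n * pi * y)" by (simp add: cos_diff sin_hf_pi cos_hf_pi)
      finally show ?thesis unfolding f_def ex using that by simp
    qed
    then show ?thesis using suminf_divide[OF summable_q_term[OF t, of 1 "1 - y"], of y] by (simp add: q_def)
  qed
  have "(\<lambda>k. \<Sum>n. f n (\<epsilon> k)) \<longlonglongrightarrow> (\<Sum>n. f n 0)"
  proof -
    have fb: "\<bar>f n y\<bar> \<le> pi * (hf n ^ 1 * exp (- (s * (hf n)\<^sup>2)))" if "0 \<le> y" for n y
    proof (cases "y = 0")
      case False
      then have "\<bar>sin (hf n * pi * y) / y\<bar> \<le> hf n * pi"
        using that abs_sin_x_le_abs_x[of "hf n * pi * y"] by (simp add: abs_mult divide_simps)
      then have "exp (- (s * (hf n)\<^sup>2)) * \<bar>sin (hf n * pi * y) / y\<bar> \<le> exp (- (s * (hf n)\<^sup>2)) * (hf n * pi)"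
        by (intro mult_left_mono) auto
      moreover have "\<bar>f n y\<bar> = exp (- (s * (hf n)\<^sup>2)) * \<bar>sin (hf n * pi * y) / y\<bar>"
        using False by (simp add: f_def abs_mult power_abs del: abs_divide times_divide_eq_right)
      ultimately show ?thesis by (simp add: mult_ac)
    qed (simp add: f_def abs_mult power_abs)
    have cf: "((\<lambda>k. f n (\<epsilon> k)) \<longlongrightarrow> f n 0) sequentially" for n
    proof -
      have "((\<lambda>y. sin (hf n * pi * y)) has_real_derivative hf n * pi) (at 0)"
        by (auto intro!: derivative_eq_intros)
      then have "((\<lambda>y. sin (hf n * pi * y) / y) \<longlongrightarrow> hf n * pi) (at 0)"
        by (simp add: has_field_derivative_iff)
      moreover have "filterlim \<epsilon> (at 0) sequentially"
        using \<epsilon>0 \<epsilon>(1) by (auto simp: filterlim_at intro!: always_eventually) (metis less_irrefl)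
      ultimately have "(\<lambda>k. sin (hf n * pi * \<epsilon> k) / \<epsilon> k) \<longlonglongrightarrow> hf n * pi" by (rule filterlim_compose)
      then have "(\<lambda>k. exp (- (s * (hf n)\<^sup>2)) * ((-1) ^ n * (sin (hf n * pi * \<epsilon> k) / \<epsilon> k))) \<longlonglongrightarrow> exp (- (s * (hf n)\<^sup>2)) * ((-1) ^ n * (hf n * pi))"
        by (intro tendsto_intros)
      moreover have "\<epsilon> k \<noteq> 0" for k using \<epsilon>(1)[of k] by simp
      ultimately show ?thesis by (simp add: f_def)
    qed
    have "\<forall>\<^sub>F (n, k) in at_top \<times>\<^sub>F sequentially. norm (f n (\<epsilon> k)) \<le> pi * (hf n ^ 1 * exp (- (s * (hf n)\<^sup>2)))"
      using fb \<epsilon>(1) by (intro always_eventually) (auto simp: less_imp_le)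
    from tannerys_theorem[of "\<lambda>n k. f n (\<epsilon> k)", OF cf this summable_mult[OF summable_power_exp_hf[OF s]]]
    show ?thesis by simp
  qed
  moreover have "0 \<le> (\<Sum>n. f n (\<epsilon> k))" for k
    using fq[of "\<epsilon> k"] \<epsilon>[of k] q1_nonneg[OF t, of "1 - \<epsilon> k"] by simp
  ultimately have "0 \<le> (\<Sum>n. f n 0)" by (intro LIMSEQ_le_const) auto
  also have "(\<lambda>n. f n 0) = (\<lambda>n. pi * hmode n s)" by (simp add: fun_eq_iff f_def hmode_def mult_ac)
  also have "(\<Sum>n. pi * hmode n s) = pi * hser 1 s"
  proof -
    have "summable (\<lambda>n. hmode n s)"
      by (rule summable_comparison_test'[OF summable_power_exp_hf[OF s, of 1], of 0]) (use hmode_bound[of s s] in simp)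
    then show ?thesis unfolding hser_1 by (rule suminf_mult)
  qed
  finally show ?thesis using pi_gt_zero by (simp add: zero_le_mult_iff)
qed

section \<open>Abel summation\<close>

lemma sum_alternating_hf: "(\<Sum>m<N. (-1) ^ m * hf m) = - ((-1) ^ N * (real N / 2))"
  by (induction N) (auto simp: hf_def field_simps)

text \<open>Summation by parts against the partial sums \<open>(-1)^(N+1) N/2\<close> of \<open>(-1)^m (m + 1/2)\<close>.\<close>

lemma abs_sum_alternating_hf_le:
  assumes dec: "\<And>n. D (Suc n) \<le> D n" and nn: "\<And>n. 0 \<le> D n"
  shows "\<bar>\<Sum>m<N. (-1) ^ m * hf m * D m\<bar> \<le> (\<Sum>m<N. D m) / 2"
proof -
  define S where "S = (\<lambda>N. \<Sum>m<N. (-1) ^ m * hf m)"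
  have S: "\<bar>S N\<bar> = real N / 2" for N unfolding S_def sum_alternating_hf by (simp add: abs_mult power_abs)
  \<comment> \<open>The boundary term S N * D N is subtracted on the left and its bound on the
    right, which makes the estimate inductive.\<close>
  have "\<bar>(\<Sum>m<N. (-1) ^ m * hf m * D m) - S N * D N\<bar> \<le> (\<Sum>m<N. D m) / 2 - real N / 2 * D N"
  proof (induction N)
    case (Suc N)
    have S': "S (Suc N) = S N + (-1) ^ N * hf N" by (simp add: S_def)
    have "(\<Sum>m<Suc N. (-1) ^ m * hf m * D m) - S (Suc N) * D (Suc N) =
       ((\<Sum>m<N. (-1) ^ m * hf m * D m) - S N * D N) + S (Suc N) * (D N - D (Suc N))"
      unfolding S' by (simp add: algebra_simps)
    also have "\<bar>\<dots>\<bar> \<le> ((\<Sum>m<N. D m) / 2 - real N / 2 * D N) + real (Suc N) / 2 * (D N - D (Suc N))"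
    proof (rule order_trans[OF abs_triangle_ineq add_mono[OF Suc]])
      show "\<bar>S (Suc N) * (D N - D (Suc N))\<bar> \<le> real (Suc N) / 2 * (D N - D (Suc N))"
        unfolding abs_mult S using dec[of N] by simp
    qed
    also have "\<dots> = (\<Sum>m<Suc N. D m) / 2 - real (Suc N) / 2 * D (Suc N)"
      by (simp add: field_simps)
    finally show ?case .
  qed (simp add: S_def)
  moreover have "\<bar>S N * D N\<bar> = real N / 2 * D N" unfolding abs_mult S using nn by simp
  ultimately show ?thesis by linarith
qed

lemma hser_term_eq: "(- \<alpha>) ^ m * (hf m * exp (- (s * (hf m)\<^sup>2))) = (-1) ^ m * hf m * (\<alpha> ^ m * exp (- (s * (hf m)\<^sup>2)))"
  by (simp add: power_minus[of \<alpha>])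

lemma hser_term_bound:
  assumes "0 \<le> \<alpha>" "\<alpha> \<le> 1"
  shows "\<bar>(- \<alpha>) ^ m * (hf m * exp (- (s * (hf m)\<^sup>2)))\<bar> \<le> hf m ^ 1 * exp (- (s * (hf m)\<^sup>2))"
proof -
  have "\<bar>(- \<alpha>) ^ m\<bar> \<le> 1" using assms by (simp add: power_abs power_le_one)
  then have "\<bar>(- \<alpha>) ^ m\<bar> * (hf m * exp (- (s * (hf m)\<^sup>2))) \<le> 1 * (hf m * exp (- (s * (hf m)\<^sup>2)))"
    by (rule mult_right_mono) simp
  then show ?thesis by (simp add: abs_mult)
qed

text \<open>The damping is monotone in m, so it joins the exponential in one decreasing sequence and
  summation by parts removes the factor \<open>hf m\<close>. The bound thus holds for all \<alpha>
  in [0, 1] with one constant.\<close>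

lemma hser_bound:
  assumes a: "0 \<le> \<alpha>" "\<alpha> \<le> 1" and s: "0 < s"
  shows "\<bar>hser \<alpha> s\<bar> \<le> 3 * (exp (- (s / 8)) / sqrt s)"
proof -
  define D where "D = (\<lambda>m. \<alpha> ^ m * exp (- (s * (hf m)\<^sup>2)))"
  have D0: "0 \<le> D m" for m using a by (simp add: D_def)
  have dec: "D (Suc m) \<le> D m" for m
  proof -
    have "\<alpha> ^ Suc m \<le> \<alpha> ^ m" using a by (intro power_decreasing) auto
    moreover have "(hf m)\<^sup>2 \<le> (hf (Suc m))\<^sup>2" by (intro power_mono) (auto simp: hf_def)
    then have "exp (- (s * (hf (Suc m))\<^sup>2)) \<le> exp (- (s * (hf m)\<^sup>2))" using s by simp
    ultimately show ?thesis unfolding D_def using a by (intro mult_mono) auto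
  qed
  \<comment> \<open>Half of the exponent is at least s/8 since \<open>hf m\<close>^2 \<ge> 1/4; the
    other half stays in the sum. The decay for large s is what later makes the integral over small
    levels converge.\<close>
  have e8: "exp (- (s * (hf m)\<^sup>2)) \<le> exp (- (s / 8)) * exp (- (s / 2 * (hf m)\<^sup>2))" for m
  proof -
    have "s / 2 * (1 / 4) \<le> s / 2 * (hf m)\<^sup>2" using s hf_sq_ge(2)[of m] by (intro mult_left_mono) auto
    then have "- (s * (hf m)\<^sup>2) \<le> - (s / 8) + - (s / 2 * (hf m)\<^sup>2)" by (simp add: field_simps)
    then show ?thesis by (simp only: exp_add[symmetric] exp_le_cancel_iff)
  qed
  have sum2: "(\<Sum>m<N. D m) / 2 \<le> 3 * (exp (- (s / 8)) / sqrt s)" for N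
  proof -
    have s2: "0 < s / 2" using s by simp
    have "(\<Sum>m<N. D m) \<le> (\<Sum>m<N. exp (- (s / 8)) * exp (- (s / 2 * (hf m)\<^sup>2)))"
    proof (rule sum_mono)
      fix m
      have "D m \<le> 1 * exp (- (s * (hf m)\<^sup>2))" unfolding D_def using a by (intro mult_right_mono power_le_one) auto
      then show "D m \<le> exp (- (s / 8)) * exp (- (s / 2 * (hf m)\<^sup>2))" using e8[of m] by linarith
    qed
    also have "\<dots> = exp (- (s / 8)) * (\<Sum>m<N. exp (- (s / 2 * (hf m)\<^sup>2)))" by (simp add: sum_distrib_left)
    also have "\<dots> \<le> exp (- (s / 8)) * (3 / sqrt (s / 2))"
    proof (rule mult_left_mono)
      have "(\<Sum>m<N. exp (- (s / 2 * (hf m)\<^sup>2))) \<le> (\<Sum>m. exp (- (s / 2 * (hf m)\<^sup>2)))"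
        by (rule sum_le_suminf[OF summable_exp_hf[OF s2]]) auto
      then show "(\<Sum>m<N. exp (- (s / 2 * (hf m)\<^sup>2))) \<le> 3 / sqrt (s / 2)"
        using exp_hf_sum_le[OF s2] by linarith
    qed simp
    also have "3 / sqrt (s / 2) \<le> 6 / sqrt s"
    proof -
      have "sqrt (s / 4) \<le> sqrt (s / 2)" using s by simp
      then have "sqrt s / 2 \<le> sqrt (s / 2)" by (simp add: real_sqrt_divide)
      then have "3 / sqrt (s / 2) \<le> 3 / (sqrt s / 2)" using s by (intro divide_left_mono) auto
      then show ?thesis by simp
    qed
    finally have "(\<Sum>m<N. D m) \<le> exp (- (s / 8)) * (6 / sqrt s)" by (simp add: mult_left_mono)
    then show ?thesis by (simp add: mult.commute)
  qed
  have sm: "summable (\<lambda>m. (- \<alpha>) ^ m * (hf m * exp (- (s * (hf m)\<^sup>2))))"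
    by (rule summable_comparison_test'[OF summable_power_exp_hf[OF s, of 1], of 0]) (simp only: real_norm_def, rule hser_term_bound[OF a])
  have "(\<lambda>N. \<bar>\<Sum>m<N. (- \<alpha>) ^ m * (hf m * exp (- (s * (hf m)\<^sup>2)))\<bar>) \<longlonglongrightarrow> \<bar>hser \<alpha> s\<bar>"
    unfolding hser_def by (intro tendsto_rabs summable_LIMSEQ sm)
  moreover have "\<bar>\<Sum>m<N. (- \<alpha>) ^ m * (hf m * exp (- (s * (hf m)\<^sup>2)))\<bar> \<le> 3 * (exp (- (s / 8)) / sqrt s)" for N
    using order_trans[OF abs_sum_alternating_hf_le[of D N, OF dec D0] sum2[of N]] unfolding hser_term_eq D_def .
  ultimately show ?thesis by (intro LIMSEQ_le_const2) auto
qed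

lemma continuous_on_hser_alpha:
  assumes s: "0 < s" shows "continuous_on {0..1} (\<lambda>\<alpha>. hser \<alpha> s)"
  unfolding hser_def
  by (rule continuous_on_suminf_bounded[OF _ hser_term_bound summable_power_exp_hf[OF s]]) (auto intro!: continuous_intros)

lemma hser_measurable [measurable]: "hser \<alpha> \<in> borel_measurable borel"
  unfolding hser_def[abs_def] by measurable

lemma summable_power_hf:
  assumes "0 < \<alpha>" "\<alpha> < 1" shows "summable (\<lambda>n. \<alpha> ^ n * hf n)"
proof -
  have "summable (\<lambda>n. real n * \<alpha> ^ n + 1/2 * \<alpha> ^ n)"
  proof (intro summable_add summable_mult summable_geometric)
    have "summable (\<lambda>n. real n * \<alpha> ^ (n - 1))"
      using termdiff_converges[of \<alpha> 1 "\<lambda>_. 1"] assms by (simp add: diffs_def summable_geometric) (subst summable_Suc_iff[symmetric], simp add: mult.commute)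
    then have "summable (\<lambda>n. \<alpha> * (real n * \<alpha> ^ (n - 1)))" by (rule summable_mult)
    moreover have "\<alpha> * (real n * \<alpha> ^ (n - 1)) = real n * \<alpha> ^ n" for n by (cases n) auto
    ultimately show "summable (\<lambda>n. real n * \<alpha> ^ n)" by (simp only:)
  qed (use assms in auto)
  then show ?thesis by (simp add: hf_def algebra_simps)
qed

text \<open>Absolutely summable coefficients and one integrable majorant for all the functions allow
  sum and integral to be exchanged; the coefficients will be (- \<alpha>)^n \<open>hf n\<close> with
  \<alpha> < 1.\<close>

lemma sums_integral_dominated:
  fixes f :: "nat \<Rightarrow> 'b \<Rightarrow> real"
  assumes [measurable]: "\<And>n. f n \<in> borel_measurable N"
    and fG: "\<And>n x. x \<in> space N \<Longrightarrow> \<bar>f n x\<bar> \<le> G x" and G: "integrable N G" and a: "summable (\<lambda>n. \<bar>a n\<bar>)"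
  shows "(\<lambda>n. a n * (\<integral>x. f n x \<partial>N)) sums (\<integral>x. (\<Sum>n. a n * f n x) \<partial>N)"
proof -
  have fi: "integrable N (f n)" for n
    by (rule Bochner_Integration.integrable_bound[OF G]) (use fG in \<open>auto intro!: AE_I2 order_trans[OF fG abs_ge_self]\<close>)
  have ai: "integrable N (\<lambda>x. a n * f n x)" for n by (intro integrable_mult_right fi)
  have s1: "AE x in N. summable (\<lambda>n. norm (a n * f n x))"
  proof (rule AE_I2)
    fix x assume x: "x \<in> space N"
    show "summable (\<lambda>n. norm (a n * f n x))"
      by (rule summable_comparison_test'[OF summable_mult2[OF a, of "G x"], of 0])
         (use fG[OF x] in \<open>auto simp: abs_mult intro!: mult_left_mono\<close>)
  qed
  have s2: "summable (\<lambda>n. \<integral>x. norm (a n * f n x) \<partial>N)"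
  proof (rule summable_comparison_test'[OF summable_mult2[OF a, of "integral\<^sup>L N G"], of 0])
    fix n
    have "(\<integral>x. norm (a n * f n x) \<partial>N) \<le> (\<integral>x. \<bar>a n\<bar> * G x \<partial>N)"
      using ai G fG by (intro integral_mono) (auto simp: abs_mult intro!: mult_left_mono)
    moreover have "0 \<le> (\<integral>x. norm (a n * f n x) \<partial>N)" by (intro Bochner_Integration.integral_nonneg) simp
    ultimately show "norm (\<integral>x. norm (a n * f n x) \<partial>N) \<le> \<bar>a n\<bar> * integral\<^sup>L N G" using G by simp
  qed
  have "(\<lambda>n. \<integral>x. a n * f n x \<partial>N) sums (\<integral>x. (\<Sum>n. a n * f n x) \<partial>N)"
    by (rule sums_integral[OF ai s1 s2])
  then show ?thesis by (simp add: integral_mult_right_zero)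
qed

lemma sqrt_mult_exp_le: assumes "0 < s" shows "exp (- (s / 4)) \<le> 2 * (exp (- (s / 8)) / sqrt s)"
proof -
  have "0 \<le> (sqrt s - 2)\<^sup>2" by simp
  then have "sqrt s \<le> 2 * (1 + s / 8)" using assms by (simp add: power2_eq_square algebra_simps)
  also have "\<dots> \<le> 2 * exp (s / 8)" by (rule mult_left_mono[OF exp_ge_add_one_self]) simp
  finally have "sqrt s * exp (- (s / 4)) \<le> 2 * exp (s / 8) * exp (- (s / 4))" by (rule mult_right_mono) simp
  also have "\<dots> = 2 * exp (- (s / 8))" by (simp add: exp_add[symmetric])
  finally show ?thesis using assms by (simp add: field_simps)
qed

text \<open>Puts a single mode under the profile exp (- s/8) / sqrt s that bounds the full series
  \<open>hser\<close>, so that one integrable majorant serves both.\<close>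

lemma exp_hf_le: assumes "0 < s" shows "exp (- (s * (hf m)\<^sup>2)) \<le> 2 * (exp (- (s / 8)) / sqrt s)"
proof -
  have "s * (1/4) \<le> s * (hf m)\<^sup>2" using assms hf_sq_ge(2)[of m] by (intro mult_left_mono) auto
  then have "exp (- (s * (hf m)\<^sup>2)) \<le> exp (- (s / 4))" by simp
  then show ?thesis using sqrt_mult_exp_le[OF assms] by linarith
qed

text \<open>Both marginals are integrals of w times \<open>hser 1\<close> at \<sigma> and at \<tau>:
  over time with \<sigma>, \<tau> proportional to s and 1 - s, and over the level with both
  proportional to 1/z^2. What Abel summation asks for is the same in each case, integrability of the
  product of the two profiles.\<close>

locale abel_weight =
  fixes N :: "'b measure" and w \<sigma> \<tau> :: "'b \<Rightarrow> real"
  assumes meas [measurable]: "w \<in> borel_measurable N" "\<sigma> \<in> borel_measurable N" "\<tau> \<in> borel_measurable N"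
    and w_nonneg: "\<And>x. 0 \<le> w x"
    and pos: "\<And>x. w x \<noteq> 0 \<Longrightarrow> 0 < \<sigma> x \<and> 0 < \<tau> x"
    and G_integrable: "integrable N (\<lambda>x. w x * ((exp (- (\<sigma> x / 8)) / sqrt (\<sigma> x)) * (exp (- (\<tau> x / 8)) / sqrt (\<tau> x))))"
begin

definition G :: "'b \<Rightarrow> real" where "G x = w x * ((exp (- (\<sigma> x / 8)) / sqrt (\<sigma> x)) * (exp (- (\<tau> x / 8)) / sqrt (\<tau> x)))"

definition I :: "nat \<Rightarrow> nat \<Rightarrow> real" where
  "I m n = (\<integral>x. w x * (exp (- (\<sigma> x * (hf m)\<^sup>2)) * exp (- (\<tau> x * (hf n)\<^sup>2))) \<partial>N)"

lemma Gi: "integrable N G" using G_integrable unfolding G_def .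

lemma G_nonneg: "0 \<le> G x"
proof (cases "w x = 0")
  case False
  from pos[OF this] w_nonneg[of x] show ?thesis unfolding G_def by (intro mult_nonneg_nonneg divide_nonneg_nonneg) auto
qed (simp add: G_def)

lemma product_bound:
  assumes "\<And>s. 0 < s \<Longrightarrow> \<bar>f s\<bar> \<le> A * (exp (- (s / 8)) / sqrt s)" "\<And>s. 0 < s \<Longrightarrow> \<bar>g s\<bar> \<le> B * (exp (- (s / 8)) / sqrt s)" "0 \<le> A" "0 \<le> B"
  shows "\<bar>w x * (f (\<sigma> x) * g (\<tau> x))\<bar> \<le> A * B * G x"
proof (cases "w x = 0")
  case False
  from pos[OF this] have p: "0 < \<sigma> x" "0 < \<tau> x" by auto
  have "\<bar>f (\<sigma> x)\<bar> * \<bar>g (\<tau> x)\<bar> \<le> (A * (exp (- (\<sigma> x / 8)) / sqrt (\<sigma> x))) * (B * (exp (- (\<tau> x / 8)) / sqrt (\<tau> x)))"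
    using assms p by (intro mult_mono) auto
  then have "w x * (\<bar>f (\<sigma> x)\<bar> * \<bar>g (\<tau> x)\<bar>) \<le> w x * ((A * (exp (- (\<sigma> x / 8)) / sqrt (\<sigma> x))) * (B * (exp (- (\<tau> x / 8)) / sqrt (\<tau> x))))"
    using w_nonneg by (rule mult_left_mono)
  then show ?thesis using w_nonneg[of x] by (simp add: G_def abs_mult mult_ac)
qed (simp add: G_def)

lemma exp_abs_bound: "0 < s \<Longrightarrow> \<bar>exp (- (s * (hf m)\<^sup>2))\<bar> \<le> 2 * (exp (- (s / 8)) / sqrt s)"
  using exp_hf_le by simp

lemma hser_product_integrable:
  assumes "0 \<le> \<alpha>" "\<alpha> \<le> 1" "0 \<le> \<beta>" "\<beta> \<le> 1"
  shows "integrable N (\<lambda>x. w x * (hser \<alpha> (\<sigma> x) * hser \<beta> (\<tau> x)))"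
proof (rule Bochner_Integration.integrable_bound[OF integrable_mult_right[OF Gi, of "3 * 3"]])
  show "AE x in N. norm (w x * (hser \<alpha> (\<sigma> x) * hser \<beta> (\<tau> x))) \<le> norm (3 * 3 * G x)"
    by (intro AE_I2) (use order_trans[OF product_bound[OF hser_bound[OF assms(1,2)] hser_bound[OF assms(3,4)]] abs_ge_self] in simp)
qed measurable

lemma I_bound: "\<bar>I m n\<bar> \<le> 4 * integral\<^sup>L N G"
proof -
  have "\<bar>I m n\<bar> \<le> (\<integral>x. \<bar>w x * (exp (- (\<sigma> x * (hf m)\<^sup>2)) * exp (- (\<tau> x * (hf n)\<^sup>2)))\<bar> \<partial>N)"
    unfolding I_def by (rule integral_abs_bound)
  also have "\<dots> \<le> (\<integral>x. 4 * G x \<partial>N)"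
  proof (rule Bochner_Integration.integral_mono')
    show "integrable N (\<lambda>x. 4 * G x)" using Gi by simp
    show "\<bar>w x * (exp (- (\<sigma> x * (hf m)\<^sup>2)) * exp (- (\<tau> x * (hf n)\<^sup>2)))\<bar> \<le> 4 * G x" for x
      using product_bound[OF exp_abs_bound[of _ m] exp_abs_bound[of _ n], of x] by simp
  qed (use G_nonneg in simp)
  finally show ?thesis using Gi by simp
qed

text \<open>For \<alpha>, \<beta> < 1 the geometric weights make the factors \<open>hf\<close>
  summable, while all mode integrands lie below a multiple of \<open>G\<close>; the exchange is made
  one index at a time.\<close>

lemma double_series:
  assumes a: "0 < \<alpha>" "\<alpha> < 1" and b: "0 < \<beta>" "\<beta> < 1"
  shows "(\<lambda>n. (- \<beta>) ^ n * hf n * I m n) sums (\<integral>x. w x * (exp (- (\<sigma> x * (hf m)\<^sup>2)) * hser \<beta> (\<tau> x)) \<partial>N)" (is ?inner)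
    and "(\<lambda>m. (- \<alpha>) ^ m * hf m * (\<integral>x. w x * (exp (- (\<sigma> x * (hf m)\<^sup>2)) * hser \<beta> (\<tau> x)) \<partial>N)) sums
      (\<integral>x. w x * (hser \<alpha> (\<sigma> x) * hser \<beta> (\<tau> x)) \<partial>N)" (is ?outer)
proof -
  have abs: "summable (\<lambda>n. \<bar>(- c) ^ n * hf n\<bar>)" if "0 < c" "c < 1" for c
    using summable_power_hf[OF that] that by (simp add: abs_mult power_abs)
  have hs: "(\<Sum>n. ((- c) ^ n * hf n) * (v * exp (- (s * (hf n)\<^sup>2)))) = v * hser c s" if c: "0 < c" "c < 1" and s: "v \<noteq> 0 \<Longrightarrow> 0 < s" for c v s
  proof (cases "v = 0")
    case False
    then have s: "0 < s" using s by simp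
    have sm: "summable (\<lambda>m. (- c) ^ m * (hf m * exp (- (s * (hf m)\<^sup>2))))"
      by (rule summable_comparison_test'[OF summable_power_exp_hf[OF s, of 1], of 0]) (simp only: real_norm_def, rule hser_term_bound, use c in auto)
    show ?thesis unfolding hser_def suminf_mult[OF sm, symmetric] by (simp only: mult_ac)
  qed simp
  have i: "(\<lambda>n. ((- \<beta>) ^ n * hf n) * (\<integral>x. (w x * exp (- (\<sigma> x * (hf m)\<^sup>2))) * exp (- (\<tau> x * (hf n)\<^sup>2)) \<partial>N)) sums
     (\<integral>x. (\<Sum>n. ((- \<beta>) ^ n * hf n) * ((w x * exp (- (\<sigma> x * (hf m)\<^sup>2))) * exp (- (\<tau> x * (hf n)\<^sup>2)))) \<partial>N)"
  proof (rule sums_integral_dominated[OF _ _ integrable_mult_right[OF Gi, of "2 * 2"] abs[OF b]])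
    show "\<bar>(w x * exp (- (\<sigma> x * (hf m)\<^sup>2))) * exp (- (\<tau> x * (hf n)\<^sup>2))\<bar> \<le> 2 * 2 * G x" for n x
      using product_bound[OF exp_abs_bound[of _ m] exp_abs_bound[of _ n], of x] by (simp add: mult.assoc)
  qed measurable
  have "(\<Sum>n. ((- \<beta>) ^ n * hf n) * ((w x * exp (- (\<sigma> x * (hf m)\<^sup>2))) * exp (- (\<tau> x * (hf n)\<^sup>2)))) = w x * (exp (- (\<sigma> x * (hf m)\<^sup>2)) * hser \<beta> (\<tau> x))" for x
    using pos[of x] by (subst hs[OF b]) auto
  then show ?inner using i unfolding I_def by (simp only: mult.assoc)
  have o: "(\<lambda>m. ((- \<alpha>) ^ m * hf m) * (\<integral>x. (w x * hser \<beta> (\<tau> x)) * exp (- (\<sigma> x * (hf m)\<^sup>2)) \<partial>N)) sums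
     (\<integral>x. (\<Sum>m. ((- \<alpha>) ^ m * hf m) * ((w x * hser \<beta> (\<tau> x)) * exp (- (\<sigma> x * (hf m)\<^sup>2)))) \<partial>N)"
  proof (rule sums_integral_dominated[OF _ _ integrable_mult_right[OF Gi, of "2 * 3"] abs[OF a]])
    fix m x
    have "\<bar>w x * (exp (- (\<sigma> x * (hf m)\<^sup>2)) * hser \<beta> (\<tau> x))\<bar> \<le> 2 * 3 * G x"
      using b by (intro product_bound exp_abs_bound hser_bound) auto
    then show "\<bar>(w x * hser \<beta> (\<tau> x)) * exp (- (\<sigma> x * (hf m)\<^sup>2))\<bar> \<le> 2 * 3 * G x" by (simp only: mult_ac)
  qed measurable
  have "(\<Sum>m. ((- \<alpha>) ^ m * hf m) * ((w x * hser \<beta> (\<tau> x)) * exp (- (\<sigma> x * (hf m)\<^sup>2)))) = w x * (hser \<alpha> (\<sigma> x) * hser \<beta> (\<tau> x))" for x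
    using pos[of x] by (subst hs[OF a]) auto
  moreover have "(w x * hser \<beta> (\<tau> x)) * exp (- (\<sigma> x * (hf m)\<^sup>2)) = w x * (exp (- (\<sigma> x * (hf m)\<^sup>2)) * hser \<beta> (\<tau> x))" for x m by simp
  ultimately show ?outer using o by (simp only:)
qed

lemma abs_summable:
  assumes a: "0 < \<alpha>" "\<alpha> < 1" and b: "0 < \<beta>" "\<beta> < 1" and c: "\<And>m n. \<bar>c m n\<bar> \<le> hf m * hf n * C"
  shows "(\<lambda>(m, n). (\<alpha> ^ m * \<beta> ^ n) * \<bar>c m n\<bar>) summable_on UNIV" "(\<lambda>(m, n). (\<alpha> ^ m * \<beta> ^ n) * c m n) summable_on UNIV"
proof -
  have C0: "0 \<le> C" using c[of 0 0] by (simp add: hf_def)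
  have sm: "(\<lambda>n. c ^ n * hf n) summable_on UNIV" if "0 < c" "c < 1" for c
    using summable_power_hf[OF that] that by (intro norm_summable_imp_summable_on) (simp add: abs_mult)
  have nm: "norm ((\<alpha> ^ m * hf m) * (\<beta> ^ n * hf n)) = (\<alpha> ^ m * hf m) * (\<beta> ^ n * hf n)" for m n
    using a b by (simp add: abs_mult)
  have "Infinite_Sum.abs_summable_on (\<lambda>(m, n). (\<alpha> ^ m * hf m) * (\<beta> ^ n * hf n)) (UNIV \<times> UNIV)"
    unfolding Infinite_Sum.abs_summable_on_Sigma_iff case_prod_conv nm
  proof (intro conjI ballI)
    show "(\<lambda>n. (\<alpha> ^ m * hf m) * (\<beta> ^ n * hf n)) summable_on UNIV" for m
      by (intro summable_on_cmult_right sm b)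
    have "(\<Sum>\<^sub>\<infinity>n. (\<alpha> ^ m * hf m) * (\<beta> ^ n * hf n)) = (\<alpha> ^ m * hf m) * (\<Sum>\<^sub>\<infinity>n. \<beta> ^ n * hf n)" for m
      by (rule infsum_cmult_right') 
    moreover have "(\<lambda>m. (\<alpha> ^ m * hf m) * (\<Sum>\<^sub>\<infinity>n. \<beta> ^ n * hf n)) summable_on UNIV"
      by (intro summable_on_cmult_left sm a)
    ultimately have "(\<lambda>m. \<Sum>\<^sub>\<infinity>n. (\<alpha> ^ m * hf m) * (\<beta> ^ n * hf n)) summable_on UNIV" by (simp only:)
    then show "Infinite_Sum.abs_summable_on (\<lambda>m. \<Sum>\<^sub>\<infinity>n. (\<alpha> ^ m * hf m) * (\<beta> ^ n * hf n)) UNIV"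
      by (rule summable_on_iff_abs_summable_on_real[THEN iffD1])
  qed
  then have "(\<lambda>(m, n). (\<alpha> ^ m * hf m) * (\<beta> ^ n * hf n)) summable_on UNIV \<times> UNIV"
    by (rule summable_on_iff_abs_summable_on_real[THEN iffD2])
  then have "(\<lambda>p. C * ((\<lambda>(m, n). (\<alpha> ^ m * hf m) * (\<beta> ^ n * hf n)) p)) summable_on UNIV"
    by (intro summable_on_cmult_right) simp
  then have s: "Infinite_Sum.abs_summable_on (\<lambda>p. C * ((\<lambda>(m, n). (\<alpha> ^ m * hf m) * (\<beta> ^ n * hf n)) p)) UNIV"
    by (rule summable_on_iff_abs_summable_on_real[THEN iffD1])
  have ab: "Infinite_Sum.abs_summable_on (\<lambda>(m, n). (\<alpha> ^ m * \<beta> ^ n) * c m n) UNIV"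
  proof (rule Infinite_Sum.abs_summable_on_comparison_test[OF s])
    fix p :: "nat \<times> nat"
    obtain m n where p: "p = (m, n)" by (cases p)
    have "(\<alpha> ^ m * \<beta> ^ n) * \<bar>c m n\<bar> \<le> (\<alpha> ^ m * \<beta> ^ n) * (hf m * hf n * C)"
      using a b c by (intro mult_left_mono) auto
    then show "norm ((\<lambda>(m, n). (\<alpha> ^ m * \<beta> ^ n) * c m n) p) \<le> norm (C * ((\<lambda>(m, n). (\<alpha> ^ m * hf m) * (\<beta> ^ n * hf n)) p))"
      using a b C0 by (simp add: p abs_mult mult_ac)
  qed
  then show "(\<lambda>(m, n). (\<alpha> ^ m * \<beta> ^ n) * c m n) summable_on UNIV"
    by (rule summable_on_iff_abs_summable_on_real[THEN iffD2])
  have "norm ((\<lambda>(m, n). (\<alpha> ^ m * \<beta> ^ n) * c m n) p) = (\<lambda>(m, n). (\<alpha> ^ m * \<beta> ^ n) * \<bar>c m n\<bar>) p" for p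
    using a b by (cases p) (simp add: abs_mult)
  with ab show "(\<lambda>(m, n). (\<alpha> ^ m * \<beta> ^ n) * \<bar>c m n\<bar>) summable_on UNIV" by (simp only:)
qed

definition u :: "nat \<Rightarrow> nat \<Rightarrow> real" where "u m n = (-1) ^ (m + n) * (hf m * hf n) * I m n"

lemma u_bound: "\<bar>u m n\<bar> \<le> hf m * hf n * (4 * integral\<^sup>L N G)"
  unfolding u_def abs_mult using I_bound[of m n] by (simp add: power_abs mult_left_mono)

text \<open>Absolute summability reduces the unordered double sum to the iterated series evaluated
  by \<open>double_series\<close>.\<close>

lemma infsum_u:
  assumes a: "0 < \<alpha>" "\<alpha> < 1" and b: "0 < \<beta>" "\<beta> < 1"
  shows "(\<Sum>\<^sub>\<infinity>(m, n). (\<alpha> ^ m * \<beta> ^ n) * u m n) = (\<integral>x. w x * (hser \<alpha> (\<sigma> x) * hser \<beta> (\<tau> x)) \<partial>N)"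
proof -
  note s = abs_summable(2)[OF a b u_bound]
  have su: "infsum g UNIV = l" if "g summable_on UNIV" "g sums l" for g :: "nat \<Rightarrow> real" and l
    using has_sum_imp_sums[OF has_sum_infsum[OF that(1)]] that(2) sums_unique2 by blast
  have s': "(\<lambda>(m, n). (\<alpha> ^ m * \<beta> ^ n) * u m n) summable_on (UNIV \<times> UNIV)" using s by simp
  have eq: "(\<alpha> ^ m * \<beta> ^ n) * u m n = ((- \<alpha>) ^ m * hf m) * ((- \<beta>) ^ n * hf n * I m n)" for m n
    by (simp add: u_def power_add power_minus[of \<alpha>] power_minus[of \<beta>])
  have inner: "(\<Sum>\<^sub>\<infinity>n. (\<alpha> ^ m * \<beta> ^ n) * u m n) = (- \<alpha>) ^ m * hf m * (\<integral>x. w x * (exp (- (\<sigma> x * (hf m)\<^sup>2)) * hser \<beta> (\<tau> x)) \<partial>N)" for m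
  proof (rule su)
    have "(\<lambda>p. (\<lambda>(m, n). (\<alpha> ^ m * \<beta> ^ n) * u m n) p) summable_on (Pair m ` UNIV)"
      by (rule summable_on_subset_banach[OF s]) simp
    then show "(\<lambda>n. (\<alpha> ^ m * \<beta> ^ n) * u m n) summable_on UNIV"
      by (subst (asm) summable_on_reindex) (auto simp: inj_on_def o_def)
    show "(\<lambda>n. (\<alpha> ^ m * \<beta> ^ n) * u m n) sums ((- \<alpha>) ^ m * hf m * (\<integral>x. w x * (exp (- (\<sigma> x * (hf m)\<^sup>2)) * hser \<beta> (\<tau> x)) \<partial>N))"
      unfolding eq by (intro sums_mult double_series(1)[OF a b])
  qed
  have "(\<Sum>\<^sub>\<infinity>(m, n). (\<alpha> ^ m * \<beta> ^ n) * u m n) = (\<Sum>\<^sub>\<infinity>m. \<Sum>\<^sub>\<infinity>n. (\<alpha> ^ m * \<beta> ^ n) * u m n)"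
    using infsum_Sigma'_banach[OF s'] by simp
  also have "\<dots> = (\<Sum>\<^sub>\<infinity>m. (- \<alpha>) ^ m * hf m * (\<integral>x. w x * (exp (- (\<sigma> x * (hf m)\<^sup>2)) * hser \<beta> (\<tau> x)) \<partial>N))"
    by (simp only: inner)
  also have "\<dots> = (\<integral>x. w x * (hser \<alpha> (\<sigma> x) * hser \<beta> (\<tau> x)) \<partial>N)"
  proof (rule su)
    show "(\<lambda>m. (- \<alpha>) ^ m * hf m * (\<integral>x. w x * (exp (- (\<sigma> x * (hf m)\<^sup>2)) * hser \<beta> (\<tau> x)) \<partial>N)) summable_on UNIV"
      using summable_on_Sigma_banach[OF s'] by (simp only: inner)
  qed (rule double_series(2)[OF a b])
  finally show ?thesis .
qed

text \<open>Joint left limits approach (1, 1) inside the closed unit square, so continuity of the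
  damped integral on that square yields the Abel limit.\<close>

lemma filterlim_abel:
  "filterlim (\<lambda>p. p) (at (1, 1) within ({0..1} \<times> {0..1})) (at_left (1::real) \<times>\<^sub>F at_left (1::real))"
  unfolding filterlim_at
proof
  have ev: "\<forall>\<^sub>F x in at_left (1::real). 0 < x \<and> x < 1"
    using eventually_at_left_real[of 0 1] by (auto elim: eventually_mono)
  show "\<forall>\<^sub>F p in at_left (1::real) \<times>\<^sub>F at_left (1::real). p \<in> {0..1} \<times> {0..1} \<and> p \<noteq> (1, 1)"
    by (rule eventually_mono[OF eventually_prodI[OF ev ev]]) (auto simp: mem_Times_iff)
  have n: "at_left (1::real) \<le> nhds 1" by (rule at_within_le_nhds)
  have "((\<lambda>p. (fst p, snd p)) \<longlongrightarrow> (1, 1)) (at_left (1::real) \<times>\<^sub>F at_left (1::real))"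
    by (rule tendsto_Pair[OF filterlim_mono[OF filterlim_fst n order_refl] filterlim_mono[OF filterlim_snd n order_refl]])
  then show "filterlim (\<lambda>p. p) (nhds (1, 1)) (at_left (1::real) \<times>\<^sub>F at_left (1::real))" by (simp only: prod.collapse)
qed

lemma tendsto_abel:
  "((\<lambda>(\<alpha>, \<beta>). \<integral>x. w x * (hser \<alpha> (\<sigma> x) * hser \<beta> (\<tau> x)) \<partial>N) \<longlongrightarrow> (\<integral>x. w x * (hser 1 (\<sigma> x) * hser 1 (\<tau> x)) \<partial>N)) (at_left 1 \<times>\<^sub>F at_left 1)"
proof -
  let ?S = "{0..1} \<times> {0..1} :: (real \<times> real) set"
  define \<Phi> where "\<Phi> = (\<lambda>p. \<integral>x. w x * (hser (fst p) (\<sigma> x) * hser (snd p) (\<tau> x)) \<partial>N)"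
  have "continuous_on ?S \<Phi>"
    unfolding continuous_on_sequentially
  proof (intro allI ballI impI, elim conjE)
    fix X :: "nat \<Rightarrow> real \<times> real" and p assume p: "p \<in> ?S" and X: "\<forall>n. X n \<in> ?S" and lim: "X \<longlonglongrightarrow> p"
    have X': "0 \<le> fst (X n)" "fst (X n) \<le> 1" "0 \<le> snd (X n)" "snd (X n) \<le> 1" for n
      using X by (auto simp: mem_Times_iff)
    have p': "fst p \<in> {0..1}" "snd p \<in> {0..1}" using p by (auto simp: mem_Times_iff)
    have "(\<lambda>n. \<Phi> (X n)) \<longlonglongrightarrow> \<Phi> p"
      unfolding \<Phi>_def
    proof (rule integral_dominated_convergence[where w="\<lambda>x. 3 * 3 * G x"])
      show "integrable N (\<lambda>x. 3 * 3 * G x)" using Gi by simp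
      show "AE x in N. (\<lambda>n. w x * (hser (fst (X n)) (\<sigma> x) * hser (snd (X n)) (\<tau> x))) \<longlonglongrightarrow> w x * (hser (fst p) (\<sigma> x) * hser (snd p) (\<tau> x))"
      proof (rule AE_I2)
        fix x
        show "(\<lambda>n. w x * (hser (fst (X n)) (\<sigma> x) * hser (snd (X n)) (\<tau> x))) \<longlonglongrightarrow> w x * (hser (fst p) (\<sigma> x) * hser (snd p) (\<tau> x))"
        proof (cases "w x = 0")
          case False
          from pos[OF this] have q: "0 < \<sigma> x" "0 < \<tau> x" by auto
          have "(\<lambda>n. hser (fst (X n)) (\<sigma> x)) \<longlonglongrightarrow> hser (fst p) (\<sigma> x)"
            by (rule continuous_on_tendsto_compose[OF continuous_on_hser_alpha[OF q(1)] tendsto_fst[OF lim]]) (use p' X' in auto)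
          moreover have "(\<lambda>n. hser (snd (X n)) (\<tau> x)) \<longlonglongrightarrow> hser (snd p) (\<tau> x)"
            by (rule continuous_on_tendsto_compose[OF continuous_on_hser_alpha[OF q(2)] tendsto_snd[OF lim]]) (use p' X' in auto)
          ultimately show ?thesis by (rule tendsto_mult_left[OF tendsto_mult])
        qed simp
      qed
      show "AE x in N. norm (w x * (hser (fst (X n)) (\<sigma> x) * hser (snd (X n)) (\<tau> x))) \<le> 3 * 3 * G x" for n
        by (intro AE_I2) (use product_bound[OF hser_bound[OF X'(1,2)] hser_bound[OF X'(3,4)]] in simp)
    qed measurable
    then show "(\<Phi> \<circ> X) \<longlonglongrightarrow> \<Phi> p" by (simp add: o_def)
  qed
  then have "(\<Phi> \<longlongrightarrow> \<Phi> (1, 1)) (at (1, 1) within ?S)" by (rule continuous_on_def[THEN iffD1, rule_format]) simp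
  from filterlim_compose[OF this filterlim_abel] show ?thesis by (simp only: \<Phi>_def case_prod_unfold fst_conv snd_conv)
qed

theorem abel_sums2_u: "abel_sums2 u (\<integral>x. w x * (hser 1 (\<sigma> x) * hser 1 (\<tau> x)) \<partial>N)"
  unfolding abel_sums2_def
proof (intro conjI allI impI)
  fix \<alpha> :: real assume "0 < \<alpha> \<and> \<alpha> < 1"
  then have a: "0 < \<alpha>" "\<alpha> < 1" by auto
  show "(\<lambda>(m, n). \<alpha> ^ (m + n) * norm (u m n)) summable_on UNIV"
    using abs_summable(1)[OF a a u_bound] by (simp add: power_add)
next
  have ev: "\<forall>\<^sub>F x in at_left (1::real). 0 < x \<and> x < 1"
    using eventually_at_left_real[of 0 1] by (auto elim: eventually_mono)
  have "\<forall>\<^sub>F p in at_left (1::real) \<times>\<^sub>F at_left (1::real). (\<lambda>(\<alpha>, \<beta>). \<integral>x. w x * (hser \<alpha> (\<sigma> x) * hser \<beta> (\<tau> x)) \<partial>N) p =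
      (\<lambda>(\<alpha>\<^sub>1, \<alpha>\<^sub>2). \<Sum>\<^sub>\<infinity>(m, n). (\<alpha>\<^sub>1 ^ m * \<alpha>\<^sub>2 ^ n) *\<^sub>R u m n) p"
    by (rule eventually_mono[OF eventually_prodI[OF ev ev]]) (auto simp: infsum_u)
  then show "((\<lambda>(\<alpha>\<^sub>1, \<alpha>\<^sub>2). \<Sum>\<^sub>\<infinity>(m, n). (\<alpha>\<^sub>1 ^ m * \<alpha>\<^sub>2 ^ n) *\<^sub>R u m n) \<longlongrightarrow> (\<integral>x. w x * (hser 1 (\<sigma> x) * hser 1 (\<tau> x)) \<partial>N)) (at_left 1 \<times>\<^sub>F at_left 1)"
    by (rule Lim_transform_eventually[OF tendsto_abel])
qed

end

section \<open>The densities\<close>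

text \<open>The factor sqrt (2 pi) is the normalisation 1 / \<open>gk 1 0\<close> of the bridge, and
  pi^2 / z^4 is the constant of the boundary term. The cut-off confines it to the strip where both
  series converge and the level is positive.\<close>

definition fden :: "real \<Rightarrow> real \<Rightarrow> real" where
  "fden s z = (if 0 < s \<and> s < 1 \<and> 0 < z then
     sqrt (2 * pi) * (pi\<^sup>2 / z ^ 4 * (hser 1 (pi\<^sup>2 / (2 * z\<^sup>2) * s) * hser 1 (pi\<^sup>2 / (2 * z\<^sup>2) * (1 - s)))) else 0)"

lemma fden_nonneg: "0 \<le> fden s z"
  unfolding fden_def by (auto intro!: mult_nonneg_nonneg divide_nonneg_nonneg hser1_nonneg divide_pos_pos mult_pos_pos)

lemma fden_measurable [measurable]:
  "(\<lambda>p. fden (snd p) (fst p)) \<in> borel_measurable (borel \<Otimes>\<^sub>M borel)" "(\<lambda>p. fden (fst p) (snd p)) \<in> borel_measurable (borel \<Otimes>\<^sub>M borel)"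
  unfolding fden_def by measurable

text \<open>Pairs are ordered as (level, time), whereas \<open>fden\<close> takes the time
  first.\<close>

definition Dm :: "(real \<times> real) measure" where
  "Dm = density (lborel \<Otimes>\<^sub>M lborel) (\<lambda>p. ennreal (fden (snd p) (fst p)))"

lemma fden_measurable1 [measurable]: "(\<lambda>s. fden s z) \<in> borel_measurable borel"
  and fden_measurable2 [measurable]: "(\<lambda>z. fden s z) \<in> borel_measurable borel"
  unfolding fden_def by measurable

lemma sets_Dm [measurable_cong]: "sets Dm = sets (borel \<Otimes>\<^sub>M borel)"
  unfolding Dm_def sets_density by (rule sets_pair_measure_cong) simp_all

lemma emeasure_Dm:
  assumes [measurable]: "A \<in> sets borel" "B \<in> sets borel"
  shows "emeasure Dm (A \<times> B) = (\<integral>\<^sup>+ z. indicator A z * (\<integral>\<^sup>+ s. indicator B s * ennreal (fden s z) \<partial>lborel) \<partial>lborel)"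
    and "emeasure Dm (A \<times> B) = (\<integral>\<^sup>+ s. indicator B s * (\<integral>\<^sup>+ z. indicator A z * ennreal (fden s z) \<partial>lborel) \<partial>lborel)"
proof -
  let ?h = "\<lambda>p. ennreal (fden (snd p) (fst p)) * indicator (A \<times> B) p"
  have hm: "?h \<in> borel_measurable (lborel \<Otimes>\<^sub>M lborel)" by measurable
  have e: "emeasure Dm (A \<times> B) = (\<integral>\<^sup>+ p. ?h p \<partial>(lborel \<Otimes>\<^sub>M lborel))"
    unfolding Dm_def by (rule emeasure_density) measurable
  have h: "?h (z, s) = indicator A z * (indicator B s * ennreal (fden s z))" for z s
    by (simp add: indicator_times mult_ac)
  have h': "?h (z, s) = indicator B s * (indicator A z * ennreal (fden s z))" for z s
    by (simp add: indicator_times mult_ac)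
  show "emeasure Dm (A \<times> B) = (\<integral>\<^sup>+ z. indicator A z * (\<integral>\<^sup>+ s. indicator B s * ennreal (fden s z) \<partial>lborel) \<partial>lborel)"
    unfolding e lborel.nn_integral_fst[OF hm, symmetric] unfolding h by (subst nn_integral_cmult) simp_all
  show "emeasure Dm (A \<times> B) = (\<integral>\<^sup>+ s. indicator B s * (\<integral>\<^sup>+ z. indicator A z * ennreal (fden s z) \<partial>lborel) \<partial>lborel)"
    unfolding e lborel_pair.nn_integral_snd[OF hm, symmetric] unfolding h' by (subst nn_integral_cmult) simp_all
qed

lemma nn_integral_Ioc_Icc:
  fixes f :: "real \<Rightarrow> ennreal"
  shows "(\<integral>\<^sup>+ x. indicator {a<..c} x * f x \<partial>lborel) = (\<integral>\<^sup>+ x. indicator {a..c} x * f x \<partial>lborel)"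
proof (rule nn_integral_cong_AE)
  show "AE x in lborel. indicator {a<..c} x * f x = indicator {a..c} x * f x"
    using AE_lborel_singleton[of a] by eventually_elim (auto simp: indicator_def)
qed

context brownian_bridge
begin

text \<open>The increment of \<open>Ps\<close> in time is the integral of \<open>fden\<close> over
  time, so \<open>rectangle_probability\<close> becomes a double integral. The boxes keep away from
  level 0 and from times 0 and 1, where the derivative formula is not at hand.\<close>

lemma box_probability:
  assumes u: "0 < u1" "u2 < 1" and a: "0 < a"
  shows "emeasure P {\<omega> \<in> space P. u1 < Rh \<omega> \<and> Rh \<omega> \<le> u2 \<and> a < Mx \<omega> \<and> Mx \<omega> \<le> c} = emeasure Dm ({a<..c} \<times> {u1<..u2})"
proof (cases "u1 \<le> u2 \<and> a \<le> c")
  case False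
  then have "{\<omega> \<in> space P. u1 < Rh \<omega> \<and> Rh \<omega> \<le> u2 \<and> a < Mx \<omega> \<and> Mx \<omega> \<le> c} = {}" "{a<..c} \<times> {u1<..u2} = {}" by auto
  then show ?thesis by (simp only: emeasure_empty)
next
  case True
  then have u12: "u1 \<le> u2" and ac: "a \<le> c" by auto
  let ?p = "prob {\<omega> \<in> space P. u1 < Rh \<omega> \<and> Rh \<omega> \<le> u2 \<and> a < Mx \<omega> \<and> Mx \<omega> \<le> c}"
  define K where "K = (\<lambda>z. \<integral>\<^sup>+ s. indicator {u1..u2} s * ennreal (fden s z) \<partial>lborel)"
  have [measurable]: "K \<in> borel_measurable borel" unfolding K_def by measurable
  define H where "H = (\<lambda>z. sqrt (2 * pi) * (Ps u2 z z - Ps u1 z z))"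
  have KH: "K z = ennreal (H z) \<and> 0 \<le> H z" if z: "0 < z" for z
  proof -
    have eq: "fden s z = sqrt (2 * pi) * (pi\<^sup>2 / z ^ 4 * (hser 1 (pi\<^sup>2 / (2 * z\<^sup>2) * s) * hser 1 (pi\<^sup>2 / (2 * z\<^sup>2) * (1 - s))))" if "s \<in> {u1..u2}" for s
      using that u z by (simp add: fden_def)
    have "continuous_on {u1..u2} (\<lambda>s. sqrt (2 * pi) * (pi\<^sup>2 / z ^ 4 * (hser 1 (pi\<^sup>2 / (2 * z\<^sup>2) * s) * hser 1 (pi\<^sup>2 / (2 * z\<^sup>2) * (1 - s)))))"
      using u z by (intro continuous_on_mult continuous_on_const continuous_on_hser1 continuous_on_diff continuous_on_id) (auto intro!: mult_pos_pos divide_pos_pos)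
    then have cont: "continuous_on {u1..u2} (\<lambda>s. fden s z)" by (rule continuous_on_eq) (simp add: eq)
    have "K z = ennreal (integral {u1..u2} (\<lambda>s. fden s z))"
      unfolding K_def by (rule nn_integral_Icc_continuous[OF cont]) (rule fden_nonneg)
    also have "integral {u1..u2} (\<lambda>s. fden s z) = H z"
      unfolding H_def Ps_increment[OF u(1) u12 u(2) z] integral_mult_right[symmetric]
      by (rule Henstock_Kurzweil_Integration.integral_cong) (simp add: eq)
    finally have "K z = ennreal (H z)" "H z = integral {u1..u2} (\<lambda>s. fden s z)"
      using \<open>integral {u1..u2} (\<lambda>s. fden s z) = H z\<close> by simp_all
    moreover have "0 \<le> integral {u1..u2} (\<lambda>s. fden s z)"
      by (rule Henstock_Kurzweil_Integration.integral_nonneg[OF integrable_continuous_interval[OF cont]]) (rule fden_nonneg)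
    ultimately show ?thesis by simp
  qed
  have hi: "(H has_integral ?p) {a..c}"
    unfolding H_def by (rule rectangle_probability[OF u(1) u12 u(2) a ac])
  have "((\<lambda>z. enn2real (K z)) has_integral ?p) {a..c}"
    by (rule has_integral_eq[OF _ hi]) (use KH a in auto)
  then have "((\<lambda>z. if z \<in> {a..c} then enn2real (K z) else 0) has_integral ?p) UNIV"
    by (simp only: has_integral_restrict_UNIV)
  then have "(\<integral>\<^sup>+ z. ennreal (if z \<in> {a..c} then enn2real (K z) else 0) \<partial>lborel) = ennreal ?p"
    by (intro nn_integral_has_integral_lborel) auto
  moreover have "ennreal (if z \<in> {a..c} then enn2real (K z) else 0) = indicator {a..c} z * K z" for z
    using KH[of z] a by (auto simp: indicator_def)
  ultimately have "emeasure P {\<omega> \<in> space P. u1 < Rh \<omega> \<and> Rh \<omega> \<le> u2 \<and> a < Mx \<omega> \<and> Mx \<omega> \<le> c} = (\<integral>\<^sup>+ z. indicator {a..c} z * K z \<partial>lborel)"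
    by (simp add: emeasure_eq_measure)
  then show ?thesis by (simp add: emeasure_Dm(1) nn_integral_Ioc_Icc K_def)
qed

text \<open>Increasing boxes exhaust the part of the quadrant with positive level and time in (0,
  1). Nothing is lost on either side: the pair lies there almost surely, and \<open>fden\<close>
  vanishes elsewhere.\<close>

lemma joint_survival:
  "emeasure P {\<omega> \<in> space P. x < Rh \<omega> \<and> y < Mx \<omega>} = emeasure Dm ({y<..} \<times> {x<..})"
proof -
  define e where "e = (\<lambda>n::nat. 1 / (real n + 2))"
  have e0: "0 < e n" for n by (simp add: e_def)
  have e_dec: "e n \<le> e m" if "m \<le> n" for m n using that by (simp add: e_def frac_le)
  have e_small: "\<exists>N. \<forall>n\<ge>N. e n < d" if d: "0 < d" for d
  proof -
    obtain N where "inverse (real (Suc N)) < d" using reals_Archimedean[OF d] by blast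
    moreover have "e N \<le> inverse (real (Suc N))" by (simp add: e_def field_simps)
    ultimately show ?thesis using e_dec[of N] by (meson le_less_trans order_trans)
  qed
  define B where "B = (\<lambda>n::nat. {max y (e n)<..real n} \<times> {max x (e n)<..1 - e n})"
  define W where "W = (\<lambda>n::nat. {\<omega> \<in> space P. max x (e n) < Rh \<omega> \<and> Rh \<omega> \<le> 1 - e n \<and> max y (e n) < Mx \<omega> \<and> Mx \<omega> \<le> real n})"
  have incB: "incseq B" unfolding incseq_def B_def
  proof (intro allI impI)
    fix m n :: nat assume "m \<le> n"
    then show "{max y (e m)<..real m} \<times> {max x (e m)<..1 - e m} \<subseteq> {max y (e n)<..real n} \<times> {max x (e n)<..1 - e n}"
      using e_dec[of m n] by auto
  qed
  have W_B: "W n = {\<omega> \<in> space P. (Mx \<omega>, Rh \<omega>) \<in> B n}" for n by (auto simp: W_def B_def)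
  have incW: "incseq W" using incB unfolding incseq_def W_B by blast
  have eqn: "emeasure P (W n) = emeasure Dm (B n)" for n
    unfolding W_def B_def by (rule box_probability) (use e0[of n] in auto)
  have UB: "(\<Union>n. B n) = {max y 0<..} \<times> {max x 0<..<1}"
  proof (intro equalityI subsetI)
    fix p assume "p \<in> (\<Union>n. B n)"
    then obtain n where "p \<in> B n" by blast
    then show "p \<in> {max y 0<..} \<times> {max x 0<..<1}" using e0[of n] by (auto simp: B_def)
  next
    fix p assume "p \<in> {max y 0<..} \<times> {max x 0<..<1}"
    then obtain z s where p: "p = (z, s)" "y < z" "0 < z" "x < s" "0 < s" "s < 1" by auto
    obtain N1 where N1: "\<forall>n\<ge>N1. e n < z" using e_small p(3) by blast
    obtain N2 where N2: "\<forall>n\<ge>N2. e n < s" using e_small p(5) by blast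
    obtain N3 where N3: "\<forall>n\<ge>N3. e n < 1 - s" using e_small[of "1 - s"] p(6) by auto
    obtain N4 where N4: "z \<le> real N4" using real_arch_simple by blast
    define N where "N = max (max N1 N2) (max N3 N4)"
    have "e N < z" "e N < s" "e N < 1 - s" "z \<le> real N" using N1 N2 N3 N4 by (auto simp: N_def)
    then have "p \<in> B N" using p by (auto simp: B_def)
    then show "p \<in> (\<Union>n. B n)" by blast
  qed
  have mB: "range B \<subseteq> sets Dm" by (auto simp: B_def sets_Dm)
  have mW: "range W \<subseteq> sets P" unfolding W_def by auto
  have "emeasure P (\<Union>n. W n) = emeasure Dm (\<Union>n. B n)"
    using LIMSEQ_unique[OF Lim_emeasure_incseq[OF mW incW]] Lim_emeasure_incseq[OF mB incB] by (simp add: eqn)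
  also have "(\<Union>n. W n) = {\<omega> \<in> space P. (Mx \<omega>, Rh \<omega>) \<in> (\<Union>n. B n)}" unfolding W_B by blast
  finally have E: "emeasure P {\<omega> \<in> space P. (Mx \<omega>, Rh \<omega>) \<in> {max y 0<..} \<times> {max x 0<..<1}} = emeasure Dm ({max y 0<..} \<times> {max x 0<..<1})"
    unfolding UB .
  have "emeasure P {\<omega> \<in> space P. x < Rh \<omega> \<and> y < Mx \<omega>} = emeasure P {\<omega> \<in> space P. (Mx \<omega>, Rh \<omega>) \<in> {max y 0<..} \<times> {max x 0<..<1}}"
  proof (rule emeasure_eq_AE)
    show "AE \<omega> in P. \<omega> \<in> {\<omega> \<in> space P. x < Rh \<omega> \<and> y < Mx \<omega>} \<longleftrightarrow> \<omega> \<in> {\<omega> \<in> space P. (Mx \<omega>, Rh \<omega>) \<in> {max y 0<..} \<times> {max x 0<..<1}}"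
      using Mx_pos_Rh_interior by eventually_elim auto
  qed measurable
  moreover have "emeasure Dm ({max y 0<..} \<times> {max x 0<..<1}) = emeasure Dm ({y<..} \<times> {x<..})"
    unfolding emeasure_Dm(1)[of "{max y 0<..}" "{max x 0<..<1}", simplified] emeasure_Dm(1)[of "{y<..}" "{x<..}", simplified]
  proof (rule nn_integral_cong)
    fix z
    have "(\<integral>\<^sup>+ s. indicator {max x 0<..<1} s * ennreal (fden s z) \<partial>lborel) = (\<integral>\<^sup>+ s. indicator {x<..} s * ennreal (fden s z) \<partial>lborel)"
      by (rule nn_integral_cong) (auto simp: indicator_def fden_def)
    moreover have "(\<integral>\<^sup>+ s. indicator {x<..} s * ennreal (fden s z) \<partial>lborel) = 0" if "\<not> 0 < z"
      using that by (simp add: fden_def)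
    ultimately show "indicator {max y 0<..} z * (\<integral>\<^sup>+ s. indicator {max x 0<..<1} s * ennreal (fden s z) \<partial>lborel) = indicator {y<..} z * (\<integral>\<^sup>+ s. indicator {x<..} s * ennreal (fden s z) \<partial>lborel)"
      by (cases "0 < z") (auto simp: indicator_def)
  qed
  ultimately show ?thesis using E by simp
qed

lemma distributed_of_survival:
  fixes X :: "'a \<Rightarrow> real"
  assumes [measurable]: "X \<in> borel_measurable P" "h \<in> borel_measurable borel"
    and s: "\<And>x. emeasure P {\<omega> \<in> space P. x < X \<omega>} = (\<integral>\<^sup>+ z. indicator {x<..} z * h z \<partial>lborel)"
  shows "distributed P lborel X h"
  unfolding distributed_def
proof (intro conjI)
  have d: "emeasure (distr P lborel X) {x<..} = emeasure P {\<omega> \<in> space P. x < X \<omega>}" for x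
    by (subst emeasure_distr) (auto intro!: arg_cong[where f="emeasure P"])
  show "distr P lborel X = density lborel h"
  proof (rule measure_eqI_lessThan)
    show "emeasure (distr P lborel X) {x<..} < \<infinity>" for x unfolding d by (simp add: emeasure_eq_measure)
    show "emeasure (distr P lborel X) {x<..} = emeasure (density lborel h) {x<..}" for x
      unfolding d s by (subst emeasure_density) (auto simp: mult.commute)
  qed simp_all
qed simp_all

lemma distributed_Mx: "distributed P lborel Mx (\<lambda>z. \<integral>\<^sup>+ s. ennreal (fden s z) \<partial>lborel)"
proof (rule distributed_of_survival)
  fix y
  have "emeasure P {\<omega> \<in> space P. y < Mx \<omega>} = emeasure P {\<omega> \<in> space P. 0 < Rh \<omega> \<and> y < Mx \<omega>}"
    by (rule emeasure_eq_AE) (use Mx_pos_Rh_interior in \<open>auto elim: eventually_mono\<close>)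
  also have "\<dots> = (\<integral>\<^sup>+ z. indicator {y<..} z * (\<integral>\<^sup>+ s. indicator {0<..} s * ennreal (fden s z) \<partial>lborel) \<partial>lborel)"
    unfolding joint_survival by (rule emeasure_Dm) simp_all
  also have "\<dots> = (\<integral>\<^sup>+ z. indicator {y<..} z * (\<integral>\<^sup>+ s. ennreal (fden s z) \<partial>lborel) \<partial>lborel)"
    by (intro nn_integral_cong arg_cong2[where f=times] refl) (auto simp: indicator_def fden_def)
  finally show "emeasure P {\<omega> \<in> space P. y < Mx \<omega>} = (\<integral>\<^sup>+ z. indicator {y<..} z * (\<integral>\<^sup>+ s. ennreal (fden s z) \<partial>lborel) \<partial>lborel)" .
qed measurable

lemma distributed_Rh: "distributed P lborel Rh (\<lambda>s. \<integral>\<^sup>+ z. ennreal (fden s z) \<partial>lborel)"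
proof (rule distributed_of_survival)
  fix x
  have "emeasure P {\<omega> \<in> space P. x < Rh \<omega>} = emeasure P {\<omega> \<in> space P. x < Rh \<omega> \<and> 0 < Mx \<omega>}"
    by (rule emeasure_eq_AE) (use Mx_pos_Rh_interior in \<open>auto elim: eventually_mono\<close>)
  also have "\<dots> = (\<integral>\<^sup>+ s. indicator {x<..} s * (\<integral>\<^sup>+ z. indicator {0<..} z * ennreal (fden s z) \<partial>lborel) \<partial>lborel)"
    unfolding joint_survival by (rule emeasure_Dm) simp_all
  also have "\<dots> = (\<integral>\<^sup>+ s. indicator {x<..} s * (\<integral>\<^sup>+ z. ennreal (fden s z) \<partial>lborel) \<partial>lborel)"
    by (intro nn_integral_cong arg_cong2[where f=times] refl) (auto simp: indicator_def fden_def)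
  finally show "emeasure P {\<omega> \<in> space P. x < Rh \<omega>} = (\<integral>\<^sup>+ s. indicator {x<..} s * (\<integral>\<^sup>+ z. ennreal (fden s z) \<partial>lborel) \<partial>lborel)" .
qed measurable

end

section \<open>Linearity of Abel sums and the diagonal series\<close>

lemma abel_sums2_scale:
  fixes u :: "nat \<Rightarrow> nat \<Rightarrow> real"
  assumes "abel_sums2 u S" shows "abel_sums2 (\<lambda>m n. c * u m n) (c * S)"
  unfolding abel_sums2_def
proof (intro conjI allI impI)
  fix \<alpha> :: real assume "0 < \<alpha> \<and> \<alpha> < 1"
  then have "(\<lambda>(m, n). \<alpha> ^ (m + n) * norm (u m n)) summable_on UNIV"
    using assms by (simp add: abel_sums2_def)
  then have "(\<lambda>p. \<bar>c\<bar> * (case p of (m, n) \<Rightarrow> \<alpha> ^ (m + n) * norm (u m n))) summable_on UNIV"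
    by (rule summable_on_cmult_right)
  moreover have "\<bar>c\<bar> * (case p of (m, n) \<Rightarrow> \<alpha> ^ (m + n) * norm (u m n)) = (case p of (m, n) \<Rightarrow> \<alpha> ^ (m + n) * norm (c * u m n))" for p
    by (cases p) (simp add: abs_mult)
  ultimately show "(\<lambda>(m, n). \<alpha> ^ (m + n) * norm (c * u m n)) summable_on UNIV" by (simp only:)
next
  have "(\<Sum>\<^sub>\<infinity>(m, n). (a ^ m * b ^ n) *\<^sub>R (c * u m n)) = c * (\<Sum>\<^sub>\<infinity>(m, n). (a ^ m * b ^ n) *\<^sub>R u m n)" for a b
    unfolding infsum_cmult_right'[symmetric] by (rule infsum_cong) auto
  moreover have "((\<lambda>p. c * (case p of (\<alpha>\<^sub>1, \<alpha>\<^sub>2) \<Rightarrow> \<Sum>\<^sub>\<infinity>(m, n). (\<alpha>\<^sub>1 ^ m * \<alpha>\<^sub>2 ^ n) *\<^sub>R u m n)) \<longlongrightarrow> c * S) (at_left 1 \<times>\<^sub>F at_left 1)"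
    by (rule tendsto_mult_left) (use assms in \<open>simp add: abel_sums2_def\<close>)
  ultimately show "((\<lambda>(\<alpha>\<^sub>1, \<alpha>\<^sub>2). \<Sum>\<^sub>\<infinity>(m, n). (\<alpha>\<^sub>1 ^ m * \<alpha>\<^sub>2 ^ n) *\<^sub>R (c * u m n)) \<longlongrightarrow> c * S) (at_left 1 \<times>\<^sub>F at_left 1)"
    by (simp add: case_prod_unfold)
qed

lemma eventually_abel_parameters:
  "\<forall>\<^sub>F p in at_left (1::real) \<times>\<^sub>F at_left (1::real). (0 < fst p \<and> fst p < 1) \<and> 0 < snd p \<and> snd p < 1"
proof -
  have "\<forall>\<^sub>F x in at_left (1::real). 0 < x \<and> x < 1"
    using eventually_at_left_real[of 0 1] by (auto elim: eventually_mono)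
  from eventually_prodI[OF this this] show ?thesis .
qed

text \<open>The definition gives absolute summability for equal parameters; two different ones are
  dominated by their maximum.\<close>

lemma abel_sums2_summable:
  fixes u :: "nat \<Rightarrow> nat \<Rightarrow> real"
  assumes u: "abel_sums2 u S" and a: "0 < a" "a < 1" and b: "0 < b" "b < 1"
  shows "(\<lambda>(m, n). (a ^ m * b ^ n) *\<^sub>R u m n) summable_on UNIV"
proof (rule summable_on_iff_abs_summable_on_real[THEN iffD2])
  let ?c = "max a b"
  have "(\<lambda>(m, n). ?c ^ (m + n) * norm (u m n)) summable_on UNIV"
    using u a b by (simp add: abel_sums2_def max_def)
  then show "Infinite_Sum.abs_summable_on (\<lambda>(m, n). (a ^ m * b ^ n) *\<^sub>R u m n) UNIV"
  proof (rule summable_on_comparison_test)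
    fix p :: "nat \<times> nat"
    obtain m n where p: "p = (m, n)" by (cases p)
    have "a ^ m * b ^ n \<le> ?c ^ m * ?c ^ n" using a b by (intro mult_mono power_mono) auto
    then have "(a ^ m * b ^ n) * norm (u m n) \<le> ?c ^ (m + n) * norm (u m n)"
      unfolding power_add by (rule mult_right_mono) simp
    then show "norm ((\<lambda>(m, n). (a ^ m * b ^ n) *\<^sub>R u m n) p) \<le> (\<lambda>(m, n). ?c ^ (m + n) * norm (u m n)) p"
      using a b by (simp add: p abs_mult)
  qed simp
qed

lemma abel_sums2_diff:
  fixes u v :: "nat \<Rightarrow> nat \<Rightarrow> real"
  assumes u: "abel_sums2 u S" and v: "abel_sums2 v T"
  shows "abel_sums2 (\<lambda>m n. u m n - v m n) (S - T)"
  unfolding abel_sums2_def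
proof (intro conjI allI impI)
  fix \<alpha> :: real assume a: "0 < \<alpha> \<and> \<alpha> < 1"
  have "(\<lambda>(m, n). \<alpha> ^ (m + n) * norm (u m n)) summable_on UNIV" "(\<lambda>(m, n). \<alpha> ^ (m + n) * norm (v m n)) summable_on UNIV"
    using u v a by (simp_all add: abel_sums2_def)
  then have "(\<lambda>p. (\<lambda>(m, n). \<alpha> ^ (m + n) * norm (u m n)) p + (\<lambda>(m, n). \<alpha> ^ (m + n) * norm (v m n)) p) summable_on UNIV"
    by (rule summable_on_add)
  then show "(\<lambda>(m, n). \<alpha> ^ (m + n) * norm (u m n - v m n)) summable_on UNIV"
  proof (rule summable_on_comparison_test)
    fix p :: "nat \<times> nat"
    obtain m n where p: "p = (m, n)" by (cases p)
    have "\<alpha> ^ (m + n) * norm (u m n - v m n) \<le> \<alpha> ^ (m + n) * (norm (u m n) + norm (v m n))"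
      using a norm_triangle_ineq4 by (intro mult_left_mono) auto
    then show "(\<lambda>(m, n). \<alpha> ^ (m + n) * norm (u m n - v m n)) p \<le> (\<lambda>(m, n). \<alpha> ^ (m + n) * norm (u m n)) p + (\<lambda>(m, n). \<alpha> ^ (m + n) * norm (v m n)) p"
      by (simp add: p algebra_simps)
    show "0 \<le> (\<lambda>(m, n). \<alpha> ^ (m + n) * norm (u m n - v m n)) p" using a by (simp add: p)
  qed
next
  have l: "((\<lambda>p. (case p of (\<alpha>\<^sub>1, \<alpha>\<^sub>2) \<Rightarrow> \<Sum>\<^sub>\<infinity>(m, n). (\<alpha>\<^sub>1 ^ m * \<alpha>\<^sub>2 ^ n) *\<^sub>R u m n) - (case p of (\<alpha>\<^sub>1, \<alpha>\<^sub>2) \<Rightarrow> \<Sum>\<^sub>\<infinity>(m, n). (\<alpha>\<^sub>1 ^ m * \<alpha>\<^sub>2 ^ n) *\<^sub>R v m n)) \<longlongrightarrow> S - T) (at_left 1 \<times>\<^sub>F at_left 1)"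
    by (rule tendsto_diff) (use u v in \<open>simp_all add: abel_sums2_def\<close>)
  show "((\<lambda>(\<alpha>\<^sub>1, \<alpha>\<^sub>2). \<Sum>\<^sub>\<infinity>(m, n). (\<alpha>\<^sub>1 ^ m * \<alpha>\<^sub>2 ^ n) *\<^sub>R (u m n - v m n)) \<longlongrightarrow> S - T) (at_left 1 \<times>\<^sub>F at_left 1)"
  proof (rule Lim_transform_eventually[OF l], rule eventually_mono[OF eventually_abel_parameters])
    fix p :: "real \<times> real" assume p: "(0 < fst p \<and> fst p < 1) \<and> 0 < snd p \<and> snd p < 1"
    obtain a b where ab: "p = (a, b)" by (cases p)
    have "(\<Sum>\<^sub>\<infinity>q. (case q of (m, n) \<Rightarrow> (a ^ m * b ^ n) *\<^sub>R u m n) - (case q of (m, n) \<Rightarrow> (a ^ m * b ^ n) *\<^sub>R v m n)) =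
      (\<Sum>\<^sub>\<infinity>(m, n). (a ^ m * b ^ n) *\<^sub>R u m n) - (\<Sum>\<^sub>\<infinity>(m, n). (a ^ m * b ^ n) *\<^sub>R v m n)"
    proof (rule infsumI)
      have "(\<lambda>(m, n). (a ^ m * b ^ n) *\<^sub>R u m n) summable_on UNIV" "(\<lambda>(m, n). (a ^ m * b ^ n) *\<^sub>R v m n) summable_on UNIV"
        using p ab abel_sums2_summable[OF u] abel_sums2_summable[OF v] by auto
      from has_sum_add[OF has_sum_infsum[OF this(1)] has_sum_cmult_right[OF has_sum_infsum[OF this(2)], of "-1"]]
      show "((\<lambda>q. (case q of (m, n) \<Rightarrow> (a ^ m * b ^ n) *\<^sub>R u m n) - (case q of (m, n) \<Rightarrow> (a ^ m * b ^ n) *\<^sub>R v m n)) has_sum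
        (\<Sum>\<^sub>\<infinity>(m, n). (a ^ m * b ^ n) *\<^sub>R u m n) - (\<Sum>\<^sub>\<infinity>(m, n). (a ^ m * b ^ n) *\<^sub>R v m n)) UNIV" by simp
    qed
    moreover have "(case q of (m, n) \<Rightarrow> (a ^ m * b ^ n) *\<^sub>R u m n) - (case q of (m, n) \<Rightarrow> (a ^ m * b ^ n) *\<^sub>R v m n) = (case q of (m, n) \<Rightarrow> (a ^ m * b ^ n) *\<^sub>R (u m n - v m n))" for q
      by (cases q) (simp add: algebra_simps)
    ultimately have "(\<Sum>\<^sub>\<infinity>(m, n). (a ^ m * b ^ n) *\<^sub>R (u m n - v m n)) = (\<Sum>\<^sub>\<infinity>(m, n). (a ^ m * b ^ n) *\<^sub>R u m n) - (\<Sum>\<^sub>\<infinity>(m, n). (a ^ m * b ^ n) *\<^sub>R v m n)"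
      by (simp only:)
    then show "(case p of (\<alpha>\<^sub>1, \<alpha>\<^sub>2) \<Rightarrow> \<Sum>\<^sub>\<infinity>(m, n). (\<alpha>\<^sub>1 ^ m * \<alpha>\<^sub>2 ^ n) *\<^sub>R u m n) - (case p of (\<alpha>\<^sub>1, \<alpha>\<^sub>2) \<Rightarrow> \<Sum>\<^sub>\<infinity>(m, n). (\<alpha>\<^sub>1 ^ m * \<alpha>\<^sub>2 ^ n) *\<^sub>R v m n) =
      (case p of (\<alpha>\<^sub>1, \<alpha>\<^sub>2) \<Rightarrow> \<Sum>\<^sub>\<infinity>(m, n). (\<alpha>\<^sub>1 ^ m * \<alpha>\<^sub>2 ^ n) *\<^sub>R (u m n - v m n))"
      unfolding ab prod.case by (rule sym)
  qed
qed

text \<open>On the diagonal the damping is a power of the product of the two parameters. With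
  summable nonnegative terms the power series is continuous up to 1, so the Abel sum is the ordinary
  sum.\<close>

lemma abel_sums2_diagonal:
  fixes a :: "nat \<Rightarrow> real"
  assumes s: "summable a" and a: "\<And>n. 0 \<le> a n"
  shows "abel_sums2 (\<lambda>m n. if m = n then a n else 0) (suminf a)"
proof -
  let ?d = "\<lambda>m n. if m = n then a n else 0"
  have diag: "(\<lambda>(m, n). g m n * ?d m n) summable_on UNIV \<and> (\<Sum>\<^sub>\<infinity>(m, n). g m n * ?d m n) = (\<Sum>n. g n n * a n)"
    if g: "\<And>n. 0 \<le> g n n \<and> g n n \<le> 1" for g :: "nat \<Rightarrow> nat \<Rightarrow> real"
  proof -
    have sm: "summable (\<lambda>n. norm (g n n * a n))"
    proof (rule summable_comparison_test'[OF s, of 0])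
      fix n
      have "g n n * a n \<le> 1 * a n" using g[of n] a by (intro mult_right_mono) auto
      then show "norm (norm (g n n * a n)) \<le> a n" using g[of n] a by (simp add: abs_mult)
    qed
    have hs: "((\<lambda>n. g n n * a n) has_sum (\<Sum>n. g n n * a n)) UNIV"
      by (rule norm_summable_imp_has_sum[OF sm summable_sums[OF summable_norm_cancel[OF sm]]])
    have "((\<lambda>(m, n). g m n * ?d m n) has_sum (\<Sum>n. g n n * a n)) (range (\<lambda>n. (n, n)))"
      by (subst has_sum_reindex) (use hs in \<open>auto simp: inj_on_def o_def\<close>)
    moreover have "((\<lambda>(m, n). g m n * ?d m n) has_sum (\<Sum>n. g n n * a n)) (range (\<lambda>n. (n, n))) \<longleftrightarrow> ((\<lambda>(m, n). g m n * ?d m n) has_sum (\<Sum>n. g n n * a n)) UNIV"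
      by (rule has_sum_cong_neutral) auto
    ultimately have "((\<lambda>(m, n). g m n * ?d m n) has_sum (\<Sum>n. g n n * a n)) UNIV" by blast
    then show ?thesis using has_sum_imp_summable infsumI by blast
  qed
  show ?thesis
    unfolding abel_sums2_def
  proof (intro conjI allI impI)
    fix \<alpha> :: real assume "0 < \<alpha> \<and> \<alpha> < 1"
    then have "(\<lambda>(m, n). \<alpha> ^ (m + n) * ?d m n) summable_on UNIV"
      by (intro diag[THEN conjunct1]) (auto simp: power_le_one)
    moreover have "norm (?d m n) = ?d m n" for m n using a by simp
    ultimately show "(\<lambda>(m, n). \<alpha> ^ (m + n) * norm (?d m n)) summable_on UNIV" by (simp only:)
  next
    have c: "continuous_on {0..1} (\<lambda>x. \<Sum>n. x ^ n * a n)"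
    proof (rule continuous_on_suminf_bounded[OF _ _ s])
      show "\<bar>x ^ n * a n\<bar> \<le> a n" if "x \<in> {0..1}" for x n
      proof -
        have "x ^ n * a n \<le> 1 * a n" using that a by (intro mult_right_mono power_le_one) auto
        then show ?thesis using that a by (simp add: abs_mult)
      qed
    qed (intro continuous_intros)
    have "((\<lambda>p. fst p * snd p) \<longlongrightarrow> 1 * 1) (at_left (1::real) \<times>\<^sub>F at_left (1::real))"
    proof (rule tendsto_mult)
      have n: "at_left (1::real) \<le> nhds 1" by (rule at_within_le_nhds)
      show "(fst \<longlongrightarrow> 1) (at_left (1::real) \<times>\<^sub>F at_left (1::real))" by (rule filterlim_mono[OF filterlim_fst n order_refl])
      show "(snd \<longlongrightarrow> 1) (at_left (1::real) \<times>\<^sub>F at_left (1::real))" by (rule filterlim_mono[OF filterlim_snd n order_refl])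
    qed
    then have "((\<lambda>p. \<Sum>n. (fst p * snd p) ^ n * a n) \<longlongrightarrow> (\<Sum>n. 1 ^ n * a n)) (at_left (1::real) \<times>\<^sub>F at_left (1::real))"
    proof (intro continuous_on_tendsto_compose[OF c])
      show "\<forall>\<^sub>F p in at_left (1::real) \<times>\<^sub>F at_left (1::real). fst p * snd p \<in> {0..1}"
        by (rule eventually_mono[OF eventually_abel_parameters]) (auto intro!: mult_le_one)
    qed simp_all
    then have l: "((\<lambda>p. \<Sum>n. (fst p * snd p) ^ n * a n) \<longlongrightarrow> suminf a) (at_left (1::real) \<times>\<^sub>F at_left (1::real))" by simp
    show "((\<lambda>(\<alpha>\<^sub>1, \<alpha>\<^sub>2). \<Sum>\<^sub>\<infinity>(m, n). (\<alpha>\<^sub>1 ^ m * \<alpha>\<^sub>2 ^ n) *\<^sub>R ?d m n) \<longlongrightarrow> suminf a) (at_left 1 \<times>\<^sub>F at_left 1)"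
    proof (rule Lim_transform_eventually[OF l], rule eventually_mono[OF eventually_abel_parameters])
      fix p :: "real \<times> real" assume p: "(0 < fst p \<and> fst p < 1) \<and> 0 < snd p \<and> snd p < 1"
      have "(\<Sum>\<^sub>\<infinity>(m, n). (fst p ^ m * snd p ^ n) * ?d m n) = (\<Sum>n. (fst p ^ n * snd p ^ n) * a n)"
        by (rule diag[THEN conjunct2]) (use p in \<open>auto simp: power_le_one mult_le_one\<close>)
      then show "(\<Sum>n. (fst p * snd p) ^ n * a n) = (case p of (\<alpha>\<^sub>1, \<alpha>\<^sub>2) \<Rightarrow> \<Sum>\<^sub>\<infinity>(m, n). (\<alpha>\<^sub>1 ^ m * \<alpha>\<^sub>2 ^ n) *\<^sub>R ?d m n)"
        by (simp only: power_mult_distrib case_prod_unfold real_scaleR_def)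
    qed
  qed
qed

section \<open>Explicit integrals and the two weights\<close>

lemma arcsine_integrable: "integrable lborel (\<lambda>s. indicator {0<..<1} s * (1 / (sqrt s * sqrt (1 - s))))"
proof -
  \<comment> \<open>A primitive of the arcsine density up to its constant, continuous up to both
    singular endpoints.\<close>
  let ?F = "\<lambda>s::real. arcsin (2 * s - 1)"
  have c: "continuous_on {0..1} ?F" by (intro continuous_on_arcsin continuous_intros) auto
  have "set_integrable lborel (einterval 0 1) (\<lambda>s. 1 / (sqrt s * sqrt (1 - s)))"
  proof (rule interval_integral_FTC_nonneg(1)[where F="?F" and A="?F 0" and B="?F 1"])
    fix s :: real assume "0 < ereal s" "ereal s < 1"
    then have s: "0 < s" "s < 1" by (simp_all add: zero_ereal_def one_ereal_def)
    have "(?F has_real_derivative inverse (sqrt (1 - (2 * s - 1)\<^sup>2)) * 2) (at s)"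
      by (rule DERIV_chain2[OF DERIV_arcsin]) (use s in \<open>auto intro!: derivative_eq_intros\<close>)
    moreover have "1 - (2 * s - 1)\<^sup>2 = 2\<^sup>2 * (s * (1 - s))" by (simp add: power2_eq_square algebra_simps)
    then have "sqrt (1 - (2 * s - 1)\<^sup>2) = 2 * (sqrt s * sqrt (1 - s))" by (simp only: real_sqrt_mult real_sqrt_abs abs_numeral)
    then have "inverse (sqrt (1 - (2 * s - 1)\<^sup>2)) * 2 = 1 / (sqrt s * sqrt (1 - s))" by (simp add: field_simps)
    ultimately show "(?F has_real_derivative 1 / (sqrt s * sqrt (1 - s))) (at s)" by simp
    show "isCont (\<lambda>s. 1 / (sqrt s * sqrt (1 - s))) s" using s by (intro continuous_intros) auto
  next
    show "((?F \<circ> real_of_ereal) \<longlongrightarrow> ?F 0) (at_right 0)"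
      unfolding zero_ereal_def ereal_tendsto_simps by (rule continuous_on_Icc_at_rightD[OF c]) simp
    show "((?F \<circ> real_of_ereal) \<longlongrightarrow> ?F 1) (at_left 1)"
      unfolding one_ereal_def ereal_tendsto_simps by (rule continuous_on_Icc_at_leftD[OF c]) simp
    show "AE x in lborel. 0 < ereal x \<longrightarrow> ereal x < 1 \<longrightarrow> 0 \<le> 1 / (sqrt x * sqrt (1 - x))"
      by (rule AE_I2) (auto simp: zero_ereal_def one_ereal_def)
  qed simp
  moreover have "einterval 0 1 = {0<..<1::real}" by (auto simp: einterval_def zero_ereal_def one_ereal_def)
  ultimately show ?thesis by (simp add: set_integrable_def)
qed

text \<open>The substitution z = sqrt c / x turns the integral into an even moment of the Gaussian.
  k = 0 provides the integrable majorant over the level, k = 1 the value of each mode pair.\<close>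

lemma inverse_gaussian_moment:
  assumes c: "0 < c"
  shows "has_bochner_integral lborel (\<lambda>z. indicator {0<..} z * (exp (- (c / z\<^sup>2)) / z ^ (2 * k + 2)))
    (sqrt pi / 2 * (fact (2 * k) / (2 ^ (2 * k) * fact k)) / sqrt c ^ (2 * k + 1))"
proof -
  define r where "r = sqrt c"
  have r: "0 < r" "r\<^sup>2 = c" using c by (auto simp: r_def)
  define I where "I = sqrt pi / 2 * (fact (2 * k) / (2 ^ (2 * k) * fact k))"
  let ?f = "\<lambda>z::real. exp (- (c / z\<^sup>2)) / z ^ (2 * k + 2)"
  let ?g = "\<lambda>x::real. r / x"
  let ?h = "\<lambda>x::real. exp (- x\<^sup>2) * x ^ (2 * k) / r ^ (2 * k + 1)"
  have h: "\<bar>- (r / x\<^sup>2)\<bar> * ?f (?g x) = ?h x" if x: "x \<in> {0<..}" for x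
  proof -
    have "c / (r / x)\<^sup>2 = x\<^sup>2" using r x c by (simp add: power_divide)
    moreover have "r / x\<^sup>2 / (r / x) ^ (2 * k + 2) = x ^ (2 * k) / r ^ (2 * k + 1)"
      using r(1) x by (simp add: power_divide power_add power2_eq_square)
    moreover have "\<bar>- (r / x\<^sup>2)\<bar> * (E / Y) = E * (r / x\<^sup>2 / Y)" "E * x ^ (2 * k) / Z = E * (x ^ (2 * k) / Z)" for E Y Z
      using r(1) x by simp_all
    ultimately show ?thesis by (simp only:)
  qed
  have "has_bochner_integral lborel (\<lambda>x::real. indicator {0..} x *\<^sub>R (exp (- x\<^sup>2) * x ^ (2 * k))) I"
    unfolding I_def by (rule gaussian_moment_even_pos)
  then have "has_bochner_integral lborel (\<lambda>x::real. (indicator {0..} x *\<^sub>R (exp (- x\<^sup>2) * x ^ (2 * k))) / r ^ (2 * k + 1)) (I / r ^ (2 * k + 1))"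
    by (rule has_bochner_integral_divide_zero)
  moreover have "AE x in lborel. (indicator {0..} x *\<^sub>R (exp (- x\<^sup>2) * x ^ (2 * k))) / r ^ (2 * k + 1) = indicator {0<..} x *\<^sub>R ?h x"
    using AE_lborel_singleton[of "0::real"] by eventually_elim (auto simp: indicator_def)
  ultimately have hb: "has_bochner_integral lborel (\<lambda>x. indicator {0<..} x *\<^sub>R ?h x) (I / r ^ (2 * k + 1))"
    by (subst (asm) has_bochner_integral_cong_AE) auto
  have hs: "set_integrable lborel {0<..} ?h" using hb by (simp add: set_integrable_def has_bochner_integral_iff)
  have "?h absolutely_integrable_on {0<..}" using hs unfolding set_integrable_def by (subst integrable_completion) auto
  moreover have "integral {0<..} ?h = I / r ^ (2 * k + 1)"
    unfolding set_borel_integral_eq_integral(2)[OF hs, symmetric] set_lebesgue_integral_def by (rule has_bochner_integral_integral_eq[OF hb])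
  moreover have "(\<lambda>x. \<bar>- (r / x\<^sup>2)\<bar> * ?f (?g x)) absolutely_integrable_on {0<..} \<longleftrightarrow> ?h absolutely_integrable_on {0<..}"
    by (rule set_integrable_cong[OF refl refl h])
  moreover have "integral {0<..} (\<lambda>x. \<bar>- (r / x\<^sup>2)\<bar> * ?f (?g x)) = integral {0<..} ?h"
    by (rule Henstock_Kurzweil_Integration.integral_cong[OF h])
  ultimately have "(\<lambda>x. \<bar>- (r / x\<^sup>2)\<bar> * ?f (?g x)) absolutely_integrable_on {0<..} \<and> integral {0<..} (\<lambda>x. \<bar>- (r / x\<^sup>2)\<bar> * ?f (?g x)) = I / r ^ (2 * k + 1)"
    by (simp only: simp_thms)
  then have 1: "?f absolutely_integrable_on (?g ` {0<..}) \<and> integral (?g ` {0<..}) ?f = I / r ^ (2 * k + 1)"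
  proof (rule has_absolute_integral_change_of_variables_1'[where f="?f" and g="?g" and g'="\<lambda>x. - (r / x\<^sup>2)" and S="{0<..}", THEN iffD1, rotated -1])
    show "(?g has_field_derivative - (r / x\<^sup>2)) (at x within {0<..})" if "x \<in> {0<..}" for x
      using that by (auto intro!: derivative_eq_intros simp: power2_eq_square)
    show "inj_on ?g {0<..}" using r by (auto simp: inj_on_def)
  qed auto
  have "?g ` {0<..} = {0<..}"
  proof (intro equalityI subsetI)
    fix x :: real assume "x \<in> {0<..}"
    then show "x \<in> ?g ` {0<..}" using r by (intro image_eqI[of _ _ "r / x"]) auto
  qed (use r in auto)
  with 1 have 2: "?f absolutely_integrable_on {0<..}" "integral {0<..} ?f = I / r ^ (2 * k + 1)" by simp_all
  have 3: "set_integrable lborel {0<..} ?f" using 2(1) unfolding set_integrable_def by (subst (asm) integrable_completion) auto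
  have "(LINT x:{0<..}|lborel. ?f x) = I / r ^ (2 * k + 1)"
    using set_borel_integral_eq_integral(2)[OF 3] 2(2) by simp
  then show ?thesis using 3 by (simp add: has_bochner_integral_iff set_integrable_def set_lebesgue_integral_def I_def r_def)
qed

text \<open>Equal exponents give the diagonal series of the density of the maximum, different ones
  the divided differences of its double series.\<close>

lemma integral_exp_pair:
  fixes a b :: real
  assumes k: "0 < k"
  shows "(\<integral>s. indicator {0<..<1} s * (exp (- (k * s * a)) * exp (- (k * (1 - s) * b))) \<partial>lborel) =
    (if a = b then exp (- (k * b)) else (exp (- (k * b)) - exp (- (k * a))) / (k * (a - b)))"
proof -
  define d where "d = k * (a - b)"
  have e: "exp (- (k * s * a)) * exp (- (k * (1 - s) * b)) = exp (- (k * b)) * exp (- (d * s))" for s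
    unfolding exp_add[symmetric] by (rule arg_cong[where f=exp]) (simp add: d_def algebra_simps)
  have "(\<integral>s. indicator {0<..<1} s * (exp (- (k * s * a)) * exp (- (k * (1 - s) * b))) \<partial>lborel) =
     (\<integral>s. (exp (- (k * b)) * exp (- (d * s))) * indicator {0..1} s \<partial>lborel)"
  proof (rule integral_cong_AE)
    show "AE s in lborel. indicator {0<..<1} s * (exp (- (k * s * a)) * exp (- (k * (1 - s) * b))) = (exp (- (k * b)) * exp (- (d * s))) * indicator {0..1} s"
      using AE_lborel_singleton[of "0::real"] AE_lborel_singleton[of "1::real"] unfolding e
      by eventually_elim (auto simp: indicator_def)
  qed measurable
  also have "\<dots> = (if a = b then exp (- (k * b)) else (exp (- (k * b)) - exp (- (k * a))) / (k * (a - b)))"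
  proof (cases "a = b")
    case True
    then have "d = 0" by (simp add: d_def)
    then show ?thesis using True by simp
  next
    case False
    then have d: "d \<noteq> 0" using k by (simp add: d_def)
    have "(\<integral>s. (exp (- (k * b)) * exp (- (d * s))) * indicator {0..1} s \<partial>lborel) = - (exp (- (k * b)) * exp (- (d * 1))) / d - - (exp (- (k * b)) * exp (- (d * 0))) / d"
    proof (rule integral_FTC_Icc_real)
      fix x :: real
      show "((\<lambda>s. - (exp (- (k * b)) * exp (- (d * s))) / d) has_real_derivative exp (- (k * b)) * exp (- (d * x))) (at x)"
        using d by (auto intro!: derivative_eq_intros)
      show "isCont (\<lambda>s. exp (- (k * b)) * exp (- (d * s))) x" by (intro continuous_intros)
    qed simp
    also have "\<dots> = (exp (- (k * b)) - exp (- (k * b)) * exp (- d)) / d" by (simp add: diff_divide_distrib)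
    also have "exp (- (k * b)) * exp (- d) = exp (- (k * a))" unfolding exp_add[symmetric] by (rule arg_cong[where f=exp]) (simp add: d_def algebra_simps)
    finally show ?thesis using False by (simp add: d_def)
  qed
  finally show ?thesis .
qed

text \<open>The two inverse square roots combine to 1 / (k sqrt (s (1 - s))), the arcsine
  singularity; the exponentials are at most 1.\<close>

lemma abel_weight_time:
  assumes k: "0 < k"
  shows "abel_weight lborel (indicator {0<..<1}) (\<lambda>s. k * s) (\<lambda>s. k * (1 - s))"
proof
  show "integrable lborel (\<lambda>x. indicator {0<..<1} x * (exp (- (k * x / 8)) / sqrt (k * x) * (exp (- (k * (1 - x) / 8)) / sqrt (k * (1 - x)))))"
  proof (rule Bochner_Integration.integrable_bound[OF integrable_mult_right[OF arcsine_integrable, of "1 / k"]])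
    have "norm (indicator {0<..<1} x * (exp (- (k * x / 8)) / sqrt (k * x) * (exp (- (k * (1 - x) / 8)) / sqrt (k * (1 - x)))))
      \<le> norm (1 / k * (indicator {0<..<1} x * (1 / (sqrt x * sqrt (1 - x)))))" for x :: real
    proof (cases "x \<in> {0<..<1}")
      case True
      then have x: "0 < x" "x < 1" by auto
      have "exp (- (k * x / 8)) * exp (- (k * (1 - x) / 8)) \<le> 1 * 1" using k x by (intro mult_mono) auto
      then have "(exp (- (k * x / 8)) * exp (- (k * (1 - x) / 8))) / (k * (sqrt x * sqrt (1 - x))) \<le> 1 / (k * (sqrt x * sqrt (1 - x)))"
        using k x by (intro divide_right_mono) auto
      moreover have "exp (- (k * x / 8)) / sqrt (k * x) * (exp (- (k * (1 - x) / 8)) / sqrt (k * (1 - x))) = (exp (- (k * x / 8)) * exp (- (k * (1 - x) / 8))) / (k * (sqrt x * sqrt (1 - x)))"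
      proof -
        have "sqrt (k * x) * sqrt (k * (1 - x)) = (sqrt k * sqrt k) * (sqrt x * sqrt (1 - x))"
          by (simp only: real_sqrt_mult mult_ac)
        then show ?thesis using k by simp
      qed
      ultimately show ?thesis using True k x by (simp add: abs_mult)
    qed simp
    then show "AE x in lborel. norm (indicator {0<..<1} x * (exp (- (k * x / 8)) / sqrt (k * x) * (exp (- (k * (1 - x) / 8)) / sqrt (k * (1 - x)))))
      \<le> norm (1 / k * (indicator {0<..<1} x * (1 / (sqrt x * sqrt (1 - x)))))" by (intro AE_I2)
  qed measurable
qed (use k in \<open>auto simp: indicator_def split: if_splits\<close>)

text \<open>The product of profiles is a constant times exp (- c / z^2) / z^2: the square roots
  contribute z^2 against z^(-4), enough at infinity, and the exponential controls z near 0. Here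
  \<sigma> carries 1 - u and \<tau> carries u, which pairs m with 1 - u and n with u as in the final
  formula.\<close>

lemma abel_weight_space:
  assumes u: "0 < u" "u < 1"
  shows "abel_weight lborel (\<lambda>z. indicator {0<..} z / z ^ 4) (\<lambda>z. pi\<^sup>2 / (2 * z\<^sup>2) * (1 - u)) (\<lambda>z. pi\<^sup>2 / (2 * z\<^sup>2) * u)"
proof
  \<comment> \<open>The arguments (1 - u) and u add up, leaving one eighth of pi^2 / (2 z^2) in the
    exponent.\<close>
  let ?c = "pi\<^sup>2 / 16"
  have c: "0 < ?c" by simp
  have i: "integrable lborel (\<lambda>z. 2 / (pi\<^sup>2 * (sqrt u * sqrt (1 - u))) * (indicator {0<..} z * (exp (- (?c / z\<^sup>2)) / z ^ (2 * 0 + 2))))"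
    using inverse_gaussian_moment[OF c, of 0] by (intro integrable_mult_right) (simp only: has_bochner_integral_iff)
  have "indicator {0<..} z / z ^ 4 * (exp (- (pi\<^sup>2 / (2 * z\<^sup>2) * (1 - u) / 8)) / sqrt (pi\<^sup>2 / (2 * z\<^sup>2) * (1 - u)) * (exp (- (pi\<^sup>2 / (2 * z\<^sup>2) * u / 8)) / sqrt (pi\<^sup>2 / (2 * z\<^sup>2) * u)))
     = 2 / (pi\<^sup>2 * (sqrt u * sqrt (1 - u))) * (indicator {0<..} z * (exp (- (?c / z\<^sup>2)) / z ^ (2 * 0 + 2)))" for z :: real
  proof (cases "0 < z")
    case True
    define k where "k = pi\<^sup>2 / (2 * z\<^sup>2)"
    have k: "0 < k" using True by (simp add: k_def)
    have "exp (- (k * (1 - u) / 8)) * exp (- (k * u / 8)) = exp (- (?c / z\<^sup>2))"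
    proof -
      have "- (k * (1 - u) / 8) + - (k * u / 8) = - (k / 8)" by (simp add: field_simps)
      moreover have "k / 8 = ?c / z\<^sup>2" by (simp add: k_def)
      ultimately show ?thesis by (simp only: exp_add[symmetric])
    qed
    moreover have "sqrt (k * (1 - u)) * sqrt (k * u) = (sqrt k * sqrt k) * (sqrt u * sqrt (1 - u))" by (simp only: real_sqrt_mult mult_ac)
    then have "sqrt (k * (1 - u)) * sqrt (k * u) = k * (sqrt u * sqrt (1 - u))" using k by simp
    ultimately have "exp (- (k * (1 - u) / 8)) / sqrt (k * (1 - u)) * (exp (- (k * u / 8)) / sqrt (k * u)) = exp (- (?c / z\<^sup>2)) / (k * (sqrt u * sqrt (1 - u)))"
      by (simp only: times_divide_times_eq)
    moreover have "1 / z ^ 4 * (E / (k * S)) = 2 / (pi\<^sup>2 * S) * (E / z ^ 2)" for E S :: real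
      using True by (simp add: k_def power2_eq_square power4_eq_xxxx mult_ac)
    ultimately show ?thesis using True by (simp add: k_def[symmetric]) (simp add: power2_eq_square)
  qed simp
  then show "integrable lborel (\<lambda>z. indicator {0<..} z / z ^ 4 * (exp (- (pi\<^sup>2 / (2 * z\<^sup>2) * (1 - u) / 8)) / sqrt (pi\<^sup>2 / (2 * z\<^sup>2) * (1 - u)) * (exp (- (pi\<^sup>2 / (2 * z\<^sup>2) * u / 8)) / sqrt (pi\<^sup>2 / (2 * z\<^sup>2) * u))))"
    using i by (simp only:)
qed (use u in \<open>auto simp: indicator_def zero_less_divide_iff zero_less_mult_iff split: if_splits\<close>)

text \<open>The density at z is the integral of \<open>fden\<close> over time. With k = pi^2 / (2
  z^2) the prefactor 2 sqrt (2 pi) / z^2 times k is sqrt (2 pi) pi^2 / z^4, so the diagonal and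
  off-diagonal parts share one constant once the double series is scaled by k.\<close>

lemma max_density:
  assumes z: "0 < z"
  shows "(\<integral>\<^sup>+ s. ennreal (fden s z) \<partial>lborel) = ennreal (\<integral>s. fden s z \<partial>lborel)"
    and "\<exists>S. abel_sums2
             (\<lambda>m n. if m = n then 0 else
                (-1) ^ (m + n) *
                ((real m + 1/2) * (real n + 1/2) / ((real m + 1/2)\<^sup>2 - (real n + 1/2)\<^sup>2)) *
                (exp (- ((real n + 1/2)\<^sup>2 * pi\<^sup>2 / (2 * z\<^sup>2))) -
                 exp (- ((real m + 1/2)\<^sup>2 * pi\<^sup>2 / (2 * z\<^sup>2))))) S \<and>
           (\<integral>s. fden s z \<partial>lborel) = sqrt (2 * pi) * pi\<^sup>2 / z ^ 4 *
                   (\<Sum>n. (real n + 1/2)\<^sup>2 * exp (- ((real n + 1/2)\<^sup>2 * pi\<^sup>2 / (2 * z\<^sup>2)))) +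
                 2 * sqrt (2 * pi) / z\<^sup>2 * S"
    and "summable (\<lambda>n. (real n + 1/2)\<^sup>2 * exp (- ((real n + 1/2)\<^sup>2 * pi\<^sup>2 / (2 * z\<^sup>2))))"
proof -
  define k where "k = pi\<^sup>2 / (2 * z\<^sup>2)"
  have k: "0 < k" using z by (simp add: k_def)
  interpret abel_weight lborel "indicator {0<..<1}" "\<lambda>s. k * s" "\<lambda>s. k * (1 - s)" by (rule abel_weight_time[OF k])
  define J where "J = (\<integral>s. indicator {0<..<1} s * (hser 1 (k * s) * hser 1 (k * (1 - s))) \<partial>lborel)"
  have fd: "fden s z = sqrt (2 * pi) * pi\<^sup>2 / z ^ 4 * (indicator {0<..<1} s * (hser 1 (k * s) * hser 1 (k * (1 - s))))" for s
    using z by (simp add: fden_def k_def indicator_def)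
  have i: "integrable lborel (\<lambda>s. fden s z)" unfolding fd by (intro integrable_mult_right hser_product_integrable) auto
  show "(\<integral>\<^sup>+ s. ennreal (fden s z) \<partial>lborel) = ennreal (\<integral>s. fden s z \<partial>lborel)"
    by (rule nn_integral_eq_integral[OF i]) (simp add: fden_nonneg)
  have fJ: "(\<integral>s. fden s z \<partial>lborel) = sqrt (2 * pi) * pi\<^sup>2 / z ^ 4 * J" unfolding fd J_def by (rule integral_mult_right_zero)
  have ex: "(real n + 1/2)\<^sup>2 * pi\<^sup>2 / (2 * z\<^sup>2) = k * (hf n)\<^sup>2" for n by (simp add: k_def hf_def)
  have sm: "summable (\<lambda>n. (hf n)\<^sup>2 * exp (- (k * (hf n)\<^sup>2)))" by (rule summable_power_exp_hf[OF k])
  then show "summable (\<lambda>n. (real n + 1/2)\<^sup>2 * exp (- ((real n + 1/2)\<^sup>2 * pi\<^sup>2 / (2 * z\<^sup>2))))"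
    unfolding ex unfolding hf_def .
  define T where "T = (\<Sum>n. (hf n)\<^sup>2 * exp (- (k * (hf n)\<^sup>2)))"
  have hfeq: "(hf m)\<^sup>2 = (hf n)\<^sup>2 \<longleftrightarrow> m = n" for m n
    by (subst power2_eq_iff_nonneg) (simp_all add: hf_def)
  \<comment> \<open>The full double series has Abel sum k J. Its diagonal is an ordinary convergent
    series T, split off here to become the first sum of the formula; scaling by k cancels the k in
    the off-diagonal integrals.\<close>
  have "abel_sums2 (\<lambda>m n. k * u m n - k * (if m = n then (hf n)\<^sup>2 * exp (- (k * (hf n)\<^sup>2)) else 0)) (k * J - k * T)"
    unfolding J_def T_def by (intro abel_sums2_diff abel_sums2_scale abel_sums2_u abel_sums2_diagonal sm) simp
  moreover have "k * u m n - k * (if m = n then (hf n)\<^sup>2 * exp (- (k * (hf n)\<^sup>2)) else 0) = (if m = n then 0 else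
                (-1) ^ (m + n) *
                ((real m + 1/2) * (real n + 1/2) / ((real m + 1/2)\<^sup>2 - (real n + 1/2)\<^sup>2)) *
                (exp (- ((real n + 1/2)\<^sup>2 * pi\<^sup>2 / (2 * z\<^sup>2))) -
                 exp (- ((real m + 1/2)\<^sup>2 * pi\<^sup>2 / (2 * z\<^sup>2)))))" for m n
  proof (cases "m = n")
    case True
    have "I n n = exp (- (k * (hf n)\<^sup>2))" unfolding I_def integral_exp_pair[OF k] by simp
    then show ?thesis using True by (simp add: u_def power2_eq_square)
  next
    case False
    have "I m n = (exp (- (k * (hf n)\<^sup>2)) - exp (- (k * (hf m)\<^sup>2))) / (k * ((hf m)\<^sup>2 - (hf n)\<^sup>2))"
      unfolding I_def integral_exp_pair[OF k] using False by (simp add: hfeq)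
    then have "k * u m n = (-1) ^ (m + n) * (hf m * hf n / ((hf m)\<^sup>2 - (hf n)\<^sup>2)) * (exp (- (k * (hf n)\<^sup>2)) - exp (- (k * (hf m)\<^sup>2)))"
      using k by (simp add: u_def)
    then show ?thesis using False unfolding ex by (simp add: hf_def)
  qed
  ultimately have "abel_sums2
             (\<lambda>m n. if m = n then 0 else
                (-1) ^ (m + n) *
                ((real m + 1/2) * (real n + 1/2) / ((real m + 1/2)\<^sup>2 - (real n + 1/2)\<^sup>2)) *
                (exp (- ((real n + 1/2)\<^sup>2 * pi\<^sup>2 / (2 * z\<^sup>2))) -
                 exp (- ((real m + 1/2)\<^sup>2 * pi\<^sup>2 / (2 * z\<^sup>2))))) (k * J - k * T)" by (simp only:)
  moreover have "(\<integral>s. fden s z \<partial>lborel) = sqrt (2 * pi) * pi\<^sup>2 / z ^ 4 *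
                   (\<Sum>n. (real n + 1/2)\<^sup>2 * exp (- ((real n + 1/2)\<^sup>2 * pi\<^sup>2 / (2 * z\<^sup>2)))) +
                 2 * sqrt (2 * pi) / z\<^sup>2 * (k * J - k * T)"
  proof -
    have "2 * sqrt (2 * pi) / z\<^sup>2 * k = sqrt (2 * pi) * pi\<^sup>2 / z ^ 4" by (simp add: k_def power2_eq_square power4_eq_xxxx)
    then have "2 * sqrt (2 * pi) / z\<^sup>2 * (k * J - k * T) = sqrt (2 * pi) * pi\<^sup>2 / z ^ 4 * (J - T)"
      by (simp only: right_diff_distrib mult.assoc[symmetric])
    moreover have "(\<Sum>n. (real n + 1/2)\<^sup>2 * exp (- ((real n + 1/2)\<^sup>2 * pi\<^sup>2 / (2 * z\<^sup>2)))) = T"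
      unfolding ex T_def unfolding hf_def by (rule refl)
    ultimately show ?thesis unfolding fJ by (simp only: right_diff_distrib)
  qed
  ultimately show "\<exists>S. abel_sums2
             (\<lambda>m n. if m = n then 0 else
                (-1) ^ (m + n) *
                ((real m + 1/2) * (real n + 1/2) / ((real m + 1/2)\<^sup>2 - (real n + 1/2)\<^sup>2)) *
                (exp (- ((real n + 1/2)\<^sup>2 * pi\<^sup>2 / (2 * z\<^sup>2))) -
                 exp (- ((real m + 1/2)\<^sup>2 * pi\<^sup>2 / (2 * z\<^sup>2))))) S \<and>
           (\<integral>s. fden s z \<partial>lborel) = sqrt (2 * pi) * pi\<^sup>2 / z ^ 4 *
                   (\<Sum>n. (real n + 1/2)\<^sup>2 * exp (- ((real n + 1/2)\<^sup>2 * pi\<^sup>2 / (2 * z\<^sup>2)))) +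
                 2 * sqrt (2 * pi) / z\<^sup>2 * S" by blast
qed

lemma powr_three_halves: "0 \<le> x \<Longrightarrow> x powr (3/2) = sqrt x ^ 3"
proof -
  assume x: "0 \<le> x"
  have "x powr (3/2) = (x powr (1/2)) powr 3" by (simp add: powr_powr)
  then show ?thesis using x by (simp add: powr_half_sqrt powr_numeral)
qed

text \<open>Integrating a mode pair over the level gives a constant times Q^(-3/2), where Q is the
  quadratic form of the two frequencies weighted by u and 1 - u; this is the origin of the exponent
  3/2.\<close>

lemma argmax_density:
  assumes u: "0 < u" "u < 1"
  shows "(\<integral>\<^sup>+ z. ennreal (fden u z) \<partial>lborel) = ennreal (\<integral>z. fden u z \<partial>lborel)"
    and "\<exists>S. abel_sums2
            (\<lambda>m n. (-1) ^ (m + n) *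
               ((2 * real m + 1) * (2 * real n + 1) /
                ((2 * real n + 1)\<^sup>2 * u + (2 * real m + 1)\<^sup>2 * (1 - u)) powr (3/2))) S \<and>
          (\<integral>z. fden u z \<partial>lborel) = 2 * S"
proof -
  interpret aw: abel_weight lborel "\<lambda>z. indicator {0<..} z / z ^ 4" "\<lambda>z. pi\<^sup>2 / (2 * z\<^sup>2) * (1 - u)" "\<lambda>z. pi\<^sup>2 / (2 * z\<^sup>2) * u"
    by (rule abel_weight_space[OF u])
  define J where "J = (\<integral>z. indicator {0<..} z / z ^ 4 * (hser 1 (pi\<^sup>2 / (2 * z\<^sup>2) * (1 - u)) * hser 1 (pi\<^sup>2 / (2 * z\<^sup>2) * u)) \<partial>lborel)"
  define K where "K = sqrt (2 * pi) * pi\<^sup>2"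
  have fd: "fden u z = K * (indicator {0<..} z / z ^ 4 * (hser 1 (pi\<^sup>2 / (2 * z\<^sup>2) * (1 - u)) * hser 1 (pi\<^sup>2 / (2 * z\<^sup>2) * u)))" for z
    using u by (simp add: fden_def K_def indicator_def)
  have i: "integrable lborel (\<lambda>z. fden u z)" unfolding fd by (intro integrable_mult_right aw.hser_product_integrable) auto
  show "(\<integral>\<^sup>+ z. ennreal (fden u z) \<partial>lborel) = ennreal (\<integral>z. fden u z \<partial>lborel)"
    by (rule nn_integral_eq_integral[OF i]) (simp add: fden_nonneg)
  have fJ: "(\<integral>z. fden u z \<partial>lborel) = 2 * (K / 2 * J)" unfolding fd J_def by (subst integral_mult_right_zero) simp
  have "abel_sums2 (\<lambda>m n. K / 2 * aw.u m n) (K / 2 * J)"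
    unfolding J_def by (rule abel_sums2_scale[OF aw.abel_sums2_u])
  moreover have "K / 2 * aw.u m n = (-1) ^ (m + n) *
               ((2 * real m + 1) * (2 * real n + 1) /
                ((2 * real n + 1)\<^sup>2 * u + (2 * real m + 1)\<^sup>2 * (1 - u)) powr (3/2))" for m n
  proof -
    define Q where "Q = (hf n)\<^sup>2 * u + (hf m)\<^sup>2 * (1 - u)"
    have Q: "0 < Q" unfolding Q_def using u by (intro add_pos_pos mult_pos_pos) auto
    define q where "q = sqrt Q"
    have q: "0 < q" using Q by (simp add: q_def)
    have C: "0 < pi\<^sup>2 / 2 * Q" using Q by simp
    have rC: "sqrt (pi\<^sup>2 / 2 * Q) = pi * q / sqrt 2" by (simp add: q_def real_sqrt_mult real_sqrt_divide)
    have "aw.I m n = (\<integral>z. indicator {0<..} z * (exp (- (pi\<^sup>2 / 2 * Q / z\<^sup>2)) / z ^ (2 * 1 + 2)) \<partial>lborel)"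
      unfolding aw.I_def
    proof (rule Bochner_Integration.integral_cong[OF refl])
      fix z :: real
      have "exp (- (pi\<^sup>2 / (2 * z\<^sup>2) * (1 - u) * (hf m)\<^sup>2)) * exp (- (pi\<^sup>2 / (2 * z\<^sup>2) * u * (hf n)\<^sup>2)) = exp (- (pi\<^sup>2 / 2 * Q / z\<^sup>2))"
      proof -
        have "- (k * (1 - u) * (hf m)\<^sup>2) + - (k * u * (hf n)\<^sup>2) = - (k * Q)" for k by (simp add: Q_def algebra_simps)
        moreover have "pi\<^sup>2 / (2 * z\<^sup>2) * Q = pi\<^sup>2 / 2 * Q / z\<^sup>2" by simp
        ultimately show ?thesis by (simp only: exp_add[symmetric])
      qed
      then show "indicator {0<..} z / z ^ 4 * (exp (- (pi\<^sup>2 / (2 * z\<^sup>2) * (1 - u) * (hf m)\<^sup>2)) * exp (- (pi\<^sup>2 / (2 * z\<^sup>2) * u * (hf n)\<^sup>2))) = indicator {0<..} z * (exp (- (pi\<^sup>2 / 2 * Q / z\<^sup>2)) / z ^ (2 * 1 + 2))"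
        by simp
    qed
    also have "\<dots> = sqrt pi / 2 * (fact (2 * 1) / (2 ^ (2 * 1) * fact 1)) / sqrt (pi\<^sup>2 / 2 * Q) ^ (2 * 1 + 1)"
      by (rule has_bochner_integral_integral_eq[OF inverse_gaussian_moment[OF C]])
    also have "\<dots> = sqrt pi / (4 * (pi * q / sqrt 2) ^ 3)" unfolding rC by (simp add: fact_2)
    also have "\<dots> = sqrt pi * (sqrt 2 * sqrt 2 * sqrt 2) / (4 * pi ^ 3 * q ^ 3)" by (simp add: power_divide power_mult_distrib power3_eq_cube)
    finally have Iv: "aw.I m n = sqrt pi * sqrt 2 / (2 * pi ^ 3 * q ^ 3)" by simp
    have "K / 2 * aw.I m n = (sqrt 2 * sqrt 2) * (sqrt pi * sqrt pi) * pi\<^sup>2 / (2 * (2 * pi ^ 3 * q ^ 3))"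
      unfolding Iv K_def real_sqrt_mult by (simp only: times_divide_times_eq mult_ac)
    also have "\<dots> = 1 / (2 * q ^ 3)" by (simp add: power3_eq_cube power2_eq_square)
    finally have KI: "K / 2 * aw.I m n = 1 / (2 * q ^ 3)" .
    \<comment> \<open>Odd integers are twice the half-integers, so the form is 4Q and its power 3/2
      is 8 q^3. The numerator contributes 4, which leaves the factor 1 / (2 q^3) found
      above.\<close>
    have "(2 * real n + 1)\<^sup>2 * u + (2 * real m + 1)\<^sup>2 * (1 - u) = 2\<^sup>2 * Q" by (simp add: Q_def hf_def power2_eq_square field_simps)
    then have P: "((2 * real n + 1)\<^sup>2 * u + (2 * real m + 1)\<^sup>2 * (1 - u)) powr (3/2) = 8 * q ^ 3"
      using Q by (simp add: powr_three_halves real_sqrt_mult q_def power_mult_distrib)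
    have "K / 2 * aw.u m n = (-1) ^ (m + n) * (hf m * hf n) * (K / 2 * aw.I m n)" unfolding aw.u_def by (simp only: mult_ac)
    also have "\<dots> = (-1) ^ (m + n) * ((2 * hf m) * (2 * hf n) / (8 * q ^ 3))" unfolding KI by simp
    also have "2 * hf m = 2 * real m + 1" by (simp add: hf_def)
    also have "2 * hf n = 2 * real n + 1" by (simp add: hf_def)
    finally show ?thesis unfolding P .
  qed
  ultimately show "\<exists>S. abel_sums2
            (\<lambda>m n. (-1) ^ (m + n) *
               ((2 * real m + 1) * (2 * real n + 1) /
                ((2 * real n + 1)\<^sup>2 * u + (2 * real m + 1)\<^sup>2 * (1 - u)) powr (3/2))) S \<and>
          (\<integral>z. fden u z \<partial>lborel) = 2 * S"
    using fJ by (intro exI[of _ "K / 2 * J"]) (simp only:)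
qed

theorem theorem5:
  fixes P :: "'a measure" and b X :: "real \<Rightarrow> 'a \<Rightarrow> real" and M \<rho> :: "'a \<Rightarrow> real"
  assumes bridge: "standard_brownian_bridge P b"
    and X: "X = (\<lambda>u \<omega>. \<bar>b u \<omega>\<bar>)"
    and M: "M = (\<lambda>\<omega>. path_sup (\<lambda>u. X u \<omega>))"
    and \<rho>: "\<rho> = (\<lambda>\<omega>. path_sup_time (\<lambda>u. X u \<omega>))"
  shows "\<exists>f g :: real \<Rightarrow> real.
    has_density P M f \<and> (\<forall>z. z \<le> 0 \<longrightarrow> f z = 0) \<and>
    (\<forall>z>0.
      summable (\<lambda>n. (real n + 1/2)\<^sup>2 * exp (- ((real n + 1/2)\<^sup>2 * pi\<^sup>2 / (2 * z\<^sup>2)))) \<and>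
      (\<exists>S. abel_sums2
             (\<lambda>m n. if m = n then 0 else
                (-1) ^ (m + n) *
                ((real m + 1/2) * (real n + 1/2) / ((real m + 1/2)\<^sup>2 - (real n + 1/2)\<^sup>2)) *
                (exp (- ((real n + 1/2)\<^sup>2 * pi\<^sup>2 / (2 * z\<^sup>2))) -
                 exp (- ((real m + 1/2)\<^sup>2 * pi\<^sup>2 / (2 * z\<^sup>2))))) S \<and>
           f z = sqrt (2 * pi) * pi\<^sup>2 / z ^ 4 *
                   (\<Sum>n. (real n + 1/2)\<^sup>2 * exp (- ((real n + 1/2)\<^sup>2 * pi\<^sup>2 / (2 * z\<^sup>2)))) +
                 2 * sqrt (2 * pi) / z\<^sup>2 * S)) \<and>
    has_density P \<rho> g \<and> (\<forall>u. u \<notin> {0<..<1} \<longrightarrow> g u = 0) \<and>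
    (\<forall>u\<in>{0<..<1}.
      \<exists>S. abel_sums2
            (\<lambda>m n. (-1) ^ (m + n) *
               ((2 * real m + 1) * (2 * real n + 1) /
                ((2 * real n + 1)\<^sup>2 * u + (2 * real m + 1)\<^sup>2 * (1 - u)) powr (3/2))) S \<and>
          g u = 2 * S)"
proof -
  interpret brownian_bridge P b by standard (rule bridge)
  have Meq: "M = Mx" and Req: "\<rho> = Rh" by (simp_all add: fun_eq_iff M \<rho> X Mx_def Rh_def)
  \<comment> \<open>The densities are the two marginals of \<open>fden\<close>; its cut-off makes
    them vanish identically outside the stated ranges.\<close>
  define f where "f = (\<lambda>z. \<integral>s. fden s z \<partial>lborel)"
  define g where "g = (\<lambda>u. \<integral>z. fden u z \<partial>lborel)"
  have f0: "f z = 0" if "z \<le> 0" for z using that by (simp add: f_def fden_def)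
  have g0: "g u = 0" if "u \<notin> {0<..<1}" for u
  proof -
    have "fden u = (\<lambda>z. 0)" using that by (auto simp: fden_def fun_eq_iff)
    then show ?thesis by (simp add: g_def)
  qed
  have fe: "(\<integral>\<^sup>+ s. ennreal (fden s z) \<partial>lborel) = ennreal (f z)" for z
  proof (cases "0 < z")
    case True
    then show ?thesis unfolding f_def by (rule max_density(1))
  qed (simp add: f_def fden_def)
  have ge: "(\<integral>\<^sup>+ z. ennreal (fden u z) \<partial>lborel) = ennreal (g u)" for u
  proof (cases "u \<in> {0<..<1}")
    case True
    then show ?thesis by (simp add: argmax_density(1) g_def)
  next
    case False
    then have "fden u = (\<lambda>z. 0)" by (auto simp: fden_def fun_eq_iff)
    then show ?thesis by (simp add: g_def)
  qed
  have "has_density P M f"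
    using distributed_Mx unfolding has_density_def Meq fe by (auto simp: f_def intro!: Bochner_Integration.integral_nonneg fden_nonneg)
  moreover have "has_density P \<rho> g"
    using distributed_Rh unfolding has_density_def Req ge by (auto simp: g_def intro!: Bochner_Integration.integral_nonneg fden_nonneg)
  ultimately show ?thesis
    using f0 g0 max_density(2,3) argmax_density(2)
    by (intro exI[of _ f] exI[of _ g]) (auto simp: f_def g_def)
qed

end
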